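(* Let $0\le\nu\le1$, $0<\mu\le1$, and let $\omega\subset\Omega$ be an arbitrary non-empty open set. Assume that the operator $A_B$ has the unique continuation property in the sense that, if $\lambda>0$, $\varphi\in D(A_B)$, $A_B\varphi=\lambda\varphi$ and $\varphi=0$ in $\omega$, then $\varphi=0$ in $\Omega$. Then the system $$\begin{cases}\mathbb D_t^{\mu,\nu}u+A_Bu=f|_\omega & \text{in }\Omega\times(0,T),\\ (\mathbb I_t^{(1-\nu)(1-\mu)}u)(\cdot,0)=u_0 & \text{in }\Omega\end{cases}$$ is mean approximately controllable in any time $T>0$; that is, for every $T>0$, every $u_0,u_1\in L^2(\Omega)$ and every $\varepsilon>0$ there exists a control function $f\in L^2(\omega\times(0,T))$ such that the weak solution $u$ of the system satisfies $\|\mathbb I_t^{(1-\nu)(1-\mu)}u(\cdot,T)-u_1\|_{L^2(\Omega)}\le\varepsilon$.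
   Context: Setting. $\Omega\subset\mathbb R^N$ ($N\ge1$) is a bounded open set. $A_B$ is a non-negative selfadjoint operator on $L^2(\Omega)$ with domain $D(A_B)$ (graph norm) compactly embedded in $L^2(\Omega)$. It is associated with a symmetric, closed, non-negative bilinear form $\mathcal E_B$ with domain $V_{1/2}:=D(\mathcal E_B)$. Its eigenvalues $(\lambda_n)_{n\in\mathbb N}$ form a non-decreasing sequence tending to $\infty$, and it is assumed that the first eigenvalue satisfies $\lambda_1>0$. $V_{-1/2}$ is the dual of $V_{1/2}$ with respect to the pivot space $L^2(\Omega)$, and $\langle\cdot,\cdot\rangle_{V_{-1/2},V_{1/2}}$ is the duality pairing. Fractional calculus. For $\alpha>0$, $\mathbb I_t^\alpha g(t):=\frac1{\Gamma(\alpha)}\int_0^t(t-\tau)^{\alpha-1}g(\tau)\,d\tau$, and $\mathbb I_t^0g:=g$. For $0\le\nu\le1$, $0<\mu\le1$, the Hilfer derivative is $\mathbb D_t^{\mu,\nu}u(t):=\mathbb I_t^{\nu(1-\mu)}\frac{d}{dt}\big(\mathbb I_t^{(1-\nu)(1-\mu)}u\big)(t)$, $t>0$. Weak solution. The control $f$ is localized in $\omega$, so that the right-hand side $f|_\omega$ is $f$ on $\omega\times(0,T)$ and $0$ on $(\Omega\setminus\omega)\times(0,T)$. A function $u$ is a weak solution of the system if $u\in C((0,T];V_{1/2})$, $\mathbb I_t^{(1-\nu)(1-\mu)}u\in C([0,T];L^2(\Omega))$, $\mathbb D_t^{\mu,\nu}u\in C((0,T];V_{-1/2})$, $\mathbb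 I_t^{(1-\nu)(1-\mu)}u(\cdot,0)=u_0$, and for every $\varphi\in V_{1/2}$ and a.e. $t\in(0,T)$, $\langle\mathbb D_t^{\mu,\nu}u(\cdot,t),\varphi\rangle_{V_{-1/2},V_{1/2}}+\mathcal E_B(u(\cdot,t),\varphi)-(f(\cdot,t),\varphi)_{L^2(\Omega)}=0$ (with $f$ extended by zero outside $\omega$). *)

theory Defs
  imports "HOL-Analysis.Analysis" "HOL-Library.Function_Algebras"
begin

section \<open>The real Hilbert space of square-integrable functions\<close>

definition square_integrable :: "('a::euclidean_space \<Rightarrow> real) \<Rightarrow> bool" where
  "square_integrable f \<longleftrightarrow> f \<in> borel_measurable lborel \<and> integrable lborel (\<lambda>x. (f x)\<^sup>2)"

lemma square_integrable_zero: "square_integrable (\<lambda>x. 0)"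
  by (simp add: square_integrable_def)

lemma square_integrable_mult:
  assumes "square_integrable f" "square_integrable g"
  shows "integrable lborel (\<lambda>x. f x * g x)"
proof (rule Bochner_Integration.integrable_bound)
  show "integrable lborel (\<lambda>x. (f x)\<^sup>2 + (g x)\<^sup>2)"
    using assms by (auto simp: square_integrable_def)
  show "(\<lambda>x. f x * g x) \<in> borel_measurable lborel"
    using assms by (auto simp: square_integrable_def)
  have "\<bar>a * b\<bar> \<le> a\<^sup>2 + b\<^sup>2" for a b :: real
  proof -
    have "0 \<le> (\<bar>a\<bar> - \<bar>b\<bar>)\<^sup>2 + a\<^sup>2 + b\<^sup>2" by simp
    then show ?thesis by (simp add: power2_eq_square algebra_simps abs_mult)
  qed
  then show "AE x in lborel. norm (f x * g x) \<le> norm ((f x)\<^sup>2 + (g x)\<^sup>2)"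
    by simp
qed

lemma square_integrable_add:
  assumes "square_integrable f" "square_integrable g"
  shows "square_integrable (\<lambda>x. f x + g x)"
proof -
  have "integrable lborel (\<lambda>x. (f x)\<^sup>2 + (g x)\<^sup>2 + 2 * (f x * g x))"
    using assms square_integrable_mult[OF assms] by (auto simp: square_integrable_def)
  then show ?thesis
    using assms by (auto simp: square_integrable_def power2_sum mult.assoc)
qed

lemma square_integrable_cmult:
  "square_integrable f \<Longrightarrow> square_integrable (\<lambda>x. c * f x)"
  by (auto simp: square_integrable_def power_mult_distrib)

lemma square_integrable_diff:
  assumes "square_integrable f" "square_integrable g"
  shows "square_integrable (\<lambda>x. f x - g x)"
  using square_integrable_add[OF assms(1) square_integrable_cmult[OF assms(2), of "-1"]] by simp

definition ae_eq :: "('a::euclidean_space \<Rightarrow> real) \<Rightarrow> ('a \<Rightarrow> real) \<Rightarrow> bool" where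
  "ae_eq f g \<longleftrightarrow> square_integrable f \<and> square_integrable g \<and> (AE x in lborel. f x = g x)"

text \<open>Every Lebesgue measurable function agrees almost everywhere with a Borel measurable one, so
  taking classes of Borel functions gives the usual \<open>L\<^sup>2\<close> of the whole space.\<close>

quotient_type (overloaded) 'a L2 = "'a::euclidean_space \<Rightarrow> real" / partial: ae_eq
proof (rule part_equivpI)
  show "\<exists>f::'a \<Rightarrow> real. ae_eq f f"
    using square_integrable_zero by (auto simp: ae_eq_def)
  show "symp (ae_eq :: ('a \<Rightarrow> real) \<Rightarrow> _)"
    by (auto simp: symp_def ae_eq_def)
  show "transp (ae_eq :: ('a \<Rightarrow> real) \<Rightarrow> _)"
    unfolding transp_def ae_eq_def by (auto elim: AE_mp)
qed

instantiation L2 :: (euclidean_space) real_vector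
begin

lift_definition zero_L2 :: "'a L2" is "\<lambda>x. 0"
  by (simp add: ae_eq_def square_integrable_zero)

lift_definition plus_L2 :: "'a L2 \<Rightarrow> 'a L2 \<Rightarrow> 'a L2" is "\<lambda>f g x. f x + g x"
  unfolding ae_eq_def by (auto intro: square_integrable_add elim: AE_mp)

lift_definition scaleR_L2 :: "real \<Rightarrow> 'a L2 \<Rightarrow> 'a L2" is "\<lambda>c f x. c * f x"
  unfolding ae_eq_def by (auto intro: square_integrable_cmult)

lift_definition uminus_L2 :: "'a L2 \<Rightarrow> 'a L2" is "\<lambda>f x. - f x"
  unfolding ae_eq_def by (auto dest: square_integrable_cmult[where c = "-1"])

lift_definition minus_L2 :: "'a L2 \<Rightarrow> 'a L2 \<Rightarrow> 'a L2" is "\<lambda>f g x. f x - g x"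
  unfolding ae_eq_def by (auto intro: square_integrable_diff elim: AE_mp)

instance
proof
  fix f g h :: "'a L2" and a b :: real
  show "f + g + h = f + (g + h)"
    by transfer (auto simp: ae_eq_def add.assoc intro!: square_integrable_add)
  show "f + g = g + f"
    by transfer (auto simp: ae_eq_def add.commute intro!: square_integrable_add)
  show "0 + f = f"
    by transfer (auto simp: ae_eq_def)
  show "- f + f = 0"
    by transfer (auto simp: ae_eq_def square_integrable_zero)
  show "f - g = f + - g"
    by transfer (auto simp: ae_eq_def intro!: square_integrable_diff)
  show "a *\<^sub>R (f + g) = a *\<^sub>R f + a *\<^sub>R g"
    by transfer (auto simp: ae_eq_def distrib_left
        intro!: square_integrable_add square_integrable_cmult)
  show "(a + b) *\<^sub>R f = a *\<^sub>R f + b *\<^sub>R f"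
    by transfer (auto simp: ae_eq_def distrib_right
        intro!: square_integrable_add square_integrable_cmult)
  show "a *\<^sub>R b *\<^sub>R f = (a * b) *\<^sub>R f"
    by transfer (auto simp: ae_eq_def mult.assoc intro!: square_integrable_cmult)
  show "1 *\<^sub>R f = f"
    by transfer (auto simp: ae_eq_def)
qed

end

instantiation L2 :: (euclidean_space) real_inner
begin

lift_definition inner_L2 :: "'a L2 \<Rightarrow> 'a L2 \<Rightarrow> real" is "\<lambda>f g. LINT x|lborel. f x * g x"
  unfolding ae_eq_def
  by (intro integral_cong_AE) (auto simp: square_integrable_def elim!: AE_mp)

definition norm_L2 :: "'a L2 \<Rightarrow> real" where "norm_L2 f = sqrt (inner f f)"

definition dist_L2 :: "'a L2 \<Rightarrow> 'a L2 \<Rightarrow> real" where "dist_L2 f g = norm (f - g)"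

definition sgn_L2 :: "'a L2 \<Rightarrow> 'a L2" where "sgn_L2 f = f /\<^sub>R norm f"

definition uniformity_L2 :: "('a L2 \<times> 'a L2) filter" where
  "uniformity_L2 = (INF e\<in>{0<..}. principal {(x, y). dist x y < e})"

definition open_L2 :: "'a L2 set \<Rightarrow> bool" where
  "open_L2 U \<longleftrightarrow> (\<forall>x\<in>U. eventually (\<lambda>(x', y). x' = x \<longrightarrow> y \<in> U) uniformity)"

instance
proof
  fix f g h :: "'a L2" and a :: real
  show "dist f g = norm (f - g)" by (rule dist_L2_def)
  show "sgn f = f /\<^sub>R norm f" by (rule sgn_L2_def)
  show "uniformity = (INF e\<in>{0<..}. principal {(x, y :: 'a L2). dist x y < e})"
    by (rule uniformity_L2_def)
  show "open U \<longleftrightarrow> (\<forall>x\<in>U. eventually (\<lambda>(x', y). x' = x \<longrightarrow> y \<in> U) uniformity)"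
    for U :: "'a L2 set" by (rule open_L2_def)
  show "inner f g = inner g f"
    by transfer (simp add: mult.commute)
  show "inner (f + g) h = inner f h + inner g h"
    by transfer (simp add: ae_eq_def distrib_right square_integrable_mult)
  show "inner (a *\<^sub>R f) g = a * inner f g"
    by transfer (simp add: mult.assoc)
  show "0 \<le> inner f f"
    by transfer simp
  show "inner f f = 0 \<longleftrightarrow> f = 0"
  proof transfer
    fix f :: "'a \<Rightarrow> real" assume "ae_eq f f"
    then have f: "square_integrable f" by (simp add: ae_eq_def)
    have "(LINT x|lborel. f x * f x) = 0 \<longleftrightarrow> (AE x in lborel. f x * f x = 0)"
      using square_integrable_mult[OF f f] by (intro integral_nonneg_eq_0_iff_AE) auto
    then show "(LINT x|lborel. f x * f x) = 0 \<longleftrightarrow> ae_eq f (\<lambda>x. 0)"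
      using f by (simp add: ae_eq_def square_integrable_zero)
  qed
  show "norm f = sqrt (inner f f)" by (rule norm_L2_def)
qed

end

lift_definition vanishes_on :: "'a::euclidean_space L2 \<Rightarrow> 'a set \<Rightarrow> bool"
  is "\<lambda>f S. AE x in lborel. x \<in> S \<longrightarrow> f x = 0"
  unfolding ae_eq_def by (intro ext) (auto elim!: AE_mp)

text \<open>\<open>L\<^sup>2(\<Omega>)\<close> is identified, through extension by zero, with a subspace of the
  \<open>L\<^sup>2\<close> of the whole space.\<close>

definition L2_on :: "'a::euclidean_space set \<Rightarrow> 'a L2 set" where
  "L2_on \<Omega> = {h. vanishes_on h (- \<Omega>)}"

definition extend0 :: "'a set \<Rightarrow> ('a \<Rightarrow> real) \<Rightarrow> 'a \<Rightarrow> real" where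
  "extend0 S f x = (if x \<in> S then f x else 0)"

definition square_integrable_on :: "('a::euclidean_space \<Rightarrow> real) \<Rightarrow> 'a set \<Rightarrow> bool" where
  "square_integrable_on f S \<longleftrightarrow> square_integrable (extend0 S f)"

text \<open>For \<open>f\<close> square integrable on \<open>\<omega> \<times> {0<..<T}\<close> the section at time \<open>t\<close> is square integrable
  for almost every \<open>t\<close> in the interval; for the remaining \<open>t\<close> the value below is irrelevant.\<close>

definition localized_control ::
    "'a::euclidean_space set \<Rightarrow> ('a \<times> real \<Rightarrow> real) \<Rightarrow> real \<Rightarrow> 'a L2" where
  "localized_control \<omega> f t = abs_L2 (extend0 \<omega> (\<lambda>x. f (x, t)))"


section \<open>Operators and forms on a Hilbert space \<open>H\<close>\<close>

text \<open>An unbounded operator is a function \<open>A\<close> together with its domain \<open>D\<close>; the values of \<open>A\<close>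
  outside \<open>D\<close> play no role, and likewise for a form \<open>E\<close> with domain \<open>V\<close>. Here \<open>H\<close>, \<open>D\<close>, \<open>V\<close> are
  subspaces of an ambient inner product space.\<close>

definition linear_operator :: "'h::real_inner set \<Rightarrow> 'h set \<Rightarrow> ('h \<Rightarrow> 'h) \<Rightarrow> bool" where
  "linear_operator H D A \<longleftrightarrow> subspace D \<and> D \<subseteq> H \<and> A ` D \<subseteq> H \<and>
     (\<forall>x\<in>D. \<forall>y\<in>D. A (x + y) = A x + A y) \<and> (\<forall>c. \<forall>x\<in>D. A (c *\<^sub>R x) = c *\<^sub>R A x)"

definition op_graph :: "'h set \<Rightarrow> ('h \<Rightarrow> 'h) \<Rightarrow> ('h \<times> 'h) set" where
  "op_graph D A = {(x, A x) |x. x \<in> D}"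

definition adjoint_graph :: "'h::real_inner set \<Rightarrow> 'h set \<Rightarrow> ('h \<Rightarrow> 'h) \<Rightarrow> ('h \<times> 'h) set" where
  "adjoint_graph H D A = {(y, z). y \<in> H \<and> z \<in> H \<and> (\<forall>x\<in>D. inner (A x) y = inner x z)}"

definition selfadjoint_operator :: "'h::real_inner set \<Rightarrow> 'h set \<Rightarrow> ('h \<Rightarrow> 'h) \<Rightarrow> bool" where
  "selfadjoint_operator H D A \<longleftrightarrow>
     linear_operator H D A \<and> H \<subseteq> closure D \<and> adjoint_graph H D A = op_graph D A"

definition nonneg_operator :: "'h::real_inner set \<Rightarrow> ('h \<Rightarrow> 'h) \<Rightarrow> bool" where
  "nonneg_operator D A \<longleftrightarrow> (\<forall>x\<in>D. 0 \<le> inner (A x) x)"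

definition graph_norm :: "('h::real_inner \<Rightarrow> 'h) \<Rightarrow> 'h \<Rightarrow> real" where
  "graph_norm A x = sqrt ((norm x)\<^sup>2 + (norm (A x))\<^sup>2)"

definition compactly_embedded_domain :: "'h::real_inner set \<Rightarrow> ('h \<Rightarrow> 'h) \<Rightarrow> bool" where
  "compactly_embedded_domain D A \<longleftrightarrow> compact (closure {x \<in> D. graph_norm A x \<le> 1})"

definition eigenvalue :: "'h::real_inner set \<Rightarrow> ('h \<Rightarrow> 'h) \<Rightarrow> real \<Rightarrow> bool" where
  "eigenvalue D A c \<longleftrightarrow> (\<exists>x\<in>D. x \<noteq> 0 \<and> A x = c *\<^sub>R x)"

definition nonneg_symmetric_form :: "'h::real_inner set \<Rightarrow> 'h set \<Rightarrow> ('h \<Rightarrow> 'h \<Rightarrow> real) \<Rightarrow> bool" where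
  "nonneg_symmetric_form H V E \<longleftrightarrow> subspace V \<and> V \<subseteq> H \<and>
     (\<forall>x\<in>V. \<forall>y\<in>V. \<forall>z\<in>V. E (x + y) z = E x z + E y z) \<and>
     (\<forall>c. \<forall>x\<in>V. \<forall>y\<in>V. E (c *\<^sub>R x) y = c * E x y) \<and>
     (\<forall>x\<in>V. \<forall>y\<in>V. E x y = E y x) \<and>
     (\<forall>x\<in>V. 0 \<le> E x x)"

definition form_norm :: "('h::real_inner \<Rightarrow> 'h \<Rightarrow> real) \<Rightarrow> 'h \<Rightarrow> real" where
  "form_norm E x = sqrt (E x x + (norm x)\<^sup>2)"

definition closed_form :: "'h::real_inner set \<Rightarrow> ('h \<Rightarrow> 'h \<Rightarrow> real) \<Rightarrow> bool" where
  "closed_form V E \<longleftrightarrow>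
     (\<forall>x. (\<forall>n. x n \<in> V) \<and> (\<forall>e>0. \<exists>k. \<forall>m\<ge>k. \<forall>n\<ge>k. form_norm E (x m - x n) < e)
        \<longrightarrow> (\<exists>y\<in>V. (\<lambda>n. form_norm E (x n - y)) \<longlonglongrightarrow> 0))"

definition associated_operator ::
    "'h::real_inner set \<Rightarrow> 'h set \<Rightarrow> ('h \<Rightarrow> 'h \<Rightarrow> real) \<Rightarrow> 'h set \<Rightarrow> ('h \<Rightarrow> 'h) \<Rightarrow> bool" where
  "associated_operator H V E D A \<longleftrightarrow>
     op_graph D A = {(x, g). x \<in> V \<and> g \<in> H \<and> (\<forall>y\<in>V. E x y = inner g y)}"


section \<open>The dual of the form domain\<close>

instantiation "fun" :: (type, real_vector) real_vector
begin

definition scaleR_fun :: "real \<Rightarrow> ('a \<Rightarrow> 'b) \<Rightarrow> 'a \<Rightarrow> 'b" where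
  "scaleR_fun c F = (\<lambda>x. c *\<^sub>R F x)"

instance
  by standard (auto simp: scaleR_fun_def fun_eq_iff scaleR_add_right scaleR_add_left)

end

lemma scaleR_fun_apply [simp]: "(c *\<^sub>R F) x = c *\<^sub>R F x"
  by (simp add: scaleR_fun_def)

text \<open>Elements of the dual are bounded linear functionals on \<open>V\<close>, extended by \<open>0\<close> outside \<open>V\<close> so that
  equality of functionals is equality of functions. The duality pairing of \<open>F\<close> with \<open>\<phi>\<close> is \<open>F \<phi>\<close>.\<close>

definition dual_space :: "'h::real_inner set \<Rightarrow> ('h \<Rightarrow> 'h \<Rightarrow> real) \<Rightarrow> ('h \<Rightarrow> real) set" where
  "dual_space V E = {F. (\<forall>x. x \<notin> V \<longrightarrow> F x = 0) \<and>
     (\<forall>x\<in>V. \<forall>y\<in>V. F (x + y) = F x + F y) \<and> (\<forall>c. \<forall>x\<in>V. F (c *\<^sub>R x) = c * F x) \<and>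
     (\<exists>C. \<forall>x\<in>V. \<bar>F x\<bar> \<le> C * form_norm E x)}"

definition dual_norm :: "'h::real_inner set \<Rightarrow> ('h \<Rightarrow> 'h \<Rightarrow> real) \<Rightarrow> ('h \<Rightarrow> real) \<Rightarrow> real" where
  "dual_norm V E F = (SUP x\<in>{x \<in> V. form_norm E x \<le> 1}. \<bar>F x\<bar>)"

text \<open>The embedding of the pivot space into the dual.\<close>

definition pivot :: "'h::real_inner set \<Rightarrow> 'h \<Rightarrow> 'h \<Rightarrow> real" where
  "pivot V h x = (if x \<in> V then inner h x else 0)"


section \<open>Calculus with values in a subspace \<open>X\<close> normed by \<open>nrm\<close>\<close>

text \<open>\<open>V\<close> with the form norm and its dual are not types, so the norm is passed explicitly.
  The integral is the Bochner integral, transcribed from \<^const>\<open>has_bochner_integral\<close>; since \<open>X\<close>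
  carries no Borel sets, measurability is imposed on the distances to the simple functions.\<close>

definition continuous_into :: "'b::real_vector set \<Rightarrow> ('b \<Rightarrow> real) \<Rightarrow> real set \<Rightarrow> (real \<Rightarrow> 'b) \<Rightarrow> bool" where
  "continuous_into X nrm S g \<longleftrightarrow>
     (\<forall>t\<in>S. g t \<in> X \<and> ((\<lambda>s. nrm (g s - g t)) \<longlongrightarrow> 0) (at t within S))"

definition has_deriv_in ::
    "'b::real_vector set \<Rightarrow> ('b \<Rightarrow> real) \<Rightarrow> real set \<Rightarrow> (real \<Rightarrow> 'b) \<Rightarrow> real \<Rightarrow> 'b \<Rightarrow> bool" where
  "has_deriv_in X nrm S g t d \<longleftrightarrow> (\<forall>s\<in>S. g s \<in> X) \<and> d \<in> X \<and>
     ((\<lambda>s. nrm ((g s - g t) /\<^sub>R (s - t) - d)) \<longlongrightarrow> 0) (at t within S)"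

definition deriv_in ::
    "'b::real_vector set \<Rightarrow> ('b \<Rightarrow> real) \<Rightarrow> real set \<Rightarrow> (real \<Rightarrow> 'b) \<Rightarrow> real \<Rightarrow> 'b" where
  "deriv_in X nrm S g t = (THE d. has_deriv_in X nrm S g t d)"

definition has_bochner_integral_in ::
    "'b::real_vector set \<Rightarrow> ('b \<Rightarrow> real) \<Rightarrow> 'a measure \<Rightarrow> ('a \<Rightarrow> 'b) \<Rightarrow> 'b \<Rightarrow> bool" where
  "has_bochner_integral_in X nrm M f I \<longleftrightarrow> f ` space M \<subseteq> X \<and> I \<in> X \<and>
     (\<exists>s. (\<forall>i. Bochner_Integration.simple_bochner_integrable M (s i) \<and> s i ` space M \<subseteq> X \<and>
              (\<lambda>x. nrm (f x - s i x)) \<in> borel_measurable M) \<and>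
          (\<lambda>i. \<integral>\<^sup>+x. ennreal (nrm (f x - s i x)) \<partial>M) \<longlonglongrightarrow> 0 \<and>
          (\<lambda>i. nrm (Bochner_Integration.simple_bochner_integral M (s i) - I)) \<longlonglongrightarrow> 0)"

definition frac_kernel :: "real \<Rightarrow> (real \<Rightarrow> 'b::real_vector) \<Rightarrow> real \<Rightarrow> real \<Rightarrow> 'b" where
  "frac_kernel \<alpha> g t \<tau> = ((t - \<tau>) powr (\<alpha> - 1) / Gamma \<alpha>) *\<^sub>R g \<tau>"

definition frac_integrable ::
    "'b::real_vector set \<Rightarrow> ('b \<Rightarrow> real) \<Rightarrow> real \<Rightarrow> (real \<Rightarrow> 'b) \<Rightarrow> real \<Rightarrow> bool" where
  "frac_integrable X nrm \<alpha> g t \<longleftrightarrow> \<alpha> = 0 \<or>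
     (\<exists>y. has_bochner_integral_in X nrm (restrict_space lborel {0<..<t}) (frac_kernel \<alpha> g t) y)"

definition frac_integral ::
    "'b::real_vector set \<Rightarrow> ('b \<Rightarrow> real) \<Rightarrow> real \<Rightarrow> (real \<Rightarrow> 'b) \<Rightarrow> real \<Rightarrow> 'b" where
  "frac_integral X nrm \<alpha> g t = (if \<alpha> = 0 then g t
     else THE y. has_bochner_integral_in X nrm (restrict_space lborel {0<..<t}) (frac_kernel \<alpha> g t) y)"


section \<open>Hilfer derivative and weak solutions\<close>

text \<open>The inner fractional integral is taken in the pivot space \<open>H\<close>; the derivative and the outer
  fractional integral are taken in the dual of \<open>V\<close>, which is where the Hilfer derivative of a weak
  solution lives.\<close>

definition inner_frac :: "'h::real_inner set \<Rightarrow> real \<Rightarrow> real \<Rightarrow> (real \<Rightarrow> 'h) \<Rightarrow> real \<Rightarrow> 'h" where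
  "inner_frac H \<mu> \<nu> u = frac_integral H norm ((1 - \<nu>) * (1 - \<mu>)) u"

definition inner_frac_deriv ::
    "'h::real_inner set \<Rightarrow> 'h set \<Rightarrow> ('h \<Rightarrow> 'h \<Rightarrow> real) \<Rightarrow> real \<Rightarrow> real \<Rightarrow> real \<Rightarrow> (real \<Rightarrow> 'h) \<Rightarrow>
     real \<Rightarrow> 'h \<Rightarrow> real" where
  "inner_frac_deriv H V E T \<mu> \<nu> u =
     deriv_in (dual_space V E) (dual_norm V E) {0<..T} (\<lambda>s. pivot V (inner_frac H \<mu> \<nu> u s))"

definition hilfer_deriv ::
    "'h::real_inner set \<Rightarrow> 'h set \<Rightarrow> ('h \<Rightarrow> 'h \<Rightarrow> real) \<Rightarrow> real \<Rightarrow> real \<Rightarrow> real \<Rightarrow> (real \<Rightarrow> 'h) \<Rightarrow>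
     real \<Rightarrow> 'h \<Rightarrow> real" where
  "hilfer_deriv H V E T \<mu> \<nu> u =
     frac_integral (dual_space V E) (dual_norm V E) (\<nu> * (1 - \<mu>)) (inner_frac_deriv H V E T \<mu> \<nu> u)"

definition hilfer_differentiable ::
    "'h::real_inner set \<Rightarrow> 'h set \<Rightarrow> ('h \<Rightarrow> 'h \<Rightarrow> real) \<Rightarrow> real \<Rightarrow> real \<Rightarrow> real \<Rightarrow> (real \<Rightarrow> 'h) \<Rightarrow> bool" where
  "hilfer_differentiable H V E T \<mu> \<nu> u \<longleftrightarrow> (\<forall>t\<in>{0<..T}.
     frac_integrable H norm ((1 - \<nu>) * (1 - \<mu>)) u t \<and>
     (\<exists>d. has_deriv_in (dual_space V E) (dual_norm V E) {0<..T}
            (\<lambda>s. pivot V (inner_frac H \<mu> \<nu> u s)) t d) \<and>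
     frac_integrable (dual_space V E) (dual_norm V E) (\<nu> * (1 - \<mu>)) (inner_frac_deriv H V E T \<mu> \<nu> u) t)"

text \<open>The integral formula for the inner fractional integral degenerates to \<open>0\<close> at \<open>t = 0\<close> when its
  order is positive, although the solution is singular there. Continuity on \<open>{0..T}\<close> and the initial
  condition therefore refer to the continuous extension \<open>v\<close> from \<open>{0<..T}\<close>.\<close>

definition weak_solution ::
    "'h::real_inner set \<Rightarrow> 'h set \<Rightarrow> ('h \<Rightarrow> 'h \<Rightarrow> real) \<Rightarrow> real \<Rightarrow> real \<Rightarrow> real \<Rightarrow> 'h \<Rightarrow>
     (real \<Rightarrow> 'h) \<Rightarrow> (real \<Rightarrow> 'h) \<Rightarrow> bool" where
  "weak_solution H V E T \<mu> \<nu> u0 g u \<longleftrightarrow>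
     continuous_into V (form_norm E) {0<..T} u \<and>
     hilfer_differentiable H V E T \<mu> \<nu> u \<and>
     (\<exists>v. continuous_on {0..T} v \<and> (\<forall>t\<in>{0<..T}. v t = inner_frac H \<mu> \<nu> u t) \<and> v 0 = u0) \<and>
     continuous_into (dual_space V E) (dual_norm V E) {0<..T} (hilfer_deriv H V E T \<mu> \<nu> u) \<and>
     (\<forall>\<phi>\<in>V. AE t in lborel. t \<in> {0<..<T} \<longrightarrow>
        hilfer_deriv H V E T \<mu> \<nu> u t \<phi> + E (u t) \<phi> - inner (g t) \<phi> = 0)"

end

theory Submission
  imports Defs "HOL-Complex_Analysis.Complex_Analysis"
begin

text \<open>
  The operator has a countable orthonormal basis of eigenvectors \<open>e n\<close> with eigenvalues \<open>lam n\<close>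
  bounded below by the first one (\<open>eigenbasis_exists\<close>). Testing the equation with \<open>e n\<close> decouples
  it into scalar Hilfer equations. Such an equation is equivalent to a Volterra equation of order
  \<open>\<mu>\<close> for the inner fractional integral \<open>Y\<close> of the mode, so \<open>Y\<close> is determined by its initial
  value and the right-hand side (\<open>hilfer_mode_unique\<close>); hence all weak solutions for one control
  have the same terminal value (\<open>weak_solution_unique\<close>).

  The controls that are used are polynomials in time, \<open>\<Sum>m<M. t ^ m *\<^sub>R gs m\<close>, with coefficients
  \<open>gs m\<close> supported in \<open>\<omega>\<close>. For them every mode is an explicit combination of the relaxation
  functions \<open>relax \<mu> b c t = t powr (b - 1) * E(- c * t powr \<mu>)\<close>, where \<open>E\<close> is the two-parameter
  Mittag-Leffler function with parameters \<open>\<mu>\<close> and \<open>b\<close>. On the half-line of non-positive arguments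
  these Mittag-Leffler functions, for \<open>b \<ge> \<mu>\<close>, are non-negative, monotone and decay like the inverse
  of the argument; this makes the mode series converge in the norms required of a weak solution
  (\<open>weak_solution_polynomial_control\<close>).

  It remains to see that the terminal values produced by such controls from zero initial data are
  dense. They form a subspace. If it is not dense, a non-zero bounded functional \<open>l\<close> vanishes on
  it; put \<open>\<psi> n = l (e n)\<close>. For every admissible coefficient \<open>g\<close>, with \<open>c n = inner g (e n) * \<psi> n\<close>,
  all the sums \<open>\<Sum>n. c n * relax \<mu> (b + m) (lam n) T\<close> vanish. For \<open>m \<ge> 1\<close> these numbers are the
  moments on \<open>[0, T]\<close> of the continuous function \<open>\<Sum>n. c n * relax \<mu> b (lam n) t\<close>, up to factorials, so
  this function vanishes on the interval (\<open>relaxation_sum_vanishes\<close>). By analytic continuation in a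
  sector it vanishes for all positive times. Letting time tend to infinity and integrating
  fractionally, one finds \<open>(\<Sum>n. c n / lam n ^ j) = 0\<close> for all \<open>j \<ge> 1\<close> (\<open>relax_moments_vanish\<close>), and
  polynomial approximation then isolates each eigenvalue (\<open>moments_vanish_imp_groups_vanish\<close>): for
  each \<open>\<sigma>\<close> the eigenvector \<open>\<Sum>n | lam n = \<sigma>. \<psi> n *\<^sub>R e n\<close> is orthogonal to all functions
  supported in \<open>\<omega>\<close>. By unique continuation it is zero. Hence all \<open>\<psi> n\<close> vanish, and so does \<open>l\<close> on
  the closed span of the \<open>e n\<close>, a contradiction.
\<close>

section \<open>Mittag-Leffler functions and fractional integrals\<close>

text \<open>The scalar Riemann-Liouville integral as a statement about existence and value at once, so that
  convergence is carried through all computations.\<close>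

definition has_frac_integral ::
    "real \<Rightarrow> (real \<Rightarrow> 'a::{banach, second_countable_topology}) \<Rightarrow> real \<Rightarrow> 'a \<Rightarrow> bool" where
  "has_frac_integral a y t I \<longleftrightarrow>
     has_bochner_integral lborel (\<lambda>s. indicator {0<..<t} s *\<^sub>R frac_kernel a y t s) I"

text \<open>The Beta integral: fractional integration shifts the exponent of a power normalized by \<open>Gamma\<close>.\<close>

lemma has_frac_integral_power:
  assumes "a > 0" "b > 0" "t > 0"
  shows "has_frac_integral a (\<lambda>s. s powr (b - 1) / Gamma b) t (t powr (a + b - 1) / Gamma (a + b))"
proof -
  have "(LINT x:{0..1}|lborel. x powr (b - 1) * (1 - x) powr (a - 1)) = Beta b a"
    using integrable_Beta[of b a] has_integral_Beta_real[of b a] assms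
    by (metis has_integral_integrable_integral set_borel_integral_eq_integral(2))
  with integrable_Beta[of b a] assms
  have beta: "has_bochner_integral lborel
      (\<lambda>x. indicator {0..1} x *\<^sub>R (x powr (b - 1) * (1 - x) powr (a - 1))) (Beta b a)"
    by (simp add: has_bochner_integral_iff set_lebesgue_integral_def set_integrable_def)
  define f where "f = (\<lambda>s. indicator {0<..<t} s *\<^sub>R frac_kernel a (\<lambda>s. s powr (b - 1) / Gamma b) t s)"
  have scaled: "f (0 + t * x) = t powr (a + b - 2) / (Gamma a * Gamma b) *
      (indicator {0..1} x *\<^sub>R (x powr (b - 1) * (1 - x) powr (a - 1)))" for x
  proof (cases "0 < x \<and> x < 1")
    case True
    have "(t - t * x) powr (a - 1) = t powr (a - 1) * (1 - x) powr (a - 1)"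
      using True assms by (subst powr_mult[symmetric]) (auto simp: algebra_simps)
    moreover have "(t * x) powr (b - 1) = t powr (b - 1) * x powr (b - 1)"
      using True assms by (simp add: powr_mult)
    moreover have "t powr (a - 1) * t powr (b - 1) = t powr (a + b - 2)"
      by (simp add: powr_add[symmetric])
    ultimately show ?thesis
      using True assms by (simp add: f_def frac_kernel_def indicator_def field_simps)
  next
    case False
    then consider "x = 0" | "x = 1" | "x < 0" | "x > 1" by linarith
    then show ?thesis
      using assms by cases (auto simp: f_def indicator_def zero_less_mult_iff)
  qed
  have "has_bochner_integral lborel (\<lambda>x. f (0 + t * x))
      (t powr (a + b - 2) / (Gamma a * Gamma b) * Beta b a)"
    unfolding scaled by (intro has_bochner_integral_mult_right beta)
  also have "t powr (a + b - 2) / (Gamma a * Gamma b) * Beta b a = t powr (a + b - 2) / Gamma (a + b)"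
    using Gamma_real_pos[OF assms(1)] Gamma_real_pos[OF assms(2)]
    by (simp add: Beta_def add.commute)
  also have "t powr (a + b - 2) / Gamma (a + b) = (t powr (a + b - 1) / Gamma (a + b)) /\<^sub>R \<bar>t\<bar>"
  proof -
    have "t powr (a + b - 1) = t powr (a + b - 2) * t"
      using assms powr_add[of t "a + b - 2" 1] by simp
    then show ?thesis using assms by (simp add: field_simps)
  qed
  finally have "has_bochner_integral lborel f (t powr (a + b - 1) / Gamma (a + b))"
    using assms(3) by (subst lborel_has_bochner_integral_real_affine_iff[of t f _ 0]) auto
  then show ?thesis
    unfolding has_frac_integral_def f_def .
qed

text \<open>The two-parameter Mittag-Leffler function at \<open>- z\<close>. The sign is built in because the
  modes of the equation are relaxation functions.\<close>

definition mitlef :: "real \<Rightarrow> real \<Rightarrow> 'a::{real_normed_field, banach} \<Rightarrow> 'a" where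
  "mitlef \<mu> b z = (\<Sum>j. (- z) ^ j /\<^sub>R Gamma (b + real j * \<mu>))"

text \<open>\<open>Gamma\<close> grows faster than every exponential, as comparison with a factorial shows; this gives the
  Mittag-Leffler series an infinite radius of convergence.\<close>

lemma inverse_Gamma_le_power:
  fixes R :: real
  assumes "R \<ge> 1"
  obtains C where "C > 0" "\<And>s. s \<ge> 3 \<Longrightarrow> inverse (Gamma s) \<le> C * R powr (- s)"
proof
  show "R ^ 2 * exp R > 0" using assms by simp
  fix s :: real assume s: "s \<ge> 3"
  define n where "n = nat \<lfloor>s\<rfloor> - 1"
  have n: "real n + 1 \<le> s" "s < real n + 2" "n \<ge> 2"
    using s unfolding n_def by linarith+
  have "fact n = Gamma (real n + 1)" by (simp add: Gamma_fact add.commute)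
  also have "\<dots> \<le> Gamma s"
    using Gamma_real_strict_mono[of "real n + 1" s] n by (cases "real n + 1 = s") auto
  finally have g: "fact n \<le> Gamma s" .
  have "R ^ n / fact n \<le> exp R"
  proof -
    have "(\<lambda>k. R ^ k /\<^sub>R fact k) sums exp R" by (rule exp_converges)
    then have "(\<Sum>k\<in>{n}. R ^ k /\<^sub>R fact k) \<le> exp R"
      unfolding sums_iff using assms sum_le_suminf[of "\<lambda>k. R ^ k /\<^sub>R fact k" "{n}"] by auto
    then show ?thesis by (simp add: field_simps)
  qed
  then have 1: "inverse (fact n) \<le> exp R * inverse (R ^ n)"
    using assms by (simp add: field_simps)
  have 2: "inverse (Gamma s) \<le> inverse (fact n)"
    using g by (intro le_imp_inverse_le) auto
  have 3: "inverse (R ^ n) \<le> R ^ 2 * R powr (- s)"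
  proof -
    have "R powr s \<le> R powr (real (n + 2))" using assms n by (intro powr_mono) auto
    also have "\<dots> = R ^ n * R ^ 2"
      using assms by (subst powr_realpow) (auto simp: power_add power2_eq_square)
    finally have "R powr s / R ^ n \<le> R ^ 2" using assms by (simp add: divide_le_eq mult.commute)
    then have "R powr s / R ^ n / R powr s \<le> R ^ 2 / R powr s"
      by (rule divide_right_mono) simp
    moreover have "R powr s / R ^ n / R powr s = inverse (R ^ n)"
      using assms by (simp add: divide_inverse)
    ultimately show ?thesis by (simp only: powr_minus divide_inverse)
  qed
  have "exp R * inverse (R ^ n) \<le> exp R * (R ^ 2 * R powr (- s))"
    by (rule mult_left_mono[OF 3]) simp
  also have "\<dots> = R ^ 2 * exp R * R powr (- s)"
    by simp
  finally show "inverse (Gamma s) \<le> R ^ 2 * exp R * R powr (- s)"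
    using 1 2 by linarith
qed

lemma Gamma_add_pos: "b > 0 \<Longrightarrow> \<mu> > 0 \<Longrightarrow> Gamma (b + real j * \<mu>) > 0"
  by (rule Gamma_real_pos, rule add_pos_nonneg) auto

lemma summable_mitlef_real:
  fixes x :: real
  assumes "\<mu> > 0" "b > 0" "x \<ge> 0"
  shows "summable (\<lambda>j. x ^ j / Gamma (b + real j * \<mu>))"
proof -
  define R where "R = (2 * x + 1) powr (1 / \<mu>)"
  have R: "R \<ge> 1" "R powr \<mu> = 2 * x + 1"
    using assms by (auto simp: R_def powr_powr ge_one_powr_ge_zero)
  obtain C where C: "C > 0" "\<And>s. s \<ge> 3 \<Longrightarrow> inverse (Gamma s) \<le> C * R powr (- s)"
    using inverse_Gamma_le_power[OF R(1)] by blast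
  show ?thesis
  proof (rule summable_comparison_test_ev)
    show "summable (\<lambda>j. C * (1/2) ^ j :: real)" by (intro summable_mult summable_geometric) simp
    have "eventually (\<lambda>j. real j \<ge> 3 / \<mu>) sequentially"
      using filterlim_real_sequentially by (simp add: filterlim_at_top)
    then show "\<forall>\<^sub>F j in sequentially. norm (x ^ j / Gamma (b + real j * \<mu>)) \<le> C * (1/2) ^ j"
    proof eventually_elim
      case (elim j)
      then have "b + real j * \<mu> \<ge> 3" using assms by (simp add: field_simps)
      then have "inverse (Gamma (b + real j * \<mu>)) \<le> C * R powr (- (b + real j * \<mu>))" by (rule C(2))
      also have "\<dots> \<le> C * R powr (- (real j * \<mu>))"
        using C R assms by (intro mult_left_mono powr_mono) auto
      also have "R powr (- (real j * \<mu>)) = inverse ((2 * x + 1) ^ j)"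
        using R assms powr_powr[of R \<mu> "real j"] by (simp add: powr_minus mult.commute[of \<mu>] powr_realpow)
      finally have "x ^ j * inverse (Gamma (b + real j * \<mu>)) \<le> C * (x ^ j * inverse ((2 * x + 1) ^ j))"
        using mult_left_mono[OF _ zero_le_power[OF assms(3)], of _ _ j]
        by (metis mult.left_commute)
      also have "x ^ j * inverse ((2 * x + 1) ^ j) = (x / (2 * x + 1)) ^ j"
        by (simp add: power_divide field_simps)
      also have "(x / (2 * x + 1)) ^ j \<le> (1/2) ^ j"
        using assms by (intro power_mono) (auto simp: field_simps)
      finally have "x ^ j * inverse (Gamma (b + real j * \<mu>)) \<le> C * (1/2) ^ j"
        using C(1) by (simp add: mult_left_mono)
      moreover have "0 \<le> x ^ j / Gamma (b + real j * \<mu>)"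
        using assms Gamma_add_pos[OF assms(2,1), of j] by (intro divide_nonneg_pos) auto
      ultimately show ?case
        unfolding real_norm_def by (simp only: abs_of_nonneg divide_inverse)
    qed
  qed
qed

lemma summable_norm_mitlef:
  fixes z :: "'a::{real_normed_field, banach}"
  assumes "\<mu> > 0" "b > 0"
  shows "summable (\<lambda>j. norm (z ^ j /\<^sub>R Gamma (b + real j * \<mu>)))"
  using summable_mitlef_real[OF assms, of "norm z"] Gamma_add_pos[OF assms(2,1)]
  by (simp add: norm_power abs_of_pos divide_inverse mult.commute del: of_nat_mult)

lemma mitlef_sums:
  fixes z :: "'a::{real_normed_field, banach}"
  assumes "\<mu> > 0" "b > 0"
  shows "(\<lambda>j. (- z) ^ j /\<^sub>R Gamma (b + real j * \<mu>)) sums mitlef \<mu> b z"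
  unfolding mitlef_def
  by (rule summable_sums, rule summable_norm_cancel, rule summable_norm_mitlef) (use assms in auto)

lemma mitlef_of_real:
  assumes "\<mu> > 0" "b > 0"
  shows "mitlef \<mu> b (of_real x :: 'a::{real_normed_field, banach}) = of_real (mitlef \<mu> b x)"
proof -
  have "(\<lambda>j. of_real ((- x) ^ j /\<^sub>R Gamma (b + real j * \<mu>)) :: 'a) sums of_real (mitlef \<mu> b x)"
    by (intro sums_of_real mitlef_sums assms)
  moreover have "(\<lambda>j. of_real ((- x) ^ j /\<^sub>R Gamma (b + real j * \<mu>)) :: 'a) sums mitlef \<mu> b (of_real x)"
    using mitlef_sums[OF assms, of "of_real x :: 'a"] by (simp add: scaleR_conv_of_real)
  ultimately show ?thesis using sums_unique2 by blast
qed
lemma mitlef_0 [simp]: "mitlef \<mu> b 0 = of_real (inverse (Gamma b))"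
  using suminf_finite[of "{0}" "\<lambda>j. (- 0) ^ j /\<^sub>R Gamma (b + real j * \<mu>)"]
  by (simp add: mitlef_def scaleR_conv_of_real)

lemma norm_mitlef_le:
  fixes z :: "'a::{real_normed_field, banach}"
  assumes "\<mu> > 0" "b > 0"
  shows "norm (mitlef \<mu> b z) \<le> mitlef \<mu> b (- norm z)"
proof -
  have g: "\<bar>Gamma (b + real j * \<mu>)\<bar> = Gamma (b + real j * \<mu>)" for j
    using Gamma_add_pos[OF assms(2,1)] by (simp add: abs_of_pos)
  have "norm (mitlef \<mu> b z) \<le> (\<Sum>j. norm ((- z) ^ j /\<^sub>R Gamma (b + real j * \<mu>)))"
    unfolding mitlef_def using summable_norm_mitlef[OF assms, of "- z"] by (rule summable_norm)
  also have "\<dots> = mitlef \<mu> b (- norm z)"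
    by (simp add: mitlef_def norm_power g)
  finally show ?thesis .
qed

lemma mitlef_recurrence:
  fixes z :: "'a::{real_normed_field, banach}"
  assumes "\<mu> > 0" "b > 0"
  shows "mitlef \<mu> b z + z * mitlef \<mu> (b + \<mu>) z = of_real (inverse (Gamma b))"
proof -
  have "(\<lambda>j. (- z) ^ Suc j /\<^sub>R Gamma (b + real (Suc j) * \<mu>)) sums (mitlef \<mu> b z - (- z) ^ 0 /\<^sub>R Gamma (b + real 0 * \<mu>))"
    using mitlef_sums[OF assms, of z] by (subst sums_Suc_iff) simp
  moreover have "(\<lambda>j. (- z) ^ Suc j /\<^sub>R Gamma (b + real (Suc j) * \<mu>)) sums (- z * mitlef \<mu> (b + \<mu>) z)"
    using sums_mult[OF mitlef_sums[of \<mu> "b + \<mu>" z], of "- z"] assms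
    by (simp add: algebra_simps)
  ultimately have "mitlef \<mu> b z - (- z) ^ 0 /\<^sub>R Gamma (b + real 0 * \<mu>) = - z * mitlef \<mu> (b + \<mu>) z"
    by (rule sums_unique2)
  then show ?thesis
    by (simp add: scaleR_conv_of_real algebra_simps)
qed

lemma has_frac_integral_cong:
  assumes "\<And>s. 0 < s \<Longrightarrow> s < t \<Longrightarrow> y s = z s"
  shows "has_frac_integral a y t I \<longleftrightarrow> has_frac_integral a z t I"
proof -
  have "(\<lambda>s. indicator {0<..<t} s *\<^sub>R frac_kernel a y t s) =
      (\<lambda>s. indicator {0<..<t} s *\<^sub>R frac_kernel a z t s)"
    using assms by (auto simp: fun_eq_iff indicator_def frac_kernel_def)
  then show ?thesis by (simp add: has_frac_integral_def)
qed

lemma has_frac_integral_add: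
  assumes "has_frac_integral a y t I" "has_frac_integral a z t J"
  shows "has_frac_integral a (\<lambda>s. y s + z s) t (I + J)"
  using has_bochner_integral_add[OF assms[unfolded has_frac_integral_def]]
  by (simp add: has_frac_integral_def frac_kernel_def scaleR_add_right)

lemma has_frac_integral_bounded_linear:
  assumes "has_frac_integral a y t I" "bounded_linear T"
  shows "has_frac_integral a (\<lambda>s. T (y s)) t (T I)"
  using has_bochner_integral_bounded_linear[OF assms(2) assms(1)[unfolded has_frac_integral_def]]
  by (simp add: has_frac_integral_def frac_kernel_def linear_simps[OF assms(2)])

lemma has_frac_integral_mult:
  fixes y :: "real \<Rightarrow> 'a::{real_normed_field, banach, second_countable_topology}"
  assumes "has_frac_integral a y t I"
  shows "has_frac_integral a (\<lambda>s. c * y s) t (c * I)"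
  using has_frac_integral_bounded_linear[OF assms bounded_linear_mult_right] .

lemma has_frac_integral_sum:
  fixes y :: "'i \<Rightarrow> real \<Rightarrow> 'a::{banach, second_countable_topology}"
  assumes "\<And>i. i \<in> S \<Longrightarrow> has_frac_integral a (y i) t (I i)"
  shows "has_frac_integral a (\<lambda>s. \<Sum>i\<in>S. y i s) t (\<Sum>i\<in>S. I i)"
proof -
  have "has_bochner_integral lborel (\<lambda>s. \<Sum>i\<in>S. indicator {0<..<t} s *\<^sub>R frac_kernel a (y i) t s) (\<Sum>i\<in>S. I i)"
    using assms by (intro has_bochner_integral_sum) (auto simp: has_frac_integral_def)
  then show ?thesis
    by (simp add: has_frac_integral_def frac_kernel_def scaleR_sum_right)
qed

lemma has_frac_integral_unique:
  "has_frac_integral a y t I \<Longrightarrow> has_frac_integral a y t J \<Longrightarrow> I = J"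
  unfolding has_frac_integral_def by (rule has_bochner_integral_eq)

text \<open>The relaxation functions: \<open>relax \<mu> 1 c\<close> solves the Caputo relaxation equation with rate \<open>c\<close>, and
  \<open>relax \<mu> \<mu> c\<close> the Riemann-Liouville one. A change of \<open>b\<close> is a fractional integration.\<close>

definition relax :: "real \<Rightarrow> real \<Rightarrow> 'a::{real_normed_field, banach} \<Rightarrow> real \<Rightarrow> 'a" where
  "relax \<mu> b c t = t powr (b - 1) *\<^sub>R mitlef \<mu> b (c * of_real (t powr \<mu>))"

lemma relax_sums:
  fixes c :: "'a::{real_normed_field, banach}"
  assumes "\<mu> > 0" "b > 0" "t > 0"
  shows "(\<lambda>j. (- c) ^ j * of_real (t powr (b + real j * \<mu> - 1) / Gamma (b + real j * \<mu>))) sums relax \<mu> b c t"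
proof -
  have "t powr (b - 1) *\<^sub>R ((- (c * of_real (t powr \<mu>))) ^ j /\<^sub>R Gamma (b + real j * \<mu>)) =
      (- c) ^ j * of_real (t powr (b + real j * \<mu> - 1) / Gamma (b + real j * \<mu>))" for j
  proof -
    have "(t powr \<mu>) ^ j = t powr (real j * \<mu>)"
      using assms by (simp add: powr_powr mult.commute flip: powr_realpow)
    moreover have "t powr (b - 1) * t powr (real j * \<mu>) = t powr (b + real j * \<mu> - 1)"
      by (simp add: powr_add[symmetric] algebra_simps)
    ultimately have "t powr (b + real j * \<mu> - 1) = t powr (b - 1) * (t powr \<mu>) ^ j" by simp
    moreover have "(- (c * of_real (t powr \<mu>))) ^ j = (- c) ^ j * of_real ((t powr \<mu>) ^ j)"
      by (simp only: mult_minus_left[symmetric] power_mult_distrib of_real_power)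
    ultimately show ?thesis
      by (simp add: scaleR_conv_of_real divide_inverse)
  qed
  then show ?thesis
    unfolding relax_def
    using sums_scaleR_right[OF mitlef_sums[OF assms(1,2), of "c * of_real (t powr \<mu>)"], of "t powr (b - 1)"]
    by (simp only:)
qed

lemma relax_of_real:
  assumes "\<mu> > 0" "b > 0"
  shows "relax \<mu> b (of_real c :: 'a::{real_normed_field, banach}) t = of_real (relax \<mu> b c t)"
proof -
  have "of_real c * of_real (t powr \<mu>) = (of_real (c * t powr \<mu>) :: 'a)" by simp
  then show ?thesis
    unfolding relax_def by (simp only: mitlef_of_real[OF assms]) (simp add: scaleR_conv_of_real)
qed

text \<open>Integrate the defining series termwise; every term is a normalized power. The terms are
  dominated by the series for \<open>- norm c\<close>, all of whose terms are non-negative.\<close>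

lemma has_frac_integral_relax:
  fixes c :: "'a::{real_normed_field, banach, second_countable_topology}"
  assumes "\<mu> > 0" "b > 0" "a > 0" "t > 0"
  shows "has_frac_integral a (relax \<mu> b c) t (relax \<mu> (b + a) c t)"
proof -
  define p where "p j s = s powr (b + real j * \<mu> - 1) / Gamma (b + real j * \<mu>)" for j s
  define f where "f j s = (- c) ^ j * of_real (p j s)" for j s
  have bj: "b + real j * \<mu> > 0" for j using assms by (simp add: add_pos_nonneg)
  have P: "has_frac_integral a (p j) t (t powr (b + a + real j * \<mu> - 1) / Gamma (b + a + real j * \<mu>))" for j
    using has_frac_integral_power[OF assms(3) bj assms(4), of j]
    by (simp add: p_def[abs_def] add_ac)
  have F: "has_frac_integral a (f j) t ((- c) ^ j * of_real (t powr (b + a + real j * \<mu> - 1) / Gamma (b + a + real j * \<mu>)))" for j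
    unfolding f_def
    by (intro has_frac_integral_mult has_frac_integral_bounded_linear[OF P] bounded_linear_of_real)
  define g where "g j s = indicator {0<..<t} s *\<^sub>R frac_kernel a (f j) t s" for j s
  have ng: "norm (g j s) = norm c ^ j * (indicator {0<..<t} s *\<^sub>R frac_kernel a (p j) t s)" for j s
    using Gamma_real_pos[OF bj, of j] Gamma_real_pos[OF assms(3)]
    by (simp add: g_def f_def p_def frac_kernel_def norm_mult norm_divide norm_power abs_mult abs_of_pos indicator_def)
  have ig: "integrable lborel (g j)" "integral\<^sup>L lborel (g j) = (- c) ^ j * of_real (t powr (b + a + real j * \<mu> - 1) / Gamma (b + a + real j * \<mu>))" for j
    using F[of j] by (simp_all add: has_frac_integral_def g_def[abs_def] has_bochner_integral_iff)
  have ing: "(LINT s|lborel. norm (g j s)) = norm c ^ j * (t powr (b + a + real j * \<mu> - 1) / Gamma (b + a + real j * \<mu>))" for j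
    unfolding ng using P[of j] by (simp add: has_frac_integral_def has_bochner_integral_iff)
  have gs: "(\<lambda>j. norm (g j s)) = (\<lambda>j. indicator {0<..<t} s * ((t - s) powr (a - 1) / Gamma a) * ((- (- norm c)) ^ j * of_real (s powr (b + real j * \<mu> - 1) / Gamma (b + real j * \<mu>))))" for s
    by (simp add: ng p_def frac_kernel_def fun_eq_iff)
  have g1: "AE s in lborel. summable (\<lambda>j. norm (g j s))"
  proof (rule AE_I2)
    fix s :: real
    show "summable (\<lambda>j. norm (g j s))"
    proof (cases "s > 0")
      case True
      show ?thesis unfolding gs
        by (intro summable_mult sums_summable[OF relax_sums] assms True)
    qed (simp add: g_def)
  qed
  have g2: "summable (\<lambda>j. LINT s|lborel. norm (g j s))"
    unfolding ing using sums_summable[OF relax_sums[of \<mu> "b + a" t "- norm c"]] assms by simp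
  have "(\<lambda>j. integral\<^sup>L lborel (g j)) sums (LINT s|lborel. (\<Sum>j. g j s))"
    by (rule sums_integral[OF ig(1) g1 g2])
  moreover have "(\<lambda>j. integral\<^sup>L lborel (g j)) sums relax \<mu> (b + a) c t"
    unfolding ig(2) using assms by (intro relax_sums) auto
  ultimately have "(LINT s|lborel. (\<Sum>j. g j s)) = relax \<mu> (b + a) c t"
    by (rule sums_unique2)
  moreover have "integrable lborel (\<lambda>s. \<Sum>j. g j s)"
    by (rule integrable_suminf[OF ig(1) g1 g2])
  moreover have "(\<Sum>j. g j s) = indicator {0<..<t} s *\<^sub>R frac_kernel a (relax \<mu> b c) t s" for s
  proof (cases "0 < s")
    case True
    have "(\<lambda>j. f j s) sums relax \<mu> b c s"
      unfolding f_def p_def by (intro relax_sums assms True)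
    then have "(\<lambda>j. g j s) sums (indicator {0<..<t} s *\<^sub>R frac_kernel a (relax \<mu> b c) t s)"
      unfolding g_def frac_kernel_def by (intro sums_scaleR_right)
    then show ?thesis by (simp add: sums_iff)
  qed (simp add: g_def)
  ultimately show ?thesis
    by (simp add: has_frac_integral_def has_bochner_integral_iff)
qed

text \<open>Splitting off the first term of the series. Together with
  \<open>has_frac_integral_relax\<close> this says that \<open>relax \<mu> b c\<close> solves the Volterra equation
  with kernel order \<open>\<mu>\<close> and a power as inhomogeneity.\<close>

lemma relax_recurrence:
  fixes c :: "'a::{real_normed_field, banach}"
  assumes "\<mu> > 0" "b > 0" "t > 0"
  shows "relax \<mu> b c t + c * relax \<mu> (b + \<mu>) c t = of_real (t powr (b - 1) / Gamma b)"
proof -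
  have "t powr (b + \<mu> - 1) = t powr (b - 1) * t powr \<mu>"
    by (simp add: powr_add[symmetric] algebra_simps)
  then have "relax \<mu> b c t + c * relax \<mu> (b + \<mu>) c t =
      t powr (b - 1) *\<^sub>R (mitlef \<mu> b (c * of_real (t powr \<mu>)) +
        (c * of_real (t powr \<mu>)) * mitlef \<mu> (b + \<mu>) (c * of_real (t powr \<mu>)))"
    by (simp add: relax_def scaleR_conv_of_real algebra_simps)
  also have "\<dots> = of_real (t powr (b - 1) / Gamma b)"
    by (simp add: mitlef_recurrence[OF assms(1,2)] scaleR_conv_of_real divide_inverse)
  finally show ?thesis .
qed

lemma mitlef_has_derivative:
  fixes z :: "'a::{real_normed_field, banach}"
  assumes "\<mu> > 0" "b > 0"
  obtains D where "(mitlef \<mu> (b + 1) has_field_derivative D) (at z)"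
    and "of_real b * mitlef \<mu> (b + 1) z + of_real \<mu> * z * D = mitlef \<mu> b z"
proof -
  define k :: "nat \<Rightarrow> 'a" where "k j = of_real ((-1) ^ j / Gamma (b + 1 + real j * \<mu>))" for j
  have ml: "mitlef \<mu> (b + 1) = (\<lambda>w::'a. \<Sum>j. k j * w ^ j)"
  proof -
    have "(- w) ^ j /\<^sub>R Gamma (b + 1 + real j * \<mu>) = k j * w ^ j" for j and w :: 'a
      by (subst power_minus) (simp add: k_def scaleR_conv_of_real divide_inverse)
    then show ?thesis by (simp add: mitlef_def fun_eq_iff)
  qed
  have sk: "summable (\<lambda>j. k j * w ^ j)" for w :: 'a
  proof -
    have "k j * w ^ j = (- w) ^ j /\<^sub>R Gamma (b + 1 + real j * \<mu>)" for j
      by (subst power_minus) (simp add: k_def scaleR_conv_of_real divide_inverse)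
    then show ?thesis
      using sums_summable[OF mitlef_sums[of \<mu> "b + 1" w]] assms by simp
  qed
  define D where "D = (\<Sum>n. diffs k n * z ^ n)"
  have "summable (\<lambda>n. diffs k n * z ^ n)"
    using termdiff_converges_all[OF sk] by simp
  then have "(\<lambda>n. of_nat n * k n * z ^ (n - Suc 0)) sums D"
    unfolding D_def by (rule diffs_equiv)
  then have "(\<lambda>n. of_real \<mu> * z * (of_nat n * k n * z ^ (n - Suc 0))) sums (of_real \<mu> * z * D)"
    by (rule sums_mult)
  moreover have "of_real \<mu> * z * (of_nat n * k n * z ^ (n - Suc 0)) = of_real (real n * \<mu>) * (k n * z ^ n)" for n
    by (cases n) (auto simp: algebra_simps)
  ultimately have "(\<lambda>n. of_real (real n * \<mu>) * (k n * z ^ n)) sums (of_real \<mu> * z * D)" by simp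
  moreover have "(\<lambda>n. of_real b * (k n * z ^ n)) sums (of_real b * mitlef \<mu> (b + 1) z)"
    unfolding ml by (intro sums_mult summable_sums sk)
  ultimately have "(\<lambda>n. of_real b * (k n * z ^ n) + of_real (real n * \<mu>) * (k n * z ^ n)) sums
      (of_real b * mitlef \<mu> (b + 1) z + of_real \<mu> * z * D)"
    by (rule sums_add[rotated])
  moreover have "of_real b * (k n * z ^ n) + of_real (real n * \<mu>) * (k n * z ^ n) = (- z) ^ n /\<^sub>R Gamma (b + real n * \<mu>)" for n
  proof -
    have pos: "b + real n * \<mu> > 0" using assms by (simp add: add_pos_nonneg)
    have G: "Gamma (b + 1 + real n * \<mu>) = (b + real n * \<mu>) * Gamma (b + real n * \<mu>)"
      using Gamma_plus1[of "b + real n * \<mu>"] pos nonpos_Ints_nonpos[of "b + real n * \<mu>"] by (force simp: add_ac)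
    have "of_real b * (k n * z ^ n) + of_real (real n * \<mu>) * (k n * z ^ n) = of_real (b + real n * \<mu>) * k n * z ^ n"
      by (simp add: algebra_simps)
    also have "of_real (b + real n * \<mu>) * k n = of_real ((b + real n * \<mu>) * ((-1) ^ n / Gamma (b + 1 + real n * \<mu>)))"
      unfolding k_def by (simp only: of_real_mult)
    also have "(b + real n * \<mu>) * ((-1) ^ n / Gamma (b + 1 + real n * \<mu>)) = (-1) ^ n / Gamma (b + real n * \<mu>)"
      unfolding G using pos by simp
    finally show ?thesis
      by (subst power_minus) (simp add: scaleR_conv_of_real divide_inverse)
  qed
  ultimately have "(\<lambda>n. (- z) ^ n /\<^sub>R Gamma (b + real n * \<mu>)) sums (of_real b * mitlef \<mu> (b + 1) z + of_real \<mu> * z * D)"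
    by simp
  then have "of_real b * mitlef \<mu> (b + 1) z + of_real \<mu> * z * D = mitlef \<mu> b z"
    using mitlef_sums[OF assms] sums_unique2 by blast
  moreover have "(mitlef \<mu> (b + 1) has_field_derivative D) (at z)"
    unfolding ml D_def by (rule termdiffs_strong_converges_everywhere[OF sk])
  ultimately show ?thesis using that by blast
qed

lemma relax_has_derivative:
  fixes c :: real
  assumes "\<mu> > 0" "b > 0" "t > 0"
  shows "(relax \<mu> (b + 1) c has_real_derivative relax \<mu> b c t) (at t)"
proof -
  obtain D where D: "(mitlef \<mu> (b + 1) has_field_derivative D) (at (c * t powr \<mu>))"
    and eq: "b * mitlef \<mu> (b + 1) (c * t powr \<mu>) + \<mu> * (c * t powr \<mu>) * D = mitlef \<mu> b (c * t powr \<mu>)"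
    using mitlef_has_derivative[OF assms(1,2), of "c * t powr \<mu>"] by auto
  have "((\<lambda>t. c * t powr \<mu>) has_real_derivative c * (\<mu> * t powr (\<mu> - 1))) (at t)"
    using assms by (auto intro!: derivative_eq_intros)
  from DERIV_chain2[OF D this]
  have "((\<lambda>t. mitlef \<mu> (b + 1) (c * t powr \<mu>)) has_real_derivative D * (c * (\<mu> * t powr (\<mu> - 1)))) (at t)" .
  moreover have "((\<lambda>t. t powr b) has_real_derivative b * t powr (b - 1)) (at t)"
    using assms by (auto intro!: derivative_eq_intros)
  ultimately have "((\<lambda>t. t powr b * mitlef \<mu> (b + 1) (c * t powr \<mu>)) has_real_derivative
      (b * t powr (b - 1)) * mitlef \<mu> (b + 1) (c * t powr \<mu>) + (D * (c * (\<mu> * t powr (\<mu> - 1)))) * t powr b) (at t)"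
    by (rule DERIV_mult[rotated])
  moreover have "(b * t powr (b - 1)) * mitlef \<mu> (b + 1) (c * t powr \<mu>) + (D * (c * (\<mu> * t powr (\<mu> - 1)))) * t powr b = relax \<mu> b c t"
  proof -
    have "t powr (\<mu> - 1) * t powr b = t powr (b - 1) * t powr \<mu>"
      by (simp add: powr_add[symmetric] algebra_simps)
    then have "(D * (c * (\<mu> * t powr (\<mu> - 1)))) * t powr b = t powr (b - 1) * (\<mu> * (c * t powr \<mu>) * D)"
      by (simp add: mult_ac)
    then show ?thesis
      by (simp add: relax_def eq[symmetric] algebra_simps)
  qed
  ultimately show ?thesis
    by (simp add: relax_def[abs_def])
qed

section \<open>Positivity of Mittag-Leffler functions\<close>

lemma Gamma_plus1_real: "x > 0 \<Longrightarrow> Gamma (x + 1) = x * Gamma (x::real)"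
  using Gamma_plus1[of x] nonpos_Ints_nonpos[of x] by fastforce

lemma mitlef_differentiable:
  fixes z :: "'a::{real_normed_field, banach}"
  assumes "\<mu> > 0" "b > 0"
  obtains D where "(mitlef \<mu> b has_field_derivative D) (at z)"
proof -
  define k :: "nat \<Rightarrow> 'a" where "k j = of_real ((-1) ^ j / Gamma (b + real j * \<mu>))" for j
  have *: "k j * w ^ j = (- w) ^ j /\<^sub>R Gamma (b + real j * \<mu>)" for j and w :: 'a
    by (subst power_minus) (simp add: k_def scaleR_conv_of_real divide_inverse)
  have "summable (\<lambda>j. k j * w ^ j)" for w :: 'a
    unfolding * using sums_summable[OF mitlef_sums[OF assms]] .
  from termdiffs_strong_converges_everywhere[OF this, of z]
  show ?thesis using that unfolding * mitlef_def[symmetric, abs_def] by blast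
qed

lemma isCont_mitlef:
  fixes z :: "'a::{real_normed_field, banach}"
  assumes "\<mu> > 0" "b > 0"
  shows "isCont (mitlef \<mu> b) z"
  using mitlef_differentiable[OF assms, of z] DERIV_isCont by blast

lemma continuous_on_relax:
  fixes c :: "'a::{real_normed_field, banach}"
  assumes "\<mu> > 0" "b > 0" "S \<subseteq> {0<..}"
  shows "continuous_on S (relax \<mu> b c)"
proof -
  have m: "continuous_on UNIV (mitlef \<mu> b :: 'a \<Rightarrow> 'a)"
    by (simp add: continuous_on_eq_continuous_at isCont_mitlef[OF assms(1,2)])
  have "continuous_on S (\<lambda>t. c * of_real (t powr \<mu>))"
    using assms by (intro continuous_intros) auto
  from continuous_on_compose2[OF m this]
  have "continuous_on S (\<lambda>t. mitlef \<mu> b (c * of_real (t powr \<mu>)))" by simp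
  then show ?thesis
    unfolding relax_def using assms by (intro continuous_intros) auto
qed

lemma has_frac_integral_nonneg:
  fixes y :: "real \<Rightarrow> real"
  assumes "has_frac_integral a y t I" "a > 0" "\<And>s. 0 < s \<Longrightarrow> s < t \<Longrightarrow> y s \<ge> 0"
  shows "I \<ge> 0"
proof -
  have "0 \<le> (LINT s|lborel. indicator {0<..<t} s *\<^sub>R frac_kernel a y t s)"
    using assms(2,3) Gamma_real_pos[of a]
    by (intro integral_nonneg_AE AE_I2) (auto simp: frac_kernel_def indicator_def)
  then show ?thesis
    using assms(1) by (simp add: has_frac_integral_def has_bochner_integral_iff)
qed

lemma has_bochner_integral_kernel_tail:
  fixes \<mu> t t0 :: real
  assumes "\<mu> > 0" "t < t0"
  shows "has_bochner_integral lborel (\<lambda>s. indicator {t<..<t0} s * (t0 - s) powr (\<mu> - 1)) ((t0 - t) powr \<mu> / \<mu>)"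
proof -
  have "has_frac_integral \<mu> (\<lambda>s. s powr (1 - 1) / Gamma 1) (t0 - t) ((t0 - t) powr (\<mu> + 1 - 1) / Gamma (\<mu> + 1))"
    using assms by (intro has_frac_integral_power) auto
  then have "has_bochner_integral lborel
      (\<lambda>s. Gamma \<mu> * (indicator {0<..<t0 - t} s *\<^sub>R frac_kernel \<mu> (\<lambda>s. s powr (1 - 1) / Gamma 1) (t0 - t) s))
      (Gamma \<mu> * ((t0 - t) powr (\<mu> + 1 - 1) / Gamma (\<mu> + 1)))"
    unfolding has_frac_integral_def by (rule has_bochner_integral_mult_right)
  also have "Gamma \<mu> * ((t0 - t) powr (\<mu> + 1 - 1) / Gamma (\<mu> + 1)) = (t0 - t) powr \<mu> / \<mu>"
    using Gamma_plus1_real[OF assms(1)] Gamma_real_pos[OF assms(1)] by (simp del: Gamma_real_pos)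
  also have "(\<lambda>s. Gamma \<mu> * (indicator {0<..<t0 - t} s *\<^sub>R frac_kernel \<mu> (\<lambda>s. s powr (1 - 1) / Gamma 1) (t0 - t) s)) =
      (\<lambda>s. indicator {t<..<t0} (t + 1 * s) * (t0 - (t + 1 * s)) powr (\<mu> - 1))"
    using Gamma_real_pos[OF assms(1)] by (auto simp: fun_eq_iff indicator_def frac_kernel_def diff_diff_eq)
  finally show ?thesis
    by (subst lborel_has_bochner_integral_real_affine_iff[of 1 _ _ t]) auto
qed

text \<open>With \<open>b = \<mu>\<close> and \<open>c = 1\<close>, \<open>r = relax \<mu> \<mu> 1\<close> satisfies
  \<open>r t = t powr (\<mu> - 1) / Gamma \<mu> - I r t\<close>, where \<open>I\<close> is the fractional integral of order \<open>\<mu>\<close>. The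
  function is positive near \<open>0\<close>. If it became negative, let \<open>t0\<close> be its first zero and let \<open>t\<close> maximize \<open>r\<close> on a short interval
  that ends at \<open>t0\<close>. Because \<open>\<mu> \<le> 1\<close>, on \<open>(0, t)\<close> the kernel at \<open>t0\<close> is at most
  \<open>(t0 / t) powr (\<mu> - 1)\<close> times the kernel at \<open>t\<close>, and the inhomogeneity scales by exactly the same
  factor. Subtracting the two equations bounds a positive multiple of \<open>r t\<close> by the contribution of
  \<open>(t, t0)\<close>, which is too small.\<close>

lemma relax_nonneg:
  assumes \<mu>: "0 < \<mu>" "\<mu> \<le> 1" and "t1 > 0"
  shows "relax \<mu> \<mu> (1::real) t1 \<ge> 0"
proof (rule ccontr)
  define r where "r = relax \<mu> \<mu> (1::real)"
  assume "\<not> ?thesis"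
  then have t1: "r t1 < 0" by (simp add: r_def)
  have G: "Gamma \<mu> > 0" using \<mu> by (simp add: Gamma_real_pos)
  have G1: "Gamma (\<mu> + 1) = \<mu> * Gamma \<mu>"
    using Gamma_plus1_real \<mu> by simp
  have cont: "continuous_on {0<..} r"
    unfolding r_def using \<mu> by (intro continuous_on_relax) auto
  obtain \<delta> where \<delta>: "\<delta> > 0" "\<And>t. 0 < t \<Longrightarrow> t \<le> \<delta> \<Longrightarrow> r t > 0"
  proof -
    have "isCont (mitlef \<mu> \<mu> :: real \<Rightarrow> real) 0" by (intro isCont_mitlef \<mu>)
    then have "(mitlef \<mu> \<mu> \<longlongrightarrow> mitlef \<mu> \<mu> 0) (at (0::real))" by (simp add: isCont_def)
    moreover have "mitlef \<mu> \<mu> (0::real) > 0" using G by simp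
    ultimately have "eventually (\<lambda>x. mitlef \<mu> \<mu> x > 0) (at (0::real))"
      by (rule order_tendstoD)
    then obtain d where d: "d > 0" "\<And>x. x \<noteq> 0 \<Longrightarrow> \<bar>x\<bar> < d \<Longrightarrow> mitlef \<mu> \<mu> (x::real) > 0"
      by (auto simp: eventually_at dist_real_def)
    show ?thesis
    proof
      show "(d / 2) powr (1 / \<mu>) > 0" using d by simp
      fix t :: real assume t: "0 < t" "t \<le> (d / 2) powr (1 / \<mu>)"
      have "t powr \<mu> \<le> ((d / 2) powr (1 / \<mu>)) powr \<mu>"
        using t \<mu> by (intro powr_mono2) auto
      also have "\<dots> = d / 2" using d \<mu> by (simp add: powr_powr)
      finally have "mitlef \<mu> \<mu> (t powr \<mu>) > 0" using d t by (intro d(2)) auto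
      then show "r t > 0" using t by (simp add: r_def relax_def)
    qed
  qed
  define S where "S = {t \<in> {\<delta>..t1}. r t \<le> 0}"
  have "closed S"
    unfolding S_def using \<delta>(1)
    by (intro continuous_on_closed_Collect_le continuous_on_subset[OF cont] continuous_on_const) auto
  moreover have "bounded S" by (rule bounded_subset[of "{\<delta>..t1}"]) (auto simp: S_def)
  ultimately have "compact S" by (simp add: compact_eq_bounded_closed)
  moreover have "t1 \<in> S"
    using t1 \<delta>(2)[of t1] assms(3) by (force simp: S_def)
  ultimately obtain t0 where t0S: "t0 \<in> S" and t0min: "\<And>t. t \<in> S \<Longrightarrow> t0 \<le> t"
    using compact_attains_inf[of S] by blast
  have t0: "r t0 \<le> 0" "\<delta> \<le> t0" "t0 > 0" using t0S \<delta>(1) by (auto simp: S_def)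
  have rpos: "r t > 0" if "0 < t" "t < t0" for t
  proof (rule ccontr)
    assume "\<not> r t > 0"
    then have "t \<in> S" using that \<delta>(2)[of t] t0S by (force simp: S_def)
    then show False using t0min that by force
  qed
  \<comment> \<open>The length of the interval: half of \<open>t0\<close> keeps \<open>t0 / t \<le> 2\<close>, the other bound makes the tail of
    the kernel small against \<open>Gamma \<mu>\<close>.\<close>
  define \<eta> where "\<eta> = min (t0 / 2) ((Gamma (\<mu> + 1) / 3) powr (1 / \<mu>))"
  have G1p: "Gamma (\<mu> + 1) > 0" using G1 G \<mu> by simp
  have \<eta>: "\<eta> > 0" "\<eta> \<le> t0 / 2" "\<eta> powr \<mu> \<le> Gamma (\<mu> + 1) / 3"
  proof -
    show "\<eta> > 0" "\<eta> \<le> t0 / 2" using t0 G1p by (auto simp: \<eta>_def)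
    have "\<eta> powr \<mu> \<le> ((Gamma (\<mu> + 1) / 3) powr (1 / \<mu>)) powr \<mu>"
      using \<open>\<eta> > 0\<close> \<mu> by (intro powr_mono2) (auto simp: \<eta>_def)
    also have "\<dots> = Gamma (\<mu> + 1) / 3" using G1p \<mu> by (simp add: powr_powr)
    finally show "\<eta> powr \<mu> \<le> Gamma (\<mu> + 1) / 3" .
  qed
  obtain t where t: "t \<in> {t0 - \<eta>..t0}" and tmax: "\<And>s. s \<in> {t0 - \<eta>..t0} \<Longrightarrow> r s \<le> r t"
    using continuous_attains_sup[of "{t0 - \<eta>..t0}" r] continuous_on_subset[OF cont, of "{t0 - \<eta>..t0}"] \<eta> t0
    by fastforce
  have "r t \<ge> r (t0 - \<eta>)" using \<eta> by (intro tmax) auto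
  moreover have "r (t0 - \<eta>) > 0" using \<eta> t0 by (intro rpos) auto
  ultimately have rt: "r t > 0" by simp
  then have tt: "t < t0" "t > 0" "t \<ge> t0 / 2" using t t0 \<eta> by (auto simp: less_le)
  define K where "K u s = indicator {0<..<u} s * ((u - s) powr (\<mu> - 1) * r s)" for u s
  have int: "has_bochner_integral lborel (K u) (u powr (\<mu> - 1) - Gamma \<mu> * r u)" if "u > 0" for u
  proof -
    have "has_frac_integral \<mu> r u (relax \<mu> (\<mu> + \<mu>) 1 u)"
      unfolding r_def using \<mu> that by (intro has_frac_integral_relax) auto
    then have "has_bochner_integral lborel (\<lambda>s. Gamma \<mu> * (indicator {0<..<u} s *\<^sub>R frac_kernel \<mu> r u s)) (Gamma \<mu> * relax \<mu> (\<mu> + \<mu>) 1 u)"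
      unfolding has_frac_integral_def by (rule has_bochner_integral_mult_right)
    also have "Gamma \<mu> * relax \<mu> (\<mu> + \<mu>) 1 u = u powr (\<mu> - 1) - Gamma \<mu> * r u"
      using relax_recurrence[OF \<mu>(1) \<mu>(1) that, of "1::real"] G by (simp add: r_def field_simps)
    also have "(\<lambda>s. Gamma \<mu> * (indicator {0<..<u} s *\<^sub>R frac_kernel \<mu> r u s)) = K u"
      using G by (auto simp: fun_eq_iff K_def frac_kernel_def)
    finally show ?thesis .
  qed
  define q where "q = (t0 / t) powr (\<mu> - 1)"
  define J where "J s = q * K t s + r t * (indicator {t<..<t0} s * (t0 - s) powr (\<mu> - 1))" for s
  have 1: "has_bochner_integral lborel J
     (q * (t powr (\<mu> - 1) - Gamma \<mu> * r t) + r t * ((t0 - t) powr \<mu> / \<mu>))"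
    unfolding J_def using tt \<mu> by (intro has_bochner_integral_add has_bochner_integral_mult_right int has_bochner_integral_kernel_tail) auto
  \<comment> \<open>Before \<open>t\<close> the kernels are compared, after \<open>t\<close> the function is estimated by its maximum.\<close>
  have 2: "AE s in lborel. K t0 s \<le> J s"
    unfolding J_def
  proof (rule AE_mp[OF AE_lborel_singleton[of t]], intro AE_I2 impI)
    fix s assume "s \<noteq> t"
    consider "s \<le> 0" | "s > 0" "s < t" | "t < s" "s < t0" | "s \<ge> t0" using \<open>s \<noteq> t\<close> by linarith
    then show "K t0 s \<le> q * K t s + r t * (indicator {t<..<t0} s * (t0 - s) powr (\<mu> - 1))"
    proof cases
      case 1 then show ?thesis using tt by (simp add: K_def)
    next
      case 2
      have "t0 / t * (t - s) \<le> t0 - s" using 2 tt by (simp add: field_simps)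
      then have "(t0 - s) powr (\<mu> - 1) \<le> (t0 / t * (t - s)) powr (\<mu> - 1)"
        using 2 tt \<mu> by (intro powr_mono2') auto
      also have "\<dots> = q * (t - s) powr (\<mu> - 1)" unfolding q_def using 2 tt by (subst powr_mult) auto
      finally have "(t0 - s) powr (\<mu> - 1) * r s \<le> q * (t - s) powr (\<mu> - 1) * r s"
        using rpos[of s] 2 tt by (intro mult_right_mono) auto
      then show ?thesis using 2 tt by (simp add: K_def)
    next
      case 3
      then have "r s \<le> r t" using t by (intro tmax) auto
      then show ?thesis using 3 tt by (simp add: K_def mult.commute mult_right_mono)
    next
      case 4 then show ?thesis using tt by (simp add: K_def)
    qed
  qed
  have "integral\<^sup>L lborel (K t0) \<le> integral\<^sup>L lborel J"
    by (rule integral_mono_AE[OF _ _ 2]) (use 1 int[OF t0(3)] in \<open>auto simp: has_bochner_integral_iff\<close>)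
  then have "t0 powr (\<mu> - 1) - Gamma \<mu> * r t0 \<le> q * (t powr (\<mu> - 1) - Gamma \<mu> * r t) + r t * ((t0 - t) powr \<mu> / \<mu>)"
    using 1 int[OF t0(3)] by (simp only: has_bochner_integral_iff)
  moreover have "q * t powr (\<mu> - 1) = t0 powr (\<mu> - 1)"
    unfolding q_def using tt t0 by (subst powr_mult[symmetric]) auto
  ultimately have "q * Gamma \<mu> * r t \<le> r t * ((t0 - t) powr \<mu> / \<mu>) + Gamma \<mu> * r t0"
    by (simp add: algebra_simps)
  also have "Gamma \<mu> * r t0 \<le> 0" using t0 G by (simp add: mult_nonneg_nonpos)
  finally have "q * Gamma \<mu> * r t \<le> ((t0 - t) powr \<mu> / \<mu>) * r t" by (simp add: mult.commute)
  then have "q * Gamma \<mu> \<le> (t0 - t) powr \<mu> / \<mu>" using rt by (rule mult_right_le_imp_le)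
  also have "(t0 - t) powr \<mu> \<le> \<eta> powr \<mu>" using t tt \<mu> by (intro powr_mono2) auto
  finally have "q * Gamma \<mu> \<le> (Gamma (\<mu> + 1) / 3) / \<mu>"
    using \<eta>(3) \<mu> by (smt (verit) divide_right_mono)
  then have "q \<le> 1 / 3" using G1 G \<mu> by simp
  moreover have "q \<ge> 1 / 2"
  proof -
    have "(t0 / t) powr (-1) \<le> q" unfolding q_def using tt t0 \<mu> by (intro powr_mono) auto
    moreover have "(t0 / t) powr (-1) = t / t0" using tt t0 by (simp add: powr_minus)
    moreover have "t / t0 \<ge> 1 / 2" using tt t0 by (simp add: field_simps)
    ultimately show ?thesis by linarith
  qed
  ultimately show False by simp
qed

text \<open>From \<open>b = \<mu>\<close> by fractional integration of order \<open>b - \<mu>\<close>; time scaling reaches every \<open>x\<close>.\<close>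

lemma mitlef_nonneg:
  assumes \<mu>: "0 < \<mu>" "\<mu> \<le> 1" and "b \<ge> \<mu>" "x \<ge> 0"
  shows "mitlef \<mu> b (x::real) \<ge> 0"
proof (cases "x = 0")
  case True
  then show ?thesis using assms Gamma_real_pos[of b] by simp
next
  case False
  define t where "t = x powr (1 / \<mu>)"
  have t: "t > 0" "t powr \<mu> = x" using False assms by (auto simp: t_def powr_powr)
  have "relax \<mu> b (1::real) t \<ge> 0"
  proof (cases "b = \<mu>")
    case True then show ?thesis using relax_nonneg[OF \<mu> t(1)] by simp
  next
    case False
    have "has_frac_integral (b - \<mu>) (relax \<mu> \<mu> (1::real)) t (relax \<mu> (\<mu> + (b - \<mu>)) 1 t)"
      using assms False t by (intro has_frac_integral_relax) auto
    then show ?thesis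
      using has_frac_integral_nonneg[of "b - \<mu>" "relax \<mu> \<mu> 1" t] relax_nonneg[OF \<mu>] False assms by auto
  qed
  then show ?thesis using t by (simp add: relax_def zero_le_mult_iff)
qed

section \<open>Monotonicity, decay and a sector bound\<close>

lemma norm_mitlef_le_norm_le:
  fixes z :: "'a::{real_normed_field, banach}"
  assumes "\<mu> > 0" "b > 0" "norm z \<le> x"
  shows "norm (mitlef \<mu> b z) \<le> mitlef \<mu> b (- x)"
proof -
  have "norm (mitlef \<mu> b z) \<le> mitlef \<mu> b (- norm z)" by (rule norm_mitlef_le[OF assms(1,2)])
  also have "\<dots> \<le> mitlef \<mu> b (- x)"
  proof (rule sums_le[OF _ mitlef_sums[OF assms(1,2)] mitlef_sums[OF assms(1,2)]])
    show "(- (- norm z)) ^ j /\<^sub>R Gamma (b + real j * \<mu>) \<le> (- (- x)) ^ j /\<^sub>R Gamma (b + real j * \<mu>)" for j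
      using assms(3) Gamma_add_pos[OF assms(2,1), of j]
      by (intro scaleR_left_mono power_mono) (auto intro: less_imp_le)
  qed
  finally show ?thesis .
qed

lemma norm_relax_le:
  fixes c :: "'a::{real_normed_field, banach}"
  assumes "\<mu> > 0" "b > 0" "norm c \<le> x"
  shows "norm (relax \<mu> b c t) \<le> relax \<mu> b (- x) t"
proof -
  have "norm (mitlef \<mu> b (c * of_real (t powr \<mu>))) \<le> mitlef \<mu> b (- (x * t powr \<mu>))"
    using assms by (intro norm_mitlef_le_norm_le) (auto simp: norm_mult mult_right_mono)
  then show ?thesis by (simp add: relax_def mult_left_mono)
qed

lemma summable_relax_shifts:
  fixes a x :: real
  assumes "\<mu> > 0" "b > 0" "t > 0" "a \<ge> 0" "x \<ge> 2 * a + 1"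
  shows "summable (\<lambda>i. a ^ i * relax \<mu> (b + real i * \<mu>) (- x) t)"
proof -
  define R where "R i = relax \<mu> (b + real i * \<mu>) (- x) t" for i
  have bi: "b + real i * \<mu> > 0" for i using assms by (simp add: add_pos_nonneg)
  have R0: "R i \<ge> 0" for i
    using norm_relax_le[OF assms(1) bi order_refl, of i "- x" t] norm_ge_zero[of "relax \<mu> (b + real i * \<mu>) (- x) t"] assms
    by (simp add: R_def)
  have step: "R (Suc i) \<le> R i / x" for i
  proof -
    have "R i - x * R (Suc i) = t powr (b + real i * \<mu> - 1) / Gamma (b + real i * \<mu>)"
      using relax_recurrence[OF assms(1) bi assms(3), of i "- x"] by (simp add: R_def algebra_simps)
    moreover have "\<dots> \<ge> 0" using Gamma_real_pos[OF bi, of i] by simp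
    ultimately show ?thesis using assms by (simp add: field_simps)
  qed
  have bound: "a ^ i * R i \<le> R 0 * (1/2) ^ i" for i
  proof (induction i)
    case (Suc i)
    have "a ^ Suc i * R (Suc i) \<le> a ^ Suc i * (R i / x)"
      using step assms by (intro mult_left_mono) auto
    also have "\<dots> = (a / x) * (a ^ i * R i)" by simp
    also have "\<dots> \<le> (1/2) * (R 0 * (1/2) ^ i)"
      using assms R0 by (intro mult_mono Suc.IH) (auto simp: field_simps)
    finally show ?case by simp
  qed simp
  show ?thesis
  proof (rule summable_comparison_test[OF exI[of _ 0]])
    show "summable (\<lambda>i. R 0 * (1/2) ^ i :: real)" by (intro summable_mult summable_geometric) simp
    show "\<forall>n\<ge>0. norm (a ^ n * relax \<mu> (b + real n * \<mu>) (- x) t) \<le> R 0 * (1 / 2) ^ n"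
      using bound R0 assms by (simp add: R_def[symmetric] abs_mult)
  qed
qed

text \<open>The analogue of the resolvent identity for the convolution semigroup of relaxation functions. Expand
  the kernel \<open>relax \<mu> \<mu> c0 (t - s)\<close> in powers of \<open>c0\<close>: each term is a fractional integral of
  \<open>relax \<mu> b c\<close>, and the resulting series telescopes by \<open>relax_recurrence\<close>.\<close>

lemma relax_resolvent_identity:
  fixes c :: "'a::{real_normed_field, banach, second_countable_topology}" and c0 :: real
  assumes "\<mu> > 0" "b > 0" "t > 0"
  obtains Q where
    "has_bochner_integral lborel (\<lambda>s. indicator {0<..<t} s *\<^sub>R (relax \<mu> \<mu> c0 (t - s) *\<^sub>R relax \<mu> b c s)) Q"
    "(c - of_real c0) * Q = relax \<mu> b (of_real c0) t - relax \<mu> b c t"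
proof -
  define x where "x = 2 * \<bar>c0\<bar> + 1 + norm c"
  have x: "x \<ge> 2 * \<bar>c0\<bar> + 1" "norm c \<le> x" by (auto simp: x_def)
  define m where "m i = real (Suc i) * \<mu>" for i
  have m: "m i > 0" for i using assms by (simp add: m_def)
  define f where "f i s = indicator {0<..<t} s *\<^sub>R ((- c0) ^ i *\<^sub>R frac_kernel (m i) (relax \<mu> b c) t s)" for i s
  define R where "R i = relax \<mu> (b + real i * \<mu>) c t" for i
  have bi: "b + real i * \<mu> > 0" for i using assms by (simp add: add_pos_nonneg)
  have bm: "b + m i = b + real (Suc i) * \<mu>" for i by (simp add: m_def)
  have I: "has_bochner_integral lborel (f i) ((- c0) ^ i *\<^sub>R R (Suc i))" for i
  proof -
    have "has_bochner_integral lborel (\<lambda>s. (- c0) ^ i *\<^sub>R (indicator {0<..<t} s *\<^sub>R frac_kernel (m i) (relax \<mu> b c) t s)) ((- c0) ^ i *\<^sub>R R (Suc i))"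
      using has_frac_integral_relax[OF assms(1,2) m assms(3), of i c]
      unfolding has_frac_integral_def R_def bm by (intro has_bochner_integral_scaleR_right)
    moreover have "(\<lambda>s. (- c0) ^ i *\<^sub>R (indicator {0<..<t} s *\<^sub>R frac_kernel (m i) (relax \<mu> b c) t s)) = f i"
      by (simp add: f_def fun_eq_iff scaleR_left_commute)
    ultimately show ?thesis by simp
  qed
  have I': "has_bochner_integral lborel (\<lambda>s. \<bar>c0\<bar> ^ i * (indicator {0<..<t} s *\<^sub>R frac_kernel (m i) (relax \<mu> b (- x)) t s)) (\<bar>c0\<bar> ^ i * relax \<mu> (b + real (Suc i) * \<mu>) (- x) t)" for i
    using has_frac_integral_relax[OF assms(1,2) m assms(3), of i "- x"]
    unfolding has_frac_integral_def bm by (intro has_bochner_integral_mult_right)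
  have le: "norm (f i s) \<le> \<bar>c0\<bar> ^ i * (indicator {0<..<t} s *\<^sub>R frac_kernel (m i) (relax \<mu> b (- x)) t s)" for i s
  proof (cases "0 < s \<and> s < t")
    case True
    have "norm (f i s) = \<bar>c0\<bar> ^ i * ((t - s) powr (m i - 1) / Gamma (m i) * norm (relax \<mu> b c s))"
      using True Gamma_real_pos[OF m, of i] by (simp add: f_def frac_kernel_def power_abs abs_mult)
    also have "\<dots> \<le> \<bar>c0\<bar> ^ i * ((t - s) powr (m i - 1) / Gamma (m i) * relax \<mu> b (- x) s)"
      using Gamma_real_pos[OF m, of i] norm_relax_le[OF assms(1,2) x(2)]
      by (intro mult_left_mono) auto
    finally show ?thesis using True by (simp add: frac_kernel_def)
  qed (auto simp: f_def)
  have S: "summable (\<lambda>i. \<bar>c0\<bar> ^ i * relax \<mu> (b + real (Suc i) * \<mu>) (- x) t)"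
  proof -
    have "summable (\<lambda>i. \<bar>c0\<bar> ^ i * relax \<mu> ((b + \<mu>) + real i * \<mu>) (- x) t)"
      using assms x by (intro summable_relax_shifts) auto
    moreover have "(b + \<mu>) + real i * \<mu> = b + real (Suc i) * \<mu>" for i by (simp add: algebra_simps)
    ultimately show ?thesis by simp
  qed
  have g2: "summable (\<lambda>i. LINT s|lborel. norm (f i s))"
  proof (rule summable_comparison_test[OF exI[of _ 0] S], intro allI impI)
    fix i
    have "(LINT s|lborel. norm (f i s)) \<le> (LINT s|lborel. \<bar>c0\<bar> ^ i * (indicator {0<..<t} s *\<^sub>R frac_kernel (m i) (relax \<mu> b (- x)) t s))"
      using I[of i] I'[of i] le by (intro integral_mono) (auto simp: has_bochner_integral_iff)
    also have "\<dots> = \<bar>c0\<bar> ^ i * relax \<mu> (b + real (Suc i) * \<mu>) (- x) t"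
      by (rule has_bochner_integral_integral_eq[OF I'])
    finally show "norm (LINT s|lborel. norm (f i s)) \<le> \<bar>c0\<bar> ^ i * relax \<mu> (b + real (Suc i) * \<mu>) (- x) t"
      by simp
  qed
  have lim: "(\<lambda>i. f i s) sums (indicator {0<..<t} s *\<^sub>R (relax \<mu> \<mu> c0 (t - s) *\<^sub>R relax \<mu> b c s))" for s
  proof (cases "0 < s \<and> s < t")
    case True
    have "(\<lambda>i. (- c0) ^ i * ((t - s) powr (\<mu> + real i * \<mu> - 1) / Gamma (\<mu> + real i * \<mu>))) sums relax \<mu> \<mu> c0 (t - s)"
      using relax_sums[OF assms(1,1), of "t - s" c0] True by simp
    then have "(\<lambda>i. ((- c0) ^ i * ((t - s) powr (\<mu> + real i * \<mu> - 1) / Gamma (\<mu> + real i * \<mu>))) *\<^sub>R relax \<mu> b c s) sums (relax \<mu> \<mu> c0 (t - s) *\<^sub>R relax \<mu> b c s)"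
      by (rule sums_scaleR_left)
    moreover have "\<mu> + real i * \<mu> = m i" for i by (simp add: m_def algebra_simps)
    ultimately show ?thesis using True by (simp add: f_def frac_kernel_def)
  qed (simp add: f_def)
  have g1: "AE s in lborel. summable (\<lambda>i. norm (f i s))"
  proof (rule AE_I2)
    fix s
    show "summable (\<lambda>i. norm (f i s))"
    proof (cases "0 < s \<and> s < t")
      case True
      have "(\<lambda>i. (- (- \<bar>c0\<bar>)) ^ i * of_real ((t - s) powr (\<mu> + real i * \<mu> - 1) / Gamma (\<mu> + real i * \<mu>))) sums relax \<mu> \<mu> (- \<bar>c0\<bar>) (t - s)"
        using True assms by (intro relax_sums) auto
      then have "summable (\<lambda>i. (\<bar>c0\<bar> ^ i * ((t - s) powr (\<mu> + real i * \<mu> - 1) / Gamma (\<mu> + real i * \<mu>))) * norm (relax \<mu> b c s))"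
        by (intro summable_mult2) (simp add: sums_iff)
      moreover have "\<mu> + real i * \<mu> = m i" for i by (simp add: m_def algebra_simps)
      ultimately show ?thesis using True Gamma_real_pos[OF m] by (simp add: f_def frac_kernel_def abs_mult power_abs abs_of_pos mult.assoc)
    qed (simp add: f_def)
  qed
  define Q where "Q = (\<Sum>i. (- c0) ^ i *\<^sub>R R (Suc i))"
  have eqsum: "(\<lambda>s. \<Sum>i. f i s) = (\<lambda>s. indicator {0<..<t} s *\<^sub>R (relax \<mu> \<mu> c0 (t - s) *\<^sub>R relax \<mu> b c s))"
    using lim by (simp add: sums_iff fun_eq_iff)
  have ints: "integrable lborel (f i)" "integral\<^sup>L lborel (f i) = (- c0) ^ i *\<^sub>R R (Suc i)" for i
    using I[of i] by (auto simp: has_bochner_integral_iff)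
  have Qs: "(\<lambda>i. (- c0) ^ i *\<^sub>R R (Suc i)) sums (LINT s|lborel. (\<Sum>i. f i s))"
    using sums_integral[OF ints(1) g1 g2] unfolding ints(2) .
  have hb: "has_bochner_integral lborel (\<lambda>s. indicator {0<..<t} s *\<^sub>R (relax \<mu> \<mu> c0 (t - s) *\<^sub>R relax \<mu> b c s)) Q"
    using integrable_suminf[OF ints(1) g1 g2] Qs unfolding eqsum[symmetric]
    by (simp add: has_bochner_integral_iff Q_def sums_iff)
  have Qs': "(\<lambda>i. (- c0) ^ i *\<^sub>R R (Suc i)) sums Q" using Qs by (simp add: Q_def sums_iff)
  have "(\<lambda>i. (- c0) ^ Suc i *\<^sub>R R (Suc i)) sums (- c0 *\<^sub>R Q)"
    using sums_scaleR_right[OF Qs', of "- c0"] by simp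
  then have RS: "(\<lambda>i. (- c0) ^ i *\<^sub>R R i) sums (- c0 *\<^sub>R Q + R 0)"
    by (subst (asm) sums_Suc_iff) simp
  have "c * R (Suc i) = of_real (t powr (b + real i * \<mu> - 1) / Gamma (b + real i * \<mu>)) - R i" for i
    using relax_recurrence[OF assms(1) bi assms(3), of i c] by (simp add: R_def algebra_simps)
  then have "(\<lambda>i. (- c0) ^ i *\<^sub>R (c * R (Suc i))) = (\<lambda>i. (- of_real c0) ^ i * of_real (t powr (b + real i * \<mu> - 1) / Gamma (b + real i * \<mu>)) - (- c0) ^ i *\<^sub>R R i)"
    by (simp add: fun_eq_iff scaleR_conv_of_real right_diff_distrib)
  moreover have "(\<lambda>i. (- of_real c0) ^ i * of_real (t powr (b + real i * \<mu> - 1) / Gamma (b + real i * \<mu>)) - (- c0) ^ i *\<^sub>R R i) sums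
      (relax \<mu> b (of_real c0) t - (- c0 *\<^sub>R Q + R 0))"
    by (intro sums_diff relax_sums RS assms)
  moreover have "(\<lambda>i. (- c0) ^ i *\<^sub>R (c * R (Suc i))) sums (c * Q)"
    using sums_mult[OF Qs', of c] by (simp add: mult_scaleR_right)
  ultimately have "c * Q = relax \<mu> b (of_real c0) t - (- c0 *\<^sub>R Q + R 0)"
    using sums_unique2 by metis
  then have "(c - of_real c0) * Q = relax \<mu> b (of_real c0) t - relax \<mu> b c t"
    by (simp add: R_def scaleR_conv_of_real algebra_simps)
  with hb show ?thesis using that by blast
qed

text \<open>The difference of two values is \<open>y - x\<close> times a convolution of non-negative functions.\<close>

lemma mitlef_antimono:
  assumes \<mu>: "0 < \<mu>" "\<mu> \<le> 1" and b: "b \<ge> \<mu>" and xy: "0 \<le> x" "x \<le> y"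
  shows "mitlef \<mu> b y \<le> mitlef \<mu> b (x::real)"
proof -
  obtain Q where Q: "has_bochner_integral lborel (\<lambda>s. indicator {0<..<1} s *\<^sub>R (relax \<mu> \<mu> x (1 - s) *\<^sub>R relax \<mu> b y s)) Q"
    "(y - x) * Q = relax \<mu> b x 1 - relax \<mu> b y 1"
    using relax_resolvent_identity[of \<mu> b 1 x y] assms by auto
  have "Q \<ge> 0"
  proof -
    have "0 \<le> (LINT s|lborel. indicator {0<..<1} s *\<^sub>R (relax \<mu> \<mu> x (1 - s) *\<^sub>R relax \<mu> b y s))"
      using assms by (intro integral_nonneg_AE AE_I2) (auto simp: relax_def indicator_def intro!: mult_nonneg_nonneg mitlef_nonneg)
    then show ?thesis using Q(1) by (simp add: has_bochner_integral_iff)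
  qed
  then have "0 \<le> (y - x) * Q" using xy by simp
  then show ?thesis using Q(2) by (simp add: relax_def)
qed

lemma mitlef_le_Gamma:
  assumes "0 < \<mu>" "\<mu> \<le> 1" "b \<ge> \<mu>" "0 \<le> x"
  shows "mitlef \<mu> b (x::real) \<le> 1 / Gamma b"
  using mitlef_antimono[OF assms(1-3) order_refl assms(4)] by (simp add: divide_inverse)

text \<open>By monotonicity, the fractional integral of \<open>relax \<mu> b x\<close> over \<open>(0, 1)\<close> bounds
  \<open>mitlef \<mu> b x\<close> from above up to a constant; the recurrence bounds \<open>x\<close> times this integral by
  \<open>1 / Gamma b\<close>.\<close>

lemma mitlef_decay:
  assumes \<mu>: "0 < \<mu>" "\<mu> \<le> 1" and b: "b \<ge> \<mu>"
  obtains C where "C > 0" "\<And>x. x \<ge> 0 \<Longrightarrow> mitlef \<mu> b (x::real) \<le> C / (1 + x)"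
proof -
  have b0: "b > 0" using \<mu> b by simp
  define k where "k = Gamma b / Gamma (b + \<mu>)"
  have G: "Gamma b > 0" "Gamma (b + \<mu>) > 0" using b0 \<mu> by (auto intro: Gamma_real_pos)
  then have k: "k > 0" by (simp add: k_def)
  define l where "l = min k 1"
  show ?thesis
  proof
    show "1 / Gamma b / l > 0" using G k by (simp add: l_def)
    fix x :: real assume x: "x \<ge> 0"
    have "has_frac_integral \<mu> (relax \<mu> b x) 1 (relax \<mu> (b + \<mu>) x 1)"
      using \<mu> b0 by (intro has_frac_integral_relax) auto
    moreover have "has_frac_integral \<mu> (\<lambda>s. - (Gamma b * mitlef \<mu> b x) * (s powr (b - 1) / Gamma b)) 1
        (- (Gamma b * mitlef \<mu> b x) * (1 powr (\<mu> + b - 1) / Gamma (\<mu> + b)))"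
      using \<mu> b0 by (intro has_frac_integral_mult has_frac_integral_power) auto
    ultimately have "has_frac_integral \<mu> (\<lambda>s. relax \<mu> b x s + - (Gamma b * mitlef \<mu> b x) * (s powr (b - 1) / Gamma b)) 1
       (relax \<mu> (b + \<mu>) x 1 + - (Gamma b * mitlef \<mu> b x) * (1 powr (\<mu> + b - 1) / Gamma (\<mu> + b)))"
      by (rule has_frac_integral_add)
    then have "0 \<le> relax \<mu> (b + \<mu>) x 1 + - (Gamma b * mitlef \<mu> b x) * (1 powr (\<mu> + b - 1) / Gamma (\<mu> + b))"
    proof (rule has_frac_integral_nonneg)
      fix s :: real assume s: "0 < s" "s < 1"
      have "mitlef \<mu> b x \<le> mitlef \<mu> b (x * s powr \<mu>)"
        using s x \<mu> b by (intro mitlef_antimono) (auto intro!: mult_left_le powr_le1)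
      then show "0 \<le> relax \<mu> b x s + - (Gamma b * mitlef \<mu> b x) * (s powr (b - 1) / Gamma b)"
        using G mult_left_mono[of "mitlef \<mu> b x" "mitlef \<mu> b (x * s powr \<mu>)" "s powr (b - 1)"]
        by (simp add: relax_def mult.commute)
    qed (use \<mu> in auto)
    then have 1: "k * mitlef \<mu> b x \<le> mitlef \<mu> (b + \<mu>) x"
      by (simp add: k_def relax_def add.commute)
    have rec: "mitlef \<mu> b x + x * mitlef \<mu> (b + \<mu>) x = 1 / Gamma b"
      using mitlef_recurrence[OF \<mu>(1) b0, of x] by (simp add: divide_inverse)
    have nn: "mitlef \<mu> b x \<ge> 0" using mitlef_nonneg[OF \<mu> b x] .
    have "l * mitlef \<mu> b x * (1 + x) = l * mitlef \<mu> b x + x * (l * mitlef \<mu> b x)" by (simp add: algebra_simps)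
    also have "\<dots> \<le> 1 * mitlef \<mu> b x + x * (k * mitlef \<mu> b x)"
      using nn x by (intro add_mono mult_right_mono mult_left_mono) (auto simp: l_def)
    also have "\<dots> \<le> mitlef \<mu> b x + x * mitlef \<mu> (b + \<mu>) x" using 1 x by (simp add: mult_left_mono)
    also have "\<dots> = 1 / Gamma b" by (rule rec)
    finally have "mitlef \<mu> b x * (l * (1 + x)) \<le> 1 / Gamma b" by (simp add: mult_ac)
    moreover have "l * (1 + x) > 0" using k x by (simp add: l_def)
    ultimately have "mitlef \<mu> b x \<le> 1 / Gamma b / (l * (1 + x))" by (rule mult_imp_le_div_pos[rotated])
    then show "mitlef \<mu> b x \<le> 1 / Gamma b / l / (1 + x)" by (simp add: mult.assoc)
  qed
qed

text \<open>Compare \<open>z\<close> with its real part \<open>l\<close> by the resolvent identity. The convolution with the positive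
  kernel \<open>relax \<mu> \<mu> l\<close> of mass at most \<open>1 / l\<close> costs the factor \<open>norm (z - l) / l \<le> 1 / 2\<close>, so the
  supremum over \<open>(0, 1]\<close> can be absorbed. The bound is uniform in the whole sector, as needed for the
  convergence of eigenfunction sums there.\<close>

lemma mitlef_sector_bound:
  fixes z :: complex
  assumes \<mu>: "0 < \<mu>" "\<mu> \<le> 1" and b: "b \<ge> 1" and z: "Re z > 0" "\<bar>Im z\<bar> \<le> Re z / 2"
  shows "norm (mitlef \<mu> b z) \<le> 2 / Gamma b"
proof -
  define l where "l = Re z"
  have G: "Gamma b > 0" using b by (intro Gamma_real_pos) auto
  define N where "N t = norm (relax \<mu> b z t)" for t
  define M where "M = (SUP t\<in>{0<..1}. N t)"
  have bdd: "bdd_above (N ` {0<..1})"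
  proof (rule bdd_aboveI2)
    fix t :: real assume t: "t \<in> {0<..1}"
    have "N t \<le> relax \<mu> b (- norm z) t" unfolding N_def using \<mu> b by (intro norm_relax_le) auto
    also have "\<dots> \<le> 1 * mitlef \<mu> b (- norm z)"
      unfolding relax_def real_scaleR_def
    proof (rule mult_mono)
      show "t powr (b - 1) \<le> 1" using t b by (intro powr_le1) auto
      have "norm (mitlef \<mu> b (- norm z * t powr \<mu>)) \<le> mitlef \<mu> b (- norm z)"
        using t \<mu> b by (intro norm_mitlef_le_norm_le) (auto simp: abs_mult intro!: mult_left_le powr_le1)
      then show "mitlef \<mu> b (- norm z * of_real (t powr \<mu>)) \<le> mitlef \<mu> b (- norm z)" by simp
      have "norm (mitlef \<mu> b (norm z * t powr \<mu>)) \<le> mitlef \<mu> b (- (norm z * t powr \<mu>))"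
        using \<mu> b by (intro norm_mitlef_le_norm_le) (auto simp: abs_mult)
      then show "0 \<le> mitlef \<mu> b (- norm z * of_real (t powr \<mu>))" by simp
    qed auto
    finally show "N t \<le> mitlef \<mu> b (- norm z)" by simp
  qed
  have NM: "N t \<le> M" if "t \<in> {0<..1}" for t
    unfolding M_def by (rule cSUP_upper[OF that bdd])
  have "N t \<le> 1 / Gamma b + M / 2" if t: "t \<in> {0<..1}" for t
  proof -
    obtain Q where Q: "has_bochner_integral lborel (\<lambda>s. indicator {0<..<t} s *\<^sub>R (relax \<mu> \<mu> l (t - s) *\<^sub>R relax \<mu> b z s)) Q"
      "(z - of_real l) * Q = relax \<mu> b (of_real l) t - relax \<mu> b z t"
      using relax_resolvent_identity[of \<mu> b t l z] \<mu> b t by auto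
    \<comment> \<open>\<open>relax \<mu> 1 0\<close> is the constant \<open>1\<close>, so \<open>P\<close> is the mass of the kernel.\<close>
    obtain P where P: "has_bochner_integral lborel (\<lambda>s. indicator {0<..<t} s *\<^sub>R (relax \<mu> \<mu> l (t - s) *\<^sub>R relax \<mu> 1 (0::real) s)) P"
      "(0 - l) * P = relax \<mu> 1 l t - relax \<mu> 1 0 t"
      using relax_resolvent_identity[of \<mu> 1 t l "0::real"] \<mu> b t by auto
    have "relax \<mu> 1 l t \<ge> 0" using \<mu> t z by (auto simp: relax_def l_def intro!: mitlef_nonneg)
    then have lP: "l * P \<le> 1" using P(2) t by (simp add: relax_def)
    have "norm Q \<le> M * P"
    proof -
      have "norm (LINT s|lborel. indicator {0<..<t} s *\<^sub>R (relax \<mu> \<mu> l (t - s) *\<^sub>R relax \<mu> b z s)) \<le>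
         (LINT s|lborel. norm (indicator {0<..<t} s *\<^sub>R (relax \<mu> \<mu> l (t - s) *\<^sub>R relax \<mu> b z s)))"
        by (rule integral_norm_bound)
      also have "\<dots> \<le> (LINT s|lborel. M * (indicator {0<..<t} s *\<^sub>R (relax \<mu> \<mu> l (t - s) *\<^sub>R relax \<mu> 1 (0::real) s)))"
      proof (rule integral_mono)
        fix s
        show "norm (indicator {0<..<t} s *\<^sub>R (relax \<mu> \<mu> l (t - s) *\<^sub>R relax \<mu> b z s)) \<le>
           M * (indicator {0<..<t} s *\<^sub>R (relax \<mu> \<mu> l (t - s) *\<^sub>R relax \<mu> 1 (0::real) s))"
        proof (cases "0 < s \<and> s < t")
          case True
          have r: "relax \<mu> \<mu> l (t - s) \<ge> 0" using True \<mu> z by (auto simp: relax_def l_def intro!: mult_nonneg_nonneg mitlef_nonneg)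
          have "norm (relax \<mu> b z s) \<le> M" using NM[of s] True t by (simp add: N_def)
          then have "relax \<mu> \<mu> l (t - s) * norm (relax \<mu> b z s) \<le> relax \<mu> \<mu> l (t - s) * M"
            using r by (rule mult_left_mono)
          then show ?thesis using True r by (simp add: relax_def[of \<mu> 1 0] mult.commute)
        qed auto
      next
        show "integrable lborel (\<lambda>s. norm (indicator {0<..<t} s *\<^sub>R (relax \<mu> \<mu> l (t - s) *\<^sub>R relax \<mu> b z s)))"
          using Q(1) by (intro integrable_norm) (simp only: has_bochner_integral_iff)
        show "integrable lborel (\<lambda>s. M * (indicator {0<..<t} s *\<^sub>R (relax \<mu> \<mu> l (t - s) *\<^sub>R relax \<mu> 1 (0::real) s)))"
          using P(1) by (intro integrable_mult_right) (simp only: has_bochner_integral_iff)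
      qed
      finally show ?thesis using Q(1) P(1) by (simp add: has_bochner_integral_iff)
    qed
    moreover have "norm (z - of_real l) = \<bar>Im z\<bar>"
      by (simp add: l_def cmod_def)
    ultimately have "norm ((z - of_real l) * Q) \<le> (l / 2) * (M * P)"
      unfolding norm_mult using z(2) z(1) by (intro mult_mono) (auto simp: l_def)
    also have "\<dots> = M / 2 * (l * P)" by simp
    also have "\<dots> \<le> M / 2 * 1"
    proof -
      have "0 \<le> N 1" by (simp add: N_def)
      also have "\<dots> \<le> M" by (rule NM) simp
      finally show ?thesis using lP by (intro mult_left_mono) auto
    qed
    finally have "norm (relax \<mu> b (of_real l) t - relax \<mu> b z t) \<le> M / 2" using Q(2) by simp
    moreover have "norm (relax \<mu> b (of_real l :: complex) t) \<le> 1 / Gamma b"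
    proof -
      have nn: "mitlef \<mu> b (l * t powr \<mu>) \<ge> 0" using \<mu> b z by (auto simp: l_def intro!: mitlef_nonneg)
      have "norm (relax \<mu> b (of_real l :: complex) t) = relax \<mu> b l t"
        using nn \<mu> b by (subst relax_of_real) (auto simp: relax_def abs_mult norm_mult)
      also have "\<dots> \<le> 1 * (1 / Gamma b)"
        unfolding relax_def real_scaleR_def using t \<mu> b z nn
        by (intro mult_mono powr_le1) (auto simp: l_def intro!: mitlef_le_Gamma)
      finally show ?thesis by simp
    qed
    ultimately show ?thesis
      unfolding N_def by (smt (verit) norm_minus_commute norm_triangle_sub)
  qed
  then have "M \<le> 1 / Gamma b + M / 2" unfolding M_def by (intro cSUP_least) auto
  then have "M \<le> 2 / Gamma b" by simp
  moreover have "N 1 \<le> M" by (rule NM) simp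
  ultimately show ?thesis by (simp add: N_def relax_def)
qed

section \<open>Uniqueness for the scalar Hilfer equation\<close>

lemma has_frac_integral_abs_le:
  fixes y z :: "real \<Rightarrow> real"
  assumes "has_frac_integral a y t I" "has_frac_integral a z t J" "a > 0"
    and "\<And>s. 0 < s \<Longrightarrow> s < t \<Longrightarrow> \<bar>y s\<bar> \<le> z s"
  shows "\<bar>I\<bar> \<le> J"
proof -
  have "0 \<le> J + c * I" if "c = 1 \<or> c = -1" for c
  proof (rule has_frac_integral_nonneg[OF has_frac_integral_add[OF assms(2) has_frac_integral_mult[OF assms(1), of c]] assms(3)])
    fix s assume "0 < s" "s < t"
    then show "0 \<le> z s + c * y s" using assms(4)[of s] that by auto
  qed
  from this[of 1] this[of "-1"] show ?thesis by auto
qed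

text \<open>Iterating the equation bounds \<open>W\<close> by the terms of a convergent Mittag-Leffler series.\<close>

lemma volterra_unique:
  fixes W :: "real \<Rightarrow> real"
  assumes \<mu>: "\<mu> > 0" and M: "\<And>t. t \<in> {0<..T} \<Longrightarrow> \<bar>W t\<bar> \<le> M"
    and eq: "\<And>t. t \<in> {0<..T} \<Longrightarrow> \<exists>I. has_frac_integral \<mu> W t I \<and> W t + c * I = 0"
    and t: "t \<in> {0<..T}"
  shows "W t = 0"
proof -
  have bound: "\<bar>W t\<bar> \<le> M * \<bar>c\<bar> ^ k * (t powr (1 + real k * \<mu> - 1) / Gamma (1 + real k * \<mu>))"
    if "t \<in> {0<..T}" for k t
    using that
  proof (induction k arbitrary: t)
    case 0 then show ?case using M[of t] by simp
  next
    case (Suc k)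
    obtain I where I: "has_frac_integral \<mu> W t I" "W t + c * I = 0" using eq[OF Suc.prems] by blast
    have "has_frac_integral \<mu> (\<lambda>s. M * \<bar>c\<bar> ^ k * (s powr (1 + real k * \<mu> - 1) / Gamma (1 + real k * \<mu>))) t
        (M * \<bar>c\<bar> ^ k * (t powr (\<mu> + (1 + real k * \<mu>) - 1) / Gamma (\<mu> + (1 + real k * \<mu>))))"
      using \<mu> Suc.prems by (intro has_frac_integral_mult has_frac_integral_power) (auto simp: add_pos_nonneg)
    then have "\<bar>I\<bar> \<le> M * \<bar>c\<bar> ^ k * (t powr (\<mu> + (1 + real k * \<mu>) - 1) / Gamma (\<mu> + (1 + real k * \<mu>)))"
      using Suc.prems Suc.IH by (intro has_frac_integral_abs_le[OF I(1) _ \<mu>]) auto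
    then have "\<bar>c\<bar> * \<bar>I\<bar> \<le> \<bar>c\<bar> * (M * \<bar>c\<bar> ^ k * (t powr (\<mu> + (1 + real k * \<mu>) - 1) / Gamma (\<mu> + (1 + real k * \<mu>))))"
      by (intro mult_left_mono) auto
    moreover have "\<bar>W t\<bar> = \<bar>c\<bar> * \<bar>I\<bar>" using I(2) by (metis abs_minus_cancel abs_mult add_eq_0_iff)
    moreover have e: "\<mu> + (1 + real k * \<mu>) = 1 + real (Suc k) * \<mu>" by (simp add: algebra_simps)
    ultimately show ?case unfolding e by (simp add: mult_ac del: of_nat_Suc)
  qed
  have "summable (\<lambda>k. (\<bar>c\<bar> * t powr \<mu>) ^ k / Gamma (1 + real k * \<mu>))"
    using \<mu> by (intro summable_mitlef_real) auto
  then have "(\<lambda>k. M * ((\<bar>c\<bar> * t powr \<mu>) ^ k / Gamma (1 + real k * \<mu>))) \<longlonglongrightarrow> M * 0"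
    by (intro tendsto_mult_left summable_LIMSEQ_zero)
  moreover have "\<bar>W t\<bar> \<le> M * ((\<bar>c\<bar> * t powr \<mu>) ^ k / Gamma (1 + real k * \<mu>))" for k
  proof -
    have "t powr (1 + real k * \<mu> - 1) = (t powr \<mu>) ^ k"
      using t by (simp add: powr_powr mult.commute flip: powr_realpow)
    then show ?thesis using bound[OF t, of k] by (simp add: power_mult_distrib mult_ac)
  qed
  ultimately have "\<bar>W t\<bar> \<le> M * 0"
    using LIMSEQ_le_const by blast
  then show ?thesis by simp
qed

lemma frac_kernel_integral_shift:
  fixes a b \<tau> t :: real
  assumes "a > 0" "b > 0" "\<tau> < t"
  shows "has_bochner_integral lborel
    (\<lambda>s. indicator {\<tau><..<t} s * ((t - s) powr (a - 1) / Gamma a * ((s - \<tau>) powr (b - 1) / Gamma b)))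
    ((t - \<tau>) powr (a + b - 1) / Gamma (a + b))"
proof -
  have "has_frac_integral a (\<lambda>s. s powr (b - 1) / Gamma b) (t - \<tau>) ((t - \<tau>) powr (a + b - 1) / Gamma (a + b))"
    using assms by (intro has_frac_integral_power) auto
  also have "?this \<longleftrightarrow> has_bochner_integral lborel (\<lambda>s. indicator {\<tau><..<t} (\<tau> + 1 * s) *
     ((t - (\<tau> + 1 * s)) powr (a - 1) / Gamma a * (((\<tau> + 1 * s) - \<tau>) powr (b - 1) / Gamma b))) ((t - \<tau>) powr (a + b - 1) / Gamma (a + b))"
    unfolding has_frac_integral_def
    by (intro has_bochner_integral_cong) (auto simp: indicator_def frac_kernel_def diff_diff_eq)
  finally show ?thesis
    by (subst lborel_has_bochner_integral_real_affine_iff[of 1 _ _ \<tau>]) auto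
qed

lemma has_frac_integral_measurable:
  fixes y :: "real \<Rightarrow> real"
  assumes "has_frac_integral a y t I" "a > 0"
  shows "(\<lambda>s. indicator {0<..<t} s * y s) \<in> borel_measurable borel"
proof -
  have [measurable]: "(\<lambda>s. indicator {0<..<t} s *\<^sub>R frac_kernel a y t s) \<in> borel_measurable borel"
    using assms(1) by (auto simp: has_frac_integral_def dest: has_bochner_integral_integrable borel_measurable_integrable)
  have "(\<lambda>s. (indicator {0<..<t} s *\<^sub>R frac_kernel a y t s) * ((t - s) powr (1 - a) * Gamma a)) \<in> borel_measurable borel"
    by measurable
  also have "(\<lambda>s. (indicator {0<..<t} s *\<^sub>R frac_kernel a y t s) * ((t - s) powr (1 - a) * Gamma a)) =
     (\<lambda>s. indicator {0<..<t} s * y s)"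
  proof
    fix s
    have "(t - s) powr (a - 1) * (t - s) powr (1 - a) = 1" if "s < t"
      using that by (simp add: powr_add[symmetric])
    then show "(indicator {0<..<t} s *\<^sub>R frac_kernel a y t s) * ((t - s) powr (1 - a) * Gamma a) = indicator {0<..<t} s * y s"
      using Gamma_real_pos[OF assms(2)] by (auto simp: indicator_def frac_kernel_def field_simps)
  qed
  finally show ?thesis .
qed

text \<open>Fubini, with the Beta integral for the inner kernel: the integral of order \<open>a + b\<close> of the absolute value of
  \<open>y\<close> majorizes the double integral.\<close>

lemma has_frac_integral_semigroup:
  fixes y Y :: "real \<Rightarrow> real"
  assumes a: "a > 0" and b: "b > 0"
    and I: "has_frac_integral (a + b) y t I"
    and Y: "\<And>s. 0 < s \<Longrightarrow> s < t \<Longrightarrow> has_frac_integral b y s (Y s)"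
  shows "has_frac_integral a Y t I"
proof -
  define z where "z s = indicator {0<..<t} s * y s" for s
  have zm[measurable]: "z \<in> borel_measurable borel"
    unfolding z_def using has_frac_integral_measurable[OF I] a b by simp
  define g where "g = (\<lambda>\<tau> s. indicator {(\<tau>, s). 0 < \<tau> \<and> \<tau> < s \<and> s < t} (\<tau>, s) *
     ((t - s) powr (a - 1) / Gamma a * ((s - \<tau>) powr (b - 1) / Gamma b)) * z \<tau>)"
  have gm[measurable]: "case_prod g \<in> borel_measurable (borel \<Otimes>\<^sub>M borel)"
  proof -
    have [measurable]: "{(\<tau>, s). 0 < \<tau> \<and> \<tau> < s \<and> s < t} \<in> sets (borel \<Otimes>\<^sub>M borel)"
    proof -
      have "{(\<tau>, s). 0 < \<tau> \<and> \<tau> < s \<and> s < (t::real)} = {p \<in> space (borel \<Otimes>\<^sub>M borel). 0 < fst p \<and> fst p < snd p \<and> snd p < t}"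
        by (auto simp: space_pair_measure)
      also have "\<dots> \<in> sets (borel \<Otimes>\<^sub>M borel)" by measurable
      finally show ?thesis .
    qed
    show ?thesis unfolding g_def split_beta' prod.collapse by measurable
  qed
  have G: "Gamma a > 0" "Gamma b > 0" "Gamma (a + b) > 0" using a b by (auto intro: Gamma_real_pos)
  have inner: "has_bochner_integral lborel (\<lambda>s. g \<tau> s) (indicator {0<..<t} \<tau> *\<^sub>R frac_kernel (a + b) y t \<tau>)" for \<tau>
  proof (cases "0 < \<tau> \<and> \<tau> < t")
    case True
    have "has_bochner_integral lborel (\<lambda>s. indicator {\<tau><..<t} s * ((t - s) powr (a - 1) / Gamma a * ((s - \<tau>) powr (b - 1) / Gamma b)) * z \<tau>)
      ((t - \<tau>) powr (a + b - 1) / Gamma (a + b) * z \<tau>)"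
      using True a b by (intro has_bochner_integral_mult_left frac_kernel_integral_shift) auto
    moreover have "(\<lambda>s. indicator {\<tau><..<t} s * ((t - s) powr (a - 1) / Gamma a * ((s - \<tau>) powr (b - 1) / Gamma b)) * z \<tau>) = g \<tau>"
      using True by (auto simp: fun_eq_iff g_def indicator_def)
    ultimately show ?thesis using True by (simp add: frac_kernel_def z_def)
  next
    case False
    then have "g \<tau> = (\<lambda>s. 0)" by (auto simp: g_def indicator_def fun_eq_iff)
    then show ?thesis using False by (simp add: has_bochner_integral_zero)
  qed
  have abs: "(LINT s|lborel. norm (g \<tau> s)) = norm (indicator {0<..<t} \<tau> *\<^sub>R frac_kernel (a + b) y t \<tau>)" for \<tau>
  proof -
    have "(LINT s|lborel. norm (g \<tau> s)) = (LINT s|lborel. sgn (z \<tau>) * g \<tau> s)"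
      using G by (intro Bochner_Integration.integral_cong) (auto simp: g_def indicator_def abs_mult sgn_if)
    also have "\<dots> = sgn (z \<tau>) * (indicator {0<..<t} \<tau> *\<^sub>R frac_kernel (a + b) y t \<tau>)"
      using inner[of \<tau>] by (simp add: has_bochner_integral_iff)
    also have "\<dots> = norm (indicator {0<..<t} \<tau> *\<^sub>R frac_kernel (a + b) y t \<tau>)"
      using G by (auto simp: z_def indicator_def frac_kernel_def abs_mult sgn_if)
    finally show ?thesis .
  qed
  have int: "integrable (lborel \<Otimes>\<^sub>M lborel) (case_prod g)"
  proof (rule lborel_pair.Fubini_integrable)
    show "case_prod g \<in> borel_measurable (lborel \<Otimes>\<^sub>M lborel)" using gm by simp
    show "integrable lborel (\<lambda>x. LINT y|lborel. norm (case (x, y) of (x, y) \<Rightarrow> g x y))"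
      using I unfolding prod.case abs by (intro integrable_norm) (auto simp: has_frac_integral_def has_bochner_integral_iff)
    show "AE x in lborel. integrable lborel (\<lambda>y. case (x, y) of (x, y) \<Rightarrow> g x y)"
      using inner by (auto simp: has_bochner_integral_iff)
  qed
  have outer: "(LINT \<tau>|lborel. g \<tau> s) = indicator {0<..<t} s *\<^sub>R frac_kernel a Y t s" for s
  proof (cases "0 < s \<and> s < t")
    case True
    have "has_bochner_integral lborel (\<lambda>\<tau>. (t - s) powr (a - 1) / Gamma a * (indicator {0<..<s} \<tau> *\<^sub>R frac_kernel b y s \<tau>)) ((t - s) powr (a - 1) / Gamma a * Y s)"
      using Y[of s] True unfolding has_frac_integral_def by (intro has_bochner_integral_mult_right) auto
    moreover have "(\<lambda>\<tau>. (t - s) powr (a - 1) / Gamma a * (indicator {0<..<s} \<tau> *\<^sub>R frac_kernel b y s \<tau>)) = (\<lambda>\<tau>. g \<tau> s)"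
      using True by (auto simp: fun_eq_iff g_def indicator_def frac_kernel_def z_def)
    ultimately have "has_bochner_integral lborel (\<lambda>\<tau>. g \<tau> s) ((t - s) powr (a - 1) / Gamma a * Y s)" by (simp only:)
    from has_bochner_integral_integral_eq[OF this] show ?thesis using True by (simp add: frac_kernel_def)
  next
    case False
    then have "(\<lambda>\<tau>. g \<tau> s) = (\<lambda>s. 0)" by (auto simp: g_def indicator_def fun_eq_iff)
    then show ?thesis using False by simp
  qed
  have "integrable lborel (\<lambda>s. LINT \<tau>|lborel. g \<tau> s)"
    by (rule lborel_pair.integrable_snd[OF int])
  moreover have "(LINT s|lborel. (LINT \<tau>|lborel. g \<tau> s)) = (LINT \<tau>|lborel. (LINT s|lborel. g \<tau> s))"
    by (rule lborel_pair.Fubini_integral[OF int])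
  moreover have "(LINT \<tau>|lborel. (LINT s|lborel. g \<tau> s)) = I"
    using I inner by (simp add: has_bochner_integral_iff has_frac_integral_def)
  ultimately show ?thesis
    unfolding outer by (simp add: has_frac_integral_def has_bochner_integral_iff)
qed

lemma has_frac_integral_imp_integrable:
  fixes y :: "real \<Rightarrow> real"
  assumes "has_frac_integral a y t I" "0 < a" "a \<le> 1"
  shows "set_integrable lborel {0<..<t} y"
  unfolding set_integrable_def
proof (rule Bochner_Integration.integrable_bound)
  show "integrable lborel (\<lambda>s. (t powr (1 - a) * Gamma a) * (indicator {0<..<t} s *\<^sub>R frac_kernel a y t s))"
    using assms(1) by (auto simp: has_frac_integral_def has_bochner_integral_iff)
  show "(\<lambda>s. indicator {0<..<t} s *\<^sub>R y s) \<in> borel_measurable lborel"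
    using has_frac_integral_measurable[OF assms(1,2)] by simp
  show "AE s in lborel. norm (indicator {0<..<t} s *\<^sub>R y s) \<le> norm ((t powr (1 - a) * Gamma a) * (indicator {0<..<t} s *\<^sub>R frac_kernel a y t s))"
  proof (rule AE_I2)
    fix s
    show "norm (indicator {0<..<t} s *\<^sub>R y s) \<le> norm ((t powr (1 - a) * Gamma a) * (indicator {0<..<t} s *\<^sub>R frac_kernel a y t s))"
    proof (cases "0 < s \<and> s < t")
      case True
      have "1 = t powr (1 - a) * t powr (a - 1)" using True by (simp add: powr_add[symmetric])
      also have "\<dots> \<le> t powr (1 - a) * (t - s) powr (a - 1)"
        using True assms by (intro mult_left_mono powr_mono2') auto
      finally have "1 * \<bar>y s\<bar> \<le> (t powr (1 - a) * (t - s) powr (a - 1)) * \<bar>y s\<bar>" by (intro mult_right_mono) auto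
      then show ?thesis using True Gamma_real_pos[OF assms(2)] by (simp add: frac_kernel_def abs_mult)
    qed auto
  qed
qed

text \<open>Near \<open>0\<close> the kernel is bounded and the function integrable, near \<open>t\<close> it is the other way round.\<close>

lemma has_frac_integral_exists:
  fixes y :: "real \<Rightarrow> real"
  assumes a: "0 < a" "a \<le> 1" and t: "t > 0" and y: "set_integrable lborel {0<..<t} y" and cont: "continuous_on {0<..t} y"
  obtains I where "has_frac_integral a y t I"
proof -
  have G: "Gamma a > 0" using a by (auto intro: Gamma_real_pos)
  obtain B where B: "\<And>s. s \<in> {t/2..t} \<Longrightarrow> \<bar>y s\<bar> \<le> B"
  proof -
    have "compact (y ` {t/2..t})"
      using t by (intro compact_continuous_image continuous_on_subset[OF cont]) auto
    then have "bounded (y ` {t/2..t})" by (rule compact_imp_bounded)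
    then obtain B where "\<forall>x\<in>y ` {t/2..t}. norm x \<le> B" unfolding bounded_iff by blast
    then show ?thesis using that[of B] by auto
  qed
  have "B \<ge> 0" using B[of t] t by simp
  define C where "C = (t / 2) powr (a - 1) / Gamma a"
  have K: "has_frac_integral a (\<lambda>s. s powr (1 - 1) / Gamma 1) t (t powr (a + 1 - 1) / Gamma (a + 1))"
    using a t by (intro has_frac_integral_power) auto
  have "integrable lborel (\<lambda>s. indicator {0<..<t} s *\<^sub>R frac_kernel a y t s)"
  proof (rule Bochner_Integration.integrable_bound)
    show "integrable lborel (\<lambda>s. C * norm (indicator {0<..<t} s *\<^sub>R y s) + B * (indicator {0<..<t} s *\<^sub>R frac_kernel a (\<lambda>s. s powr (1 - 1) / Gamma 1) t s))"
      using y K by (auto simp: has_frac_integral_def has_bochner_integral_iff set_integrable_def)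
    have [measurable]: "(\<lambda>s. indicator {0<..<t} s *\<^sub>R y s) \<in> borel_measurable lborel"
      using y by (auto simp: set_integrable_def)
    have "(\<lambda>s. ((t - s) powr (a - 1) / Gamma a) *\<^sub>R (indicator {0<..<t} s *\<^sub>R y s)) \<in> borel_measurable lborel"
      by measurable
    then show "(\<lambda>s. indicator {0<..<t} s *\<^sub>R frac_kernel a y t s) \<in> borel_measurable lborel"
      by (simp add: frac_kernel_def mult_ac)
    show "AE s in lborel. norm (indicator {0<..<t} s *\<^sub>R frac_kernel a y t s) \<le>
      norm (C * norm (indicator {0<..<t} s *\<^sub>R y s) + B * (indicator {0<..<t} s *\<^sub>R frac_kernel a (\<lambda>s. s powr (1 - 1) / Gamma 1) t s))"
    proof (rule AE_I2)
      fix s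
      have nn: "0 \<le> C * norm (indicator {0<..<t} s *\<^sub>R y s)" "0 \<le> B * (indicator {0<..<t} s *\<^sub>R frac_kernel a (\<lambda>s. s powr (1 - 1) / Gamma 1) t s)"
        using G \<open>B \<ge> 0\<close> by (auto simp: C_def frac_kernel_def indicator_def)
      have "norm (indicator {0<..<t} s *\<^sub>R frac_kernel a y t s) \<le> C * norm (indicator {0<..<t} s *\<^sub>R y s) + B * (indicator {0<..<t} s *\<^sub>R frac_kernel a (\<lambda>s. s powr (1 - 1) / Gamma 1) t s)"
      proof -
        consider "s \<le> 0 \<or> s \<ge> t" | "0 < s" "s \<le> t/2" | "s \<ge> t/2" "s < t" by linarith
        then show ?thesis
        proof cases
          case 1 then show ?thesis by auto
        next
          case 2
          then have "(t - s) powr (a - 1) \<le> (t / 2) powr (a - 1)" using t a by (intro powr_mono2') auto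
          then have "(t - s) powr (a - 1) / Gamma a * \<bar>y s\<bar> \<le> C * \<bar>y s\<bar>"
            using G unfolding C_def by (intro mult_right_mono divide_right_mono) auto
          then show ?thesis using 2 t nn G by (simp add: frac_kernel_def abs_mult)
        next
          case 3
          then have "(t - s) powr (a - 1) / Gamma a * \<bar>y s\<bar> \<le> (t - s) powr (a - 1) / Gamma a * B"
            using G B[of s] by (intro mult_left_mono) auto
          then show ?thesis using 3 t nn G by (simp add: frac_kernel_def abs_mult mult.commute)
        qed
      qed
      then show "norm (indicator {0<..<t} s *\<^sub>R frac_kernel a y t s) \<le>
        norm (C * norm (indicator {0<..<t} s *\<^sub>R y s) + B * (indicator {0<..<t} s *\<^sub>R frac_kernel a (\<lambda>s. s powr (1 - 1) / Gamma 1) t s))"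
        using nn by (simp only: real_norm_def abs_of_nonneg[OF add_nonneg_nonneg[OF nn]])
    qed
  qed
  then show ?thesis using that by (auto simp: has_frac_integral_def has_bochner_integral_iff)
qed

lemma derivative_measurable:
  fixes Y d :: "real \<Rightarrow> real"
  assumes cont: "continuous_on {0<..T} Y" and deriv: "\<And>t. t \<in> {0<..<T} \<Longrightarrow> (Y has_real_derivative d t) (at t)"
  shows "(\<lambda>t. indicator {0<..<T} t * d t) \<in> borel_measurable borel"
proof (rule borel_measurable_LIMSEQ_real)
  define Z where "Z t = indicator {0<..T} t *\<^sub>R Y t" for t
  have [measurable]: "Z \<in> borel_measurable borel"
    unfolding Z_def using cont by (intro borel_measurable_continuous_on_indicator) auto
  \<comment> \<open>Difference quotients along a fixed null sequence; \<open>Z\<close> makes them total.\<close>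
  define e where "e n = 1 / real (Suc n)" for n
  define f where "f n t = indicator {0<..<T} t * ((Z (t + e n) - Z t) / e n)" for n t
  show "f n \<in> borel_measurable borel" for n unfolding f_def by measurable
  show "(\<lambda>n. f n t) \<longlonglongrightarrow> indicator {0<..<T} t * d t" for t
  proof (cases "t \<in> {0<..<T}")
    case True
    have e0: "e \<longlonglongrightarrow> 0" unfolding e_def by (rule LIMSEQ_Suc[OF lim_1_over_n])
    then have "filterlim e (at 0) sequentially"
      by (auto simp: filterlim_at e_def intro!: always_eventually)
    moreover have "((\<lambda>h. (Y (t + h) - Y t) / h) \<longlongrightarrow> d t) (at 0)"
      using deriv[OF True] by (simp add: DERIV_def)
    ultimately have lim: "(\<lambda>n. (Y (t + e n) - Y t) / e n) \<longlonglongrightarrow> d t"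
      by (rule filterlim_compose[rotated])
    have "eventually (\<lambda>n. e n < T - t) sequentially" using order_tendstoD(2)[OF e0, of "T - t"] True by simp
    then have "eventually (\<lambda>n. (Y (t + e n) - Y t) / e n = f n t) sequentially"
    proof eventually_elim
      case (elim n)
      have "e n > 0" by (simp add: e_def)
      then show ?case using elim True by (simp add: f_def Z_def)
    qed
    then show ?thesis using Lim_transform_eventually[OF lim] True by simp
  qed (simp add: f_def)
qed

text \<open>The integral of order \<open>0\<close> is the identity; this case really occurs for the boundary values of the
  two orders.\<close>

definition frac_rel :: "real \<Rightarrow> (real \<Rightarrow> real) \<Rightarrow> real \<Rightarrow> real \<Rightarrow> bool" where
  "frac_rel a y t I \<longleftrightarrow> (if a = 0 then I = y t else has_frac_integral a y t I)"

text \<open>Let \<open>\<alpha>\<close> and \<open>\<kappa>\<close> be the inner and the outer order. Integrating the scalar equation with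
  order \<open>1 - \<kappa>\<close> completes the outer integral of \<open>d\<close> to order \<open>1\<close>, that is to \<open>Y t - Y 0\<close>, and turns \<open>y\<close>
  into the integral of \<open>Y\<close> of order \<open>1 - \<kappa> - \<alpha> = \<mu>\<close>. What remains is a Volterra equation for \<open>Y\<close>.\<close>

lemma hilfer_mode_volterra:
  fixes y Y d q f :: "real \<Rightarrow> real"
  assumes \<mu>: "0 < \<mu>" and \<alpha>: "0 \<le> \<alpha>" and \<kappa>: "0 \<le> \<kappa>" and sum: "\<alpha> + \<kappa> = 1 - \<mu>"
    and y: "continuous_on {0<..T} y"
    and Y: "\<And>t. t \<in> {0<..T} \<Longrightarrow> frac_rel \<alpha> y t (Y t)"
    and Yc: "continuous_on {0..T} Y"
    and d: "\<And>t. t \<in> {0<..<T} \<Longrightarrow> (Y has_real_derivative d t) (at t)"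
    and q: "\<And>t. t \<in> {0<..T} \<Longrightarrow> frac_rel \<kappa> d t (q t)"
    and f: "continuous_on UNIV f"
    and eq: "AE t in lborel. t \<in> {0<..<T} \<longrightarrow> q t + l * y t = f t"
    and t: "t \<in> {0<..T}"
  obtains J where "has_frac_integral \<mu> Y t J" "has_frac_integral (1 - \<kappa>) f t (Y t - Y 0 + l * J)"
proof -
  have t0: "0 < t" "t \<le> T" using t by auto
  have k1: "0 < 1 - \<kappa>" "1 - \<kappa> \<le> 1" using \<mu> \<alpha> \<kappa> sum by linarith+
  have yi: "set_integrable lborel {0<..<t} y"
  proof (cases "\<alpha> = 0")
    case True
    have "set_integrable lborel {0..t} Y"
      by (rule borel_integrable_atLeastAtMost') (use t0 in \<open>auto intro: continuous_on_subset[OF Yc]\<close>)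
    then have "set_integrable lborel {0<..<t} Y" by (rule set_integrable_subset) auto
    also have "?this \<longleftrightarrow> ?thesis"
      using Y True t0 by (intro set_integrable_cong) (auto simp: frac_rel_def)
    finally show ?thesis .
  next
    case False
    then have "has_frac_integral \<alpha> y t (Y t)" using Y[OF t] by (simp add: frac_rel_def)
    then show ?thesis
      by (rule has_frac_integral_imp_integrable) (use False \<alpha> \<kappa> \<mu> sum in auto)
  qed
  have dm: "(\<lambda>s. indicator {0<..<t} s *\<^sub>R d s) \<in> borel_measurable lborel"
  proof -
    have "(\<lambda>s. indicator {0<..<t} s * d s) \<in> borel_measurable borel"
      by (rule derivative_measurable[of t Y]) (use t0 d in \<open>auto intro: continuous_on_subset[OF Yc]\<close>)
    then show ?thesis by simp
  qed
  have di: "set_integrable lborel {0<..<t} d"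
  proof (cases "\<kappa> = 0")
    case True
    have fi: "set_integrable lborel {0<..<t} f"
      by (rule set_integrable_subset[of _ "{0..t}"], rule borel_integrable_atLeastAtMost')
        (auto intro: continuous_on_subset[OF f])
    have "set_integrable lborel {0<..<t} (\<lambda>s. f s - l * y s)"
      using fi yi by (intro set_integral_diff set_integrable_mult_right) auto
    then show ?thesis
      unfolding set_integrable_def
    proof (rule integrable_cong_AE_imp[OF _ dm])
      show "AE s in lborel. indicator {0<..<t} s *\<^sub>R (f s - l * y s) = indicator {0<..<t} s *\<^sub>R d s"
        using eq
      proof eventually_elim
        case (elim s)
        show ?case
        proof (cases "s \<in> {0<..<t}")
          case inside: True
          then have "q s = d s" using q[of s] True t0 by (simp add: frac_rel_def)
          with elim inside t0 show ?thesis by simp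
        qed simp
      qed
    qed
  next
    case False
    then have "has_frac_integral \<kappa> d t (q t)" using q[OF t] by (simp add: frac_rel_def)
    then show ?thesis
      by (rule has_frac_integral_imp_integrable) (use False \<alpha> \<kappa> \<mu> sum in auto)
  qed
  have d1: "has_frac_integral 1 d t (Y t - Y 0)"
  proof -
    have "(d has_integral (Y t - Y 0)) {0..t}"
    proof (rule fundamental_theorem_of_calculus_interior)
      show "continuous_on {0..t} Y" using t0 by (auto intro: continuous_on_subset[OF Yc])
      show "(Y has_vector_derivative d s) (at s)" if "s \<in> {0<..<t}" for s
        using d[of s] that t0 by (simp add: has_real_derivative_iff_has_vector_derivative)
    qed (use t0 in auto)
    then have "(d has_integral (Y t - Y 0)) {0<..<t}" by (simp add: has_integral_Icc_iff_Ioo)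
    then have "(LINT s:{0<..<t}|lborel. d s) = Y t - Y 0"
      using set_borel_integral_eq_integral(2)[OF di] by (simp add: integral_unique)
    then have "has_bochner_integral lborel (\<lambda>s. indicator {0<..<t} s *\<^sub>R d s) (Y t - Y 0)"
      using di by (simp add: has_bochner_integral_iff set_integrable_def set_lebesgue_integral_def)
    also have "(\<lambda>s. indicator {0<..<t} s *\<^sub>R d s) = (\<lambda>s. indicator {0<..<t} s *\<^sub>R frac_kernel 1 d t s)"
      by (auto simp: fun_eq_iff indicator_def frac_kernel_def)
    finally show ?thesis by (simp add: has_frac_integral_def)
  qed
  have q1: "has_frac_integral (1 - \<kappa>) q t (Y t - Y 0)"
  proof (cases "\<kappa> = 0")
    case True
    have "has_frac_integral 1 q t (Y t - Y 0) \<longleftrightarrow> has_frac_integral 1 d t (Y t - Y 0)"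
      using q True t0 by (intro has_frac_integral_cong) (auto simp: frac_rel_def)
    then show ?thesis using d1 True by simp
  next
    case False
    show ?thesis
    proof (rule has_frac_integral_semigroup)
      show "has_frac_integral (1 - \<kappa> + \<kappa>) d t (Y t - Y 0)" using d1 by simp
      show "has_frac_integral \<kappa> d s (q s)" if "0 < s" "s < t" for s
        using q[of s] that t0 False by (simp add: frac_rel_def)
    qed (use k1 \<kappa> False in auto)
  qed
  obtain J where J: "has_frac_integral (1 - \<kappa>) y t J"
    by (rule has_frac_integral_exists[OF k1 t0(1) yi continuous_on_subset[OF y]]) (use t0 in auto)
  have J2: "has_frac_integral \<mu> Y t J"
  proof (cases "\<alpha> = 0")
    case True
    then have "\<mu> = 1 - \<kappa>" using sum by simp
    moreover have "has_frac_integral (1 - \<kappa>) Y t J \<longleftrightarrow> has_frac_integral (1 - \<kappa>) y t J"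
      using Y True t0 by (intro has_frac_integral_cong) (auto simp: frac_rel_def)
    ultimately show ?thesis using J by simp
  next
    case False
    show ?thesis
    proof (rule has_frac_integral_semigroup[OF \<mu>])
      have "\<mu> + \<alpha> = 1 - \<kappa>" using sum by simp
      then show "has_frac_integral (\<mu> + \<alpha>) y t J" using J by simp
      show "has_frac_integral \<alpha> y s (Y s)" if "0 < s" "s < t" for s
        using Y[of s] that t0 False by (simp add: frac_rel_def)
    qed (use \<alpha> False in auto)
  qed
  have "has_frac_integral (1 - \<kappa>) (\<lambda>s. q s + l * y s) t (Y t - Y 0 + l * J)"
    by (intro has_frac_integral_add has_frac_integral_mult q1 J)
  then have "has_frac_integral (1 - \<kappa>) f t (Y t - Y 0 + l * J)"
    unfolding has_frac_integral_def
  proof (subst has_bochner_integral_cong_AE[symmetric, rotated 3])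
    show "has_bochner_integral lborel (\<lambda>s. indicator {0<..<t} s *\<^sub>R frac_kernel (1 - \<kappa>) (\<lambda>s. q s + l * y s) t s) (Y t - Y 0 + l * J) \<Longrightarrow>
       has_bochner_integral lborel (\<lambda>s. indicator {0<..<t} s *\<^sub>R frac_kernel (1 - \<kappa>) (\<lambda>s. q s + l * y s) t s) (Y t - Y 0 + l * J)" .
    show "(\<lambda>s. indicator {0<..<t} s *\<^sub>R frac_kernel (1 - \<kappa>) (\<lambda>s. q s + l * y s) t s) \<in> borel_measurable lborel"
      if "has_bochner_integral lborel (\<lambda>s. indicator {0<..<t} s *\<^sub>R frac_kernel (1 - \<kappa>) (\<lambda>s. q s + l * y s) t s) (Y t - Y 0 + l * J)"
      using that by (auto dest: has_bochner_integral_integrable borel_measurable_integrable simp: has_bochner_integral_iff)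
    have [measurable]: "f \<in> borel_measurable borel" using f by (rule borel_measurable_continuous_onI)
    show "(\<lambda>s. indicator {0<..<t} s *\<^sub>R frac_kernel (1 - \<kappa>) f t s) \<in> borel_measurable lborel"
      unfolding frac_kernel_def by measurable
    show "AE s in lborel. indicator {0<..<t} s *\<^sub>R frac_kernel (1 - \<kappa>) (\<lambda>s. q s + l * y s) t s =
        indicator {0<..<t} s *\<^sub>R frac_kernel (1 - \<kappa>) f t s"
      using eq by eventually_elim (use t0 in \<open>auto simp: indicator_def frac_kernel_def\<close>)
  qed
  with J2 show ?thesis using that by blast
qed

text \<open>The difference of two solutions satisfies the homogeneous Volterra equation.\<close>

lemma hilfer_mode_unique:
  fixes y Y d q y' Y' d' q' f :: "real \<Rightarrow> real"
  assumes par: "0 < \<mu>" "0 \<le> \<alpha>" "0 \<le> \<kappa>" "\<alpha> + \<kappa> = 1 - \<mu>" and f: "continuous_on UNIV f"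
    and 1: "continuous_on {0<..T} y" "\<And>t. t \<in> {0<..T} \<Longrightarrow> frac_rel \<alpha> y t (Y t)" "continuous_on {0..T} Y"
      "\<And>t. t \<in> {0<..<T} \<Longrightarrow> (Y has_real_derivative d t) (at t)"
      "\<And>t. t \<in> {0<..T} \<Longrightarrow> frac_rel \<kappa> d t (q t)"
      "AE t in lborel. t \<in> {0<..<T} \<longrightarrow> q t + l * y t = f t"
    and 2: "continuous_on {0<..T} y'" "\<And>t. t \<in> {0<..T} \<Longrightarrow> frac_rel \<alpha> y' t (Y' t)" "continuous_on {0..T} Y'"
      "\<And>t. t \<in> {0<..<T} \<Longrightarrow> (Y' has_real_derivative d' t) (at t)"
      "\<And>t. t \<in> {0<..T} \<Longrightarrow> frac_rel \<kappa> d' t (q' t)"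
      "AE t in lborel. t \<in> {0<..<T} \<longrightarrow> q' t + l * y' t = f t"
    and init: "Y 0 = Y' 0" and t: "t \<in> {0<..T}"
  shows "Y t = Y' t"
proof -
  define W where "W s = Y s + - 1 * Y' s" for s
  have Wc: "continuous_on {0..T} W" unfolding W_def by (intro continuous_intros 1(3) 2(3))
  have "compact (W ` {0..T})" by (intro compact_continuous_image Wc) auto
  then have "bounded (W ` {0..T})" by (rule compact_imp_bounded)
  then obtain M where M: "\<forall>x\<in>W ` {0..T}. norm x \<le> M" unfolding bounded_iff by blast
  have "W t = 0"
  proof (rule volterra_unique[OF par(1) _ _ t, of W M l])
    show "\<bar>W s\<bar> \<le> M" if "s \<in> {0<..T}" for s using M that by auto
    show "\<exists>I. has_frac_integral \<mu> W s I \<and> W s + l * I = 0" if s: "s \<in> {0<..T}" for s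
    proof -
      obtain J where J: "has_frac_integral \<mu> Y s J" "has_frac_integral (1 - \<kappa>) f s (Y s - Y 0 + l * J)"
        using hilfer_mode_volterra[OF par 1(1-5) f 1(6) s] by blast
      obtain J' where J': "has_frac_integral \<mu> Y' s J'" "has_frac_integral (1 - \<kappa>) f s (Y' s - Y' 0 + l * J')"
        using hilfer_mode_volterra[OF par 2(1-5) f 2(6) s] by blast
      have "has_frac_integral \<mu> W s (J + - 1 * J')"
        unfolding W_def by (intro has_frac_integral_add has_frac_integral_mult J J')
      moreover have "Y s - Y 0 + l * J = Y' s - Y' 0 + l * J'"
        using has_frac_integral_unique[OF J(2) J'(2)] .
      ultimately show ?thesis using init by (auto simp: W_def algebra_simps intro!: exI[of _ "J + - 1 * J'"])
    qed
  qed
  then show ?thesis by (simp add: W_def)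
qed

section \<open>Minimizing sequences in incomplete spaces\<close>

text \<open>Minimizing \<open>B x x - 2 * l x\<close> as in the Riesz representation theorem. The minimizing sequence is
  Cauchy by the parallelogram law; since \<open>W\<close> need not be complete, the conclusion speaks of the sequence
  instead of its limit.\<close>

lemma riesz_minimizing_sequence:
  fixes B :: "'h::real_vector \<Rightarrow> 'h \<Rightarrow> real"
  assumes W: "subspace W"
    and add: "\<And>x y z. x \<in> W \<Longrightarrow> y \<in> W \<Longrightarrow> z \<in> W \<Longrightarrow> B (x + y) z = B x z + B y z"
    and scale: "\<And>c x y. x \<in> W \<Longrightarrow> y \<in> W \<Longrightarrow> B (c *\<^sub>R x) y = c * B x y"
    and sym: "\<And>x y. x \<in> W \<Longrightarrow> y \<in> W \<Longrightarrow> B x y = B y x"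
    and nonneg: "\<And>x. x \<in> W \<Longrightarrow> 0 \<le> B x x"
    and ladd: "\<And>x y. x \<in> W \<Longrightarrow> y \<in> W \<Longrightarrow> l (x + y) = l x + l y"
    and lscale: "\<And>c x. x \<in> W \<Longrightarrow> l (c *\<^sub>R x) = c * l x"
    and C: "0 \<le> C" and bounded: "\<And>x. x \<in> W \<Longrightarrow> (l x)\<^sup>2 \<le> C * B x x"
  obtains x :: "nat \<Rightarrow> 'h" where "\<And>k. x k \<in> W"
    and "\<And>e. e > 0 \<Longrightarrow> \<exists>N. \<forall>m\<ge>N. \<forall>n\<ge>N. B (x m - x n) (x m - x n) < e"
    and "\<And>\<phi>. \<phi> \<in> W \<Longrightarrow> (\<lambda>k. B (x k) \<phi>) \<longlonglongrightarrow> l \<phi>"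
proof -
  note Wc = subspace_add[OF W] subspace_scale[OF W] subspace_diff[OF W]
  define J where "J x = B x x - 2 * l x" for x
  have expand: "B (x + c *\<^sub>R y) (x + c *\<^sub>R y) = B x x + 2 * c * B x y + c\<^sup>2 * B y y" if "x \<in> W" "y \<in> W" for x y c
  proof -
    have "B (x + c *\<^sub>R y) (x + c *\<^sub>R y) = B (x + c *\<^sub>R y) x + c * B (x + c *\<^sub>R y) y"
      using that add[of x "c *\<^sub>R y" "x + c *\<^sub>R y"] scale[of y "x + c *\<^sub>R y" c] sym[of "x + c *\<^sub>R y" x] sym[of "x + c *\<^sub>R y" y]
      by (simp add: Wc)
    also have "\<dots> = B x x + 2 * c * B x y + c\<^sup>2 * B y y"
      using that add[of x "c *\<^sub>R y"] scale[of y _ c] sym[of x y] by (simp add: Wc power2_eq_square algebra_simps)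
    finally show ?thesis .
  qed
  have Jexpand: "J (x + c *\<^sub>R y) = J x + 2 * c * (B x y - l y) + c\<^sup>2 * B y y" if "x \<in> W" "y \<in> W" for x y c
    unfolding J_def expand[OF that] using that by (simp add: ladd lscale Wc algebra_simps)
  have Jlow: "- C \<le> J x" if x: "x \<in> W" for x
  proof -
    have "(l x)\<^sup>2 \<le> C * B x x" by (rule bounded[OF x])
    also have "\<dots> \<le> ((C + B x x) / 2)\<^sup>2"
    proof -
      have "((C + B x x) / 2)\<^sup>2 - C * B x x = ((C - B x x) / 2)\<^sup>2" by (simp add: power2_eq_square field_simps)
      then show ?thesis by (smt (verit) zero_le_power2)
    qed
    finally have "l x \<le> (C + B x x) / 2" by (rule power2_le_imp_le) (use C nonneg[OF x] in auto)
    then show ?thesis by (simp add: J_def)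
  qed
  define m where "m = Inf (J ` W)"
  have bdd: "bdd_below (J ` W)" using Jlow by (intro bdd_belowI2)
  have mle: "m \<le> J x" if "x \<in> W" for x unfolding m_def by (rule cINF_lower[OF bdd that])
  have "\<exists>x\<in>W. J x < m + inverse (real (Suc k))" for k
  proof -
    have "Inf (J ` W) < m + inverse (real (Suc k))" by (simp add: m_def)
    then obtain z where "z \<in> J ` W" "z < m + inverse (real (Suc k))"
      using cInf_lessD[of "J ` W"] subspace_0[OF W] by blast
    then show ?thesis by blast
  qed
  then obtain x where x: "\<And>k. x k \<in> W" "\<And>k. J (x k) < m + inverse (real (Suc k))" by metis
  have par: "B (a - b) (a - b) \<le> 2 * (J a - m) + 2 * (J b - m)" if "a \<in> W" "b \<in> W" for a b
  proof -
    have "J (a + (1/2) *\<^sub>R (b - a)) \<ge> m" using that by (intro mle Wc)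
    moreover have "J (a + (1/2) *\<^sub>R (b - a)) = J a + (B a (b - a) - l (b - a)) + B (b - a) (b - a) / 4"
      using that by (subst Jexpand) (auto simp: Wc power2_eq_square)
    moreover have "J (a + 1 *\<^sub>R (b - a)) = J a + 2 * (B a (b - a) - l (b - a)) + B (b - a) (b - a)"
      using that by (subst Jexpand) (auto simp: Wc)
    moreover have "B (a - b) (a - b) = B (b - a) (b - a)"
      using expand[of 0 "b - a" "-1"] expand[of 0 "b - a" 1] scale[of 0 "b - a" 0] subspace_0[OF W] that by (simp add: Wc)
    ultimately show ?thesis by simp
  qed
  have inv0: "(\<lambda>k. inverse (real (Suc k))) \<longlonglongrightarrow> 0" by (rule LIMSEQ_inverse_real_of_nat)
  show ?thesis
  proof (rule that[OF x(1)])
    fix e :: real assume e: "e > 0"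
    obtain N where N: "inverse (real (Suc N)) < e / 4" using e reals_Archimedean[of "e / 4"] by auto
    have "B (x i - x j) (x i - x j) < e" if "i \<ge> N" "j \<ge> N" for i j
    proof -
      have "J (x k) - m < e / 4" if "k \<ge> N" for k
      proof -
        have "J (x k) - m < inverse (real (Suc k))" using x(2)[of k] by linarith
        also have "\<dots> \<le> inverse (real (Suc N))" using that by (intro le_imp_inverse_le) auto
        also note N
        finally show ?thesis .
      qed
      from this[OF that(1)] this[OF that(2)] have "2 * (J (x i) - m) + 2 * (J (x j) - m) < e" by (simp add: field_simps)
      with par[OF x(1) x(1), of i j] show ?thesis by (rule order.strict_trans1)
    qed
    then show "\<exists>N. \<forall>m\<ge>N. \<forall>n\<ge>N. B (x m - x n) (x m - x n) < e" by blast
  next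
    fix \<phi> assume \<phi>: "\<phi> \<in> W"
    define b where "b = B \<phi> \<phi> + 1"
    have b: "b > 0" using nonneg[OF \<phi>] by (simp add: b_def)
    have bound: "(B (x k) \<phi> - l \<phi>)\<^sup>2 \<le> b * inverse (real (Suc k))" for k
    proof -
      define r where "r = B (x k) \<phi> - l \<phi>"
      have "m \<le> J (x k + (- r / b) *\<^sub>R \<phi>)" using x(1) \<phi> by (intro mle Wc)
      also have "\<dots> = J (x k) - 2 * r\<^sup>2 / b + (r / b)\<^sup>2 * B \<phi> \<phi>"
        using x(1) \<phi> by (subst Jexpand) (auto simp: r_def[symmetric] power2_eq_square)
      also have "(r / b)\<^sup>2 * B \<phi> \<phi> \<le> (r / b)\<^sup>2 * b" by (intro mult_left_mono) (auto simp: b_def)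
      also have "(r / b)\<^sup>2 * b = r\<^sup>2 / b" using b by (simp add: power2_eq_square)
      finally have "r\<^sup>2 / b \<le> J (x k) - m" by simp
      also have "\<dots> \<le> inverse (real (Suc k))" using x(2)[of k] by linarith
      finally have "r\<^sup>2 / b \<le> inverse (real (Suc k))" .
      then show ?thesis using b by (simp add: r_def[symmetric] pos_divide_le_eq mult.commute)
    qed
    have "(\<lambda>k. (B (x k) \<phi> - l \<phi>)\<^sup>2) \<longlonglongrightarrow> 0"
    proof (rule tendsto_sandwich[of "\<lambda>_. 0"])
      show "(\<lambda>k. b * inverse (real (Suc k))) \<longlonglongrightarrow> 0" using tendsto_mult_left[OF inv0, of b] by simp
    qed (use bound in auto)
    then have "(\<lambda>k. sqrt ((B (x k) \<phi> - l \<phi>)\<^sup>2)) \<longlonglongrightarrow> sqrt 0" by (rule tendsto_real_sqrt)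
    then have "(\<lambda>k. B (x k) \<phi> - l \<phi>) \<longlonglongrightarrow> 0" by (simp add: tendsto_rabs_zero_iff)
    then show "(\<lambda>k. B (x k) \<phi>) \<longlonglongrightarrow> l \<phi>" by (simp add: LIM_zero_iff)
  qed
qed

text \<open>A Hahn-Banach functional without completeness: let \<open>r\<close> be a minimizing sequence for the distance of
  \<open>u\<close> from \<open>R\<close> and take the limit of the functionals \<open>inner (u - r k)\<close>. If it vanished at \<open>u\<close>, the
  distance of \<open>u\<close> from \<open>R\<close> would be zero.\<close>

lemma separating_functional:
  fixes R :: "'h::real_inner set" and u :: 'h
  assumes R: "subspace R" and u: "u \<notin> closure R"
  obtains l where "bounded_linear l" "\<And>x. x \<in> R \<Longrightarrow> l x = 0" "l u \<noteq> (0::real)"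
proof -
  obtain r :: "nat \<Rightarrow> 'h" where r: "\<And>k. r k \<in> R"
    and rC: "\<And>e. e > 0 \<Longrightarrow> \<exists>N. \<forall>m\<ge>N. \<forall>n\<ge>N. inner (r m - r n) (r m - r n) < e"
    and rlim: "\<And>\<phi>. \<phi> \<in> R \<Longrightarrow> (\<lambda>k. inner (r k) \<phi>) \<longlonglongrightarrow> inner u \<phi>"
  proof (rule riesz_minimizing_sequence[OF R, of inner "inner u" "inner u u"])
    show "(inner u x)\<^sup>2 \<le> inner u u * inner x x" for x by (rule Cauchy_Schwarz_ineq)
  qed (auto simp: inner_left_distrib inner_right_distrib inner_commute)
  have Cau: "Cauchy r"
  proof (rule CauchyI)
    fix e :: real assume "e > 0"
    then obtain N where "\<forall>m\<ge>N. \<forall>n\<ge>N. inner (r m - r n) (r m - r n) < e\<^sup>2" using rC[of "e\<^sup>2"] by auto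
    then show "\<exists>M. \<forall>m\<ge>M. \<forall>n\<ge>M. norm (r m - r n) < e"
      using \<open>e > 0\<close> by (auto simp: power2_norm_eq_inner[symmetric] power2_less_imp_less intro!: exI[of _ N])
  qed
  then obtain K where K: "\<And>n. norm (r n) \<le> K"
    using Bseq_def Cauchy_Bseq by blast
  have conv: "convergent (\<lambda>k. inner (u - r k) \<phi>)" for \<phi>
  proof -
    have "Cauchy (\<lambda>k. inner (r k) \<phi>)"
      using bounded_linear.Cauchy[OF bounded_linear_inner_left Cau] .
    then have "convergent (\<lambda>k. inner (r k) \<phi>)" by (rule Cauchy_convergent)
    then show ?thesis unfolding inner_diff_left by (intro convergent_diff convergent_const)
  qed
  define l where "l \<phi> = lim (\<lambda>k. inner (u - r k) \<phi>)" for \<phi>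
  have l: "(\<lambda>k. inner (u - r k) \<phi>) \<longlonglongrightarrow> l \<phi>" for \<phi>
    unfolding l_def using conv convergent_LIMSEQ_iff by blast
  show ?thesis
  proof
    show "bounded_linear l"
    proof
      show "l (x + y) = l x + l y" for x y
        using LIMSEQ_unique[OF l[of "x + y", unfolded inner_right_distrib] tendsto_add[OF l l]] .
      show "l (c *\<^sub>R x) = c *\<^sub>R l x" for c x
        using LIMSEQ_unique[OF l[of "c *\<^sub>R x", unfolded inner_scaleR_right] tendsto_mult_left[OF l]] by simp
      have "norm (l x) \<le> norm x * (norm u + K)" for x
      proof (rule LIMSEQ_le_const2[OF tendsto_norm[OF l]], intro exI allI impI)
        fix k
        have "norm (inner (u - r k) x) \<le> norm (u - r k) * norm x" using Cauchy_Schwarz_ineq2 by simp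
        also have "\<dots> \<le> (norm u + K) * norm x"
          using norm_triangle_ineq4[of u "r k"] K[of k] by (intro mult_right_mono) auto
        finally show "norm (inner (u - r k) x) \<le> norm x * (norm u + K)" by (simp add: mult.commute)
      qed
      then show "\<exists>K. \<forall>x. norm (l x) \<le> norm x * K" by blast
    qed
    show "l x = 0" if "x \<in> R" for x
    proof -
      have "(\<lambda>k. inner u x - inner (r k) x) \<longlonglongrightarrow> inner u x - inner u x"
        by (intro tendsto_diff tendsto_const rlim that)
      then show ?thesis using LIMSEQ_unique[OF l[of x]] by (simp add: inner_diff_left)
    qed
    note lR = this
    show "l u \<noteq> 0"
    proof
      assume lu: "l u = 0"
      have "u \<in> closure R"
        unfolding closure_approachable
      proof (intro allI impI)
        fix e :: real assume e: "e > 0"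
        define d where "d = e\<^sup>2 / (2 * (\<bar>K\<bar> + 1))"
        have d: "d > 0" using e by (auto simp: d_def intro!: divide_pos_pos mult_pos_pos)
        obtain N1 where N1: "\<And>m n. m \<ge> N1 \<Longrightarrow> n \<ge> N1 \<Longrightarrow> norm (r m - r n) < d"
          using CauchyD[OF Cau d] by blast
        obtain N2 where N2: "\<And>n. n \<ge> N2 \<Longrightarrow> \<bar>inner (u - r n) u\<bar> < e\<^sup>2 / 2"
          using LIMSEQ_D[OF l[of u], of "e\<^sup>2 / 2"] e lu by auto
        define k where "k = max N1 N2"
        have "\<bar>inner (u - r k) (r k)\<bar> \<le> d * \<bar>K\<bar>"
        proof -
          have le: "\<bar>inner (u - r k) (r k) - inner (u - r n) (r k)\<bar> \<le> d * \<bar>K\<bar>" if "n \<ge> N1" for n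
          proof -
            have "inner (u - r k) (r k) - inner (u - r n) (r k) = inner (r n - r k) (r k)" by (simp add: inner_diff_left)
            also have "\<bar>\<dots>\<bar> \<le> norm (r n - r k) * norm (r k)" by (rule Cauchy_Schwarz_ineq2)
            also have "\<dots> \<le> d * \<bar>K\<bar>" using N1[of n k] that K[of k] d by (intro mult_mono) (auto simp: k_def)
            finally show ?thesis .
          qed
          have lim: "(\<lambda>n. \<bar>inner (u - r k) (r k) - inner (u - r n) (r k)\<bar>) \<longlonglongrightarrow> \<bar>inner (u - r k) (r k) - 0\<bar>"
            using l[of "r k"] lR[OF r, of k] by (intro tendsto_intros) auto
          have "\<bar>inner (u - r k) (r k) - 0\<bar> \<le> d * \<bar>K\<bar>"
            by (rule LIMSEQ_le_const2[OF lim]) (use le in blast)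
          then show ?thesis by simp
        qed
        also have "d * \<bar>K\<bar> < e\<^sup>2 / 2"
        proof -
          have "d * \<bar>K\<bar> < d * (\<bar>K\<bar> + 1)" using d by simp
          also have "\<dots> = e\<^sup>2 / 2"
          proof -
            define p where "p = \<bar>K\<bar> + 1"
            have "p > 0" by (simp add: p_def)
            then show ?thesis unfolding d_def p_def[symmetric] by simp
          qed
          finally show ?thesis .
        qed
        finally have "\<bar>inner (u - r k) (r k)\<bar> < e\<^sup>2 / 2" .
        moreover have "(norm (u - r k))\<^sup>2 = inner (u - r k) u - inner (u - r k) (r k)"
          by (simp add: power2_norm_eq_inner inner_diff_right)
        moreover have "\<bar>inner (u - r k) u\<bar> < e\<^sup>2 / 2" by (rule N2) (simp add: k_def)
        ultimately have "(norm (u - r k))\<^sup>2 < e\<^sup>2 / 2 + e\<^sup>2 / 2" by (smt (verit))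
        then have "(norm (u - r k))\<^sup>2 < e\<^sup>2" by simp
        then have "norm (u - r k) < e" by (rule power2_less_imp_less) (use e in auto)
        then show "\<exists>y\<in>R. dist y u < e" using r by (auto simp: dist_norm norm_minus_commute)
      qed
      then show False using u by simp
    qed
  qed
qed

section \<open>Spectral theory of the form operator\<close>

lemma discriminant_bound:
  fixes a b c :: real
  assumes "\<And>t. 0 \<le> a + 2 * t * b + t\<^sup>2 * c" "0 \<le> c"
  shows "b\<^sup>2 \<le> a * c"
proof (cases "c = 0")
  case True
  have "b = 0"
  proof (rule ccontr)
    assume "b \<noteq> 0"
    then have "a + 2 * (- (a + 1) / (2 * b)) * b = -1" by (simp add: field_simps)
    then show False using assms(1)[of "- (a + 1) / (2 * b)"] True by simp
  qed
  then show ?thesis using True by simp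
next
  case False
  then have c: "c > 0" using assms(2) by simp
  have "a + 2 * (- b / c) * b + (- b / c)\<^sup>2 * c = a - b\<^sup>2 / c"
    using c by (simp add: power2_eq_square)
  then have "b\<^sup>2 / c \<le> a" using assms(1)[of "- b / c"] by simp
  then show ?thesis using c by (simp add: pos_divide_le_eq)
qed

text \<open>The operator of a closed form with compact resolvent on a closed subspace \<open>H\<close> of an inner product
  space.\<close>

locale form_operator =
  fixes H D V :: "'h::real_inner set" and A :: "'h \<Rightarrow> 'h" and E :: "'h \<Rightarrow> 'h \<Rightarrow> real"
  assumes subspace_H: "subspace H" and closed_H: "closed H"
    and selfadjoint: "selfadjoint_operator H D A"
    and compact_domain: "compactly_embedded_domain D A"
    and form: "nonneg_symmetric_form H V E" and closed: "closed_form V E"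
    and associated: "associated_operator H V E D A"
begin

lemma subspace_V: "subspace V" and V_sub_H: "x \<in> V \<Longrightarrow> x \<in> H"
  and E_add: "\<lbrakk>x \<in> V; y \<in> V; z \<in> V\<rbrakk> \<Longrightarrow> E (x + y) z = E x z + E y z"
  and E_scale: "\<lbrakk>x \<in> V; y \<in> V\<rbrakk> \<Longrightarrow> E (c *\<^sub>R x) y = c * E x y"
  and E_sym: "\<lbrakk>x \<in> V; y \<in> V\<rbrakk> \<Longrightarrow> E x y = E y x"
  and E_nonneg: "x \<in> V \<Longrightarrow> 0 \<le> E x x"
  using form by (auto simp: nonneg_symmetric_form_def)

lemma D_iff: "x \<in> D \<and> A x = g \<longleftrightarrow> x \<in> V \<and> g \<in> H \<and> (\<forall>y\<in>V. E x y = inner g y)"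
proof -
  have "(x, g) \<in> op_graph D A \<longleftrightarrow> x \<in> D \<and> A x = g" by (auto simp: op_graph_def)
  then show ?thesis using associated by (auto simp: associated_operator_def)
qed

lemma D_sub_V: "x \<in> D \<Longrightarrow> x \<in> V" and A_in_H: "x \<in> D \<Longrightarrow> A x \<in> H"
  and E_A: "x \<in> D \<Longrightarrow> y \<in> V \<Longrightarrow> E x y = inner (A x) y"
  using D_iff[of x "A x"] by auto

lemma D_sub_H: "x \<in> D \<Longrightarrow> x \<in> H" using D_sub_V V_sub_H by blast

lemma subspace_D: "subspace D" and A_add: "\<lbrakk>x \<in> D; y \<in> D\<rbrakk> \<Longrightarrow> A (x + y) = A x + A y"
  and A_scale: "x \<in> D \<Longrightarrow> A (c *\<^sub>R x) = c *\<^sub>R A x" and D_dense: "H \<subseteq> closure D"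
  using selfadjoint by (auto simp: selfadjoint_operator_def linear_operator_def)

text \<open>The inner product of the form domain; \<open>form_norm E\<close> is its norm.\<close>

definition F :: "'h \<Rightarrow> 'h \<Rightarrow> real" where "F x y = E x y + inner x y"

lemma F_add: "\<lbrakk>x \<in> V; y \<in> V; z \<in> V\<rbrakk> \<Longrightarrow> F (x + y) z = F x z + F y z"
  and F_scale: "\<lbrakk>x \<in> V; y \<in> V\<rbrakk> \<Longrightarrow> F (c *\<^sub>R x) y = c * F x y"
  and F_sym: "\<lbrakk>x \<in> V; y \<in> V\<rbrakk> \<Longrightarrow> F x y = F y x"
  and F_ge: "x \<in> V \<Longrightarrow> inner x x \<le> F x x"
  and F_nonneg: "x \<in> V \<Longrightarrow> 0 \<le> F x x"
  using E_sym[of x y] E_nonneg[of x]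
  by (auto simp: F_def E_add E_scale inner_left_distrib algebra_simps inner_commute)

lemma F_add2: "\<lbrakk>x \<in> V; y \<in> V; z \<in> V\<rbrakk> \<Longrightarrow> F z (x + y) = F z x + F z y"
  using F_sym[of z "x + y"] F_sym[of z x] F_sym[of z y] F_add[of x y z]
  by (simp add: subspace_add[OF subspace_V])

lemma F_scale2: "\<lbrakk>x \<in> V; y \<in> V\<rbrakk> \<Longrightarrow> F y (c *\<^sub>R x) = c * F y x"
  using F_sym[of y "c *\<^sub>R x"] F_sym[of y x] F_scale[of x y]
  by (simp add: subspace_scale[OF subspace_V])

lemma F_diff: "\<lbrakk>x \<in> V; y \<in> V; z \<in> V\<rbrakk> \<Longrightarrow> F (x - y) z = F x z - F y z"
  using F_add[of "x - y" y z] by (simp add: subspace_diff[OF subspace_V])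

lemma form_norm_F: "form_norm E x = sqrt (F x x)"
  by (simp add: form_norm_def F_def power2_norm_eq_inner)

lemma norm_le_form_norm: "x \<in> V \<Longrightarrow> norm x \<le> form_norm E x"
  by (simp add: form_norm_F norm_eq_sqrt_inner F_ge)

lemma F_Cauchy_Schwarz:
  assumes "x \<in> V" "y \<in> V"
  shows "(F x y)\<^sup>2 \<le> F x x * F y y"
proof (rule discriminant_bound)
  fix t
  have "0 \<le> F (x + t *\<^sub>R y) (x + t *\<^sub>R y)"
    using assms by (intro F_nonneg subspace_add[OF subspace_V] subspace_scale[OF subspace_V])
  also have "\<dots> = F x x + 2 * t * F x y + t\<^sup>2 * F y y"
    using assms F_sym[of x y]
    by (simp add: F_add F_add2 F_scale F_scale2 subspace_add[OF subspace_V] subspace_scale[OF subspace_V]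
        power2_eq_square algebra_simps)
  finally show "0 \<le> F x x + 2 * t * F x y + t\<^sup>2 * F y y" .
qed (use assms F_nonneg in auto)

lemma abs_F_le: "x \<in> V \<Longrightarrow> y \<in> V \<Longrightarrow> \<bar>F x y\<bar> \<le> form_norm E x * form_norm E y"
  using real_sqrt_le_mono[OF F_Cauchy_Schwarz[of x y]] by (simp add: form_norm_F real_sqrt_mult)

text \<open>Riesz representation of \<open>inner f\<close> in the form domain, which is complete because the form is closed.\<close>

lemma resolvent_exists:
  assumes f: "f \<in> H"
  shows "\<exists>x\<in>D. x + A x = f"
proof -
  obtain x :: "nat \<Rightarrow> 'h" where x: "\<And>k. x k \<in> V"
    and xC: "\<And>e. e > 0 \<Longrightarrow> \<exists>N. \<forall>m\<ge>N. \<forall>n\<ge>N. F (x m - x n) (x m - x n) < e"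
    and xl: "\<And>\<phi>. \<phi> \<in> V \<Longrightarrow> (\<lambda>k. F (x k) \<phi>) \<longlonglongrightarrow> inner f \<phi>"
  proof (rule riesz_minimizing_sequence[OF subspace_V, of F "inner f" "inner f f"])
    show "(inner f x)\<^sup>2 \<le> inner f f * F x x" if "x \<in> V" for x
      using Cauchy_Schwarz_ineq[of f x] mult_left_mono[OF F_ge[OF that], of "inner f f"] by simp
  qed (auto simp: F_add F_scale F_sym F_nonneg inner_right_distrib)
  have "\<forall>e>0. \<exists>k. \<forall>m\<ge>k. \<forall>n\<ge>k. form_norm E (x m - x n) < e"
  proof (intro allI impI)
    fix e :: real assume e: "e > 0"
    then obtain N where N: "\<forall>m\<ge>N. \<forall>n\<ge>N. F (x m - x n) (x m - x n) < e\<^sup>2" using xC[of "e\<^sup>2"] by auto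
    have "form_norm E (x m - x n) < e" if "m \<ge> N" "n \<ge> N" for m n
      unfolding form_norm_F using N that e real_less_lsqrt by (meson less_imp_le real_sqrt_less_iff real_less_lsqrt)
    then show "\<exists>k. \<forall>m\<ge>k. \<forall>n\<ge>k. form_norm E (x m - x n) < e" by blast
  qed
  then obtain y where y: "y \<in> V" "(\<lambda>n. form_norm E (x n - y)) \<longlonglongrightarrow> 0"
    using closed x unfolding closed_form_def by blast
  have "F y \<phi> = inner f \<phi>" if "\<phi> \<in> V" for \<phi>
  proof -
    have "(\<lambda>k. F (x k) \<phi> - F y \<phi>) \<longlonglongrightarrow> 0"
    proof (rule Lim_null_comparison)
      show "\<forall>\<^sub>F k in sequentially. norm (F (x k) \<phi> - F y \<phi>) \<le> form_norm E (x k - y) * form_norm E \<phi>"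
        using abs_F_le[of "x _ - y" \<phi>] x y(1) that
        by (intro always_eventually allI) (simp add: F_diff[symmetric] subspace_diff[OF subspace_V])
      show "(\<lambda>k. form_norm E (x k - y) * form_norm E \<phi>) \<longlonglongrightarrow> 0"
        using tendsto_mult_right[OF y(2), of "form_norm E \<phi>"] by simp
    qed
    then have "(\<lambda>k. F (x k) \<phi>) \<longlonglongrightarrow> F y \<phi>" by (rule LIM_zero_cancel)
    then show ?thesis using xl[OF that] LIMSEQ_unique by blast
  qed
  then have "\<forall>\<phi>\<in>V. E y \<phi> = inner (f - y) \<phi>" by (auto simp: F_def inner_diff_left algebra_simps)
  then have "y \<in> D \<and> A y = f - y"
    using D_iff[of y "f - y"] y(1) f V_sub_H subspace_diff[OF subspace_H] by auto
  then show ?thesis by (auto intro!: bexI[of _ y])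
qed

definition eigvec :: "'h \<Rightarrow> real \<Rightarrow> bool" where "eigvec x c \<longleftrightarrow> x \<in> D \<and> A x = c *\<^sub>R x"

lemma A_sym: "x \<in> D \<Longrightarrow> y \<in> D \<Longrightarrow> inner (A x) y = inner x (A y)"
  using E_A[of x y] E_A[of y x] E_sym[of x y] D_sub_V by (metis inner_commute)

lemma eigvec_nonneg:
  assumes "eigvec x c" "x \<noteq> 0" shows "0 \<le> c"
proof -
  have "0 \<le> c * inner x x" using assms E_nonneg[of x] E_A[of x x] D_sub_V[of x] by (simp add: eigvec_def)
  moreover have "0 < inner x x" using assms by simp
  ultimately show ?thesis by (simp only: zero_le_mult_iff) auto
qed

lemma eigvec_orthogonal: "eigvec x c \<Longrightarrow> eigvec y d \<Longrightarrow> c \<noteq> d \<Longrightarrow> inner x y = 0"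
  using A_sym[of x y] by (auto simp: eigvec_def)

text \<open>The resolvent of \<open>A\<close> at \<open>- 1\<close>, the inverse of \<open>x \<mapsto> x + A x\<close>.\<close>

definition G :: "'h \<Rightarrow> 'h" where "G f = (SOME x. x \<in> D \<and> x + A x = f)"

lemma G: "f \<in> H \<Longrightarrow> G f \<in> D" "f \<in> H \<Longrightarrow> G f + A (G f) = f"
  using someI_ex[of "\<lambda>x. x \<in> D \<and> x + A x = f"] resolvent_exists[of f] by (auto simp: G_def)

lemma F_D: "x \<in> D \<Longrightarrow> y \<in> V \<Longrightarrow> F x y = inner (x + A x) y"
  by (simp add: F_def E_A inner_left_distrib)

text \<open>The resolvent is single-valued because \<open>A\<close> is non-negative.\<close>

lemma G_eq:
  assumes "x \<in> D" "x + A x = f" "f \<in> H" shows "G f = x"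
proof -
  have d: "G f - x \<in> D" using assms G subspace_diff[OF subspace_D] by auto
  have "A (G f) = A (G f - x) + A x" using A_add[OF d assms(1)] by simp
  then have "(G f - x) + A (G f - x) = (G f + A (G f)) - (x + A x)" by (simp add: algebra_simps)
  then have "(G f - x) + A (G f - x) = 0" using G(2)[OF assms(3)] assms(2) by simp
  then have "F (G f - x) (G f - x) = 0" using F_D[OF d] d D_sub_V by auto
  then have "inner (G f - x) (G f - x) \<le> 0" using F_ge[OF D_sub_V[OF d]] by simp
  then show ?thesis using inner_ge_zero[of "G f - x"] by (metis antisym inner_eq_zero_iff eq_iff_diff_eq_0)
qed

lemma G_diff:
  assumes "f \<in> H" "g \<in> H" shows "G (f - g) = G f - G g"
proof (rule G_eq)
  have "A (G f) = A (G f - G g) + A (G g)"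
    using A_add[of "G f - G g" "G g"] assms G subspace_diff[OF subspace_D] by auto
  then have "G f - G g + A (G f - G g) = (G f + A (G f)) - (G g + A (G g))" by (simp add: algebra_simps)
  then show "G f - G g + A (G f - G g) = f - g"
    using G(2)[OF assms(1)] G(2)[OF assms(2)] by simp
qed (use assms G subspace_diff[OF subspace_D] subspace_diff[OF subspace_H] in auto)

lemma G_scale:
  assumes "f \<in> H" shows "G (c *\<^sub>R f) = c *\<^sub>R G f"
proof (rule G_eq)
  show "c *\<^sub>R G f + A (c *\<^sub>R G f) = c *\<^sub>R f"
    using G[OF assms] by (simp add: A_scale scaleR_add_right[symmetric])
qed (use assms G subspace_scale[OF subspace_D] subspace_scale[OF subspace_H] in auto)

lemma inner_G: "f \<in> H \<Longrightarrow> g \<in> H \<Longrightarrow> inner (G f) g = F (G f) (G g)"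
  using F_D[OF G(1), of g "G f"] F_sym[of "G f" "G g"] G D_sub_V by (metis inner_commute)

lemma norm_G_le: assumes "f \<in> H" shows "norm (G f) \<le> norm f"
proof (cases "G f = 0")
  case False
  have "(norm (G f))\<^sup>2 \<le> F (G f) (G f)" using F_ge[OF D_sub_V[OF G(1)[OF assms]]] by (simp add: power2_norm_eq_inner)
  also have "\<dots> = inner (G f) f" using inner_G[OF assms assms] by simp
  also have "\<dots> \<le> norm (G f) * norm f" by (rule norm_cauchy_schwarz)
  finally show ?thesis using False by (simp add: power2_eq_square)
qed simp

text \<open>The orthogonal complement \<open>M\<close> of the eigenvectors is invariant under the resolvent \<open>G\<close>. If \<open>M\<close> were
  not zero, let \<open>s > 0\<close> be the supremum of \<open>inner (G f) f\<close> over its unit ball. For a maximizing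
  sequence, \<open>G f - s *\<^sub>R f\<close> tends to \<open>0\<close>, and by compactness of the graph-norm ball a subsequence of
  \<open>G f\<close> converges. The limit would be a non-zero eigenvector of \<open>A\<close> in \<open>M\<close>.\<close>

lemma eigenvectors_complete:
  assumes h: "h \<in> H" "\<And>x c. eigvec x c \<Longrightarrow> inner h x = 0"
  shows "h = 0"
proof (rule ccontr)
  assume h0: "h \<noteq> 0"
  define M where "M = {f \<in> H. \<forall>x c. eigvec x c \<longrightarrow> inner f x = 0}"
  have MH: "f \<in> M \<Longrightarrow> f \<in> H" for f by (simp add: M_def)
  have Mscale: "c *\<^sub>R f \<in> M" if "f \<in> M" for c f
    using that subspace_scale[OF subspace_H] by (auto simp: M_def)
  have GM: "G f \<in> M" if f: "f \<in> M" for f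
    unfolding M_def
  proof (intro CollectI conjI allI impI)
    show "G f \<in> H" using G(1)[OF MH[OF f]] D_sub_H by blast
    fix x c assume x: "eigvec x c"
    show "inner (G f) x = 0"
    proof (cases "x = 0")
      case False
      have "(1 + c) * inner (G f) x = inner (G f) x + inner (A (G f)) x"
        using A_sym[OF G(1)[OF MH[OF f]], of x] x by (simp add: eigvec_def algebra_simps)
      also have "\<dots> = inner f x" using G(2)[OF MH[OF f]] by (metis inner_left_distrib)
      also have "\<dots> = 0" using f x by (auto simp: M_def)
      finally show ?thesis using eigvec_nonneg[OF x False] by auto
    qed simp
  qed
  define q where "q f = inner (G f) f" for f
  have q_F: "q f = F (G f) (G f)" if "f \<in> H" for f using inner_G[OF that that] by (simp add: q_def)
  have q_nonneg: "q f \<ge> 0" if "f \<in> H" for f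
    using F_nonneg D_sub_V G(1)[OF that] q_F[OF that] by simp
  have q_le: "q f \<le> 1" if "f \<in> H" "norm f \<le> 1" for f
  proof -
    have "q f \<le> norm (G f) * norm f" unfolding q_def by (rule norm_cauchy_schwarz)
    also have "\<dots> \<le> 1 * 1" using norm_G_le[OF that(1)] that by (intro mult_mono) auto
    finally show ?thesis by simp
  qed
  define U where "U = {f \<in> M. norm f \<le> 1}"
  define s where "s = (SUP f\<in>U. q f)"
  have bdd: "bdd_above (q ` U)" using q_le MH by (intro bdd_aboveI2[of _ _ 1]) (auto simp: U_def)
  have hM: "h \<in> M" using h by (auto simp: M_def)
  have hU: "(1 / norm h) *\<^sub>R h \<in> U" using hM h0 Mscale by (auto simp: U_def)
  have s_pos: "s > 0"
  proof -
    define f where "f = (1 / norm h) *\<^sub>R h"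
    have f: "f \<in> U" "f \<in> H" "f \<noteq> 0" using hU MH h0 by (auto simp: f_def U_def)
    have "G f \<noteq> 0"
    proof
      assume "G f = 0"
      then have "f = 0" using G(2)[OF f(2)] A_scale[of 0 0] subspace_0[OF subspace_D] by simp
      with f show False by simp
    qed
    then have "0 < inner (G f) (G f)" by simp
    also have "\<dots> \<le> q f" using F_ge[OF D_sub_V[OF G(1)[OF f(2)]]] q_F[OF f(2)] by simp
    also have "\<dots> \<le> s" unfolding s_def by (rule cSUP_upper[OF f(1) bdd])
    finally show ?thesis .
  qed
  have q_s: "q f \<le> s * (norm f)\<^sup>2" if f: "f \<in> M" for f
  proof (cases "f = 0")
    case False
    have "(1 / norm f) *\<^sub>R f \<in> U" using f False Mscale by (auto simp: U_def)
    then have "q ((1 / norm f) *\<^sub>R f) \<le> s" unfolding s_def by (rule cSUP_upper[OF _ bdd])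
    moreover have "q ((1 / norm f) *\<^sub>R f) = q f / (norm f)\<^sup>2"
      using G_scale[OF MH[OF f], of "1 / norm f"] by (simp add: q_def power2_eq_square)
    ultimately show ?thesis using False by (simp add: pos_divide_le_eq)
  qed (simp add: q_def)
  have G_s: "norm (G f) \<le> s * norm f" if f: "f \<in> M" for f
  proof (cases "G f = 0")
    case False
    have GfH: "G f \<in> H" using MH GM f by blast
    have "((norm (G f))\<^sup>2)\<^sup>2 = (inner (G f) (G f))\<^sup>2" by (simp add: power2_norm_eq_inner)
    also have "\<dots> \<le> q f * q (G f)"
      unfolding q_F[OF MH[OF f]] q_F[OF GfH] inner_G[OF MH[OF f] GfH]
      using G(1) MH[OF f] GfH D_sub_V by (intro F_Cauchy_Schwarz) auto
    also have "\<dots> \<le> (s * (norm f)\<^sup>2) * (s * (norm (G f))\<^sup>2)"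
      using q_s f GM s_pos q_nonneg GfH by (intro mult_mono) auto
    finally have "(norm (G f))\<^sup>2 * (norm (G f))\<^sup>2 \<le> (s * norm f)\<^sup>2 * (norm (G f))\<^sup>2"
      by (simp add: power2_eq_square mult_ac)
    then have "(norm (G f))\<^sup>2 \<le> (s * norm f)\<^sup>2" by (rule mult_right_le_imp_le) (use False in simp)
    then show ?thesis by (rule power2_le_imp_le) (use s_pos in auto)
  qed (use s_pos in simp)
  have "\<exists>f\<in>U. s - inverse (real (Suc k)) < q f" for k
  proof -
    have "s - inverse (real (Suc k)) < Sup (q ` U)" by (simp add: s_def)
    then show ?thesis using less_cSup_iff[OF _ bdd, of "s - inverse (real (Suc k))"] hU by auto
  qed
  then obtain f where f: "\<And>k. f k \<in> U" "\<And>k. s - inverse (real (Suc k)) < q (f k)" by metis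
  have fM: "f k \<in> M" "norm (f k) \<le> 1" "f k \<in> H" for k using f(1)[of k] MH by (auto simp: U_def)
  define S where "S = {x \<in> D. graph_norm A x \<le> 1}"
  \<comment> \<open>\<open>norm (G f) \<le> 1\<close> and \<open>norm (A (G f)) \<le> 2\<close>, hence the factor.\<close>
  have "(1/3) *\<^sub>R G (f k) \<in> S" for k
  proof -
    have 1: "norm (G (f k)) \<le> 1" using norm_G_le[OF fM(3)] fM(2) order_trans by blast
    have "A (G (f k)) = f k - G (f k)" using G(2)[OF fM(3)[of k]] by (simp add: algebra_simps)
    then have 2: "norm (A (G (f k))) \<le> 2" using norm_triangle_ineq4[of "f k" "G (f k)"] 1 fM(2)[of k] by simp
    have "(norm ((1/3) *\<^sub>R G (f k)))\<^sup>2 + (norm ((1/3) *\<^sub>R A (G (f k))))\<^sup>2 \<le> (1/3)\<^sup>2 + (2/3)\<^sup>2"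
      using 1 2 by (intro add_mono power_mono) auto
    also have "\<dots> \<le> 1" by (simp add: power2_eq_square)
    finally have "graph_norm A ((1/3) *\<^sub>R G (f k)) \<le> 1"
      unfolding graph_norm_def A_scale[OF G(1)[OF fM(3)]] by (simp add: real_le_lsqrt)
    then show ?thesis using G(1)[OF fM(3)] subspace_scale[OF subspace_D] by (auto simp: S_def)
  qed
  then have "\<forall>k. (1/3) *\<^sub>R G (f k) \<in> closure S" using closure_subset by blast
  moreover have "seq_compact (closure S)"
    using compact_domain by (simp add: compactly_embedded_domain_def S_def compact_imp_seq_compact)
  ultimately obtain z0 r where r: "strict_mono (r :: nat \<Rightarrow> nat)" "((\<lambda>k. (1/3) *\<^sub>R G (f k)) \<circ> r) \<longlonglongrightarrow> z0"
    unfolding seq_compact_def by metis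
  define z where "z = 3 *\<^sub>R z0"
  have Gz: "(\<lambda>k. G (f (r k))) \<longlonglongrightarrow> z"
    using tendsto_scaleR[OF tendsto_const r(2), of 3] by (simp add: z_def o_def)
  have "(\<lambda>k. norm (G (f k) - s *\<^sub>R f k)) \<longlonglongrightarrow> 0"
  proof (rule tendsto_sandwich[of "\<lambda>_. 0"])
    show "(\<lambda>k. sqrt (2 * s * inverse (real (Suc k)))) \<longlonglongrightarrow> 0"
      using tendsto_real_sqrt[OF tendsto_mult_left[OF LIMSEQ_inverse_real_of_nat, of "2 * s"]] by simp
    show "\<forall>\<^sub>F k in sequentially. norm (G (f k) - s *\<^sub>R f k) \<le> sqrt (2 * s * inverse (real (Suc k)))"
    proof (intro always_eventually allI)
      fix k
      have "(norm (G (f k) - s *\<^sub>R f k))\<^sup>2 = (norm (G (f k)))\<^sup>2 - 2 * s * q (f k) + s\<^sup>2 * (norm (f k))\<^sup>2"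
        unfolding power2_norm_eq_inner
        by (simp add: inner_diff_left inner_diff_right q_def inner_commute power2_eq_square algebra_simps)
      also have "\<dots> \<le> s\<^sup>2 * 1 - 2 * s * (s - inverse (real (Suc k))) + s\<^sup>2 * 1"
      proof (intro add_mono diff_mono mult_left_mono)
        have "s * norm (f k) \<le> s * 1" using fM(2)[of k] s_pos by (intro mult_left_mono) auto
        then have "norm (G (f k)) \<le> s" using G_s[OF fM(1)[of k]] by linarith
        then show "(norm (G (f k)))\<^sup>2 \<le> s\<^sup>2 * 1" by (simp add: power_mono)
        show "(norm (f k))\<^sup>2 \<le> 1" using fM(2)[of k] by (simp add: power_le_one)
        show "s - inverse (real (Suc k)) \<le> q (f k)" using f(2)[of k] by simp
      qed (use s_pos in auto)
      also have "\<dots> = 2 * s * inverse (real (Suc k))" by (simp add: power2_eq_square algebra_simps)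
      finally show "norm (G (f k) - s *\<^sub>R f k) \<le> sqrt (2 * s * inverse (real (Suc k)))"
        by (rule real_le_rsqrt)
    qed
  qed auto
  then have "(\<lambda>k. norm (G (f (r k)) - s *\<^sub>R f (r k))) \<longlonglongrightarrow> 0"
    using LIMSEQ_subseq_LIMSEQ[OF _ r(1)] by (fastforce simp: o_def)
  then have "(\<lambda>k. G (f (r k)) - s *\<^sub>R f (r k)) \<longlonglongrightarrow> 0" by (rule tendsto_norm_zero_cancel)
  from tendsto_diff[OF Gz this] have "(\<lambda>k. s *\<^sub>R f (r k)) \<longlonglongrightarrow> z" by simp
  from tendsto_scaleR[OF tendsto_const this, of "1/s"]
  have fw: "(\<lambda>k. f (r k)) \<longlonglongrightarrow> (1/s) *\<^sub>R z" using s_pos by simp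
  define w where "w = (1/s) *\<^sub>R z"
  have wH: "w \<in> H" unfolding w_def by (rule closed_sequentially[OF closed_H _ fw]) (use fM in auto)
  have wM: "w \<in> M"
    unfolding M_def
  proof (intro CollectI conjI allI impI wH)
    fix x c assume "eigvec x c"
    then have "(\<lambda>k. inner (f (r k)) x) = (\<lambda>k. 0)" using fM(1) by (auto simp: M_def)
    moreover have "(\<lambda>k. inner (f (r k)) x) \<longlonglongrightarrow> inner w x" unfolding w_def by (intro tendsto_intros fw)
    ultimately show "inner w x = 0" using LIMSEQ_unique tendsto_const by metis
  qed
  have "(\<lambda>k. G (f (r k)) - G w) \<longlonglongrightarrow> 0"
  proof (rule Lim_null_comparison)
    show "\<forall>\<^sub>F k in sequentially. norm (G (f (r k)) - G w) \<le> norm (f (r k) - w)"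
      using norm_G_le[OF subspace_diff[OF subspace_H fM(3) wH]] G_diff[OF fM(3) wH] by simp
    show "(\<lambda>k. norm (f (r k) - w)) \<longlonglongrightarrow> 0"
      using tendsto_norm[OF tendsto_diff[OF fw tendsto_const[of w]]] by (simp add: w_def)
  qed
  then have "(\<lambda>k. G (f (r k))) \<longlonglongrightarrow> G w" by (rule LIM_zero_cancel)
  with Gz have zw: "z = G w" using LIMSEQ_unique by blast
  have "z \<in> D" "z + A z = (1/s) *\<^sub>R z" using G[OF wH] unfolding zw[symmetric] by (simp_all only: w_def)
  then have "eigvec z (1/s - 1)" by (auto simp: eigvec_def algebra_simps)
  moreover have "z \<in> M" using Mscale[OF wM, of s] s_pos by (simp add: w_def)
  ultimately have "inner z z = 0" by (auto simp: M_def)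
  then have z0: "z = 0" by simp
  have "s \<le> norm z"
  proof (rule LIMSEQ_le[OF _ tendsto_norm[OF Gz]])
    have "(\<lambda>k. s - inverse (real (Suc (r k)))) \<longlonglongrightarrow> s - 0"
      using LIMSEQ_subseq_LIMSEQ[OF LIMSEQ_inverse_real_of_nat r(1)] by (intro tendsto_diff tendsto_const) (simp add: o_def)
    then show "(\<lambda>k. s - inverse (real (Suc (r k)))) \<longlonglongrightarrow> s" by simp
    have "s - inverse (real (Suc (r k))) \<le> norm (G (f (r k)))" for k
    proof -
      have "q (f (r k)) \<le> norm (G (f (r k))) * norm (f (r k))" unfolding q_def by (rule norm_cauchy_schwarz)
      also have "\<dots> \<le> norm (G (f (r k)))" using fM(2)[of "r k"] by (simp add: mult_left_le)
      finally show ?thesis using f(2)[of "r k"] by simp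
    qed
    then show "\<exists>N. \<forall>n\<ge>N. s - inverse (real (Suc (r n))) \<le> norm (G (f (r n)))" by blast
  qed
  then show False using s_pos z0 by simp
qed

end

context form_operator
begin

text \<open>Up to a common factor the vectors lie in the graph-norm unit ball, whose closure is compact, while
  their mutual distances are \<open>sqrt 2\<close>.\<close>

lemma orthonormal_eigenvectors_finite:
  assumes ev: "\<And>b. b \<in> B \<Longrightarrow> \<exists>c\<le>R. eigvec b c" and nrm: "\<And>b. b \<in> B \<Longrightarrow> norm b = 1"
    and orth: "\<And>b b'. b \<in> B \<Longrightarrow> b' \<in> B \<Longrightarrow> b \<noteq> b' \<Longrightarrow> inner b b' = 0"
  shows "finite B"
proof (rule ccontr)
  assume "infinite B"
  then obtain f :: "nat \<Rightarrow> 'h" where f: "inj f" "range f \<subseteq> B"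
    using infinite_countable_subset by blast
  have fB: "f k \<in> B" for k using f by auto
  define \<rho> where "\<rho> = sqrt (1 + R\<^sup>2)"
  have \<rho>: "\<rho> > 0" "\<rho>\<^sup>2 = 1 + R\<^sup>2" by (auto simp: \<rho>_def add_pos_nonneg)
  define S where "S = {x \<in> D. graph_norm A x \<le> 1}"
  have "(1/\<rho>) *\<^sub>R f k \<in> S" for k
  proof -
    obtain c where c: "c \<le> R" "eigvec (f k) c" using ev[OF fB] by blast
    have n: "norm (f k) = 1" by (rule nrm[OF fB])
    have "f k \<noteq> 0" using n by (metis norm_zero zero_neq_one)
    then have "c \<ge> 0" by (rule eigvec_nonneg[OF c(2)])
    have "(norm ((1/\<rho>) *\<^sub>R f k))\<^sup>2 + (norm (A ((1/\<rho>) *\<^sub>R f k)))\<^sup>2 = (1 + c\<^sup>2) / \<rho>\<^sup>2"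
      using c(2) n \<rho>(1) A_scale[of "f k" "1/\<rho>"] by (simp add: eigvec_def power_divide add_divide_distrib)
    also have "\<dots> \<le> 1" using \<rho> \<open>c \<ge> 0\<close> c(1) by (simp add: power_mono add_pos_nonneg)
    finally have "graph_norm A ((1/\<rho>) *\<^sub>R f k) \<le> 1" unfolding graph_norm_def by (simp add: real_le_lsqrt)
    then show ?thesis using c(2) subspace_scale[OF subspace_D] by (auto simp: S_def eigvec_def)
  qed
  then have "\<forall>k. (1/\<rho>) *\<^sub>R f k \<in> closure S" using closure_subset by blast
  moreover have "seq_compact (closure S)"
    using compact_domain by (simp add: compactly_embedded_domain_def S_def compact_imp_seq_compact)
  ultimately obtain z r where r: "strict_mono (r :: nat \<Rightarrow> nat)" "((\<lambda>k. (1/\<rho>) *\<^sub>R f k) \<circ> r) \<longlonglongrightarrow> z"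
    unfolding seq_compact_def by metis
  have "Cauchy ((\<lambda>k. (1/\<rho>) *\<^sub>R f k) \<circ> r)" using r(2) LIMSEQ_imp_Cauchy by blast
  then obtain N where N: "\<And>m n. m \<ge> N \<Longrightarrow> n \<ge> N \<Longrightarrow> norm ((1/\<rho>) *\<^sub>R f (r m) - (1/\<rho>) *\<^sub>R f (r n)) < 1/\<rho>"
    using CauchyD[of _ "1/\<rho>"] \<rho>(1) by fastforce
  have ne: "f (r N) \<noteq> f (r (Suc N))"
    using f(1) r(1) by (auto simp: inj_eq strict_mono_eq)
  have "(1/\<rho>) *\<^sub>R f (r N) - (1/\<rho>) *\<^sub>R f (r (Suc N)) = (1/\<rho>) *\<^sub>R (f (r N) - f (r (Suc N)))"
    by (simp add: scaleR_diff_right)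
  then have "norm (f (r N) - f (r (Suc N))) < 1"
    using N[of N "Suc N"] \<rho>(1) by (simp add: divide_less_cancel)
  then have "(norm (f (r N) - f (r (Suc N))))\<^sup>2 < 1" by (simp add: power_less_one_iff abs_square_less_1)
  moreover have "(norm (f (r N) - f (r (Suc N))))\<^sup>2 = (norm (f (r N)))\<^sup>2 + (norm (f (r (Suc N))))\<^sup>2"
    using orth[OF fB fB ne] by (simp add: power2_norm_eq_inner inner_diff_left inner_diff_right inner_commute)
  ultimately show False using nrm[OF fB] by simp
qed

lemma eigvec_scale: "eigvec x c \<Longrightarrow> eigvec (k *\<^sub>R x) c"
  using A_scale[of x] subspace_scale[OF subspace_D] by (auto simp: eigvec_def)

lemma eigvec_add: "eigvec x c \<Longrightarrow> eigvec y c \<Longrightarrow> eigvec (x + y) c"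
  using A_add[of x y] subspace_add[OF subspace_D] by (auto simp: eigvec_def scaleR_add_right)

lemma eigvec_zero: "eigvec 0 c"
  using subspace_0[OF subspace_D] A_scale[of 0 0] by (simp add: eigvec_def)

lemma eigvec_sum: "(\<And>b. b \<in> S \<Longrightarrow> eigvec (f b) c) \<Longrightarrow> eigvec (\<Sum>b\<in>S. k b *\<^sub>R f b) c"
  by (induction S rule: infinite_finite_induct) (auto intro!: eigvec_add eigvec_scale eigvec_zero)

text \<open>Take a maximal orthonormal set of eigenvectors. By maximality it spans every eigenspace, hence it is
  complete and meets every eigenvalue, so it is infinite; it is countable because only finitely many of its
  elements belong to eigenvalues below a given bound.\<close>

lemma eigenbasis_exists:
  assumes inf: "infinite {c. eigenvalue D A c}"
  obtains e :: "nat \<Rightarrow> 'h" and lam :: "nat \<Rightarrow> real" where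
    "\<And>n. eigvec (e n) (lam n)"
    "\<And>m n. inner (e m) (e n) = (if m = n then 1 else 0)"
    "\<And>h. h \<in> H \<Longrightarrow> (\<And>n. inner h (e n) = 0) \<Longrightarrow> h = 0"
    "\<And>R. finite {n. lam n \<le> R}"
proof -
  define \<O> where "\<O> = {B. (\<forall>b\<in>B. (\<exists>c. eigvec b c) \<and> norm b = 1) \<and> (\<forall>b\<in>B. \<forall>b'\<in>B. b \<noteq> b' \<longrightarrow> inner b b' = 0)}"
  have "\<exists>M\<in>\<O>. \<forall>X\<in>\<O>. M \<subseteq> X \<longrightarrow> X = M"
  proof (rule subset_Zorn')
    fix C assume C: "subset.chain \<O> C"
    then have CO: "C \<subseteq> \<O>" and tot: "\<And>X Y. X \<in> C \<Longrightarrow> Y \<in> C \<Longrightarrow> X \<subseteq> Y \<or> Y \<subseteq> X"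
      by (auto simp: subset_chain_def)
    have "inner b b' = 0" if "b \<in> X" "X \<in> C" "b' \<in> Y" "Y \<in> C" "b \<noteq> b'" for b b' X Y
    proof -
      have "\<exists>Z\<in>C. b \<in> Z \<and> b' \<in> Z" using tot[of X Y] that by blast
      then show ?thesis using CO that(5) by (auto simp: \<O>_def)
    qed
    then show "\<Union>C \<in> \<O>" using CO by (fastforce simp: \<O>_def)
  qed
  then obtain B where B: "B \<in> \<O>" and max: "\<And>X. X \<in> \<O> \<Longrightarrow> B \<subseteq> X \<Longrightarrow> X = B" by blast
  have Bev: "\<exists>c. eigvec b c" and Bn: "norm b = 1" if "b \<in> B" for b using B that by (auto simp: \<O>_def)
  have Bo: "inner b b' = 0" if "b \<in> B" "b' \<in> B" "b \<noteq> b'" for b b' using B that by (auto simp: \<O>_def)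
  have max0: "x = 0" if x: "eigvec x c" and perp: "\<And>b. b \<in> B \<Longrightarrow> inner x b = 0" for x c
  proof (rule ccontr)
    assume x0: "x \<noteq> 0"
    define x1 where "x1 = (1 / norm x) *\<^sub>R x"
    have "eigvec x1 c" using x A_scale[of x] subspace_scale[OF subspace_D] by (auto simp: eigvec_def x1_def)
    moreover have "norm x1 = 1" using x0 by (simp add: x1_def)
    moreover have "inner x1 b = 0" if "b \<in> B" for b using perp[OF that] by (simp add: x1_def)
    ultimately have "insert x1 B \<in> \<O>" using B by (auto simp: \<O>_def inner_commute)
    then have "x1 \<in> B" using max[of "insert x1 B"] by blast
    then have "inner x x1 = 0" by (rule perp)
    then show False using x0 by (simp add: x1_def)
  qed
  have fin: "finite {b \<in> B. \<exists>c\<le>R. eigvec b c}" for R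
    by (rule orthonormal_eigenvectors_finite) (use Bn Bo in auto)
  have span: "\<exists>T. finite T \<and> T \<subseteq> {b \<in> B. eigvec b c} \<and> x = (\<Sum>b\<in>T. inner x b *\<^sub>R b)" if x: "eigvec x c" for x c
  proof -
    define T where "T = {b \<in> B. eigvec b c}"
    have T: "finite T" by (rule finite_subset[OF _ fin[of c]]) (auto simp: T_def)
    define p where "p = (\<Sum>b\<in>T. inner x b *\<^sub>R b)"
    have "eigvec p c" unfolding p_def by (rule eigvec_sum) (auto simp: T_def)
    then have xp: "eigvec (x - p) c"
      using eigvec_add[OF x eigvec_scale[of p c "-1"]] by simp
    have "x - p = 0"
    proof (rule max0[OF xp])
      fix b assume b: "b \<in> B"
      show "inner (x - p) b = 0"
      proof (cases "b \<in> T")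
        case True
        have "inner p b = (\<Sum>b'\<in>T. inner x b' * inner b' b)" by (simp add: p_def inner_sum_left)
        also have "\<dots> = (\<Sum>b'\<in>T. if b' = b then inner x b else 0)"
          using Bo Bn b by (intro sum.cong) (auto simp: T_def power2_norm_eq_inner[symmetric])
        also have "\<dots> = inner x b" using T True by simp
        finally show ?thesis by (simp add: inner_diff_left)
      next
        case False
        then obtain d where "eigvec b d" "d \<noteq> c" using Bev[OF b] b by (auto simp: T_def)
        then show ?thesis using eigvec_orthogonal[OF xp, of b d] by simp
      qed
    qed
    then show ?thesis using T by (auto simp: p_def T_def)
  qed
  have complete: "h = 0" if h: "h \<in> H" "\<And>b. b \<in> B \<Longrightarrow> inner h b = 0" for h
  proof (rule eigenvectors_complete[OF h(1)])
    fix x c assume "eigvec x c"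
    then obtain T where "T \<subseteq> {b \<in> B. eigvec b c}" "x = (\<Sum>b\<in>T. inner x b *\<^sub>R b)" using span by blast
    then have "inner h x = (\<Sum>b\<in>T. inner x b * inner h b)" by (metis (no_types, lifting) inner_scaleR_right inner_sum_right sum.cong)
    also have "\<dots> = 0" using h(2) \<open>T \<subseteq> _\<close> by (intro sum.neutral) auto
    finally show "inner h x = 0" .
  qed
  define \<kappa> where "\<kappa> b = (SOME c. eigvec b c)" for b
  have \<kappa>: "eigvec b (\<kappa> b)" if "b \<in> B" for b unfolding \<kappa>_def using Bev[OF that] by (rule someI_ex)
  have \<kappa>_eq: "\<kappa> b = c" if "b \<in> B" "eigvec b c" for b c
  proof -
    have "\<kappa> b *\<^sub>R b = c *\<^sub>R b" using \<kappa>[OF that(1)] that(2) by (simp add: eigvec_def)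
    moreover have "b \<noteq> 0" using Bn[OF that(1)] by auto
    ultimately show ?thesis by simp
  qed
  have "{c. eigenvalue D A c} \<subseteq> \<kappa> ` B"
  proof
    fix c assume "c \<in> {c. eigenvalue D A c}"
    then obtain x where x: "x \<noteq> 0" "eigvec x c" by (auto simp: eigenvalue_def eigvec_def)
    then obtain T where T: "T \<subseteq> {b \<in> B. eigvec b c}" "x = (\<Sum>b\<in>T. inner x b *\<^sub>R b)" using span by blast
    have "T \<noteq> {}" using T(2) x(1) by (metis sum.empty)
    then obtain b where "b \<in> T" by blast
    then show "c \<in> \<kappa> ` B" using T(1) \<kappa>_eq by (auto intro!: image_eqI[of _ _ b])
  qed
  then have Binf: "infinite B" using inf finite_subset by blast
  have "B = (\<Union>n::nat. {b \<in> B. \<exists>c\<le>real n. eigvec b c})"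
    using Bev real_arch_simple by fast
  moreover have "countable (\<Union>n::nat. {b \<in> B. \<exists>c\<le>real n. eigvec b c})"
    by (rule countable_UN[OF countableI_type], rule countable_finite, rule fin)
  ultimately have "countable B" by metis
  then have bij: "bij_betw (from_nat_into B) UNIV B" using Binf by (rule bij_betw_from_nat_into)
  define e where "e = from_nat_into B"
  have einj: "inj e" and esurj: "B = range e"
    using bij by (auto simp: e_def bij_betw_def)
  have eB: "e n \<in> B" for n using esurj by blast
  show ?thesis
  proof
    show "eigvec (e n) (\<kappa> (e n))" for n by (rule \<kappa>[OF eB])
    show "inner (e m) (e n) = (if m = n then 1 else 0)" for m n
      using Bn[OF eB[of n]] Bo[OF eB[of m] eB[of n]] inj_eq[OF einj, of m n]
      by (auto simp: norm_eq_sqrt_inner)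
    show "h = 0" if "h \<in> H" "\<And>n. inner h (e n) = 0" for h
      using complete[of h] that esurj by auto
    have "{n. \<kappa> (e n) \<le> R} \<subseteq> e -` {b \<in> B. \<exists>c\<le>R. eigvec b c}" for R using \<kappa> eB by auto
    then show "finite {n. \<kappa> (e n) \<le> R}" for R
      using finite_vimageI[OF fin einj] finite_subset by blast
  qed
qed

end

section \<open>Eigenfunction series in the form domain and in its dual\<close>

locale eigenbasis = form_operator +
  fixes e :: "nat \<Rightarrow> 'a" and lam :: "nat \<Rightarrow> real" and l0 :: real
  assumes eig: "eigvec (e n) (lam n)"
    and orth: "inner (e m) (e n) = (if m = n then 1 else 0)"
    and complete: "h \<in> H \<Longrightarrow> (\<And>n. inner h (e n) = 0) \<Longrightarrow> h = 0"
    and finite_lam: "finite {n. lam n \<le> R}"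
    and l0: "0 < l0" "l0 \<le> lam n"
begin

abbreviation wt :: "nat \<Rightarrow> real" where "wt n \<equiv> 1 + lam n"

lemma lam_pos: "0 < lam n" and wt_ge1: "1 \<le> wt n" and wt_pos: "0 < wt n"
  using l0(1) l0(2)[of n] by auto

lemma e_D: "e n \<in> D" and e_V: "e n \<in> V" and e_H: "e n \<in> H"
  using eig[of n] D_sub_V D_sub_H by (auto simp: eigvec_def)

lemma norm_e: "norm (e n) = 1" by (simp add: norm_eq_sqrt_inner orth)

lemma E_e: "x \<in> V \<Longrightarrow> E (e n) x = lam n * inner (e n) x"
  using E_A[OF e_D[of n], of x] eig[of n] by (simp add: eigvec_def)

lemma F_e: "x \<in> V \<Longrightarrow> F (e n) x = wt n * inner (e n) x"
  by (simp add: F_def E_e algebra_simps)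

lemma F_diff2: "\<lbrakk>x \<in> V; y \<in> V; z \<in> V\<rbrakk> \<Longrightarrow> F z (x - y) = F z x - F z y"
  using F_add2[of "x - y" y z] by (simp add: subspace_diff[OF subspace_V])

definition comb :: "(nat \<Rightarrow> real) \<Rightarrow> nat set \<Rightarrow> 'a" where "comb c K = (\<Sum>n\<in>K. c n *\<^sub>R e n)"

lemma comb_V: "comb c K \<in> V" and comb_H: "comb c K \<in> H"
  unfolding comb_def
  by (auto intro!: subspace_sum[OF subspace_V] subspace_scale[OF subspace_V] e_V
      subspace_sum[OF subspace_H] subspace_scale[OF subspace_H] e_H)

lemma inner_comb: "inner (comb c K) x = (\<Sum>n\<in>K. c n * inner (e n) x)"
  by (simp add: comb_def inner_sum_left)

lemma inner_comb_e: "finite K \<Longrightarrow> inner (comb c K) (e n) = (if n \<in> K then c n else 0)"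
  by (simp add: inner_comb orth if_distrib cong: if_cong)

lemma F_comb: "finite K \<Longrightarrow> x \<in> V \<Longrightarrow> F (comb c K) x = (\<Sum>n\<in>K. c n * (wt n * inner (e n) x))"
proof (induction K rule: finite_induct)
  case empty
  then show ?case using F_scale[of 0 x 0] by (simp add: comb_def subspace_0[OF subspace_V])
next
  case (insert n K)
  then have "comb c (insert n K) = c n *\<^sub>R e n + comb c K" by (simp add: comb_def)
  then show ?case using insert comb_V
    by (simp add: F_add F_scale F_e e_V subspace_scale[OF subspace_V])
qed

lemma F_comb_self: "finite K \<Longrightarrow> F (comb c K) (comb c K) = (\<Sum>n\<in>K. wt n * (c n)\<^sup>2)"
  by (simp add: F_comb comb_V inner_commute[of "e _"] inner_comb_e power2_eq_square mult_ac)

lemma inner_comb_self: "finite K \<Longrightarrow> inner (comb c K) (comb c K) = (\<Sum>n\<in>K. (c n)\<^sup>2)"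
  by (subst inner_comb) (simp add: inner_commute[of "e _"] inner_comb_e power2_eq_square)

lemma comb_diff: "M \<subseteq> N \<Longrightarrow> finite N \<Longrightarrow> comb c N - comb c M = comb c (N - M)"
  unfolding comb_def by (rule sum_diff[symmetric])

text \<open>The coefficient sequences of the elements of the form domain.\<close>

definition vsum :: "(nat \<Rightarrow> real) \<Rightarrow> bool" where "vsum c \<longleftrightarrow> summable (\<lambda>n. wt n * (c n)\<^sup>2)"

text \<open>The vector with prescribed Fourier coefficients.\<close>

definition S :: "(nat \<Rightarrow> real) \<Rightarrow> 'a" where "S c = (\<Sum>n. c n *\<^sub>R e n)"

text \<open>The partial sums are Cauchy in the form norm, and the form is closed.\<close>

lemma V_series:
  assumes "vsum c"
  shows V_series_sums: "(\<lambda>n. c n *\<^sub>R e n) sums S c" and V_series_V: "S c \<in> V"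
    and V_series_conv: "(\<lambda>N. form_norm E (comb c {..<N} - S c)) \<longlonglongrightarrow> 0"
proof -
  have Cau: "\<forall>d>0. \<exists>k. \<forall>m\<ge>k. \<forall>n\<ge>k. form_norm E (comb c {..<m} - comb c {..<n}) < d"
  proof (intro allI impI)
    fix d :: real assume d: "d > 0"
    have "Cauchy (\<lambda>N. \<Sum>n<N. wt n * (c n)\<^sup>2)"
      using assms unfolding vsum_def by (simp add: summable_iff_convergent convergent_Cauchy)
    from CauchyD[OF this, of "d\<^sup>2"] d
    obtain k where k: "\<And>m n. m \<ge> k \<Longrightarrow> n \<ge> k \<Longrightarrow> norm ((\<Sum>n<m. wt n * (c n)\<^sup>2) - (\<Sum>n<n. wt n * (c n)\<^sup>2)) < d\<^sup>2"
      by auto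
    have le: "form_norm E (comb c {..<m} - comb c {..<n}) < d" if "m \<ge> n" "n \<ge> k" for m n
    proof -
      have "F (comb c {..<m} - comb c {..<n}) (comb c {..<m} - comb c {..<n}) = (\<Sum>n\<in>{..<m} - {..<n}. wt n * (c n)\<^sup>2)"
        using that by (subst (1 2) comb_diff) (auto simp: F_comb_self)
      also have "\<dots> = (\<Sum>n<m. wt n * (c n)\<^sup>2) - (\<Sum>n<n. wt n * (c n)\<^sup>2)"
        using that by (intro sum_diff) auto
      also have "\<dots> < d\<^sup>2" using k[of m n] that by auto
      finally show ?thesis unfolding form_norm_F using d by (metis less_imp_le real_sqrt_less_iff real_sqrt_unique)
    qed
    have "form_norm E (comb c {..<m} - comb c {..<n}) < d" if "m \<ge> k" "n \<ge> k" for m n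
    proof (cases "m \<ge> n")
      case False
      have "F (comb c {..<m} - comb c {..<n}) (comb c {..<m} - comb c {..<n}) = F (comb c {..<n} - comb c {..<m}) (comb c {..<n} - comb c {..<m})"
        using F_scale[of "comb c {..<n} - comb c {..<m}" "comb c {..<m} - comb c {..<n}" "-1"]
          F_scale2[of "comb c {..<n} - comb c {..<m}" "comb c {..<n} - comb c {..<m}" "-1"]
        by (simp add: subspace_diff[OF subspace_V] comb_V)
      then show ?thesis using le[OF _ that(1), of n] False by (simp add: form_norm_F)
    qed (use le that in auto)
    then show "\<exists>k. \<forall>m\<ge>k. \<forall>n\<ge>k. form_norm E (comb c {..<m} - comb c {..<n}) < d" by blast
  qed
  then obtain y where y: "y \<in> V" "(\<lambda>N. form_norm E (comb c {..<N} - y)) \<longlonglongrightarrow> 0"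
    using closed[unfolded closed_form_def, rule_format, of "\<lambda>N. comb c {..<N}"] comb_V by blast
  have "(\<lambda>N. comb c {..<N} - y) \<longlonglongrightarrow> 0"
    by (rule Lim_null_comparison[OF _ y(2)])
      (intro always_eventually allI norm_le_form_norm subspace_diff[OF subspace_V] comb_V y(1))
  then have "(\<lambda>N. comb c {..<N}) \<longlonglongrightarrow> y" by (rule LIM_zero_cancel)
  then have s: "(\<lambda>n. c n *\<^sub>R e n) sums y" by (simp add: sums_def comb_def)
  then have "y = S c" by (simp add: S_def sums_iff)
  with s y show "(\<lambda>n. c n *\<^sub>R e n) sums S c" "S c \<in> V" "(\<lambda>N. form_norm E (comb c {..<N} - S c)) \<longlonglongrightarrow> 0" by auto
qed

lemma sums_inner_e:
  assumes "(\<lambda>n. c n *\<^sub>R e n) sums y"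
  shows "inner y (e n) = c n"
proof -
  have "(\<lambda>m. inner (c m *\<^sub>R e m) (e n)) sums inner y (e n)"
    by (rule bounded_linear.sums[OF bounded_linear_inner_left assms])
  moreover have "(\<lambda>m. inner (c m *\<^sub>R e m) (e n)) sums c n"
    using sums_single[of n c] by (simp add: orth if_distrib eq_commute cong: if_cong)
  ultimately show ?thesis using sums_unique2 by blast
qed

lemma S_coeff: "vsum c \<Longrightarrow> inner (S c) (e n) = c n"
  using sums_inner_e[OF V_series_sums] .

lemma sums_norm:
  assumes "(\<lambda>n. c n *\<^sub>R e n) sums y"
  shows "(\<lambda>n. (c n)\<^sup>2) sums (norm y)\<^sup>2"
proof -
  have "(\<lambda>n. inner (c n *\<^sub>R e n) y) sums inner y y"
    by (rule bounded_linear.sums[OF bounded_linear_inner_left assms])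
  moreover have "inner (c n *\<^sub>R e n) y = (c n)\<^sup>2" for n
    using sums_inner_e[OF assms, of n] by (simp add: inner_commute[of "e n"] power2_eq_square)
  ultimately show ?thesis by (simp only: power2_norm_eq_inner)
qed

lemma F_S:
  assumes c: "vsum c" and x: "x \<in> V"
  shows "(\<lambda>n. c n * (wt n * inner (e n) x)) sums F (S c) x"
proof -
  have "(\<lambda>N. F (comb c {..<N}) x - F (S c) x) \<longlonglongrightarrow> 0"
  proof (rule Lim_null_comparison)
    show "\<forall>\<^sub>F N in sequentially. norm (F (comb c {..<N}) x - F (S c) x) \<le> form_norm E (comb c {..<N} - S c) * form_norm E x"
      using abs_F_le[OF subspace_diff[OF subspace_V comb_V V_series_V[OF c]] x]
      by (simp add: F_diff[OF comb_V V_series_V[OF c] x])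
    show "(\<lambda>N. form_norm E (comb c {..<N} - S c) * form_norm E x) \<longlonglongrightarrow> 0"
      using tendsto_mult_right[OF V_series_conv[OF c], of "form_norm E x"] by simp
  qed
  then have "(\<lambda>N. F (comb c {..<N}) x) \<longlonglongrightarrow> F (S c) x" by (rule LIM_zero_cancel)
  then show ?thesis by (simp add: sums_def F_comb[OF _ x])
qed

lemma form_norm_S:
  assumes "vsum c"
  shows "(form_norm E (S c))\<^sup>2 = (\<Sum>n. wt n * (c n)\<^sup>2)"
proof -
  have "(\<lambda>n. c n * (wt n * inner (e n) (S c))) sums F (S c) (S c)"
    by (rule F_S[OF assms V_series_V[OF assms]])
  then have "(\<lambda>n. wt n * (c n)\<^sup>2) sums F (S c) (S c)"
    by (simp add: inner_commute[of "e _"] S_coeff[OF assms] power2_eq_square mult_ac)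
  then show ?thesis using F_nonneg[OF V_series_V[OF assms]] by (simp add: form_norm_F sums_iff)
qed

lemma bessel: assumes "finite K" shows "(\<Sum>n\<in>K. (inner h (e n))\<^sup>2) \<le> (norm h)\<^sup>2"
proof -
  define c where "c n = inner h (e n)" for n
  have ch: "inner (comb c K) h = (\<Sum>n\<in>K. (c n)\<^sup>2)"
    unfolding inner_comb power2_eq_square by (simp only: c_def inner_commute)
  have "0 \<le> inner (h - comb c K) (h - comb c K)" by simp
  also have "\<dots> = (norm h)\<^sup>2 - (\<Sum>n\<in>K. (c n)\<^sup>2)"
    using ch inner_comb_self[OF assms, of c] inner_commute[of h "comb c K"]
    by (simp add: inner_diff_left inner_diff_right power2_norm_eq_inner)
  finally show ?thesis by (simp add: c_def)
qed

lemma norm_comb_le: "finite K \<Longrightarrow> norm (comb (\<lambda>n. inner h (e n)) K) \<le> norm h"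
  by (rule power2_le_imp_le) (simp_all add: power2_norm_eq_inner[of "comb _ _"] inner_comb_self bessel)

lemma bessel_F: assumes "finite K" "x \<in> V" shows "(\<Sum>n\<in>K. wt n * (inner x (e n))\<^sup>2) \<le> F x x"
proof -
  define c where "c n = inner x (e n)" for n
  have xc: "F (comb c K) x = (\<Sum>n\<in>K. wt n * (c n)\<^sup>2)"
    using assms by (simp add: F_comb c_def inner_commute power2_eq_square mult_ac)
  have d: "x - comb c K \<in> V" using assms comb_V subspace_diff[OF subspace_V] by blast
  have "0 \<le> F (x - comb c K) (x - comb c K)" by (rule F_nonneg[OF d])
  also have "\<dots> = F x x - F (comb c K) x"
    using xc F_comb_self[OF assms(1), of c] F_sym[OF assms(2) comb_V, of c K]
    by (simp only: F_diff[OF assms(2) comb_V d] F_diff2[OF assms(2) comb_V assms(2)] F_diff2[OF assms(2) comb_V comb_V])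
  finally show ?thesis using xc by (simp add: c_def)
qed

lemma vsum_coeff: assumes "x \<in> V" shows "vsum (\<lambda>n. inner x (e n))"
  unfolding vsum_def
  by (rule bounded_imp_summable[of _ "F x x"]) (use bessel_F[OF _ assms] wt_pos in \<open>auto simp: less_imp_le\<close>)

lemma S_coeff_V: assumes x: "x \<in> V" shows "S (\<lambda>n. inner x (e n)) = x"
proof -
  have "S (\<lambda>n. inner x (e n)) - x = 0"
  proof (rule complete)
    show "S (\<lambda>n. inner x (e n)) - x \<in> H"
      using V_sub_H V_series_V[OF vsum_coeff[OF x]] x subspace_diff[OF subspace_H] by blast
    show "inner (S (\<lambda>n. inner x (e n)) - x) (e n) = 0" for n
      by (simp add: inner_diff_left S_coeff[OF vsum_coeff[OF x]])
  qed
  then show ?thesis by simp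
qed

text \<open>Elements of \<open>H\<close> outside the form domain are reached by density of \<open>D\<close>: the projections onto
  the partial sums are contractions.\<close>

lemma expansion:
  assumes h: "h \<in> H"
  shows "(\<lambda>n. inner h (e n) *\<^sub>R e n) sums h"
proof -
  have "(\<lambda>N. comb (\<lambda>n. inner h (e n)) {..<N}) \<longlonglongrightarrow> h"
  proof (rule LIMSEQ_I)
    fix r :: real assume r: "r > 0"
    have "h \<in> closure D" using D_dense h by blast
    then obtain x where x: "x \<in> D" "norm (x - h) < r / 3"
      unfolding closure_approachable dist_norm using r by (metis zero_less_divide_iff zero_less_numeral)
    have "(\<lambda>n. inner x (e n) *\<^sub>R e n) sums x"
      using V_series_sums[OF vsum_coeff[OF D_sub_V[OF x(1)]]] S_coeff_V[OF D_sub_V[OF x(1)]] by simp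
    then have "(\<lambda>N. comb (\<lambda>n. inner x (e n)) {..<N}) \<longlonglongrightarrow> x" by (simp add: sums_def comb_def)
    then obtain N where N: "\<And>n. n \<ge> N \<Longrightarrow> norm (comb (\<lambda>n. inner x (e n)) {..<n} - x) < r / 3"
      using LIMSEQ_D[of _ x "r / 3"] r by auto
    have "norm (comb (\<lambda>n. inner h (e n)) {..<n} - h) < r" if "n \<ge> N" for n
    proof -
      have "comb (\<lambda>n. inner (h - x) (e n)) {..<n} = comb (\<lambda>n. inner h (e n)) {..<n} - comb (\<lambda>n. inner x (e n)) {..<n}"
        by (simp add: comb_def inner_diff_left scaleR_diff_left sum_subtractf)
      then have "norm (comb (\<lambda>n. inner h (e n)) {..<n} - comb (\<lambda>n. inner x (e n)) {..<n}) \<le> norm (h - x)"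
        using norm_comb_le[of "{..<n}" "h - x"] by simp
      moreover have "comb (\<lambda>n. inner h (e n)) {..<n} - h = (comb (\<lambda>n. inner h (e n)) {..<n} - comb (\<lambda>n. inner x (e n)) {..<n}) + (comb (\<lambda>n. inner x (e n)) {..<n} - x) + (x - h)"
        by simp
      ultimately show ?thesis
        using norm_triangle_ineq[of "(comb (\<lambda>n. inner h (e n)) {..<n} - comb (\<lambda>n. inner x (e n)) {..<n}) + (comb (\<lambda>n. inner x (e n)) {..<n} - x)" "x - h"]
          norm_triangle_ineq[of "comb (\<lambda>n. inner h (e n)) {..<n} - comb (\<lambda>n. inner x (e n)) {..<n}" "comb (\<lambda>n. inner x (e n)) {..<n} - x"]
          N[OF that] x(2) by (simp add: norm_minus_commute)
    qed
    then show "\<exists>no. \<forall>n\<ge>no. norm (comb (\<lambda>n. inner h (e n)) {..<n} - h) < r" by blast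
  qed
  then show ?thesis by (simp add: sums_def comb_def)
qed

lemma parseval: "h \<in> H \<Longrightarrow> (\<lambda>n. (inner h (e n))\<^sup>2) sums (norm h)\<^sup>2"
  by (rule sums_norm[OF expansion])

abbreviation Vd where "Vd \<equiv> dual_space V E"
abbreviation dn where "dn \<equiv> dual_norm V E"

lemma form_norm_nonneg: "x \<in> V \<Longrightarrow> 0 \<le> form_norm E x" by (simp add: form_norm_F F_nonneg)

lemma form_norm_scale: "x \<in> V \<Longrightarrow> form_norm E (c *\<^sub>R x) = \<bar>c\<bar> * form_norm E x"
  by (simp add: form_norm_F F_scale F_scale2 subspace_scale[OF subspace_V] real_sqrt_mult[symmetric] mult.assoc[symmetric])
    (simp add: real_sqrt_mult)

lemma form_norm_eq_0: "x \<in> V \<Longrightarrow> form_norm E x = 0 \<longleftrightarrow> x = 0"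
  using norm_le_form_norm[of x] form_norm_scale[of 0 0] subspace_0[OF subspace_V] by auto

lemma form_norm_zero: "form_norm E 0 = 0"
  using form_norm_eq_0 subspace_0[OF subspace_V] by blast

lemma dual_bound:
  assumes "f \<in> Vd" obtains C where "\<And>x. x \<in> V \<Longrightarrow> \<bar>f x\<bar> \<le> C * form_norm E x"
  using assms unfolding dual_space_def by blast

lemma dual_add: "f \<in> Vd \<Longrightarrow> x \<in> V \<Longrightarrow> y \<in> V \<Longrightarrow> f (x + y) = f x + f y"
  and dual_scale: "f \<in> Vd \<Longrightarrow> x \<in> V \<Longrightarrow> f (c *\<^sub>R x) = c * f x"
  and dual_out: "f \<in> Vd \<Longrightarrow> x \<notin> V \<Longrightarrow> f x = 0"
  by (auto simp: dual_space_def)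

lemma dual_comb: assumes f: "f \<in> Vd" shows "finite K \<Longrightarrow> f (comb c K) = (\<Sum>n\<in>K. c n * f (e n))"
proof (induction K rule: finite_induct)
  case empty
  then show ?case using dual_scale[OF f subspace_0[OF subspace_V], of 0] by (simp add: comb_def)
next
  case (insert n K)
  then have "comb c (insert n K) = c n *\<^sub>R e n + comb c K" by (simp add: comb_def)
  then show ?case using insert comb_V
    by (simp add: dual_add[OF f] dual_scale[OF f] e_V subspace_scale[OF subspace_V])
qed

lemma dual_bdd: assumes "f \<in> Vd" shows "bdd_above ((\<lambda>x. \<bar>f x\<bar>) ` {x \<in> V. form_norm E x \<le> 1})"
proof -
  obtain C where C: "\<And>x. x \<in> V \<Longrightarrow> \<bar>f x\<bar> \<le> C * form_norm E x"
    using dual_bound[OF assms] by blast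
  have "\<bar>f x\<bar> \<le> \<bar>C\<bar>" if "x \<in> V" "form_norm E x \<le> 1" for x
  proof -
    have "\<bar>f x\<bar> \<le> \<bar>C\<bar> * form_norm E x" using C[OF that(1)] form_norm_nonneg[OF that(1)]
      by (meson abs_ge_self mult_right_mono order_trans)
    also have "\<dots> \<le> \<bar>C\<bar> * 1" using that by (intro mult_left_mono) auto
    finally show ?thesis by simp
  qed
  then show ?thesis by (intro bdd_aboveI2) auto
qed

lemma dual_le: assumes f: "f \<in> Vd" and x: "x \<in> V" shows "\<bar>f x\<bar> \<le> dn f * form_norm E x"
proof (cases "x = 0")
  case True
  then show ?thesis using dual_scale[OF f x, of 0] form_norm_eq_0[OF x] by simp
next
  case False
  have p: "form_norm E x > 0" using form_norm_nonneg[OF x] form_norm_eq_0[OF x] False by simp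
  define y where "y = (1 / form_norm E x) *\<^sub>R x"
  have y: "y \<in> V" "form_norm E y \<le> 1"
    using x p by (auto simp: y_def form_norm_scale subspace_scale[OF subspace_V])
  have "\<bar>f y\<bar> \<le> dn f" unfolding dual_norm_def by (rule cSUP_upper[OF _ dual_bdd[OF f]]) (use y in auto)
  moreover have "\<bar>f y\<bar> = \<bar>f x\<bar> / form_norm E x" using p dual_scale[OF f x] by (simp add: y_def abs_mult)
  ultimately show ?thesis using p by (simp add: pos_divide_le_eq)
qed

lemma dual_norm_le:
  assumes "0 \<le> K" "\<And>x. x \<in> V \<Longrightarrow> \<bar>f x\<bar> \<le> K * form_norm E x"
  shows "dn f \<le> K"
  unfolding dual_norm_def
proof (rule cSUP_least)
  show "{x \<in> V. form_norm E x \<le> 1} \<noteq> {}"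
    using subspace_0[OF subspace_V] form_norm_zero by force
  fix x assume x: "x \<in> {x \<in> V. form_norm E x \<le> 1}"
  then have "\<bar>f x\<bar> \<le> K * form_norm E x" using assms(2) by blast
  also have "\<dots> \<le> K * 1" using x assms(1) by (intro mult_left_mono) auto
  finally show "\<bar>f x\<bar> \<le> K" by simp
qed

lemma dual_norm_nonneg: assumes "f \<in> Vd" shows "0 \<le> dn f"
proof -
  have "0 \<le> \<bar>f 0\<bar>" by simp
  also have "\<dots> \<le> dn f" unfolding dual_norm_def
    by (rule cSUP_upper[OF _ dual_bdd[OF assms]]) (use subspace_0[OF subspace_V] form_norm_zero in auto)
  finally show ?thesis .
qed

lemma subspace_dual: "subspace Vd"
proof (rule subspaceI)
  show "0 \<in> Vd" by (auto simp: dual_space_def zero_fun_def intro!: exI[of _ 0])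
  fix f g assume f: "f \<in> Vd" and g: "g \<in> Vd"
  obtain C C' where "\<And>x. x \<in> V \<Longrightarrow> \<bar>f x\<bar> \<le> C * form_norm E x" "\<And>x. x \<in> V \<Longrightarrow> \<bar>g x\<bar> \<le> C' * form_norm E x"
    using dual_bound[OF f] dual_bound[OF g] by metis
  then have "\<forall>x\<in>V. \<bar>f x + g x\<bar> \<le> (C + C') * form_norm E x"
    by (smt (verit) distrib_right)
  then have "\<exists>C. \<forall>x\<in>V. \<bar>f x + g x\<bar> \<le> C * form_norm E x" by blast
  then show "f + g \<in> Vd" using f g by (auto simp: dual_space_def distrib_left)
next
  fix c f assume f: "f \<in> Vd"
  obtain C where C: "\<And>x. x \<in> V \<Longrightarrow> \<bar>f x\<bar> \<le> C * form_norm E x"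
    using dual_bound[OF f] by blast
  have "\<forall>x\<in>V. \<bar>c * f x\<bar> \<le> (\<bar>c\<bar> * C) * form_norm E x"
    using C by (simp add: abs_mult mult.assoc mult_left_mono)
  then have "\<exists>C. \<forall>x\<in>V. \<bar>c * f x\<bar> \<le> C * form_norm E x" by blast
  then show "c *\<^sub>R f \<in> Vd" using f by (auto simp: dual_space_def distrib_left)
qed

text \<open>Finite eigenfunction combinations are dense in the form domain, so they suffice to compute the dual
  norm.\<close>

lemma dual_norm_le_comb:
  assumes f: "f \<in> Vd" and K: "0 \<le> K" "\<And>c N. \<bar>f (comb c {..<N})\<bar> \<le> K * form_norm E (comb c {..<N})"
  shows "dn f \<le> K"
proof (rule dual_norm_le[OF K(1)])
  fix x assume x: "x \<in> V"
  define c where "c = (\<lambda>n. inner x (e n))"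
  have c: "vsum c" "S c = x" using vsum_coeff[OF x] S_coeff_V[OF x] by (simp_all add: c_def)
  have "(\<lambda>N. f (comb c {..<N}) - f x) \<longlonglongrightarrow> 0"
  proof (rule Lim_null_comparison)
    show "\<forall>\<^sub>F N in sequentially. norm (f (comb c {..<N}) - f x) \<le> dn f * form_norm E (comb c {..<N} - x)"
    proof (intro always_eventually allI)
      fix N
      have "f (comb c {..<N} - x) = f (comb c {..<N}) - f x"
        using dual_add[OF f comb_V, of "(-1) *\<^sub>R x" c "{..<N}"] dual_scale[OF f x, of "-1"] x subspace_neg[OF subspace_V x] by simp
      then show "norm (f (comb c {..<N}) - f x) \<le> dn f * form_norm E (comb c {..<N} - x)"
        using dual_le[OF f subspace_diff[OF subspace_V comb_V x], of c "{..<N}"] by simp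
    qed
    show "(\<lambda>N. dn f * form_norm E (comb c {..<N} - x)) \<longlonglongrightarrow> 0"
      using tendsto_mult_left[OF V_series_conv[OF c(1)], of "dn f"] c(2) by simp
  qed
  then have lim: "(\<lambda>N. f (comb c {..<N})) \<longlonglongrightarrow> f x" by (rule LIM_zero_cancel)
  show "\<bar>f x\<bar> \<le> K * form_norm E x"
  proof (rule LIMSEQ_le_const2[OF tendsto_rabs[OF lim]], intro exI allI impI)
    fix N
    have "form_norm E (comb c {..<N}) \<le> form_norm E x"
      unfolding form_norm_F F_comb_self[OF finite_lessThan] using bessel_F[OF _ x, of "{..<N}"] by (simp add: c_def)
    then show "\<bar>f (comb c {..<N})\<bar> \<le> K * form_norm E x"
      using K(2)[of c N] K(1) by (meson mult_left_mono order_trans)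
  qed
qed

lemma dual_eq_0:
  assumes f: "f \<in> Vd" and "\<And>n. f (e n) = 0"
  shows "f = 0"
proof
  fix x
  have "dn f \<le> 0"
    by (rule dual_norm_le_comb[OF f]) (use assms in \<open>auto simp: dual_comb[OF f]\<close>)
  then have "dn f = 0" using dual_norm_nonneg[OF f] by simp
  then show "f x = 0 x" using dual_le[OF f, of x] dual_out[OF f, of x] by (cases "x \<in> V") auto
qed

lemma dual_norm_eq_0: "f \<in> Vd \<Longrightarrow> dn f = 0 \<Longrightarrow> f = 0"
  using dual_le[of f "e _"] by (intro dual_eq_0) (auto simp: e_V)

lemma dual_norm_triangle: "f \<in> Vd \<Longrightarrow> g \<in> Vd \<Longrightarrow> dn (f + g) \<le> dn f + dn g"
  using dual_le[of f] dual_le[of g]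
  by (intro dual_norm_le) (auto simp: dual_norm_nonneg distrib_right intro!: order_trans[OF abs_triangle_ineq] add_mono)

text \<open>The coefficient sequences of the elements of the dual space.\<close>

definition dsum :: "(nat \<Rightarrow> real) \<Rightarrow> bool" where "dsum c \<longleftrightarrow> summable (\<lambda>n. (c n)\<^sup>2 / wt n)"

text \<open>The functional with prescribed values on the eigenvectors.\<close>

definition DF :: "(nat \<Rightarrow> real) \<Rightarrow> 'a \<Rightarrow> real" where
  "DF c = (\<lambda>x. if x \<in> V then (\<Sum>n. c n * inner (e n) x) else 0)"

lemma DF_aux:
  assumes c: "dsum c" and x: "x \<in> V"
  shows "summable (\<lambda>n. \<bar>c n * inner (e n) x\<bar>)"
    and "\<bar>\<Sum>n. c n * inner (e n) x\<bar> \<le> sqrt (\<Sum>n. (c n)\<^sup>2 / wt n) * form_norm E x"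
proof -
  define K where "K = sqrt (\<Sum>n. (c n)\<^sup>2 / wt n) * form_norm E x"
  have part: "(\<Sum>n<N. \<bar>c n * inner (e n) x\<bar>) \<le> K" for N
  proof -
    have "(\<Sum>n<N. \<bar>c n * inner (e n) x\<bar>) = (\<Sum>n<N. (\<bar>c n\<bar> / sqrt (wt n)) * (sqrt (wt n) * \<bar>inner (e n) x\<bar>))"
      using wt_pos by (intro sum.cong) (auto simp: abs_mult less_imp_neq[symmetric])
    also have "\<dots> \<le> sqrt ((\<Sum>n<N. (\<bar>c n\<bar> / sqrt (wt n))\<^sup>2) * (\<Sum>n<N. (sqrt (wt n) * \<bar>inner (e n) x\<bar>)\<^sup>2))"
      by (rule real_le_rsqrt[OF Cauchy_Schwarz_ineq_sum])
    also have "\<dots> = sqrt ((\<Sum>n<N. (c n)\<^sup>2 / wt n) * (\<Sum>n<N. wt n * (inner x (e n))\<^sup>2))"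
      using wt_pos by (simp add: power_divide power_mult_distrib less_imp_le inner_commute)
    also have "\<dots> \<le> sqrt ((\<Sum>n. (c n)\<^sup>2 / wt n) * F x x)"
      using c wt_pos unfolding dsum_def
      by (intro real_sqrt_le_mono mult_mono bessel_F x sum_le_suminf sum_nonneg suminf_nonneg) (auto simp: less_imp_le)
    also have "\<dots> = K" by (simp add: K_def form_norm_F real_sqrt_mult)
    finally show ?thesis .
  qed
  show s: "summable (\<lambda>n. \<bar>c n * inner (e n) x\<bar>)"
    by (rule bounded_imp_summable[of _ K]) (use part[of "Suc _"] in \<open>auto simp only: lessThan_Suc_atMost abs_ge_zero\<close>)
  have "\<bar>\<Sum>n. c n * inner (e n) x\<bar> \<le> (\<Sum>n. \<bar>c n * inner (e n) x\<bar>)" by (rule summable_rabs[OF s])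
  also have "\<dots> \<le> K" using part by (intro suminf_le_const s)
  finally show "\<bar>\<Sum>n. c n * inner (e n) x\<bar> \<le> sqrt (\<Sum>n. (c n)\<^sup>2 / wt n) * form_norm E x" by (simp add: K_def)
qed

lemma DF_sums: "dsum c \<Longrightarrow> x \<in> V \<Longrightarrow> (\<lambda>n. c n * inner (e n) x) sums DF c x"
  using summable_rabs_cancel[OF DF_aux(1)] by (simp add: DF_def summable_sums)

lemma DF_dual: assumes c: "dsum c" shows "DF c \<in> Vd"
  unfolding dual_space_def
proof (intro CollectI conjI ballI allI impI exI)
  fix x assume x: "x \<in> V"
  show "\<bar>DF c x\<bar> \<le> sqrt (\<Sum>n. (c n)\<^sup>2 / wt n) * form_norm E x" using DF_aux(2)[OF c x] x by (simp add: DF_def)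
  fix y assume y: "y \<in> V"
  show "DF c (x + y) = DF c x + DF c y"
    using sums_unique2[OF DF_sums[OF c subspace_add[OF subspace_V x y]]] sums_add[OF DF_sums[OF c x] DF_sums[OF c y]]
    by (simp add: inner_right_distrib distrib_left)
next
  fix k x assume x: "x \<in> V"
  show "DF c (k *\<^sub>R x) = k * DF c x"
    using sums_unique2[OF DF_sums[OF c subspace_scale[OF subspace_V x, of k]]] sums_mult[OF DF_sums[OF c x], of k]
    by (simp add: mult_ac)
qed (auto simp: DF_def)

lemma DF_norm_le: "dsum c \<Longrightarrow> dn (DF c) \<le> sqrt (\<Sum>n. (c n)\<^sup>2 / wt n)"
  using DF_aux(2)[of c] wt_pos by (intro dual_norm_le real_sqrt_ge_zero suminf_nonneg) (auto simp: DF_def dsum_def less_imp_le)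

lemma DF_e: "dsum c \<Longrightarrow> DF c (e n) = c n"
  using sums_unique2[OF DF_sums[OF _ e_V, of c n], of "c n"] sums_single[of n c]
  by (simp add: orth if_distrib cong: if_cong)

lemma dual_eqI: "f \<in> Vd \<Longrightarrow> g \<in> Vd \<Longrightarrow> (\<And>n. f (e n) = g (e n)) \<Longrightarrow> f = g"
  using dual_eq_0[of "f - g"] subspace_diff[OF subspace_dual] by (auto simp: fun_eq_iff)

lemma pivot_dual: assumes h: "h \<in> H" shows "pivot V h \<in> Vd"
  unfolding dual_space_def
proof (intro CollectI conjI ballI allI impI exI)
  fix x assume x: "x \<in> V"
  have "\<bar>inner h x\<bar> \<le> norm h * norm x" by (rule Cauchy_Schwarz_ineq2)
  also have "\<dots> \<le> norm h * form_norm E x" using norm_le_form_norm[OF x] by (intro mult_left_mono) auto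
  finally show "\<bar>pivot V h x\<bar> \<le> norm h * form_norm E x" using x by (simp add: pivot_def)
qed (auto simp: pivot_def inner_right_distrib subspace_add[OF subspace_V] subspace_scale[OF subspace_V])

lemma pivot_e: "pivot V h (e n) = inner h (e n)" by (simp add: pivot_def e_V)

end

section \<open>Bochner integrals tested by norming functionals\<close>

lemma measurable_restrict_lborel:
  "u \<in> measurable borel N \<Longrightarrow> u \<in> measurable (restrict_space lborel S) N"
  by (intro measurable_restrict_space1) simp

text \<open>A bounded functional commutes with the Bochner integral. Measurability of the composition is
  a separate hypothesis because \<open>X\<close> carries no Borel sets.\<close>

lemma has_bochner_integral_in_functional:
  fixes \<phi> :: "'b::real_vector \<Rightarrow> real"
  assumes hb: "has_bochner_integral_in X nrm M f I" and lin: "linear \<phi>" and X: "subspace X"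
    and bound: "\<And>x. x \<in> X \<Longrightarrow> \<bar>\<phi> x\<bar> \<le> C * nrm x" and C: "0 \<le> C"
    and meas: "(\<lambda>x. \<phi> (f x)) \<in> borel_measurable M"
  shows "has_bochner_integral M (\<lambda>x. \<phi> (f x)) (\<phi> I)"
proof -
  interpret \<phi>: linear \<phi> by fact
  from hb obtain s where fX: "f ` space M \<subseteq> X" and IX: "I \<in> X"
    and s: "\<And>i. Bochner_Integration.simple_bochner_integrable M (s i)" "\<And>i. s i ` space M \<subseteq> X"
      "\<And>i. (\<lambda>x. nrm (f x - s i x)) \<in> borel_measurable M"
    and lim: "(\<lambda>i. \<integral>\<^sup>+x. ennreal (nrm (f x - s i x)) \<partial>M) \<longlonglongrightarrow> 0"
    and limI: "(\<lambda>i. nrm (Bochner_Integration.simple_bochner_integral M (s i) - I)) \<longlonglongrightarrow> 0"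
    unfolding has_bochner_integral_in_def by blast
  have sX: "Bochner_Integration.simple_bochner_integral M (s i) \<in> X" for i
    unfolding Bochner_Integration.simple_bochner_integral_def using s(2)[of i]
    by (intro subspace_sum[OF X] subspace_scale[OF X]) auto
  have int: "Bochner_Integration.simple_bochner_integral M (\<lambda>x. \<phi> (s i x)) = \<phi> (Bochner_Integration.simple_bochner_integral M (s i))" for i
    by (rule Bochner_Integration.simple_bochner_integral_linear[OF lin s(1)])
  show ?thesis
  proof (rule has_bochner_integral.intros[OF meas])
    show "Bochner_Integration.simple_bochner_integrable M (\<lambda>x. \<phi> (s i x))" for i
      using Bochner_Integration.simple_bochner_integrable_compose2[OF _ s(1)[of i] s(1)[of i], of "\<lambda>a b. \<phi> a"] by (simp add: \<phi>.zero)
    show "(\<lambda>i. \<integral>\<^sup>+x. ennreal (norm (\<phi> (f x) - \<phi> (s i x))) \<partial>M) \<longlonglongrightarrow> 0"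
    proof (rule tendsto_sandwich[of "\<lambda>_. 0"])
      show "\<forall>\<^sub>F i in sequentially. (\<integral>\<^sup>+x. ennreal (norm (\<phi> (f x) - \<phi> (s i x))) \<partial>M) \<le> ennreal C * (\<integral>\<^sup>+x. ennreal (nrm (f x - s i x)) \<partial>M)"
      proof (intro always_eventually allI)
        fix i
        have "(\<integral>\<^sup>+x. ennreal (norm (\<phi> (f x) - \<phi> (s i x))) \<partial>M) \<le> (\<integral>\<^sup>+x. ennreal C * ennreal (nrm (f x - s i x)) \<partial>M)"
        proof (intro nn_integral_mono)
          fix x assume "x \<in> space M"
          then have "f x - s i x \<in> X" using fX s(2)[of i] by (intro subspace_diff[OF X]) auto
          then have "\<bar>\<phi> (f x) - \<phi> (s i x)\<bar> \<le> C * nrm (f x - s i x)" using bound[of "f x - s i x"] by (simp add: \<phi>.diff)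
          then show "ennreal (norm (\<phi> (f x) - \<phi> (s i x))) \<le> ennreal C * ennreal (nrm (f x - s i x))"
            using C by (simp add: ennreal_mult'[symmetric] ennreal_leI)
        qed
        also have "\<dots> = ennreal C * (\<integral>\<^sup>+x. ennreal (nrm (f x - s i x)) \<partial>M)"
          using s(3)[of i] by (intro nn_integral_cmult) auto
        finally show "(\<integral>\<^sup>+x. ennreal (norm (\<phi> (f x) - \<phi> (s i x))) \<partial>M) \<le> ennreal C * (\<integral>\<^sup>+x. ennreal (nrm (f x - s i x)) \<partial>M)" .
      qed
      show "(\<lambda>i. ennreal C * (\<integral>\<^sup>+x. ennreal (nrm (f x - s i x)) \<partial>M)) \<longlonglongrightarrow> 0"
        using ennreal_tendsto_cmult[OF _ lim, of "ennreal C"] by simp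
    qed auto
    have "(\<lambda>i. \<phi> (Bochner_Integration.simple_bochner_integral M (s i)) - \<phi> I) \<longlonglongrightarrow> 0"
    proof (rule Lim_null_comparison)
      show "\<forall>\<^sub>F i in sequentially. norm (\<phi> (Bochner_Integration.simple_bochner_integral M (s i)) - \<phi> I) \<le> C * nrm (Bochner_Integration.simple_bochner_integral M (s i) - I)"
        using bound[OF subspace_diff[OF X sX IX]] by (simp add: \<phi>.diff)
      show "(\<lambda>i. C * nrm (Bochner_Integration.simple_bochner_integral M (s i) - I)) \<longlonglongrightarrow> 0"
        using tendsto_mult_left[OF limI, of C] by simp
    qed
    then show "(\<lambda>i. Bochner_Integration.simple_bochner_integral M (\<lambda>x. \<phi> (s i x))) \<longlonglongrightarrow> \<phi> I"
      unfolding int by (rule LIM_zero_cancel)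
  qed
qed

text \<open>A set \<open>L\<close> of linear functionals that computes the norm \<open>nrm\<close>. For \<open>H\<close> and for the dual of the form
  domain such functionals come from finite eigenfunction combinations; testing with them reduces
  vector-valued integrals to scalar ones without completeness of \<open>X\<close>.\<close>

locale norming =
  fixes X :: "'b::real_vector set" and nrm :: "'b \<Rightarrow> real" and L :: "('b \<Rightarrow> real) set"
  assumes X: "subspace X" and nonneg: "x \<in> X \<Longrightarrow> 0 \<le> nrm x"
    and triangle: "x \<in> X \<Longrightarrow> y \<in> X \<Longrightarrow> nrm (x + y) \<le> nrm x + nrm y"
    and scale: "x \<in> X \<Longrightarrow> nrm (c *\<^sub>R x) = \<bar>c\<bar> * nrm x"
    and L_linear: "\<phi> \<in> L \<Longrightarrow> linear \<phi>" and L_bound: "\<phi> \<in> L \<Longrightarrow> x \<in> X \<Longrightarrow> \<bar>\<phi> x\<bar> \<le> nrm x"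
    and norming: "x \<in> X \<Longrightarrow> 0 \<le> K \<Longrightarrow> (\<And>\<phi>. \<phi> \<in> L \<Longrightarrow> \<bar>\<phi> x\<bar> \<le> K) \<Longrightarrow> nrm x \<le> K"
begin

lemma nrm_zero: "nrm 0 = 0" using scale[of 0 0] subspace_0[OF X] by simp

lemma nrm_minus_commute: "x \<in> X \<Longrightarrow> y \<in> X \<Longrightarrow> nrm (x - y) = nrm (y - x)"
  using scale[of "y - x" "-1"] subspace_diff[OF X] by simp

lemma nrm_diff_le: "x \<in> X \<Longrightarrow> y \<in> X \<Longrightarrow> z \<in> X \<Longrightarrow> nrm (x - z) \<le> nrm (x - y) + nrm (y - z)"
  using triangle[of "x - y" "y - z"] subspace_diff[OF X] by simp

lemma continuous_nrm_diff:
  assumes f: "\<And>\<tau>. \<tau> \<in> S \<Longrightarrow> f \<tau> \<in> X" and c: "\<And>\<tau>. \<tau> \<in> S \<Longrightarrow> ((\<lambda>\<sigma>. nrm (f \<sigma> - f \<tau>)) \<longlongrightarrow> 0) (at \<tau> within S)" and y: "y \<in> X"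
  shows "continuous_on S (\<lambda>\<tau>. nrm (f \<tau> - y))"
  unfolding continuous_on_def
proof
  fix \<tau> assume \<tau>: "\<tau> \<in> S"
  have "((\<lambda>\<sigma>. nrm (f \<sigma> - y) - nrm (f \<tau> - y)) \<longlongrightarrow> 0) (at \<tau> within S)"
  proof (rule Lim_null_comparison[OF _ c[OF \<tau>]])
    show "\<forall>\<^sub>F \<sigma> in at \<tau> within S. norm (nrm (f \<sigma> - y) - nrm (f \<tau> - y)) \<le> nrm (f \<sigma> - f \<tau>)"
      unfolding eventually_at_filter
    proof (intro always_eventually allI impI)
      fix \<sigma> assume "\<sigma> \<in> S"
      then show "norm (nrm (f \<sigma> - y) - nrm (f \<tau> - y)) \<le> nrm (f \<sigma> - f \<tau>)"
        using nrm_diff_le[OF f[of \<sigma>] f[OF \<tau>] y] nrm_diff_le[OF f[OF \<tau>] f[of \<sigma>] y] nrm_minus_commute[OF f[of \<sigma>] f[OF \<tau>]] by auto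
    qed
  qed
  then show "((\<lambda>\<tau>. nrm (f \<tau> - y)) \<longlongrightarrow> nrm (f \<tau> - y)) (at \<tau> within S)" by (rule LIM_zero_cancel)
qed

lemma uniformly_continuous:
  fixes f :: "real \<Rightarrow> 'b"
  assumes f: "\<And>\<tau>. \<tau> \<in> S \<Longrightarrow> f \<tau> \<in> X" and c: "\<And>\<tau>. \<tau> \<in> S \<Longrightarrow> ((\<lambda>\<sigma>. nrm (f \<sigma> - f \<tau>)) \<longlongrightarrow> 0) (at \<tau> within S)"
    and ab: "{a..b} \<subseteq> S" and \<epsilon>: "\<epsilon> > 0"
  shows "\<exists>\<delta>>0. \<forall>\<sigma>\<in>{a..b}. \<forall>\<tau>\<in>{a..b}. \<bar>\<sigma> - \<tau>\<bar> < \<delta> \<longrightarrow> nrm (f \<sigma> - f \<tau>) < \<epsilon>"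
proof (rule ccontr)
  assume neg: "\<not> ?thesis"
  have "\<exists>\<sigma>\<in>{a..b}. \<exists>\<tau>\<in>{a..b}. \<bar>\<sigma> - \<tau>\<bar> < inverse (real (Suc n)) \<and> nrm (f \<sigma> - f \<tau>) \<ge> \<epsilon>" for n
  proof -
    have "inverse (real (Suc n)) > 0" by simp
    then show ?thesis using neg by (meson not_le)
  qed
  then obtain \<sigma> \<tau> where st: "\<And>n. \<sigma> n \<in> {a..b}" "\<And>n. \<tau> n \<in> {a..b}" "\<And>n. \<bar>\<sigma> n - \<tau> n\<bar> < inverse (real (Suc n))"
    "\<And>n. nrm (f (\<sigma> n) - f (\<tau> n)) \<ge> \<epsilon>" by metis
  have "seq_compact {a..b}" by (simp add: compact_imp_seq_compact)
  then obtain x r where x: "x \<in> {a..b}" and r: "strict_mono (r :: nat \<Rightarrow> nat)" "(\<sigma> \<circ> r) \<longlonglongrightarrow> x"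
    using st(1) unfolding seq_compact_def by metis
  have cx: "continuous_on S (\<lambda>\<tau>. nrm (f \<tau> - f x))"
    using x ab by (intro continuous_nrm_diff f c) auto
  have "(\<lambda>n. \<sigma> (r n) - \<tau> (r n)) \<longlonglongrightarrow> 0"
  proof (rule Lim_null_comparison)
    show "\<forall>\<^sub>F n in sequentially. norm (\<sigma> (r n) - \<tau> (r n)) \<le> inverse (real (Suc (r n)))"
      using st(3) by (auto intro!: always_eventually less_imp_le simp del: of_nat_Suc)
    show "(\<lambda>n. inverse (real (Suc (r n)))) \<longlonglongrightarrow> 0"
      using LIMSEQ_subseq_LIMSEQ[OF LIMSEQ_inverse_real_of_nat r(1)] by (simp add: o_def)
  qed
  from tendsto_diff[OF r(2)[unfolded o_def] this] have t: "(\<lambda>n. \<tau> (r n)) \<longlonglongrightarrow> x" by simp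
  have "(\<lambda>n. nrm (f (\<sigma> (r n)) - f x)) \<longlonglongrightarrow> nrm (f x - f x)"
    by (rule continuous_on_tendsto_compose[OF cx r(2)[unfolded o_def]]) (use x ab st in \<open>auto intro!: always_eventually\<close>)
  moreover have "(\<lambda>n. nrm (f (\<tau> (r n)) - f x)) \<longlonglongrightarrow> nrm (f x - f x)"
    by (rule continuous_on_tendsto_compose[OF cx t]) (use x ab st in \<open>auto intro!: always_eventually\<close>)
  ultimately have "(\<lambda>n. nrm (f (\<sigma> (r n)) - f x) + nrm (f (\<tau> (r n)) - f x)) \<longlonglongrightarrow> 0 + 0"
    by (intro tendsto_add) (simp_all add: nrm_zero)
  moreover have "\<epsilon> \<le> nrm (f (\<sigma> (r n)) - f x) + nrm (f (\<tau> (r n)) - f x)" for n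
  proof -
    have "f (\<sigma> (r n)) \<in> X" "f (\<tau> (r n)) \<in> X" "f x \<in> X"
      by (rule f, rule subsetD[OF ab], rule st x)+
    then show ?thesis using st(4)[of "r n"] nrm_diff_le[of "f (\<sigma> (r n))" "f x" "f (\<tau> (r n))"] nrm_minus_commute[of "f x" "f (\<tau> (r n))"] by simp
  qed
  ultimately have "\<epsilon> \<le> 0 + 0" using LIMSEQ_le_const by blast
  then show False using \<epsilon> by simp
qed

text \<open>A candidate \<open>I\<close> for the integral that passes all scalar tests from \<open>L\<close> is the integral. The simple
  functions are step functions sampling \<open>f\<close> on a compact subinterval, on which \<open>f\<close> is uniformly
  continuous; the remaining part is controlled by the majorant \<open>g\<close>.\<close>

lemma has_bochner_integral_in_exists:
  fixes f :: "real \<Rightarrow> 'b"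
  assumes t: "0 < t" and f: "\<And>\<tau>. \<tau> \<in> {0<..<t} \<Longrightarrow> f \<tau> \<in> X"
    and c: "\<And>\<tau>. \<tau> \<in> {0<..<t} \<Longrightarrow> ((\<lambda>\<sigma>. nrm (f \<sigma> - f \<tau>)) \<longlongrightarrow> 0) (at \<tau> within {0<..<t})"
    and g: "set_integrable lborel {0<..<t} g" "\<And>\<tau>. \<tau> \<in> {0<..<t} \<Longrightarrow> nrm (f \<tau>) \<le> g \<tau>"
    and I: "I \<in> X" "\<And>\<phi>. \<phi> \<in> L \<Longrightarrow> has_bochner_integral lborel (\<lambda>\<tau>. indicator {0<..<t} \<tau> *\<^sub>R \<phi> (f \<tau>)) (\<phi> I)"
  shows "has_bochner_integral_in X nrm (restrict_space lborel {0<..<t}) f I"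
proof -
  define M where "M = restrict_space lborel {0<..<t}"
  have spM: "space M = {0<..<t}" by (simp add: M_def space_restrict_space)
  have setsM: "sets M = sets (restrict_space borel {0<..<t})" unfolding M_def by (rule sets_restrict_space_cong) simp
  note borelM = measurable_restrict_lborel[of _ _ "{0<..<t}", folded M_def]
  have finM: "finite_measure M"
    by standard (use t in \<open>simp add: M_def emeasure_restrict_space space_restrict_space\<close>)
  define a b where "a i = t / real (i + 3)" and "b i = t - t / real (i + 3)" for i :: nat
  have ab: "{a i..b i} \<subseteq> {0<..<t}" for i
  proof -
    have "0 < t / real (i + 3)" using t by simp
    then have "0 < a i" "b i < t" unfolding a_def b_def by linarith+
    then show ?thesis by auto
  qed
  have "\<exists>\<delta>>0. \<forall>\<sigma>\<in>{a i..b i}. \<forall>\<tau>\<in>{a i..b i}. \<bar>\<sigma> - \<tau>\<bar> < \<delta> \<longrightarrow> nrm (f \<sigma> - f \<tau>) < inverse (real (Suc i))" for i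
    by (rule uniformly_continuous[OF f c ab]) auto
  then obtain \<delta> where \<delta>: "\<And>i. \<delta> i > 0" "\<And>i \<sigma> \<tau>. \<sigma> \<in> {a i..b i} \<Longrightarrow> \<tau> \<in> {a i..b i} \<Longrightarrow> \<bar>\<sigma> - \<tau>\<bar> < \<delta> i \<Longrightarrow> nrm (f \<sigma> - f \<tau>) < inverse (real (Suc i))"
    by metis
  define j where "j i \<tau> = \<lfloor>(\<tau> - a i) / (\<delta> i / 2)\<rfloor>" for i \<tau>
  define p where "p i (k::int) = a i + of_int k * (\<delta> i / 2)" for i k
  define s where "s i \<tau> = (if \<tau> \<in> {a i..b i} then f (p i (j i \<tau>)) else 0)" for i \<tau>
  have pj: "p i (j i \<tau>) \<in> {a i..b i}" "\<bar>\<tau> - p i (j i \<tau>)\<bar> < \<delta> i" if "\<tau> \<in> {a i..b i}" for i \<tau>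
  proof -
    define x where "x = (\<tau> - a i) / (\<delta> i / 2)"
    have "\<delta> i / 2 > 0" using \<delta>(1)[of i] by simp
    then have x: "x \<ge> 0" "\<tau> = a i + x * (\<delta> i / 2)"
      using that by (auto simp only: x_def atLeastAtMost_iff nonzero_eq_divide_eq less_irrefl
        intro!: divide_nonneg_pos) (simp_all add: field_simps)
    have k: "0 \<le> \<lfloor>x\<rfloor>" "of_int \<lfloor>x\<rfloor> \<le> x" "x < of_int \<lfloor>x\<rfloor> + 1" using x by auto
    define P Q where "P = of_int \<lfloor>x\<rfloor> * (\<delta> i / 2)" and "Q = x * (\<delta> i / 2)"
    have p: "p i (j i \<tau>) = a i + P" by (simp add: p_def j_def x_def P_def)
    have "0 \<le> P" using k \<delta>(1)[of i] by (auto simp: P_def)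
    moreover have "P \<le> Q" unfolding P_def Q_def using k \<delta>(1)[of i] by (intro mult_right_mono) auto
    moreover have "Q \<le> P + \<delta> i / 2"
    proof -
      have "Q \<le> (of_int \<lfloor>x\<rfloor> + 1) * (\<delta> i / 2)" unfolding Q_def using k \<delta>(1)[of i] by (intro mult_right_mono) auto
      then show ?thesis by (simp add: P_def distrib_right)
    qed
    moreover have "\<tau> = a i + Q" using x(2) by (simp add: Q_def)
    moreover have "\<tau> \<le> b i" "\<delta> i / 2 < \<delta> i" using that \<delta>(1)[of i] by auto
    ultimately show "p i (j i \<tau>) \<in> {a i..b i}" "\<bar>\<tau> - p i (j i \<tau>)\<bar> < \<delta> i"
      unfolding p by (simp_all only: atLeastAtMost_iff abs_less_iff) linarith+
  qed
  have sX: "s i \<tau> \<in> X" for i \<tau>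
    using f[OF subsetD[OF ab pj(1)], of \<tau> i] subspace_0[OF X] by (simp add: s_def)
  have jm: "j i \<in> measurable M (count_space UNIV)" for i
    unfolding j_def by (rule borelM) measurable
  have simple: "simple_function M (s i)" for i
  proof -
    have "finite (s i ` space M)"
    proof (rule finite_subset)
      define m where "m = \<lfloor>(b i - a i) / (\<delta> i / 2)\<rfloor>"
      show "s i ` space M \<subseteq> insert 0 ((\<lambda>k. f (p i k)) ` {0..m})"
      proof
        fix y assume "y \<in> s i ` space M"
        then obtain \<tau> where y: "y = s i \<tau>" by auto
        show "y \<in> insert 0 ((\<lambda>k. f (p i k)) ` {0..m})"
        proof (cases "\<tau> \<in> {a i..b i}")
          case True
          then have "j i \<tau> \<in> {0..m}" using \<delta>(1)[of i] by (auto simp: j_def m_def intro!: floor_mono divide_right_mono)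
          then show ?thesis using y True by (auto simp: s_def)
        qed (auto simp: y s_def)
      qed
    qed simp
    moreover have "s i -` {y} \<inter> space M \<in> sets M" for y
    proof -
      have [measurable]: "j i \<in> measurable M (count_space UNIV)" by (rule jm)
      have "s i -` {y} \<inter> space M = {\<tau> \<in> space M. if \<tau> \<in> {a i..b i} then f (p i (j i \<tau>)) = y else 0 = y}"
        by (auto simp: s_def)
      also have "\<dots> \<in> sets M"
      proof -
        have 1: "{\<tau> \<in> space M. f (p i (j i \<tau>)) = y} \<in> sets M"
          using measurable_sets[OF jm[of i], of "{k. f (p i k) = y}"] by (simp add: vimage_def Int_def conj_commute)
        have 2: "{\<tau> \<in> space M. \<tau> \<in> {a i..b i}} \<in> sets M"
          using measurable_sets[OF borelM[of "\<lambda>x. x" borel], of "{a i..b i}"] by (simp add: vimage_def Int_def conj_commute)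
        have "{\<tau> \<in> space M. if \<tau> \<in> {a i..b i} then f (p i (j i \<tau>)) = y else 0 = y} =
          ({\<tau> \<in> space M. f (p i (j i \<tau>)) = y} \<inter> {\<tau> \<in> space M. \<tau> \<in> {a i..b i}}) \<union> (if 0 = y then space M - {\<tau> \<in> space M. \<tau> \<in> {a i..b i}} else {})"
          by auto
        also have "\<dots> \<in> sets M" using 1 2 by auto
        finally show ?thesis .
      qed
      finally show ?thesis .
    qed
    ultimately show ?thesis by (simp add: simple_function_def)
  qed
  have sbi: "Bochner_Integration.simple_bochner_integrable M (s i)" for i
  proof
    show "simple_function M (s i)" by (rule simple)
    have "emeasure M {y \<in> space M. s i y \<noteq> 0} \<le> emeasure M (space M)"
      by (rule emeasure_space)
    then show "emeasure M {y \<in> space M. s i y \<noteq> 0} \<noteq> \<infinity>"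
      using finite_measure.emeasure_finite[OF finM, of "space M"] by (auto simp: top_unique)
  qed
  have meas: "(\<lambda>\<tau>. nrm (f \<tau> - s i \<tau>)) \<in> borel_measurable M" for i
  proof -
    have 0: "(\<lambda>\<tau>. nrm (f \<tau> - y)) \<in> borel_measurable M" if "y \<in> X" for y
    proof -
      have "(\<lambda>\<tau>. nrm (f \<tau> - y)) \<in> borel_measurable (restrict_space borel {0<..<t})"
        by (intro borel_measurable_continuous_on_restrict continuous_nrm_diff f c that)
      then show ?thesis using measurable_cong_sets[OF setsM refl] by blast
    qed
    have fin: "finite (s i ` space M)" using simple[of i] by (simp add: simple_function_def)
    have "(\<lambda>\<tau>. \<Sum>y\<in>s i ` space M. indicator {x \<in> space M. s i x = y} \<tau> * nrm (f \<tau> - y)) \<in> borel_measurable M"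
    proof (intro borel_measurable_sum borel_measurable_times)
      fix y assume y: "y \<in> s i ` space M"
      have "{x \<in> space M. s i x = y} \<in> sets M"
        using simple[of i] y by (auto simp: simple_function_def vimage_def Int_def conj_commute)
      then show "(\<lambda>x. indicat_real {x \<in> space M. s i x = y} x) \<in> borel_measurable M" by (intro borel_measurable_indicator)
      show "(\<lambda>\<tau>. nrm (f \<tau> - y)) \<in> borel_measurable M" using y sX by (intro 0) auto
    qed
    also have "?this \<longleftrightarrow> ?thesis"
    proof (rule measurable_cong)
      fix \<tau> assume \<tau>: "\<tau> \<in> space M"
      have "(\<Sum>y\<in>s i ` space M. indicator {x \<in> space M. s i x = y} \<tau> * nrm (f \<tau> - y)) = (\<Sum>y\<in>s i ` space M. if y = s i \<tau> then nrm (f \<tau> - y) else 0)"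
        using \<tau> by (intro sum.cong) (auto simp: indicator_def)
      also have "\<dots> = nrm (f \<tau> - s i \<tau>)" using fin \<tau> by simp
      finally show "(\<Sum>y\<in>s i ` space M. indicator {x \<in> space M. s i x = y} \<tau> * nrm (f \<tau> - y)) = nrm (f \<tau> - s i \<tau>)" .
    qed
    finally show ?thesis .
  qed
  have gM: "integrable M g" using g(1) by (simp add: M_def integrable_restrict_space set_integrable_def)
  have g0: "0 \<le> g \<tau>" if "\<tau> \<in> {0<..<t}" for \<tau> using g(2)[OF that] nonneg[OF f[OF that]] by linarith
  define h where "h i \<tau> = inverse (real (Suc i)) + indicator (- {a i..b i}) \<tau> * g \<tau>" for i \<tau>
  have hle: "nrm (f \<tau> - s i \<tau>) \<le> h i \<tau>" if \<tau>: "\<tau> \<in> space M" for i \<tau>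
  proof (cases "\<tau> \<in> {a i..b i}")
    case True
    then have "nrm (f \<tau> - s i \<tau>) < inverse (real (Suc i))"
      using pj[OF True] \<delta>(2)[of \<tau> i "p i (j i \<tau>)"] by (simp add: s_def)
    then show ?thesis using True by (simp add: h_def)
  next
    case False
    have "nrm (f \<tau>) \<le> inverse (real (Suc i)) + g \<tau>"
      by (rule add_increasing) (use g(2) \<tau> spM in auto)
    moreover have "s i \<tau> = 0" "indicat_real (- {a i..b i}) \<tau> = 1" using False by (auto simp: s_def)
    ultimately show ?thesis by (simp add: h_def del: of_nat_Suc)
  qed
  have h0: "0 \<le> h i \<tau>" if "\<tau> \<in> space M" for i \<tau> using g0 that spM by (auto simp: h_def indicator_def)
  have hm: "(\<lambda>\<tau>. h i \<tau>) \<in> borel_measurable M" for i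
  proof -
    have [measurable]: "g \<in> borel_measurable M" using gM by auto
    have [measurable]: "(\<lambda>\<tau>. indicat_real (- {a i..b i}) \<tau>) \<in> borel_measurable M" by (rule borelM) simp
    show ?thesis unfolding h_def by measurable
  qed
  interpret M: finite_measure M by (rule finM)
  have dom: "integrable M (\<lambda>\<tau>. 1 + g \<tau>)" using gM by simp
  have hbound: "norm (h i \<tau>) \<le> 1 + g \<tau>" if "\<tau> \<in> space M" for i \<tau>
  proof -
    have "inverse (real (Suc i)) \<le> 1" by (simp add: field_simps)
    moreover have "indicator (- {a i..b i}) \<tau> * g \<tau> \<le> g \<tau>" using g0 that spM by (auto simp: indicator_def)
    ultimately show ?thesis using h0[OF that, of i] by (simp add: h_def del: of_nat_Suc)
  qed
  have hi: "integrable M (h i)" for i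
    by (rule Bochner_Integration.integrable_bound[OF dom hm]) (use hbound g0 spM in \<open>auto intro!: AE_I2 order_trans[OF hbound[unfolded real_norm_def]]\<close>)
  have hlim: "(\<lambda>i. integral\<^sup>L M (h i)) \<longlonglongrightarrow> integral\<^sup>L M (\<lambda>\<tau>. 0::real)"
  proof (rule integral_dominated_convergence[OF _ hm dom])
    show "AE \<tau> in M. (\<lambda>i. h i \<tau>) \<longlonglongrightarrow> 0"
    proof (rule AE_I2)
      fix \<tau> assume \<tau>: "\<tau> \<in> space M"
      have lim: "(\<lambda>i. t / real (i + 3)) \<longlonglongrightarrow> 0"
        by (rule LIMSEQ_ignore_initial_segment[OF lim_const_over_n])
      have pos: "0 < \<tau>" "0 < t - \<tau>" using \<tau> spM by auto
      from order_tendstoD(2)[OF lim pos(1)] order_tendstoD(2)[OF lim pos(2)]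
      have "eventually (\<lambda>i. inverse (real (Suc i)) = h i \<tau>) sequentially"
        by eventually_elim (simp add: h_def a_def b_def)
      then show "(\<lambda>i. h i \<tau>) \<longlonglongrightarrow> 0" by (rule Lim_transform_eventually[OF LIMSEQ_inverse_real_of_nat])
    qed
    show "AE \<tau> in M. norm (h i \<tau>) \<le> 1 + g \<tau>" for i using hbound by (intro AE_I2)
  qed simp
  have nn: "(\<lambda>i. \<integral>\<^sup>+\<tau>. ennreal (nrm (f \<tau> - s i \<tau>)) \<partial>M) \<longlonglongrightarrow> 0"
  proof (rule tendsto_sandwich[of "\<lambda>_. 0"])
    show "\<forall>\<^sub>F i in sequentially. (\<integral>\<^sup>+\<tau>. ennreal (nrm (f \<tau> - s i \<tau>)) \<partial>M) \<le> ennreal (integral\<^sup>L M (h i))"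
    proof (intro always_eventually allI)
      fix i
      have "(\<integral>\<^sup>+\<tau>. ennreal (nrm (f \<tau> - s i \<tau>)) \<partial>M) \<le> (\<integral>\<^sup>+\<tau>. ennreal (h i \<tau>) \<partial>M)"
        using hle by (intro nn_integral_mono ennreal_leI)
      also have "\<dots> = ennreal (integral\<^sup>L M (h i))" using hi h0 by (intro nn_integral_eq_integral AE_I2)
      finally show "(\<integral>\<^sup>+\<tau>. ennreal (nrm (f \<tau> - s i \<tau>)) \<partial>M) \<le> ennreal (integral\<^sup>L M (h i))" .
    qed
    show "(\<lambda>i. ennreal (integral\<^sup>L M (h i))) \<longlonglongrightarrow> 0" using tendsto_ennrealI[OF hlim] by simp
  qed auto
  have intX: "Bochner_Integration.simple_bochner_integral M (s i) \<in> X" for i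
    unfolding Bochner_Integration.simple_bochner_integral_def using sX
    by (intro subspace_sum[OF X] subspace_scale[OF X]) auto
  have Ile: "nrm (Bochner_Integration.simple_bochner_integral M (s i) - I) \<le> integral\<^sup>L M (h i)" for i
  proof (rule norming[OF subspace_diff[OF X intX I(1)]])
    show "0 \<le> integral\<^sup>L M (h i)" using h0 by (intro integral_nonneg_AE AE_I2)
    fix \<phi> assume \<phi>: "\<phi> \<in> L"
    interpret \<phi>: linear \<phi> by (rule L_linear[OF \<phi>])
    have "has_bochner_integral M (\<lambda>\<tau>. \<phi> (f \<tau>)) (\<phi> I)"
      using I(2)[OF \<phi>] by (simp add: has_bochner_integral_iff M_def integrable_restrict_space integral_restrict_space set_lebesgue_integral_def)
    then have 1: "integrable M (\<lambda>\<tau>. \<phi> (f \<tau>))" "integral\<^sup>L M (\<lambda>\<tau>. \<phi> (f \<tau>)) = \<phi> I" by (auto simp: has_bochner_integral_iff)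
    have ls: "Bochner_Integration.simple_bochner_integrable M (\<lambda>x. \<phi> (s i x))"
      using Bochner_Integration.simple_bochner_integrable_compose2[OF _ sbi[of i] sbi[of i], of "\<lambda>a b. \<phi> a"] by (simp add: \<phi>.zero)
    have 2: "integrable M (\<lambda>x. \<phi> (s i x))" "integral\<^sup>L M (\<lambda>x. \<phi> (s i x)) = \<phi> (Bochner_Integration.simple_bochner_integral M (s i))"
      using Bochner_Integration.simple_bochner_integral_linear[OF L_linear[OF \<phi>] sbi[of i]]
        has_bochner_integral_simple_bochner_integrable[OF ls] by (auto simp: has_bochner_integral_iff)
    have "\<phi> (Bochner_Integration.simple_bochner_integral M (s i) - I) = integral\<^sup>L M (\<lambda>\<tau>. \<phi> (s i \<tau>) - \<phi> (f \<tau>))"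
      using 1 2 by (simp add: \<phi>.diff)
    also have "\<bar>\<dots>\<bar> \<le> integral\<^sup>L M (\<lambda>\<tau>. \<bar>\<phi> (s i \<tau>) - \<phi> (f \<tau>)\<bar>)" by (rule integral_abs_bound)
    also have "\<dots> \<le> integral\<^sup>L M (h i)"
    proof (rule integral_mono)
      show "integrable M (\<lambda>\<tau>. \<bar>\<phi> (s i \<tau>) - \<phi> (f \<tau>)\<bar>)" using 1 2 by simp
      fix \<tau> assume \<tau>: "\<tau> \<in> space M"
      have fX: "f \<tau> \<in> X" using f \<tau> spM by simp
      have "\<bar>\<phi> (s i \<tau> - f \<tau>)\<bar> \<le> nrm (s i \<tau> - f \<tau>)" by (rule L_bound[OF \<phi> subspace_diff[OF X sX fX]])
      then show "\<bar>\<phi> (s i \<tau>) - \<phi> (f \<tau>)\<bar> \<le> h i \<tau>" using hle[OF \<tau>, of i] nrm_minus_commute[OF sX fX] by (simp add: \<phi>.diff)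
    qed (rule hi)
    finally show "\<bar>\<phi> (Bochner_Integration.simple_bochner_integral M (s i) - I)\<bar> \<le> integral\<^sup>L M (h i)" .
  qed
  have limI: "(\<lambda>i. nrm (Bochner_Integration.simple_bochner_integral M (s i) - I)) \<longlonglongrightarrow> 0"
    by (rule Lim_null_comparison[of _ "\<lambda>i. integral\<^sup>L M (h i)"])
      (use Ile nonneg[OF subspace_diff[OF X intX I(1)]] hlim in \<open>auto intro!: always_eventually\<close>)
  show ?thesis
    unfolding has_bochner_integral_in_def M_def[symmetric]
    using f I(1) sbi sX meas nn limI spM by (intro conjI exI[of _ s]) auto
qed

end

section \<open>Continuity and fractional integrals of eigenfunction series\<close>

text \<open>Dominated convergence for weighted square sums: coefficientwise convergence under a square-summable
  majorant gives convergence of the sum.\<close>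

lemma tannery_squares:
  fixes w b c0 :: "nat \<Rightarrow> real" and c :: "nat \<Rightarrow> 'x \<Rightarrow> real"
  assumes lim: "\<And>n. ((\<lambda>s. c n s) \<longlongrightarrow> c0 n) F"
    and w: "\<And>n. 0 \<le> w n" and b: "summable (\<lambda>n. (b n)\<^sup>2)"
    and bound: "eventually (\<lambda>s. \<forall>n. w n * (c n s)\<^sup>2 \<le> B * (b n)\<^sup>2) F"
    and bound0: "\<And>n. w n * (c0 n)\<^sup>2 \<le> B * (b n)\<^sup>2"
  shows "((\<lambda>s. \<Sum>n. w n * (c n s - c0 n)\<^sup>2) \<longlongrightarrow> 0) F"
proof (cases "F = bot")
  case False
  have le: "w n * (x - y)\<^sup>2 \<le> 2 * (w n * x\<^sup>2) + 2 * (w n * y\<^sup>2)" for n x y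
  proof -
    have "(x - y)\<^sup>2 \<le> 2 * x\<^sup>2 + 2 * y\<^sup>2"
      using zero_le_power2[of "x + y"] by (simp add: power2_sum power2_diff)
    then have "w n * (x - y)\<^sup>2 \<le> w n * (2 * x\<^sup>2 + 2 * y\<^sup>2)" using w by (rule mult_left_mono)
    then show ?thesis by (simp add: algebra_simps)
  qed
  have "((\<lambda>s. \<Sum>n. w n * (c n s - c0 n)\<^sup>2) \<longlongrightarrow> (\<Sum>n. w n * (c0 n - c0 n)\<^sup>2)) F"
  proof (rule tannerys_theorem[of "\<lambda>n s. w n * (c n s - c0 n)\<^sup>2" "\<lambda>n. w n * (c0 n - c0 n)\<^sup>2" F "\<lambda>n. 4 * B * (b n)\<^sup>2", THEN conjunct2, THEN conjunct2])
    show "((\<lambda>s. w n * (c n s - c0 n)\<^sup>2) \<longlongrightarrow> w n * (c0 n - c0 n)\<^sup>2) F" for n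
      by (intro tendsto_intros lim)
    have "eventually (\<lambda>s. \<forall>n. norm (w n * (c n s - c0 n)\<^sup>2) \<le> 4 * B * (b n)\<^sup>2) F"
      using bound
    proof eventually_elim
      case (elim s)
      show ?case
      proof
        fix n
        have "w n * (c n s - c0 n)\<^sup>2 \<le> 4 * B * (b n)\<^sup>2"
        proof -
          have "w n * (c n s - c0 n)\<^sup>2 \<le> 2 * (B * (b n)\<^sup>2) + 2 * (B * (b n)\<^sup>2)"
            by (rule order_trans[OF le], intro add_mono mult_left_mono) (use elim bound0[of n] in auto)
          then show ?thesis by simp
        qed
        then show "norm (w n * (c n s - c0 n)\<^sup>2) \<le> 4 * B * (b n)\<^sup>2" using w by simp
      qed
    qed
    then show "\<forall>\<^sub>F (n, s) in at_top \<times>\<^sub>F F. norm (w n * (c n s - c0 n)\<^sup>2) \<le> 4 * B * (b n)\<^sup>2"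
      unfolding eventually_prod_filter
      by (intro exI[of _ "\<lambda>_. True"] exI[of _ "\<lambda>s. \<forall>n. norm (w n * (c n s - c0 n)\<^sup>2) \<le> 4 * B * (b n)\<^sup>2"]) auto
    show "summable (\<lambda>n. 4 * B * (b n)\<^sup>2)" using b by (intro summable_mult)
  qed (rule False)
  then show ?thesis by simp
qed simp

text \<open>Singular majorants in time are harmless for continuity because they are bounded away from \<open>0\<close>.\<close>

lemma at_within_frac_powr_bound:
  fixes t r C :: real
  assumes "t \<in> {0<..T}" "0 \<le> r" "0 \<le> C"
  shows "eventually (\<lambda>s. s \<in> {0<..T} \<and> t/2 < s \<and> C * s powr (- r) \<le> C * (t/2) powr (- r)) (at t within {0<..T})"
proof -
  have "eventually (\<lambda>s. t/2 < s) (at t within {0<..T})"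
    using assms by (intro order_tendstoD(1)[OF tendsto_ident_at]) auto
  moreover have "eventually (\<lambda>s. s \<in> {0<..T}) (at t within {0<..T})"
    by (simp add: eventually_at_filter)
  ultimately show ?thesis
  proof eventually_elim
    case (elim s)
    then have "s powr (- r) \<le> (t/2) powr (- r)" using assms by (intro powr_mono2') auto
    then show ?case using elim assms by (simp add: mult_left_mono)
  qed
qed

context eigenbasis
begin

lemma norming_H: "norming H norm {\<lambda>x. inner x (comb c {..<N}) |c N. norm (comb c {..<N}) \<le> 1}"
proof (rule norming.intro)
  show "subspace H" by (rule subspace_H)
  fix \<phi> :: "'a \<Rightarrow> real" assume "\<phi> \<in> {\<lambda>x. inner x (comb c {..<N}) |c N. norm (comb c {..<N}) \<le> 1}"
  then obtain c N where \<phi>: "\<phi> = (\<lambda>x. inner x (comb c {..<N}))" "norm (comb c {..<N}) \<le> 1" by blast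
  show "linear \<phi>" unfolding \<phi>(1) by (intro linearI) (auto simp: inner_left_distrib)
  show "\<bar>\<phi> x\<bar> \<le> norm x" for x
    using Cauchy_Schwarz_ineq2[of x "comb c {..<N}"] mult_left_le[OF \<phi>(2), of "norm x"] by (simp add: \<phi>(1))
next
  fix x :: 'a and K :: real
  assume x: "x \<in> H" and K: "0 \<le> K"
    and le: "\<And>\<phi>. \<phi> \<in> {\<lambda>x. inner x (comb c {..<N}) |c N. norm (comb c {..<N}) \<le> 1} \<Longrightarrow> \<bar>\<phi> x\<bar> \<le> K"
  define c where "c n = inner x (e n)" for n
  have lim: "(\<lambda>N. comb c {..<N}) \<longlonglongrightarrow> x"
    using expansion[OF x] by (simp add: sums_def comb_def c_def)
  have "norm (comb c {..<N}) \<le> K" for N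
  proof (cases "comb c {..<N} = 0")
    case False
    define r where "r = norm (comb c {..<N})"
    have r: "r > 0" using False by (simp add: r_def)
    have sc: "comb (\<lambda>n. c n / r) {..<N} = (1/r) *\<^sub>R comb c {..<N}" by (simp add: comb_def scaleR_sum_right)
    have "norm (comb (\<lambda>n. c n / r) {..<N}) \<le> 1" unfolding sc using r by (simp add: r_def)
    then have "\<bar>inner x (comb (\<lambda>n. c n / r) {..<N})\<bar> \<le> K" by (intro le[of "\<lambda>x. inner x (comb (\<lambda>n. c n / r) {..<N})"]) blast
    moreover have "inner x (comb c {..<N}) = r\<^sup>2"
    proof -
      have "inner (comb c {..<N}) x = inner (comb c {..<N}) (comb c {..<N})"
        unfolding inner_comb_self[OF finite_lessThan] by (subst inner_comb) (simp add: c_def inner_commute power2_eq_square)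
      then show ?thesis by (simp add: r_def power2_norm_eq_inner inner_commute)
    qed
    ultimately show ?thesis using r by (simp add: sc power2_eq_square r_def[symmetric])
  qed (use K in simp)
  then show "norm x \<le> K" using tendsto_norm[OF lim] by (intro LIMSEQ_le_const2[of "\<lambda>N. norm (comb c {..<N})"]) auto
qed (auto simp: norm_triangle_ineq)

lemma norming_dual: "norming Vd dn {\<lambda>f. f (comb c {..<N}) |c N. form_norm E (comb c {..<N}) \<le> 1}"
proof (rule norming.intro)
  show "subspace Vd" by (rule subspace_dual)
  show "0 \<le> dn f" if "f \<in> Vd" for f by (rule dual_norm_nonneg[OF that])
  show "dn (f + g) \<le> dn f + dn g" if "f \<in> Vd" "g \<in> Vd" for f g by (rule dual_norm_triangle[OF that])
  show "dn (c *\<^sub>R f) = \<bar>c\<bar> * dn f" if f: "f \<in> Vd" for c f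
  proof -
    have le: "dn (c *\<^sub>R f) \<le> \<bar>c\<bar> * dn f" if f: "f \<in> Vd" for c f
      using dual_le[OF f] dual_norm_nonneg[OF f]
      by (intro dual_norm_le) (auto simp: abs_mult mult.assoc mult_left_mono)
    show ?thesis
    proof (cases "c = 0")
      case True
      then show ?thesis using le[OF f, of 0] dual_norm_nonneg[OF subspace_scale[OF subspace_dual f, of 0]] by simp
    next
      case False
      have "dn f \<le> \<bar>1/c\<bar> * dn (c *\<^sub>R f)"
        using le[OF subspace_scale[OF subspace_dual f, of c], of "1/c"] False by simp
      then have "\<bar>c\<bar> * dn f \<le> dn (c *\<^sub>R f)" using False by (simp add: field_simps)
      then show ?thesis using le[OF f, of c] by simp
    qed
  qed
  fix \<phi> :: "('a \<Rightarrow> real) \<Rightarrow> real" assume "\<phi> \<in> {\<lambda>f. f (comb c {..<N}) |c N. form_norm E (comb c {..<N}) \<le> 1}"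
  then obtain c N where \<phi>: "\<phi> = (\<lambda>f. f (comb c {..<N}))" "form_norm E (comb c {..<N}) \<le> 1" by blast
  show "linear \<phi>" unfolding \<phi>(1) by (intro linearI) auto
  show "\<bar>\<phi> f\<bar> \<le> dn f" if "f \<in> Vd" for f
    using dual_le[OF that comb_V, of c "{..<N}"] mult_left_le[OF \<phi>(2) dual_norm_nonneg[OF that]] by (simp add: \<phi>(1))
next
  fix f :: "'a \<Rightarrow> real" and K :: real
  assume f: "f \<in> Vd" and K: "0 \<le> K"
    and le: "\<And>\<phi>. \<phi> \<in> {\<lambda>f. f (comb c {..<N}) |c N. form_norm E (comb c {..<N}) \<le> 1} \<Longrightarrow> \<bar>\<phi> f\<bar> \<le> K"
  show "dn f \<le> K"
  proof (rule dual_norm_le_comb[OF f K])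
    fix c N
    define r where "r = form_norm E (comb c {..<N})"
    show "\<bar>f (comb c {..<N})\<bar> \<le> K * form_norm E (comb c {..<N})"
    proof (cases "comb c {..<N} = 0")
      case True
      then show ?thesis using dual_le[OF f subspace_0[OF subspace_V]] by (simp add: form_norm_zero)
    next
      case False
      have r: "r > 0" using form_norm_nonneg[OF comb_V, of c "{..<N}"] form_norm_eq_0[OF comb_V, of c "{..<N}"] False by (simp add: r_def)
      have sc: "comb (\<lambda>n. c n / r) {..<N} = (1/r) *\<^sub>R comb c {..<N}" by (simp add: comb_def scaleR_sum_right)
      have "form_norm E (comb (\<lambda>n. c n / r) {..<N}) \<le> 1" unfolding sc using r by (simp add: form_norm_scale[OF comb_V] r_def)
      then have "\<bar>f (comb (\<lambda>n. c n / r) {..<N})\<bar> \<le> K" by (intro le[of "\<lambda>f. f (comb (\<lambda>n. c n / r) {..<N})"]) blast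
      then show ?thesis unfolding sc using r by (simp add: dual_scale[OF f comb_V] abs_mult r_def[symmetric] pos_divide_le_eq)
    qed
  qed
qed

text \<open>The majorant may blow up like \<open>t powr (- r)\<close> at \<open>0\<close>, as the solutions do.\<close>

lemma continuous_into_V:
  assumes c: "\<And>n. continuous_on {0<..T} (c n)" and b: "summable (\<lambda>n. (b n)\<^sup>2)" and C: "0 \<le> C" "0 \<le> r"
    and bound: "\<And>n t. t \<in> {0<..T} \<Longrightarrow> sqrt (wt n) * \<bar>c n t\<bar> \<le> C * t powr (- r) * b n"
  shows "continuous_into V (form_norm E) {0<..T} (\<lambda>t. S (\<lambda>n. c n t))"
    and "\<And>t. t \<in> {0<..T} \<Longrightarrow> vsum (\<lambda>n. c n t)"
proof -
  have sq: "wt n * (c n t)\<^sup>2 \<le> (C * t powr (- r))\<^sup>2 * (b n)\<^sup>2" if "t \<in> {0<..T}" for n t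
  proof -
    have "(sqrt (wt n) * \<bar>c n t\<bar>)\<^sup>2 \<le> (C * t powr (- r) * b n)\<^sup>2"
      using bound[OF that, of n] by (intro power_mono) (auto simp: less_imp_le[OF wt_pos])
    then show ?thesis by (simp add: power_mult_distrib less_imp_le[OF wt_pos])
  qed
  show vs: "vsum (\<lambda>n. c n t)" if "t \<in> {0<..T}" for t
    unfolding vsum_def
    by (rule summable_comparison_test[OF exI[of _ 0] summable_mult[OF b, of "(C * t powr (- r))\<^sup>2"]])
      (use sq[OF that] wt_pos in \<open>auto simp: less_imp_le\<close>)
  show "continuous_into V (form_norm E) {0<..T} (\<lambda>t. S (\<lambda>n. c n t))"
    unfolding continuous_into_def
  proof (intro ballI conjI)
    fix t assume t: "t \<in> {0<..T}"
    show "S (\<lambda>n. c n t) \<in> V" by (rule V_series_V[OF vs[OF t]])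
    define B where "B = (C * (t/2) powr (- r))\<^sup>2"
    have "((\<lambda>s. \<Sum>n. wt n * (c n s - c n t)\<^sup>2) \<longlongrightarrow> 0) (at t within {0<..T})"
    proof (rule tannery_squares[where B = B and b = b])
      show "((\<lambda>s. c n s) \<longlongrightarrow> c n t) (at t within {0<..T})" for n using c t by (simp add: continuous_on_def)
      have le: "(C * s powr (- r))\<^sup>2 * (b n)\<^sup>2 \<le> B * (b n)\<^sup>2" if "C * s powr (- r) \<le> C * (t/2) powr (- r)" for s n
        unfolding B_def using that C by (intro mult_right_mono power_mono) auto
      show "\<forall>\<^sub>F s in at t within {0<..T}. \<forall>n. wt n * (c n s)\<^sup>2 \<le> B * (b n)\<^sup>2"
        using at_within_frac_powr_bound[OF t C(2) C(1)] by eventually_elim (use sq le in \<open>blast intro: order_trans\<close>)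
      show "wt n * (c n t)\<^sup>2 \<le> B * (b n)\<^sup>2" for n
      proof (rule order_trans[OF sq[OF t] le])
        show "C * t powr (- r) \<le> C * (t/2) powr (- r)" using t C by (intro mult_left_mono powr_mono2') auto
      qed
    qed (simp_all add: less_imp_le[OF wt_pos] b)
    then have "((\<lambda>s. sqrt (\<Sum>n. wt n * (c n s - c n t)\<^sup>2)) \<longlongrightarrow> sqrt 0) (at t within {0<..T})" by (rule tendsto_real_sqrt)
    then have "((\<lambda>s. sqrt (\<Sum>n. wt n * (c n s - c n t)\<^sup>2)) \<longlongrightarrow> 0) (at t within {0<..T})" by (simp only: real_sqrt_zero)
    moreover have "eventually (\<lambda>s. sqrt (\<Sum>n. wt n * (c n s - c n t)\<^sup>2) = form_norm E (S (\<lambda>n. c n s) - S (\<lambda>n. c n t))) (at t within {0<..T})"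
      unfolding eventually_at_filter
    proof (intro always_eventually allI impI)
      fix s assume s: "s \<in> {0<..T}"
      have d: "vsum (\<lambda>n. inner (S (\<lambda>n. c n s) - S (\<lambda>n. c n t)) (e n))"
        by (intro vsum_coeff subspace_diff[OF subspace_V] V_series_V vs s t)
      have cf: "inner (S (\<lambda>n. c n s) - S (\<lambda>n. c n t)) (e n) = c n s - c n t" for n
        by (simp only: inner_diff_left S_coeff[OF vs[OF s]] S_coeff[OF vs[OF t]])
      have Seq: "S (\<lambda>n. inner (S (\<lambda>n. c n s) - S (\<lambda>n. c n t)) (e n)) = S (\<lambda>n. c n s) - S (\<lambda>n. c n t)"
        by (intro S_coeff_V subspace_diff[OF subspace_V] V_series_V vs s t)
      have "(form_norm E (S (\<lambda>n. c n s) - S (\<lambda>n. c n t)))\<^sup>2 = (\<Sum>n. wt n * (c n s - c n t)\<^sup>2)"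
        using form_norm_S[OF d, unfolded Seq] by (simp only: cf)
      moreover have "0 \<le> form_norm E (S (\<lambda>n. c n s) - S (\<lambda>n. c n t))"
        by (intro form_norm_nonneg subspace_diff[OF subspace_V] V_series_V vs s t)
      ultimately show "sqrt (\<Sum>n. wt n * (c n s - c n t)\<^sup>2) = form_norm E (S (\<lambda>n. c n s) - S (\<lambda>n. c n t))"
        by (metis real_sqrt_unique)
    qed
    ultimately show "((\<lambda>s. form_norm E (S (\<lambda>n. c n s) - S (\<lambda>n. c n t))) \<longlongrightarrow> 0) (at t within {0<..T})"
      by (rule Lim_transform_eventually)
  qed
qed

lemma dsum_bounded:
  assumes b: "summable (\<lambda>n. (b n)\<^sup>2)" and bound: "\<And>n. \<bar>c n\<bar> \<le> K * sqrt (wt n) * b n"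
  shows "dsum c" and "(c n)\<^sup>2 / wt n \<le> K\<^sup>2 * (b n)\<^sup>2" and "0 \<le> K \<Longrightarrow> dn (DF c) \<le> K * sqrt (\<Sum>n. (b n)\<^sup>2)"
proof -
  have sq: "(c n)\<^sup>2 / wt n \<le> K\<^sup>2 * (b n)\<^sup>2" for n
  proof -
    have "\<bar>c n\<bar>\<^sup>2 \<le> (K * sqrt (wt n) * b n)\<^sup>2" using bound[of n] by (intro power_mono) auto
    then have "(c n)\<^sup>2 \<le> (K\<^sup>2 * (b n)\<^sup>2) * wt n" by (simp add: power_mult_distrib less_imp_le[OF wt_pos] mult_ac)
    then show ?thesis by (simp add: pos_divide_le_eq[OF wt_pos])
  qed
  then show "(c n)\<^sup>2 / wt n \<le> K\<^sup>2 * (b n)\<^sup>2" .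
  show d: "dsum c" unfolding dsum_def
    by (rule summable_comparison_test[OF exI[of _ 0] summable_mult[OF b, of "K\<^sup>2"]])
      (use sq wt_pos in \<open>auto simp: less_imp_le\<close>)
  show "dn (DF c) \<le> K * sqrt (\<Sum>n. (b n)\<^sup>2)" if "0 \<le> K"
  proof -
    have "dn (DF c) \<le> sqrt (\<Sum>n. (c n)\<^sup>2 / wt n)" by (rule DF_norm_le[OF d])
    also have "\<dots> \<le> sqrt (\<Sum>n. K\<^sup>2 * (b n)\<^sup>2)"
      using d sq summable_mult[OF b] unfolding dsum_def by (intro real_sqrt_le_mono suminf_le) auto
    also have "\<dots> = K * sqrt (\<Sum>n. (b n)\<^sup>2)" using that by (simp add: suminf_mult[OF b] real_sqrt_mult)
    finally show ?thesis .
  qed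
qed

lemma DF_diff: "dsum c \<Longrightarrow> dsum c' \<Longrightarrow> dsum (\<lambda>n. c n - c' n) \<Longrightarrow> DF c - DF c' = DF (\<lambda>n. c n - c' n)"
  using DF_dual subspace_diff[OF subspace_dual] by (intro dual_eqI) (auto simp: DF_e)

lemma DF_scale: "dsum c \<Longrightarrow> dsum (\<lambda>n. k * c n) \<Longrightarrow> k *\<^sub>R DF c = DF (\<lambda>n. k * c n)"
  using DF_dual subspace_scale[OF subspace_dual] by (intro dual_eqI) (auto simp: DF_e)

lemma dsum_diff: assumes "dsum c" "dsum c'" shows "dsum (\<lambda>n. c n - c' n)"
  unfolding dsum_def
proof (rule summable_comparison_test[OF exI[of _ 0]], intro allI impI)
  show "summable (\<lambda>n. 2 * ((c n)\<^sup>2 / wt n) + 2 * ((c' n)\<^sup>2 / wt n))"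
    using assms unfolding dsum_def by (intro summable_add summable_mult)
  fix n
  have "(c n - c' n)\<^sup>2 \<le> 2 * (c n)\<^sup>2 + 2 * (c' n)\<^sup>2"
    using zero_le_power2[of "c n + c' n"] by (simp add: power2_sum power2_diff)
  then have "(c n - c' n)\<^sup>2 / wt n \<le> (2 * (c n)\<^sup>2 + 2 * (c' n)\<^sup>2) / wt n"
    by (rule divide_right_mono) (simp add: less_imp_le[OF wt_pos])
  then show "norm ((c n - c' n)\<^sup>2 / wt n) \<le> 2 * ((c n)\<^sup>2 / wt n) + 2 * ((c' n)\<^sup>2 / wt n)"
    by (simp add: less_imp_le[OF wt_pos] add_divide_distrib)
qed

lemma dsum_scale: "dsum c \<Longrightarrow> dsum (\<lambda>n. k * c n)"
  unfolding dsum_def using summable_mult[of "\<lambda>n. (c n)\<^sup>2 / wt n" "k\<^sup>2"] by (simp add: power_mult_distrib mult.assoc)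

lemma tendsto_DF:
  assumes b: "summable (\<lambda>n. (b n)\<^sup>2)" and lim: "\<And>n. ((\<lambda>s. c n s) \<longlongrightarrow> c0 n) \<F>"
    and bound: "eventually (\<lambda>s. \<forall>n. \<bar>c n s\<bar> \<le> K * sqrt (wt n) * b n) \<F>"
    and bound0: "\<And>n. \<bar>c0 n\<bar> \<le> K * sqrt (wt n) * b n"
  shows "((\<lambda>s. dn (DF (\<lambda>n. c n s) - DF c0)) \<longlongrightarrow> 0) \<F>"
proof -
  have "((\<lambda>s. \<Sum>n. (1 / wt n) * (c n s - c0 n)\<^sup>2) \<longlongrightarrow> 0) \<F>"
  proof (rule tannery_squares[OF lim, where B = "K\<^sup>2" and b = b])
    show "\<forall>\<^sub>F s in \<F>. \<forall>n. (1 / wt n) * (c n s)\<^sup>2 \<le> K\<^sup>2 * (b n)\<^sup>2"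
      using bound
    proof eventually_elim
      case (elim s)
      then show ?case using dsum_bounded(2)[OF b, of "\<lambda>n. c n s" K] by simp
    qed
    show "(1 / wt n) * (c0 n)\<^sup>2 \<le> K\<^sup>2 * (b n)\<^sup>2" for n using dsum_bounded(2)[OF b bound0] by simp
  qed (simp_all add: less_imp_le[OF wt_pos] b)
  then have lim0: "((\<lambda>s. sqrt (\<Sum>n. (c n s - c0 n)\<^sup>2 / wt n)) \<longlongrightarrow> 0) \<F>"
    using tendsto_real_sqrt by fastforce
  show ?thesis
  proof (rule Lim_null_comparison[OF _ lim0])
    show "\<forall>\<^sub>F s in \<F>. norm (dn (DF (\<lambda>n. c n s) - DF c0)) \<le> sqrt (\<Sum>n. (c n s - c0 n)\<^sup>2 / wt n)"
      using bound
    proof eventually_elim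
      case (elim s)
      have 1: "dsum (\<lambda>n. c n s)" using elim by (intro dsum_bounded(1)[OF b]) blast
      have 2: "dsum c0" by (rule dsum_bounded(1)[OF b bound0])
      have 3: "DF (\<lambda>n. c n s) - DF c0 = DF (\<lambda>n. c n s - c0 n)" by (rule DF_diff[OF 1 2 dsum_diff[OF 1 2]])
      show ?case unfolding 3 using DF_norm_le[OF dsum_diff[OF 1 2]] dual_norm_nonneg[OF DF_dual[OF dsum_diff[OF 1 2]]] by simp
    qed
  qed
qed

lemma continuous_into_dual:
  assumes c: "\<And>n. continuous_on {0<..T} (c n)" and b: "summable (\<lambda>n. (b n)\<^sup>2)" "\<And>n. 0 \<le> b n" and C: "0 \<le> C" "0 \<le> r"
    and bound: "\<And>n t. t \<in> {0<..T} \<Longrightarrow> \<bar>c n t\<bar> \<le> C * t powr (- r) * sqrt (wt n) * b n"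
  shows "continuous_into Vd dn {0<..T} (\<lambda>t. DF (\<lambda>n. c n t))"
  unfolding continuous_into_def
proof (intro ballI conjI)
  fix t assume t: "t \<in> {0<..T}"
  show "DF (\<lambda>n. c n t) \<in> Vd" by (rule DF_dual, rule dsum_bounded(1)[OF b(1)], rule bound[OF t])
  have le: "\<bar>c n s\<bar> \<le> (C * (t/2) powr (- r)) * sqrt (wt n) * b n" if "s \<in> {0<..T}" "C * s powr (- r) \<le> C * (t/2) powr (- r)" for s n
  proof -
    have "C * s powr (- r) * sqrt (wt n) * b n \<le> (C * (t/2) powr (- r)) * sqrt (wt n) * b n"
      using that(2) b(2) by (intro mult_right_mono) (auto simp: less_imp_le[OF wt_pos])
    then show ?thesis using bound[OF that(1), of n] by linarith
  qed
  show "((\<lambda>s. dn (DF (\<lambda>n. c n s) - DF (\<lambda>n. c n t))) \<longlongrightarrow> 0) (at t within {0<..T})"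
  proof (rule tendsto_DF[OF b(1), of _ _ _ "C * (t/2) powr (- r)"])
    show "((\<lambda>s. c n s) \<longlongrightarrow> c n t) (at t within {0<..T})" for n using c t by (simp add: continuous_on_def)
    show "\<forall>\<^sub>F s in at t within {0<..T}. \<forall>n. \<bar>c n s\<bar> \<le> C * (t/2) powr (- r) * sqrt (wt n) * b n"
      using at_within_frac_powr_bound[OF t C(2) C(1)] by eventually_elim (use le in blast)
    show "\<bar>c n t\<bar> \<le> C * (t/2) powr (- r) * sqrt (wt n) * b n" for n
      using t C by (intro le t mult_left_mono powr_mono2') auto
  qed
qed

text \<open>The bound of order \<open>t powr (p - 1)\<close> with \<open>p > 0\<close> makes the kernel times \<open>g\<close> integrable at both ends.\<close>

lemma frac_integral_in:
  assumes nm: "norming X nrm L" and b: "0 < p" "0 \<le> C" and \<alpha>: "0 < \<alpha>" and t: "t \<in> {0<..T}"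
    and cont: "continuous_into X nrm {0<..T} g" and bound: "\<And>s. s \<in> {0<..T} \<Longrightarrow> nrm (g s) \<le> C * s powr (p - 1)"
    and I: "I \<in> X" "\<And>\<phi>. \<phi> \<in> L \<Longrightarrow> has_frac_integral \<alpha> (\<lambda>s. \<phi> (g s)) t (\<phi> I)"
  shows "has_bochner_integral_in X nrm (restrict_space lborel {0<..<t}) (frac_kernel \<alpha> g t) I"
proof -
  interpret norming X nrm L by fact
  define k where "k \<tau> = (t - \<tau>) powr (\<alpha> - 1) / Gamma \<alpha>" for \<tau>
  have fk: "frac_kernel \<alpha> h t \<tau> = k \<tau> *\<^sub>R h \<tau>" for h :: "real \<Rightarrow> 'z::real_vector" and \<tau> by (simp add: frac_kernel_def k_def)
  have gX: "g \<tau> \<in> X" if "\<tau> \<in> {0<..<t}" for \<tau> using cont that t by (auto simp: continuous_into_def)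
  have k0: "0 \<le> k \<tau>" for \<tau> using Gamma_real_pos[OF \<alpha>] by (simp add: k_def)
  have kc: "continuous_on {0<..<t} k" unfolding k_def using Gamma_real_pos[OF \<alpha>] by (intro continuous_intros) auto
  show ?thesis
  proof (rule has_bochner_integral_in_exists[of t _ "\<lambda>\<tau>. C * (k \<tau> * \<tau> powr (p - 1))"])
    show "0 < t" using t by simp
    show "frac_kernel \<alpha> g t \<tau> \<in> X" if "\<tau> \<in> {0<..<t}" for \<tau> unfolding frac_kernel_def by (rule subspace_scale[OF X gX[OF that]])
    show "((\<lambda>\<sigma>. nrm (frac_kernel \<alpha> g t \<sigma> - frac_kernel \<alpha> g t \<tau>)) \<longlongrightarrow> 0) (at \<tau> within {0<..<t})" if \<tau>: "\<tau> \<in> {0<..<t}" for \<tau>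
    proof (rule Lim_null_comparison)
      have kl: "(k \<longlongrightarrow> k \<tau>) (at \<tau> within {0<..<t})" using kc \<tau> by (simp add: continuous_on_def)
      have gl: "((\<lambda>\<sigma>. nrm (g \<sigma> - g \<tau>)) \<longlongrightarrow> 0) (at \<tau> within {0<..<t})"
        by (rule tendsto_within_subset[of _ _ _ "{0<..T}"]) (use cont \<tau> t in \<open>auto simp: continuous_into_def\<close>)
      have "((\<lambda>\<sigma>. k \<sigma> * nrm (g \<sigma> - g \<tau>) + \<bar>k \<sigma> - k \<tau>\<bar> * nrm (g \<tau>)) \<longlongrightarrow> k \<tau> * 0 + \<bar>k \<tau> - k \<tau>\<bar> * nrm (g \<tau>)) (at \<tau> within {0<..<t})"
        by (intro tendsto_intros kl gl)
      then show "((\<lambda>\<sigma>. k \<sigma> * nrm (g \<sigma> - g \<tau>) + \<bar>k \<sigma> - k \<tau>\<bar> * nrm (g \<tau>)) \<longlongrightarrow> 0) (at \<tau> within {0<..<t})" by simp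
      show "\<forall>\<^sub>F \<sigma> in at \<tau> within {0<..<t}. norm (nrm (frac_kernel \<alpha> g t \<sigma> - frac_kernel \<alpha> g t \<tau>)) \<le> k \<sigma> * nrm (g \<sigma> - g \<tau>) + \<bar>k \<sigma> - k \<tau>\<bar> * nrm (g \<tau>)"
        unfolding eventually_at_filter
      proof (intro always_eventually allI impI)
        fix \<sigma> assume \<sigma>: "\<sigma> \<in> {0<..<t}"
        have eq: "frac_kernel \<alpha> g t \<sigma> - frac_kernel \<alpha> g t \<tau> = k \<sigma> *\<^sub>R (g \<sigma> - g \<tau>) + (k \<sigma> - k \<tau>) *\<^sub>R g \<tau>"
          by (simp add: fk algebra_simps)
        have 1: "k \<sigma> *\<^sub>R (g \<sigma> - g \<tau>) \<in> X" "(k \<sigma> - k \<tau>) *\<^sub>R g \<tau> \<in> X"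
          by (intro subspace_scale[OF X] subspace_diff[OF X] gX \<sigma> \<tau>)+
        have "nrm (k \<sigma> *\<^sub>R (g \<sigma> - g \<tau>) + (k \<sigma> - k \<tau>) *\<^sub>R g \<tau>) \<le> k \<sigma> * nrm (g \<sigma> - g \<tau>) + \<bar>k \<sigma> - k \<tau>\<bar> * nrm (g \<tau>)"
          using triangle[OF 1] scale[OF subspace_diff[OF X gX[OF \<sigma>] gX[OF \<tau>]], of "k \<sigma>"] scale[OF gX[OF \<tau>], of "k \<sigma> - k \<tau>"] k0[of \<sigma>] by simp
        moreover have "0 \<le> nrm (k \<sigma> *\<^sub>R (g \<sigma> - g \<tau>) + (k \<sigma> - k \<tau>) *\<^sub>R g \<tau>)" by (intro nonneg subspace_add[OF X] 1)
        ultimately show "norm (nrm (frac_kernel \<alpha> g t \<sigma> - frac_kernel \<alpha> g t \<tau>)) \<le> k \<sigma> * nrm (g \<sigma> - g \<tau>) + \<bar>k \<sigma> - k \<tau>\<bar> * nrm (g \<tau>)"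
          unfolding eq by simp
      qed
    qed
    show "set_integrable lborel {0<..<t} (\<lambda>\<tau>. C * (k \<tau> * \<tau> powr (p - 1)))"
    proof -
      have "has_frac_integral \<alpha> (\<lambda>s. C * Gamma p * (s powr (p - 1) / Gamma p)) t (C * Gamma p * (t powr (\<alpha> + p - 1) / Gamma (\<alpha> + p)))"
        using b \<alpha> t by (intro has_frac_integral_mult has_frac_integral_power) auto
      then show ?thesis
        using Gamma_real_pos[OF b(1)] by (simp add: has_frac_integral_def fk set_integrable_def has_bochner_integral_iff mult.left_commute)
    qed
    show "nrm (frac_kernel \<alpha> g t \<tau>) \<le> C * (k \<tau> * \<tau> powr (p - 1))" if \<tau>: "\<tau> \<in> {0<..<t}" for \<tau>
    proof -
      have "k \<tau> * nrm (g \<tau>) \<le> k \<tau> * (C * \<tau> powr (p - 1))" using bound[of \<tau>] \<tau> t k0[of \<tau>] by (intro mult_left_mono) auto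
      then show ?thesis using scale[OF gX[OF \<tau>], of "k \<tau>"] k0[of \<tau>] by (simp add: fk mult_ac)
    qed
    show "I \<in> X" by (rule I(1))
    show "has_bochner_integral lborel (\<lambda>\<tau>. indicator {0<..<t} \<tau> *\<^sub>R \<phi> (frac_kernel \<alpha> g t \<tau>)) (\<phi> I)" if \<phi>: "\<phi> \<in> L" for \<phi>
      using I(2)[OF \<phi>] linear_scale[OF L_linear[OF \<phi>]] by (simp add: has_frac_integral_def fk)
  qed
qed

text \<open>Passing to Fourier coefficients under the fractional integral.\<close>

lemma frac_functional:
  assumes hb: "has_bochner_integral_in X nrm (restrict_space lborel {0<..<t}) (frac_kernel \<alpha> g t) I"
    and lin: "linear \<phi>" and X: "subspace X" and bound: "\<And>x. x \<in> X \<Longrightarrow> \<bar>\<phi> x\<bar> \<le> C * nrm x" "0 \<le> C"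
    and meas: "(\<lambda>s. indicator {0<..<t} s * \<phi> (g s)) \<in> borel_measurable borel"
  shows "has_frac_integral \<alpha> (\<lambda>s. \<phi> (g s)) t (\<phi> I)"
proof -
  have sc: "\<phi> (frac_kernel \<alpha> g t s) = frac_kernel \<alpha> (\<lambda>s. \<phi> (g s)) t s" for s
    by (simp add: frac_kernel_def linear_scale[OF lin])
  have m: "(\<lambda>s. indicator {0<..<t} s *\<^sub>R frac_kernel \<alpha> (\<lambda>s. \<phi> (g s)) t s) \<in> borel_measurable lborel"
  proof -
    have [measurable]: "(\<lambda>s. indicator {0<..<t} s * \<phi> (g s)) \<in> borel_measurable borel" by (rule meas)
    have "(\<lambda>s. ((t - s) powr (\<alpha> - 1) / Gamma \<alpha>) * (indicator {0<..<t} s * \<phi> (g s))) \<in> borel_measurable lborel" by measurable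
    then show ?thesis by (simp add: frac_kernel_def mult_ac)
  qed
  have "has_bochner_integral (restrict_space lborel {0<..<t}) (\<lambda>s. \<phi> (frac_kernel \<alpha> g t s)) (\<phi> I)"
  proof (rule has_bochner_integral_in_functional[OF hb lin X bound])
    show "(\<lambda>s. \<phi> (frac_kernel \<alpha> g t s)) \<in> borel_measurable (restrict_space lborel {0<..<t})"
      unfolding sc using m by (subst borel_measurable_restrict_space_iff) auto
  qed
  then show ?thesis
    unfolding sc by (simp add: has_frac_integral_def has_bochner_integral_iff integrable_restrict_space integral_restrict_space)
qed

end

section \<open>Weak solutions and their Fourier coefficients\<close>

text \<open>The problem in the eigenbasis; the abbreviations below are the orders of the inner and the outer
  fractional integral.\<close>

locale hilfer_problem = eigenbasis +
  fixes \<mu> \<nu> T :: real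
  assumes \<mu>: "0 < \<mu>" "\<mu> \<le> 1" and \<nu>: "0 \<le> \<nu>" "\<nu> \<le> 1" and T: "0 < T"
begin

abbreviation \<alpha> where "\<alpha> \<equiv> (1 - \<nu>) * (1 - \<mu>)"
abbreviation \<kappa> where "\<kappa> \<equiv> \<nu> * (1 - \<mu>)"

lemma orders: "0 \<le> \<alpha>" "0 \<le> \<kappa>" "\<alpha> + \<kappa> = 1 - \<mu>"
proof -
  show "0 \<le> \<alpha>" "0 \<le> \<kappa>" using \<mu> \<nu> by (auto intro!: mult_nonneg_nonneg)
  show "\<alpha> + \<kappa> = 1 - \<mu>" by (simp add: algebra_simps)
qed

lemma lin_e: "linear (\<lambda>x. inner x (e n))" by (intro linearI) (auto simp: inner_left_distrib)

lemma lin_dual_e: "linear (\<lambda>f :: 'a \<Rightarrow> real. f (e n))" by (intro linearI) auto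

lemma inner_e_le: "\<bar>inner x (e n)\<bar> \<le> 1 * norm x"
  using Cauchy_Schwarz_ineq2[of x "e n"] by (simp add: norm_e)

lemma dual_e_le: "f \<in> Vd \<Longrightarrow> \<bar>f (e n)\<bar> \<le> form_norm E (e n) * dn f"
  using dual_le[OF _ e_V, of f n] by (simp add: mult.commute)

lemma H_eqI: "x \<in> H \<Longrightarrow> y \<in> H \<Longrightarrow> (\<And>n. inner x (e n) = inner y (e n)) \<Longrightarrow> x = y"
  using complete[of "x - y"] subspace_diff[OF subspace_H] by (auto simp: inner_diff_left)

lemma frac_integral_H:
  assumes hb: "has_bochner_integral_in H norm (restrict_space lborel {0<..<t}) (frac_kernel a u t) I" and a: "a \<noteq> 0"
    and meas: "\<And>n. (\<lambda>s. indicator {0<..<t} s * inner (u s) (e n)) \<in> borel_measurable borel"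
  shows "frac_integral H norm a u t = I" "has_frac_integral a (\<lambda>s. inner (u s) (e n)) t (inner I (e n))"
proof -
  have fr: "has_frac_integral a (\<lambda>s. inner (u s) (e n)) t (inner J (e n))"
    if "has_bochner_integral_in H norm (restrict_space lborel {0<..<t}) (frac_kernel a u t) J" for J n
    by (rule frac_functional[OF that lin_e subspace_H inner_e_le _ meas]) simp
  show "has_frac_integral a (\<lambda>s. inner (u s) (e n)) t (inner I (e n))" by (rule fr[OF hb])
  have "(THE y. has_bochner_integral_in H norm (restrict_space lborel {0<..<t}) (frac_kernel a u t) y) = I"
  proof (rule the_equality[of _ I])
    fix J assume J: "has_bochner_integral_in H norm (restrict_space lborel {0<..<t}) (frac_kernel a u t) J"
    show "J = I"
      by (rule H_eqI) (use J hb has_frac_integral_unique[OF fr[OF J] fr[OF hb]] in \<open>auto simp: has_bochner_integral_in_def\<close>)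
  qed (rule hb)
  then show "frac_integral H norm a u t = I" using a by (simp add: frac_integral_def)
qed

lemma frac_integral_dual:
  assumes hb: "has_bochner_integral_in Vd dn (restrict_space lborel {0<..<t}) (frac_kernel a g t) I" and a: "a \<noteq> 0"
    and meas: "\<And>n. (\<lambda>s. indicator {0<..<t} s * g s (e n)) \<in> borel_measurable borel"
  shows "frac_integral Vd dn a g t = I" "has_frac_integral a (\<lambda>s. g s (e n)) t (I (e n))"
proof -
  have fr: "has_frac_integral a (\<lambda>s. g s (e n)) t (J (e n))"
    if "has_bochner_integral_in Vd dn (restrict_space lborel {0<..<t}) (frac_kernel a g t) J" for J n
    by (rule frac_functional[where \<phi> = "\<lambda>f. f (e n)" and C = "form_norm E (e n)", OF that lin_dual_e subspace_dual _ form_norm_nonneg[OF e_V] meas])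
      (rule dual_e_le)
  show "has_frac_integral a (\<lambda>s. g s (e n)) t (I (e n))" by (rule fr[OF hb])
  have "(THE y. has_bochner_integral_in Vd dn (restrict_space lborel {0<..<t}) (frac_kernel a g t) y) = I"
  proof (rule the_equality[of _ I])
    fix J assume J: "has_bochner_integral_in Vd dn (restrict_space lborel {0<..<t}) (frac_kernel a g t) J"
    show "J = I"
      by (rule dual_eqI) (use J hb has_frac_integral_unique[OF fr[OF J] fr[OF hb]] in \<open>auto simp: has_bochner_integral_in_def\<close>)
  qed (rule hb)
  then show "frac_integral Vd dn a g t = I" using a by (simp add: frac_integral_def)
qed

text \<open>Limits in the dual norm are unique, so the definite description denotes the derivative.\<close>

lemma deriv_in_dual:
  assumes d: "has_deriv_in Vd dn {0<..T} g t d" and t: "t \<in> {0<..T}"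
  shows "deriv_in Vd dn {0<..T} g t = d"
  unfolding deriv_in_def
proof (rule the_equality[of _ d])
  fix d' assume d': "has_deriv_in Vd dn {0<..T} g t d'"
  interpret N: norming Vd dn "{\<lambda>f. f (comb c {..<N}) |c N. form_norm E (comb c {..<N}) \<le> 1}" by (rule norming_dual)
  have dV: "d \<in> Vd" "d' \<in> Vd" and gV: "\<And>s. s \<in> {0<..T} \<Longrightarrow> g s \<in> Vd" using d d' by (auto simp: has_deriv_in_def)
  have nt: "at t within {0<..T} \<noteq> bot"
  proof -
    have "t islimpt {0<..<t}" using t by (intro islimpt_greaterThanLessThan2) auto
    then have "t islimpt {0<..T}" by (rule islimpt_subset) (use t in auto)
    then show ?thesis by (simp add: trivial_limit_within)
  qed
  define Q where "Q s = (g s - g t) /\<^sub>R (s - t)" for s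
  have "((\<lambda>s. dn (Q s - d) + dn (Q s - d')) \<longlongrightarrow> 0 + 0) (at t within {0<..T})"
    using d d' unfolding has_deriv_in_def Q_def by (intro tendsto_add) auto
  moreover have "eventually (\<lambda>s. dn (d - d') \<le> dn (Q s - d) + dn (Q s - d')) (at t within {0<..T})"
    unfolding eventually_at_filter
  proof (intro always_eventually allI impI)
    fix s assume s: "s \<in> {0<..T}"
    have QV: "Q s \<in> Vd" unfolding Q_def by (intro subspace_scale[OF subspace_dual] subspace_diff[OF subspace_dual] gV s t)
    show "dn (d - d') \<le> dn (Q s - d) + dn (Q s - d')"
      using N.nrm_diff_le[OF dV(1) QV dV(2)] N.nrm_minus_commute[OF dV(1) QV] by simp
  qed
  ultimately have "dn (d - d') \<le> 0 + 0" by (rule tendsto_lowerbound[OF _ _ nt])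
  then have "dn (d - d') = 0" using dual_norm_nonneg[OF subspace_diff[OF subspace_dual dV]] by simp
  then have "d - d' = 0" by (rule dual_norm_eq_0[OF subspace_diff[OF subspace_dual dV]])
  then show "d' = d" by simp
qed (rule d)

text \<open>Every Fourier coefficient of a weak solution solves the scalar Hilfer problem, since pairing with
  \<open>e n\<close> commutes with both fractional integrals and with the derivative.\<close>

lemma weak_solution_modes:
  assumes w: "weak_solution H V E T \<mu> \<nu> u0 g u" and fn: "\<And>n t. t \<in> {0<..<T} \<Longrightarrow> inner (g t) (e n) = f n t"
  obtains Y d q where
    "\<And>n. continuous_on {0<..T} (\<lambda>t. inner (u t) (e n))"
    "\<And>n t. t \<in> {0<..T} \<Longrightarrow> frac_rel \<alpha> (\<lambda>t. inner (u t) (e n)) t (Y n t)"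
    "\<And>n. continuous_on {0..T} (Y n)" "\<And>n. Y n 0 = inner u0 (e n)"
    "\<And>n t. t \<in> {0<..<T} \<Longrightarrow> (Y n has_real_derivative d n t) (at t)"
    "\<And>n t. t \<in> {0<..T} \<Longrightarrow> frac_rel \<kappa> (d n) t (q n t)"
    "\<And>n. AE t in lborel. t \<in> {0<..<T} \<longrightarrow> q n t + lam n * inner (u t) (e n) = f n t"
    "\<And>n. Y n T = inner (inner_frac H \<mu> \<nu> u T) (e n)" "inner_frac H \<mu> \<nu> u T \<in> H"
proof -
  have uc: "continuous_into V (form_norm E) {0<..T} u" and hd: "hilfer_differentiable H V E T \<mu> \<nu> u"
    and eq: "\<And>\<phi>. \<phi> \<in> V \<Longrightarrow> AE t in lborel. t \<in> {0<..<T} \<longrightarrow> hilfer_deriv H V E T \<mu> \<nu> u t \<phi> + E (u t) \<phi> - inner (g t) \<phi> = 0"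
    using w by (auto simp: weak_solution_def)
  obtain v where v: "continuous_on {0..T} v" "\<And>t. t \<in> {0<..T} \<Longrightarrow> v t = inner_frac H \<mu> \<nu> u t" "v 0 = u0"
    using w by (auto simp: weak_solution_def)
  have uV: "u t \<in> V" if "t \<in> {0<..T}" for t using uc that by (auto simp: continuous_into_def)
  have yc: "continuous_on {0<..T} (\<lambda>t. inner (u t) (e n))" for n
    unfolding continuous_on_def
  proof
    fix t assume t: "t \<in> {0<..T}"
    have "((\<lambda>s. inner (u s) (e n) - inner (u t) (e n)) \<longlongrightarrow> 0) (at t within {0<..T})"
    proof (rule Lim_null_comparison)
      show "((\<lambda>s. form_norm E (u s - u t)) \<longlongrightarrow> 0) (at t within {0<..T})" using uc t by (auto simp: continuous_into_def)
      show "\<forall>\<^sub>F s in at t within {0<..T}. norm (inner (u s) (e n) - inner (u t) (e n)) \<le> form_norm E (u s - u t)"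
        unfolding eventually_at_filter
      proof (intro always_eventually allI impI)
        fix s assume "s \<in> {0<..T}"
        then show "norm (inner (u s) (e n) - inner (u t) (e n)) \<le> form_norm E (u s - u t)"
          using inner_e_le[of "u s - u t" n] norm_le_form_norm[OF subspace_diff[OF subspace_V uV uV[OF t]]] by (fastforce simp: inner_diff_left)
      qed
    qed
    then show "((\<lambda>t. inner (u t) (e n)) \<longlongrightarrow> inner (u t) (e n)) (at t within {0<..T})" by (rule LIM_zero_cancel)
  qed
  have meas: "(\<lambda>s. indicator {0<..<t} s * inner (u s) (e n)) \<in> borel_measurable borel" if "t \<in> {0<..T}" for t n
    using borel_measurable_continuous_on_indicator[OF _ continuous_on_subset[OF yc[of n]], of "{0<..<t}"] that by (simp add: subset_eq)
  have Y: "frac_rel \<alpha> (\<lambda>t. inner (u t) (e n)) t (inner (v t) (e n)) \<and> v t \<in> H" if t: "t \<in> {0<..T}" for n t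
  proof (cases "\<alpha> = 0")
    case True
    then show ?thesis using v(2)[OF t] V_sub_H[OF uV[OF t]] by (simp only: frac_rel_def inner_frac_def frac_integral_def, (simp)?)
  next
    case False
    obtain I where I: "has_bochner_integral_in H norm (restrict_space lborel {0<..<t}) (frac_kernel \<alpha> u t) I"
      using hd t False unfolding hilfer_differentiable_def frac_integrable_def by blast
    have "v t = I" using v(2)[OF t] frac_integral_H(1)[OF I False meas[OF t]] by (simp add: inner_frac_def)
    moreover have "I \<in> H" using I by (simp add: has_bochner_integral_in_def)
    ultimately show ?thesis using frac_integral_H(2)[OF I False meas[OF t], of n] False by (simp add: frac_rel_def)
  qed
  define dd where "dd = inner_frac_deriv H V E T \<mu> \<nu> u"
  have dd: "has_deriv_in Vd dn {0<..T} (\<lambda>s. pivot V (inner_frac H \<mu> \<nu> u s)) t (dd t)" if t: "t \<in> {0<..T}" for t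
  proof -
    obtain d where d: "has_deriv_in Vd dn {0<..T} (\<lambda>s. pivot V (inner_frac H \<mu> \<nu> u s)) t d"
      using hd t unfolding hilfer_differentiable_def by blast
    then show ?thesis using deriv_in_dual[OF d t] by (simp add: dd_def inner_frac_deriv_def)
  qed
  have der: "((\<lambda>t. inner (v t) (e n)) has_real_derivative dd t (e n)) (at t)" if t: "t \<in> {0<..<T}" for n t
  proof -
    have t': "t \<in> {0<..T}" using t by auto
    let ?p = "\<lambda>s. pivot V (inner_frac H \<mu> \<nu> u s)"
    have pV: "?p s \<in> Vd" if "s \<in> {0<..T}" for s using dd[OF t'] that by (auto simp: has_deriv_in_def)
    have dV: "dd t \<in> Vd" using dd[OF t'] by (auto simp: has_deriv_in_def)
    have "((\<lambda>s. (inner (v s) (e n) - inner (v t) (e n)) / (s - t) - dd t (e n)) \<longlongrightarrow> 0) (at t within {0<..T})"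
    proof (rule Lim_null_comparison)
      have "((\<lambda>s. form_norm E (e n) * dn ((?p s - ?p t) /\<^sub>R (s - t) - dd t)) \<longlongrightarrow> form_norm E (e n) * 0) (at t within {0<..T})"
        using dd[OF t'] unfolding has_deriv_in_def by (intro tendsto_mult_left) auto
      then show "((\<lambda>s. form_norm E (e n) * dn ((?p s - ?p t) /\<^sub>R (s - t) - dd t)) \<longlongrightarrow> 0) (at t within {0<..T})" by simp
      show "\<forall>\<^sub>F s in at t within {0<..T}. norm ((inner (v s) (e n) - inner (v t) (e n)) / (s - t) - dd t (e n)) \<le> form_norm E (e n) * dn ((?p s - ?p t) /\<^sub>R (s - t) - dd t)"
        unfolding eventually_at_filter
      proof (intro always_eventually allI impI)
        fix s assume s: "s \<in> {0<..T}"
        have "(?p s - ?p t) /\<^sub>R (s - t) - dd t \<in> Vd"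
          by (intro subspace_diff[OF subspace_dual] subspace_scale[OF subspace_dual] pV s t' dV)
        from dual_e_le[OF this, of n]
        show "norm ((inner (v s) (e n) - inner (v t) (e n)) / (s - t) - dd t (e n)) \<le> form_norm E (e n) * dn ((?p s - ?p t) /\<^sub>R (s - t) - dd t)"
          using v(2)[OF s] v(2)[OF t'] by (simp add: pivot_e divide_inverse mult.commute)
      qed
    qed
    then have "((\<lambda>t. inner (v t) (e n)) has_real_derivative dd t (e n)) (at t within {0<..T})"
      unfolding has_field_derivative_iff by (rule LIM_zero_cancel)
    then have "((\<lambda>t. inner (v t) (e n)) has_real_derivative dd t (e n)) (at t within {0<..<T})"
      by (rule DERIV_subset) auto
    then show ?thesis using t by (simp add: at_within_open[of t "{0<..<T}"])
  qed
  have Yc: "continuous_on {0..T} (\<lambda>t. inner (v t) (e n))" for n by (intro continuous_intros v(1))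
  have measd: "(\<lambda>s. indicator {0<..<t} s * dd s (e n)) \<in> borel_measurable borel" if "t \<in> {0<..T}" for t n
    by (rule derivative_measurable[of t "\<lambda>t. inner (v t) (e n)"])
      (use that der in \<open>auto intro: continuous_on_subset[OF Yc]\<close>)
  have q: "frac_rel \<kappa> (\<lambda>t. dd t (e n)) t (hilfer_deriv H V E T \<mu> \<nu> u t (e n))" if t: "t \<in> {0<..T}" for n t
  proof (cases "\<kappa> = 0")
    case True
    then show ?thesis by (simp only: frac_rel_def hilfer_deriv_def frac_integral_def dd_def, (simp)?)
  next
    case False
    obtain I where I: "has_bochner_integral_in Vd dn (restrict_space lborel {0<..<t}) (frac_kernel \<kappa> dd t) I"
      using hd t False unfolding hilfer_differentiable_def frac_integrable_def dd_def by blast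
    have "hilfer_deriv H V E T \<mu> \<nu> u t = I"
      using frac_integral_dual(1)[OF I False measd[OF t]] by (simp add: hilfer_deriv_def dd_def)
    then show ?thesis using frac_integral_dual(2)[OF I False measd[OF t], of n] False by (simp add: frac_rel_def)
  qed
  have eqn: "AE t in lborel. t \<in> {0<..<T} \<longrightarrow> hilfer_deriv H V E T \<mu> \<nu> u t (e n) + lam n * inner (u t) (e n) = f n t" for n
    using eq[OF e_V[of n]]
  proof eventually_elim
    case (elim t)
    show ?case
    proof
      assume t: "t \<in> {0<..<T}"
      then have "E (u t) (e n) = lam n * inner (u t) (e n)"
        using E_e[OF uV, of t n] E_sym[OF uV e_V, of t n] by (simp add: inner_commute)
      then show "hilfer_deriv H V E T \<mu> \<nu> u t (e n) + lam n * inner (u t) (e n) = f n t"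
        using elim t fn[OF t, of n] by simp
    qed
  qed
  have TT: "T \<in> {0<..T}" using T by simp
  show ?thesis
  proof (rule that[of "\<lambda>n t. inner (v t) (e n)" "\<lambda>n t. dd t (e n)" "\<lambda>n t. hilfer_deriv H V E T \<mu> \<nu> u t (e n)"])
    show "inner_frac H \<mu> \<nu> u T \<in> H" using Y[OF TT] v(2)[OF TT] by simp
    show "inner (v T) (e n) = inner (inner_frac H \<mu> \<nu> u T) (e n)" for n using v(2)[OF TT] by simp
  qed (use yc Y Yc v(3) der q eqn in auto)
qed

text \<open>Two vectors of \<open>H\<close> with the same Fourier coefficients agree.\<close>

lemma weak_solution_unique:
  assumes w: "weak_solution H V E T \<mu> \<nu> u0 g u" "weak_solution H V E T \<mu> \<nu> u0 g u'"
    and fn: "\<And>n t. t \<in> {0<..<T} \<Longrightarrow> inner (g t) (e n) = f n t" and fc: "\<And>n. continuous_on UNIV (f n)"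
  shows "inner_frac H \<mu> \<nu> u T = inner_frac H \<mu> \<nu> u' T"
proof -
  obtain Y d q where 1:
    "\<And>n. continuous_on {0<..T} (\<lambda>t. inner (u t) (e n))"
    "\<And>n t. t \<in> {0<..T} \<Longrightarrow> frac_rel \<alpha> (\<lambda>t. inner (u t) (e n)) t (Y n t)"
    "\<And>n. continuous_on {0..T} (Y n)" "\<And>n. Y n 0 = inner u0 (e n)"
    "\<And>n t. t \<in> {0<..<T} \<Longrightarrow> (Y n has_real_derivative d n t) (at t)"
    "\<And>n t. t \<in> {0<..T} \<Longrightarrow> frac_rel \<kappa> (d n) t (q n t)"
    "\<And>n. AE t in lborel. t \<in> {0<..<T} \<longrightarrow> q n t + lam n * inner (u t) (e n) = f n t"
    "\<And>n. Y n T = inner (inner_frac H \<mu> \<nu> u T) (e n)" "inner_frac H \<mu> \<nu> u T \<in> H"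
    by (rule weak_solution_modes[OF w(1) fn]) blast+
  obtain Y' d' q' where 2:
    "\<And>n. continuous_on {0<..T} (\<lambda>t. inner (u' t) (e n))"
    "\<And>n t. t \<in> {0<..T} \<Longrightarrow> frac_rel \<alpha> (\<lambda>t. inner (u' t) (e n)) t (Y' n t)"
    "\<And>n. continuous_on {0..T} (Y' n)" "\<And>n. Y' n 0 = inner u0 (e n)"
    "\<And>n t. t \<in> {0<..<T} \<Longrightarrow> (Y' n has_real_derivative d' n t) (at t)"
    "\<And>n t. t \<in> {0<..T} \<Longrightarrow> frac_rel \<kappa> (d' n) t (q' n t)"
    "\<And>n. AE t in lborel. t \<in> {0<..<T} \<longrightarrow> q' n t + lam n * inner (u' t) (e n) = f n t"
    "\<And>n. Y' n T = inner (inner_frac H \<mu> \<nu> u' T) (e n)" "inner_frac H \<mu> \<nu> u' T \<in> H"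
    by (rule weak_solution_modes[OF w(2) fn]) blast+
  have "Y n T = Y' n T" for n
    by (rule hilfer_mode_unique[OF \<mu>(1) orders fc 1(1,2,3,5,6,7) 2(1,2,3,5,6,7)]) (use 1(4) 2(4) T in auto)
  then show ?thesis using 1(8,9) 2(8,9) by (intro H_eqI) auto
qed

text \<open>Scalar solutions that are bounded, uniformly in \<open>n\<close>, by a square-summable sequence times a power
  of \<open>t\<close> in the weights of \<open>H\<close>, of the form domain and of its dual, sum up to a weak solution. The bounds with
  exponents above \<open>- 1\<close> provide integrability, those with \<open>t powr (- r)\<close> only continuity for positive
  times.\<close>

lemma weak_solution_of_modes:
  fixes y Y d q :: "nat \<Rightarrow> real \<Rightarrow> real"
  assumes b: "summable (\<lambda>n. (b n)\<^sup>2)" "\<And>n. 0 \<le> b n" and C: "0 \<le> C" "0 \<le> r" "0 < p" "0 < p'"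
    and yc: "\<And>n. continuous_on {0<..T} (y n)" and Yc: "\<And>n. continuous_on {0..T} (Y n)"
    and Y: "\<And>n t. t \<in> {0<..T} \<Longrightarrow> frac_rel \<alpha> (y n) t (Y n t)"
    and d: "\<And>n t. 0 < t \<Longrightarrow> (Y n has_real_derivative d n t) (at t)"
    and dc: "\<And>n. continuous_on {0<..T} (d n)" and qc: "\<And>n. continuous_on {0<..T} (q n)"
    and q: "\<And>n t. t \<in> {0<..T} \<Longrightarrow> frac_rel \<kappa> (d n) t (q n t)"
    and yb: "\<And>n t. t \<in> {0<..T} \<Longrightarrow> \<bar>y n t\<bar> \<le> C * t powr (p - 1) * b n"
    and yV: "\<And>n t. t \<in> {0<..T} \<Longrightarrow> sqrt (wt n) * \<bar>y n t\<bar> \<le> C * t powr (- r) * b n"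
    and YV: "\<And>n t. t \<in> {0<..T} \<Longrightarrow> sqrt (wt n) * \<bar>Y n t\<bar> \<le> C * t powr (- r) * b n"
    and Yb: "\<And>n t. t \<in> {0..T} \<Longrightarrow> \<bar>Y n t\<bar> \<le> C * b n"
    and db: "\<And>n t. t \<in> {0<..T} \<Longrightarrow> \<bar>d n t\<bar> \<le> C * t powr (p' - 1) * sqrt (wt n) * b n"
    and dr: "\<And>n t. t \<in> {0<..T} \<Longrightarrow> \<bar>d n t\<bar> \<le> C * t powr (- r) * sqrt (wt n) * b n"
    and qb: "\<And>n t. t \<in> {0<..T} \<Longrightarrow> \<bar>q n t\<bar> \<le> C * t powr (- r) * sqrt (wt n) * b n"
    and u0: "u0 \<in> H" "\<And>n. Y n 0 = inner u0 (e n)"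
    and g: "\<And>t. t \<in> {0<..<T} \<Longrightarrow> g t \<in> H"
    and eq: "\<And>n t. t \<in> {0<..<T} \<Longrightarrow> q n t + lam n * y n t = inner (g t) (e n)"
  shows "weak_solution H V E T \<mu> \<nu> u0 g (\<lambda>t. S (\<lambda>n. y n t)) \<and>
    inner_frac H \<mu> \<nu> (\<lambda>t. S (\<lambda>n. y n t)) T = S (\<lambda>n. Y n T) \<and> vsum (\<lambda>n. Y n T)"
proof -
  define u where "u t = S (\<lambda>n. y n t)" for t
  have uc: "continuous_into V (form_norm E) {0<..T} u" and yvs: "vsum (\<lambda>n. y n t)" if "t \<in> {0<..T}" for t
    using continuous_into_V[OF yc b(1) C(1,2) yV] that by (simp_all add: u_def[abs_def])
  have Yc': "continuous_on {0<..T} (Y n)" for n by (rule continuous_on_subset[OF Yc]) auto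
  have SYc: "continuous_into V (form_norm E) {0<..T} (\<lambda>t. S (\<lambda>n. Y n t))" and Yvs: "vsum (\<lambda>n. Y n t)" if "t \<in> {0<..T}" for t
    using continuous_into_V[OF Yc' b(1) C(1,2) YV] that by simp_all
  have TT: "T \<in> {0<..T}" using T by simp
  have goal3: "vsum (\<lambda>n. Y n T)" by (rule Yvs[OF TT])
  have uV: "u t \<in> V" if "t \<in> {0<..T}" for t unfolding u_def by (rule V_series_V[OF yvs[OF that]])
  have SYV: "S (\<lambda>n. Y n t) \<in> V" if "t \<in> {0<..T}" for t by (rule V_series_V[OF Yvs[OF that]])
  have ue: "inner (u t) (e n) = y n t" if "t \<in> {0<..T}" for t n unfolding u_def by (rule S_coeff[OF yvs[OF that]])
  define B where "B = sqrt (\<Sum>n. (b n)\<^sup>2)"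
  have B: "0 \<le> B" using b(1) by (simp add: B_def suminf_nonneg)
  have norm_u: "norm (u t) \<le> (C * B) * t powr (p - 1)" if t: "t \<in> {0<..T}" for t
  proof -
    have s: "(\<lambda>n. (y n t)\<^sup>2) sums (norm (u t))\<^sup>2" unfolding u_def by (rule sums_norm[OF V_series_sums[OF yvs[OF t]]])
    have le: "(y n t)\<^sup>2 \<le> (C * t powr (p - 1))\<^sup>2 * (b n)\<^sup>2" for n
    proof -
      have "\<bar>y n t\<bar>\<^sup>2 \<le> (C * t powr (p - 1) * b n)\<^sup>2" using yb[OF t, of n] by (intro power_mono) auto
      then show ?thesis by (simp add: power_mult_distrib)
    qed
    have "(norm (u t))\<^sup>2 \<le> (\<Sum>n. (C * t powr (p - 1))\<^sup>2 * (b n)\<^sup>2)"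
      by (rule sums_le[OF le s summable_sums[OF summable_mult[OF b(1)]]])
    also have "\<dots> = ((C * B) * t powr (p - 1))\<^sup>2"
      using suminf_mult[OF b(1), of "(C * t powr (p - 1))\<^sup>2"] b(1) by (simp add: B_def power_mult_distrib suminf_nonneg mult_ac)
    finally show ?thesis by (rule power2_le_imp_le) (use C B in auto)
  qed
  have continuous_u_H: "continuous_into H norm {0<..T} u"
    unfolding continuous_into_def
  proof (intro ballI conjI)
    fix t assume t: "t \<in> {0<..T}"
    show "u t \<in> H" by (rule V_sub_H[OF uV[OF t]])
    show "((\<lambda>s. norm (u s - u t)) \<longlongrightarrow> 0) (at t within {0<..T})"
    proof (rule Lim_null_comparison)
      show "((\<lambda>s. form_norm E (u s - u t)) \<longlongrightarrow> 0) (at t within {0<..T})" using uc[OF t] t by (auto simp: continuous_into_def)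
      show "\<forall>\<^sub>F s in at t within {0<..T}. norm (norm (u s - u t)) \<le> form_norm E (u s - u t)"
        unfolding eventually_at_filter using norm_le_form_norm[OF subspace_diff[OF subspace_V uV uV[OF t]]]
        by (intro always_eventually) auto
    qed
  qed
  have meas: "(\<lambda>s. indicator {0<..<t} s * inner (u s) (e n)) \<in> borel_measurable borel" if t: "t \<in> {0<..T}" for t n
  proof -
    have "continuous_on {0<..<t} (y n)" by (rule continuous_on_subset[OF yc]) (use t in auto)
    then have "continuous_on {0<..<t} (\<lambda>s. inner (u s) (e n))"
      by (rule continuous_on_eq) (use t in \<open>auto simp: ue\<close>)
    from borel_measurable_continuous_on_indicator[OF _ this] show ?thesis by simp
  qed
  have fracH: "inner_frac H \<mu> \<nu> u t = S (\<lambda>n. Y n t) \<and> frac_integrable H norm \<alpha> u t" if t: "t \<in> {0<..T}" for t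
  proof (cases "\<alpha> = 0")
    case True
    have "Y n t = y n t" for n using Y[OF t, of n] True by (simp only: frac_rel_def, (simp)?)
    then show ?thesis using True by (simp only: inner_frac_def frac_integral_def frac_integrable_def u_def, (simp)?)
  next
    case False
    then have a: "0 < \<alpha>" using orders by linarith
    have hb: "has_bochner_integral_in H norm (restrict_space lborel {0<..<t}) (frac_kernel \<alpha> u t) (S (\<lambda>n. Y n t))"
    proof (rule frac_integral_in[where X = H and nrm = norm and g = u, OF norming_H C(3) _ a t continuous_u_H norm_u])
      show "0 \<le> C * B" using C B by simp
      show "S (\<lambda>n. Y n t) \<in> H" by (rule V_sub_H[OF SYV[OF t]])
      fix \<phi> assume "\<phi> \<in> {\<lambda>x. inner x (comb c {..<N}) |c N. norm (comb c {..<N}) \<le> 1}"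
      then obtain c N where \<phi>: "\<phi> = (\<lambda>x. inner x (comb c {..<N}))" by blast
      have ex: "inner x (comb c {..<N}) = (\<Sum>n<N. c n * inner x (e n))" for x
        unfolding inner_commute[of x] inner_comb ..
      have "has_frac_integral \<alpha> (\<lambda>s. \<Sum>n<N. c n * y n s) t (\<Sum>n<N. c n * Y n t)"
        using Y[OF t] False by (intro has_frac_integral_sum has_frac_integral_mult) (simp add: frac_rel_def split: if_splits)
      then show "has_frac_integral \<alpha> (\<lambda>s. \<phi> (u s)) t (\<phi> (S (\<lambda>n. Y n t)))"
        unfolding \<phi> ex S_coeff[OF Yvs[OF t]]
        by (subst has_frac_integral_cong[of _ _ "\<lambda>s. \<Sum>n<N. c n * y n s"]) (use t in \<open>auto simp: ue\<close>)
    qed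
    then show ?thesis
      using frac_integral_H(1)[OF hb False meas[OF t]] by (auto simp: inner_frac_def frac_integrable_def)
  qed
  have dsY: "dsum (\<lambda>n. Y n t)" if t: "t \<in> {0<..T}" for t
  proof (rule dsum_bounded(1)[OF b(1), of _ C])
    fix n
    have "C * b n * 1 \<le> C * b n * sqrt (wt n)" using C b(2) wt_ge1 by (intro mult_left_mono) auto
    then show "\<bar>Y n t\<bar> \<le> C * sqrt (wt n) * b n" using Yb[of t n] t by (simp add: mult_ac)
  qed
  have dsd: "dsum (\<lambda>n. d n t)" if t: "t \<in> {0<..T}" for t by (rule dsum_bounded(1)[OF b(1) dr[OF t]])
  have dsq: "dsum (\<lambda>n. q n t)" if t: "t \<in> {0<..T}" for t by (rule dsum_bounded(1)[OF b(1) qb[OF t]])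
  have piv: "pivot V (inner_frac H \<mu> \<nu> u t) = DF (\<lambda>n. Y n t)" if t: "t \<in> {0<..T}" for t
    using fracH[OF t] by (intro dual_eqI pivot_dual DF_dual dsY t) (auto simp: pivot_e DF_e[OF dsY[OF t]] S_coeff[OF Yvs[OF t]] V_sub_H[OF SYV[OF t]])
  have deriv: "has_deriv_in Vd dn {0<..T} (\<lambda>s. pivot V (inner_frac H \<mu> \<nu> u s)) t (DF (\<lambda>n. d n t))" if t: "t \<in> {0<..T}" for t
    unfolding has_deriv_in_def
  proof (intro conjI ballI)
    show "pivot V (inner_frac H \<mu> \<nu> u s) \<in> Vd" if "s \<in> {0<..T}" for s unfolding piv[OF that] by (rule DF_dual[OF dsY[OF that]])
    show "DF (\<lambda>n. d n t) \<in> Vd" by (rule DF_dual[OF dsd[OF t]])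
    define Q where "Q n s = (Y n s - Y n t) / (s - t)" for n s
    define K where "K = C * (t/2) powr (- r)"
    have db2: "\<bar>d n s\<bar> \<le> K * sqrt (wt n) * b n" if "s \<in> {0<..T}" "t/2 < s" for n s
    proof -
      have "s powr (- r) \<le> (t/2) powr (- r)" using that t C by (intro powr_mono2') auto
      then have "C * s powr (- r) * sqrt (wt n) * b n \<le> K * sqrt (wt n) * b n"
        unfolding K_def using C b(2) by (intro mult_right_mono mult_left_mono) (auto simp: less_imp_le[OF wt_pos])
      then show ?thesis using dr[OF that(1), of n] by linarith
    qed
    have "((\<lambda>s. dn (DF (\<lambda>n. Q n s) - DF (\<lambda>n. d n t))) \<longlongrightarrow> 0) (at t within {0<..T})"
    proof (rule tendsto_DF[OF b(1), of _ _ _ K])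
      show "((\<lambda>s. Q n s) \<longlongrightarrow> d n t) (at t within {0<..T})" for n
        using d[of t n] t DERIV_subset[of "Y n" "d n t" t UNIV "{0<..T}"] unfolding has_field_derivative_iff Q_def by auto
      show "\<bar>d n t\<bar> \<le> K * sqrt (wt n) * b n" for n using t by (intro db2) auto
      have nt: "eventually (\<lambda>s. s \<noteq> t) (at t within {0<..T})" by (simp add: eventually_at_filter)
      show "\<forall>\<^sub>F s in at t within {0<..T}. \<forall>n. \<bar>Q n s\<bar> \<le> K * sqrt (wt n) * b n"
        using at_within_frac_powr_bound[OF t C(2) C(1)] nt
      proof eventually_elim
        case (elim s)
        show ?case
        proof
          fix n
          have m: "\<exists>z. min s t < z \<and> z < max s t \<and> Y n (max s t) - Y n (min s t) = (max s t - min s t) * d n z"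
            by (rule MVT2) (use elim t in \<open>auto simp: min_def max_def intro!: d split: if_splits\<close>)
          then obtain z where z: "min s t < z" "z < max s t" "Y n (max s t) - Y n (min s t) = (max s t - min s t) * d n z" by blast
          have "Q n s = d n z" using z(3) elim unfolding Q_def by (auto simp: min_def max_def field_simps split: if_splits)
          moreover have "z \<in> {0<..T}" "t/2 < z" using z elim t by (auto simp: min_def max_def split: if_splits)
          ultimately show "\<bar>Q n s\<bar> \<le> K * sqrt (wt n) * b n" using db2 by simp
        qed
      qed
    qed
    moreover have "eventually (\<lambda>s. dn (DF (\<lambda>n. Q n s) - DF (\<lambda>n. d n t)) =
       dn ((pivot V (inner_frac H \<mu> \<nu> u s) - pivot V (inner_frac H \<mu> \<nu> u t)) /\<^sub>R (s - t) - DF (\<lambda>n. d n t))) (at t within {0<..T})"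
      unfolding eventually_at_filter
    proof (intro always_eventually allI impI)
      fix s assume s: "s \<in> {0<..T}"
      have 1: "dsum (\<lambda>n. Y n s - Y n t)" by (rule dsum_diff[OF dsY[OF s] dsY[OF t]])
      have "DF (\<lambda>n. Q n s) = (DF (\<lambda>n. Y n s) - DF (\<lambda>n. Y n t)) /\<^sub>R (s - t)"
        unfolding Q_def DF_diff[OF dsY[OF s] dsY[OF t] 1] using DF_scale[OF 1 dsum_scale[OF 1], of "inverse (s - t)"]
        by (simp add: divide_inverse mult.commute)
      then show "dn (DF (\<lambda>n. Q n s) - DF (\<lambda>n. d n t)) =
       dn ((pivot V (inner_frac H \<mu> \<nu> u s) - pivot V (inner_frac H \<mu> \<nu> u t)) /\<^sub>R (s - t) - DF (\<lambda>n. d n t))"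
        by (simp only: piv[OF s] piv[OF t])
    qed
    ultimately show "((\<lambda>s. dn ((pivot V (inner_frac H \<mu> \<nu> u s) - pivot V (inner_frac H \<mu> \<nu> u t)) /\<^sub>R (s - t) - DF (\<lambda>n. d n t))) \<longlongrightarrow> 0) (at t within {0<..T})"
      by (rule Lim_transform_eventually)
  qed
  define dd where "dd = inner_frac_deriv H V E T \<mu> \<nu> u"
  have dd: "dd t = DF (\<lambda>n. d n t)" if t: "t \<in> {0<..T}" for t
    unfolding dd_def inner_frac_deriv_def by (rule deriv_in_dual[OF deriv[OF t] t])
  have ddc: "continuous_into Vd dn {0<..T} dd"
  proof -
    have "continuous_into Vd dn {0<..T} (\<lambda>t. DF (\<lambda>n. d n t))" by (rule continuous_into_dual[OF dc b C(1,2) dr])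
    then show ?thesis unfolding continuous_into_def
      by (auto simp: dd elim!: Lim_transform_eventually simp: eventually_at_filter)
  qed
  have dd_norm: "dn (dd t) \<le> (C * B) * t powr (p' - 1)" if t: "t \<in> {0<..T}" for t
    using dsum_bounded(3)[OF b(1) db[OF t]] C t by (simp add: dd[OF t] B_def mult_ac)
  have measd: "(\<lambda>s. indicator {0<..<t} s * dd s (e n)) \<in> borel_measurable borel" if t: "t \<in> {0<..T}" for t n
  proof -
    have "continuous_on {0<..<t} (d n)" by (rule continuous_on_subset[OF dc]) (use t in auto)
    then have "continuous_on {0<..<t} (\<lambda>s. dd s (e n))"
      by (rule continuous_on_eq) (use t in \<open>auto simp: dd DF_e[OF dsd]\<close>)
    from borel_measurable_continuous_on_indicator[OF _ this] show ?thesis by simp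
  qed
  have hil: "hilfer_deriv H V E T \<mu> \<nu> u t = DF (\<lambda>n. q n t) \<and> frac_integrable Vd dn \<kappa> dd t" if t: "t \<in> {0<..T}" for t
  proof (cases "\<kappa> = 0")
    case True
    have "q n t = d n t" for n using q[OF t, of n] True by (simp only: frac_rel_def, (simp)?)
    then show ?thesis using True dd[OF t] by (simp only: hilfer_deriv_def dd_def frac_integral_def frac_integrable_def, (simp)?)
  next
    case False
    then have a: "0 < \<kappa>" using orders by linarith
    have hb: "has_bochner_integral_in Vd dn (restrict_space lborel {0<..<t}) (frac_kernel \<kappa> dd t) (DF (\<lambda>n. q n t))"
    proof (rule frac_integral_in[where X = Vd and nrm = dn and g = dd, OF norming_dual C(4) _ a t ddc dd_norm])
      show "0 \<le> C * B" using C B by simp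
      show "DF (\<lambda>n. q n t) \<in> Vd" by (rule DF_dual[OF dsq[OF t]])
      fix \<phi> assume "\<phi> \<in> {\<lambda>f :: 'a \<Rightarrow> real. f (comb c {..<N}) |c N. form_norm E (comb c {..<N}) \<le> 1}"
      then obtain c N where \<phi>: "\<phi> = (\<lambda>f. f (comb c {..<N}))" by blast
      have "has_frac_integral \<kappa> (\<lambda>s. \<Sum>n<N. c n * d n s) t (\<Sum>n<N. c n * q n t)"
        using q[OF t] False by (intro has_frac_integral_sum has_frac_integral_mult) (simp add: frac_rel_def)
      moreover have "\<phi> (DF (\<lambda>n. q n t)) = (\<Sum>n<N. c n * q n t)"
        unfolding \<phi> by (simp add: dual_comb[OF DF_dual[OF dsq[OF t]]] DF_e[OF dsq[OF t]])
      moreover have "\<phi> (dd s) = (\<Sum>n<N. c n * d n s)" if "s \<in> {0<..T}" for s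
        unfolding \<phi> dd[OF that] by (simp add: dual_comb[OF DF_dual[OF dsd[OF that]]] DF_e[OF dsd[OF that]])
      ultimately show "has_frac_integral \<kappa> (\<lambda>s. \<phi> (dd s)) t (\<phi> (DF (\<lambda>n. q n t)))"
        by (subst has_frac_integral_cong[of _ _ "\<lambda>s. \<Sum>n<N. c n * d n s"]) (use t in auto)
    qed
    then show ?thesis
      using frac_integral_dual(1)[OF hb False measd[OF t]] by (auto simp: hilfer_deriv_def dd_def frac_integrable_def)
  qed
  have hd: "hilfer_differentiable H V E T \<mu> \<nu> u"
    unfolding hilfer_differentiable_def using fracH deriv hil unfolding dd_def by blast
  have hc: "continuous_into Vd dn {0<..T} (hilfer_deriv H V E T \<mu> \<nu> u)"
  proof -
    have "continuous_into Vd dn {0<..T} (\<lambda>t. DF (\<lambda>n. q n t))" by (rule continuous_into_dual[OF qc b C(1,2) qb])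
    then show ?thesis unfolding continuous_into_def
      using hil by (auto elim!: Lim_transform_eventually simp: eventually_at_filter)
  qed
  define v where "v t = (if t = 0 then u0 else S (\<lambda>n. Y n t))" for t
  have vc: "continuous_on {0..T} v"
    unfolding continuous_on_def
  proof
    fix t assume t: "t \<in> {0..T}"
    have vs: "(\<lambda>n. Y n s *\<^sub>R e n) sums v s" if "s \<in> {0..T}" for s
      using that expansion[OF u0(1)] V_series_sums[OF Yvs, of s] by (auto simp: v_def u0(2))
    have "((\<lambda>s. \<Sum>n. 1 * (Y n s - Y n t)\<^sup>2) \<longlongrightarrow> 0) (at t within {0..T})"
    proof (rule tannery_squares[where B = "C\<^sup>2" and b = b])
      show "((\<lambda>s. Y n s) \<longlongrightarrow> Y n t) (at t within {0..T})" for n using Yc t by (simp add: continuous_on_def)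
      have le: "1 * (Y n s)\<^sup>2 \<le> C\<^sup>2 * (b n)\<^sup>2" if "s \<in> {0..T}" for n s
      proof -
        have "\<bar>Y n s\<bar>\<^sup>2 \<le> (C * b n)\<^sup>2" using Yb[OF that, of n] by (intro power_mono) auto
        then show ?thesis by (simp add: power_mult_distrib)
      qed
      show "\<forall>\<^sub>F s in at t within {0..T}. \<forall>n. 1 * (Y n s)\<^sup>2 \<le> C\<^sup>2 * (b n)\<^sup>2"
        unfolding eventually_at_filter using le by (intro always_eventually) blast
      show "1 * (Y n t)\<^sup>2 \<le> C\<^sup>2 * (b n)\<^sup>2" for n by (rule le[OF t])
    qed (use b in auto)
    moreover have "eventually (\<lambda>s. (\<Sum>n. 1 * (Y n s - Y n t)\<^sup>2) = (norm (v s - v t))\<^sup>2) (at t within {0..T})"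
      unfolding eventually_at_filter
    proof (intro always_eventually allI impI)
      fix s assume s: "s \<in> {0..T}"
      have "(\<lambda>n. (Y n s - Y n t) *\<^sub>R e n) sums (v s - v t)"
        using sums_diff[OF vs[OF s] vs[OF t]] by (simp add: scaleR_diff_left)
      from sums_norm[OF this] show "(\<Sum>n. 1 * (Y n s - Y n t)\<^sup>2) = (norm (v s - v t))\<^sup>2" by (simp add: sums_iff)
    qed
    ultimately have "((\<lambda>s. (norm (v s - v t))\<^sup>2) \<longlongrightarrow> 0) (at t within {0..T})" by (rule Lim_transform_eventually)
    from tendsto_real_sqrt[OF this] have "((\<lambda>s. norm (v s - v t)) \<longlongrightarrow> 0) (at t within {0..T})" by simp
    from LIM_zero_cancel[OF tendsto_norm_zero_cancel[OF this]]
    show "(v \<longlongrightarrow> v t) (at t within {0..T})" .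
  qed
  have weq: "hilfer_deriv H V E T \<mu> \<nu> u t \<phi> + E (u t) \<phi> - inner (g t) \<phi> = 0" if \<phi>: "\<phi> \<in> V" and t: "t \<in> {0<..<T}" for \<phi> t
  proof -
    have t': "t \<in> {0<..T}" using t by auto
    have 1: "(\<lambda>n. q n t * inner (e n) \<phi>) sums hilfer_deriv H V E T \<mu> \<nu> u t \<phi>"
      using DF_sums[OF dsq[OF t'] \<phi>] hil[OF t'] by simp
    have 2: "(\<lambda>n. y n t * (wt n * inner (e n) \<phi>)) sums F (u t) \<phi>" unfolding u_def by (rule F_S[OF yvs[OF t'] \<phi>])
    have 3: "(\<lambda>n. y n t * inner (e n) \<phi>) sums inner (u t) \<phi>"
      using bounded_linear.sums[OF bounded_linear_inner_left V_series_sums[OF yvs[OF t']], of \<phi>] by (simp add: u_def)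
    have 4: "(\<lambda>n. inner (g t) (e n) * inner (e n) \<phi>) sums inner (g t) \<phi>"
      using bounded_linear.sums[OF bounded_linear_inner_left expansion[OF g[OF t]], of \<phi>] by simp
    have "(\<lambda>n. q n t * inner (e n) \<phi> + (y n t * (wt n * inner (e n) \<phi>) - y n t * inner (e n) \<phi>)) sums (hilfer_deriv H V E T \<mu> \<nu> u t \<phi> + (F (u t) \<phi> - inner (u t) \<phi>))"
      by (intro sums_add sums_diff 1 2 3)
    moreover have "q n t * inner (e n) \<phi> + (y n t * (wt n * inner (e n) \<phi>) - y n t * inner (e n) \<phi>) = inner (g t) (e n) * inner (e n) \<phi>" for n
      unfolding eq[OF t, of n, symmetric] by (simp add: algebra_simps)
    ultimately have "hilfer_deriv H V E T \<mu> \<nu> u t \<phi> + (F (u t) \<phi> - inner (u t) \<phi>) = inner (g t) \<phi>"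
      using 4 by (simp add: sums_iff)
    then show ?thesis by (simp add: F_def)
  qed
  have "weak_solution H V E T \<mu> \<nu> u0 g u"
    unfolding weak_solution_def
  proof (intro conjI ballI)
    show "continuous_into V (form_norm E) {0<..T} u" by (rule uc[OF TT])
    show "\<exists>v. continuous_on {0..T} v \<and> (\<forall>t\<in>{0<..T}. v t = inner_frac H \<mu> \<nu> u t) \<and> v 0 = u0"
      using vc fracH by (intro exI[of _ v]) (auto simp: v_def)
    show "AE t in lborel. t \<in> {0<..<T} \<longrightarrow> hilfer_deriv H V E T \<mu> \<nu> u t \<phi> + E (u t) \<phi> - inner (g t) \<phi> = 0" if "\<phi> \<in> V" for \<phi>
      using weq[OF that] by (intro AE_I2) blast
  qed (rule hd hc)+
  moreover have "inner_frac H \<mu> \<nu> u T = S (\<lambda>n. Y n T)" using fracH TT by blast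
  ultimately show ?thesis using goal3 by (simp add: u_def[abs_def])
qed

end

section \<open>Recovering spectral groups from a vanishing relaxation sum\<close>

lemma relax_limit_zero:
  fixes l :: real
  assumes \<mu>: "0 < \<mu>" "\<mu> \<le> 1" and b: "\<mu> \<le> b" and l: "0 < l"
  shows "((\<lambda>x. mitlef \<mu> b (l * x)) \<longlongrightarrow> 0) at_top"
proof -
  obtain C where C: "C > 0" "\<And>x. x \<ge> 0 \<Longrightarrow> mitlef \<mu> b (x::real) \<le> C / (1 + x)" using mitlef_decay[OF \<mu> b] by blast
  show ?thesis
  proof (rule tendsto_sandwich[of "\<lambda>_. 0"])
    show "\<forall>\<^sub>F x in at_top. 0 \<le> mitlef \<mu> b (l * x)"
      using eventually_ge_at_top[of 0] by eventually_elim (use mitlef_nonneg[OF \<mu> b] l in auto)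
    show "\<forall>\<^sub>F x in at_top. mitlef \<mu> b (l * x) \<le> C / (1 + l * x)"
      using eventually_ge_at_top[of 0] by eventually_elim (use C l in auto)
    have "filterlim (\<lambda>x. 1 + l * x) at_top at_top"
      using l by (intro filterlim_tendsto_add_at_top[OF tendsto_const] filterlim_tendsto_pos_mult_at_top[OF tendsto_const _ filterlim_ident]) auto
    then show "((\<lambda>x. C / (1 + l * x)) \<longlongrightarrow> 0) at_top"
      by (intro tendsto_divide_0[OF tendsto_const] filterlim_at_top_imp_at_infinity)
  qed simp
qed

text \<open>By \<open>mitlef_sector_bound\<close> the series converges uniformly in a sector around the positive half-line, so
  its sum is holomorphic there and the identity theorem applies.\<close>

lemma sum_mitlef_continuation:
  fixes c l :: "nat \<Rightarrow> real"
  assumes \<mu>: "0 < \<mu>" "\<mu> \<le> 1" and b: "1 \<le> b" and c: "summable (\<lambda>n. \<bar>c n\<bar>)" and l: "\<And>n. 0 < l n"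
    and R: "0 < R" and zero: "\<And>x. 0 < x \<Longrightarrow> x < R \<Longrightarrow> (\<Sum>n. c n * mitlef \<mu> b (l n * x)) = 0" and x: "0 < x"
  shows "(\<Sum>n. c n * mitlef \<mu> b (l n * x)) = 0"
proof -
  \<comment> \<open>The open sector of the uniform bound.\<close>
  define U where "U = {z::complex. Re z > 0 \<and> \<bar>Im z\<bar> < Re z / 2}"
  have b0: "b > 0" using b by simp
  have bound: "norm (of_real (c n) * mitlef \<mu> b (of_real (l n) * z)) \<le> \<bar>c n\<bar> * (2 / Gamma b)" if z: "z \<in> U" for n and z :: complex
  proof -
    have "norm (mitlef \<mu> b (of_real (l n) * z)) \<le> 2 / Gamma b"
      using z l[of n] mult_strict_left_mono[of "\<bar>Im z\<bar>" "Re z / 2" "l n"]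
      by (intro mitlef_sector_bound[OF \<mu> b]) (auto simp: U_def abs_mult)
    from mult_left_mono[OF this, of "\<bar>c n\<bar>"] show ?thesis by (simp add: norm_mult)
  qed
  have U: "U = {z. 0 < Re z} \<inter> {z. Im z < Re z / 2} \<inter> {z. - Im z < Re z / 2}" by (auto simp: U_def abs_less_iff)
  have openU: "open U" unfolding U by (intro open_Int open_Collect_less continuous_intros) auto
  have conU: "connected U"
  proof (rule convex_connected)
    show "convex U"
      unfolding U
    proof (intro convex_Int)
      have "convex {z::complex. inner (Complex 1 0) z > 0}" by (rule convex_halfspace_gt)
      then show "convex {z::complex. 0 < Re z}" by (simp add: inner_complex_def)
      have "convex {z::complex. inner (Complex (-1/2) 1) z < 0}" by (rule convex_halfspace_lt)
      then show "convex {z::complex. Im z < Re z / 2}" by (simp add: inner_complex_def)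
      have "convex {z::complex. inner (Complex (-1/2) (-1)) z < 0}" by (rule convex_halfspace_lt)
      then show "convex {z::complex. - Im z < Re z / 2}" by (rule back_subst[of convex]) (auto simp: inner_complex_def)
    qed
  qed
  define G where "G z = (\<Sum>n. of_real (c n) * mitlef \<mu> b (of_real (l n) * z))" for z :: complex
  have ul: "uniform_limit U (\<lambda>N z. \<Sum>n<N. of_real (c n) * mitlef \<mu> b (of_real (l n) * z)) G sequentially"
    unfolding G_def by (rule Weierstrass_m_test[OF bound]) (use c in \<open>auto intro: summable_mult2\<close>)
  have hol: "(\<lambda>z. \<Sum>n<N. of_real (c n) * mitlef \<mu> b (of_real (l n) * z)) holomorphic_on U" for N
  proof -
    have m: "(mitlef \<mu> b :: complex \<Rightarrow> complex) holomorphic_on UNIV"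
      using mitlef_differentiable[OF \<mu>(1) b0] unfolding holomorphic_on_def field_differentiable_def by (metis at_within_open open_UNIV UNIV_I)
    have "(mitlef \<mu> b \<circ> (\<lambda>z. of_real (l n) * z)) holomorphic_on U" for n
      by (intro holomorphic_on_compose holomorphic_intros holomorphic_on_subset[OF m]) auto
    then show ?thesis unfolding o_def by (intro holomorphic_intros)
  qed
  have Ghol: "G holomorphic_on U"
  proof (rule holomorphic_uniform_sequence[OF openU hol])
    fix z assume "z \<in> U"
    then obtain d where "d > 0" "cball z d \<subseteq> U" using openU open_contains_cball by blast
    then show "\<exists>d>0. cball z d \<subseteq> U \<and> uniform_limit (cball z d) (\<lambda>N z. \<Sum>n<N. of_real (c n) * mitlef \<mu> b (of_real (l n) * z)) G sequentially"
      using uniform_limit_on_subset[OF ul] by blast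
  qed
  have Greal: "G (of_real y) = of_real (\<Sum>n. c n * mitlef \<mu> b (l n * y))" if y: "0 < y" for y
  proof -
    have "(\<lambda>n. \<bar>c n * mitlef \<mu> b (l n * y)\<bar>) = (\<lambda>n. norm (of_real (c n) * mitlef \<mu> b (of_real (l n) * of_real y :: complex)))"
      using mitlef_of_real[OF \<mu>(1) b0, where 'a = complex] by (simp add: norm_mult abs_mult flip: of_real_mult)
    moreover have "summable (\<lambda>n. norm (of_real (c n) * mitlef \<mu> b (of_real (l n) * of_real y :: complex)))"
      by (rule summable_comparison_test[OF exI[of _ 0] summable_mult2[OF c, of "2 / Gamma b"]])
        (use bound[of "of_real y"] y in \<open>auto simp: U_def\<close>)
    ultimately have s: "summable (\<lambda>n. c n * mitlef \<mu> b (l n * y))" by (metis summable_rabs_cancel)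
    have "(\<lambda>n. of_real (c n * mitlef \<mu> b (l n * y)) :: complex) sums of_real (\<Sum>n. c n * mitlef \<mu> b (l n * y))"
      by (intro sums_of_real summable_sums s)
    then show ?thesis
      using mitlef_of_real[OF \<mu>(1) b0, where 'a = complex] by (simp add: G_def sums_iff flip: of_real_mult)
  qed
  have "G (of_real x) = 0"
  proof (rule analytic_continuation[OF Ghol openU conU, of "of_real ` {0<..<R}" "of_real (R/2)"])
    show "of_real ` {0<..<R} \<subseteq> U" by (auto simp: U_def)
    show "of_real (R/2) \<in> U" "of_real x \<in> U" using R x by (auto simp: U_def)
    show "G z = 0" if "z \<in> of_real ` {0<..<R}" for z using that Greal zero by auto
    show "complex_of_real (R/2) islimpt of_real ` {0<..<R}"
    proof (rule islimpt_isCont_image)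
      show "(R/2) islimpt {0<..<R}" using R by (intro interior_limit_point) (auto simp: interior_open)
      show "\<forall>\<^sub>F y in at (R/2). complex_of_real y \<noteq> complex_of_real (R/2)"
        unfolding of_real_eq_iff by (simp add: eventually_at_filter del: of_real_divide)
    qed auto
  qed
  then show ?thesis using Greal[OF x] by simp
qed

text \<open>The numbers \<open>1 / l n\<close> lie in a compact interval. By Weierstrass approximation the sum vanishes with
  any continuous function \<open>f\<close> of \<open>1 / l n\<close> in place of the powers, after splitting off one factor
  \<open>1 / l n\<close>; tent functions that shrink to the point \<open>1 / \<sigma>\<close> isolate the group of \<open>\<sigma>\<close>.\<close>

lemma moments_vanish_imp_groups_vanish:
  fixes c l :: "nat \<Rightarrow> real"
  assumes c: "summable (\<lambda>n. \<bar>c n\<bar>)" and l0: "0 < l0" and l: "\<And>n. l0 \<le> l n"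
    and zero: "\<And>j. j \<ge> 1 \<Longrightarrow> (\<Sum>n. c n / l n ^ j) = 0" and fin: "finite {n. l n = \<sigma>}"
  shows "(\<Sum>n | l n = \<sigma>. c n) = 0"
proof (cases "\<exists>n. l n = \<sigma>")
  case False
  then show ?thesis by simp
next
  case True
  then have \<sigma>: "\<sigma> \<ge> l0" using l by auto
  define z where "z n = 1 / l n" for n
  have z: "0 < z n" "z n \<le> 1 / l0" for n using l[of n] l0 by (auto simp: z_def field_simps)
  have lpos: "0 < l n" for n using l[of n] l0 by linarith
  have cz: "summable (\<lambda>n. \<bar>c n * f n\<bar>)" if "\<And>n. \<bar>f n\<bar> \<le> K" for f :: "nat \<Rightarrow> real" and K
    by (rule summable_comparison_test[OF exI[of _ 0] summable_mult2[OF c, of K]])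
      (use that in \<open>auto simp: abs_mult intro!: mult_left_mono\<close>)
  have czs: "summable (\<lambda>n. c n * f n)" if "\<And>n. \<bar>f n\<bar> \<le> K" for f :: "nat \<Rightarrow> real" and K
    by (rule summable_rabs_cancel[OF cz[of f K]]) (use that in auto)
  have mon: "(\<Sum>n. c n * (z n * z n ^ i)) = 0" for i
  proof -
    have "c n * (z n * z n ^ i) = c n / l n ^ Suc i" for n
      unfolding power_Suc[symmetric] z_def power_one_over by simp
    then show ?thesis using zero[of "Suc i"] by (simp only:)
  qed
  have zi: "\<bar>z n * z n ^ i\<bar> \<le> (1 / l0) ^ Suc i" for n i
  proof -
    have "z n ^ Suc i \<le> (1 / l0) ^ Suc i" using z[of n] by (intro power_mono) auto
    moreover have "\<bar>z n * z n ^ i\<bar> = z n ^ Suc i" unfolding power_Suc[symmetric] using z(1)[of n] by (intro abs_of_nonneg) simp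
    ultimately show ?thesis by (simp only:)
  qed
  have poly: "(\<Sum>n. c n * (z n * p (z n))) = 0" if "real_polynomial_function p" for p :: "real \<Rightarrow> real"
  proof -
    from that obtain a :: "nat \<Rightarrow> real" and N where p: "p = (\<lambda>x. \<Sum>i\<le>N. a i * x ^ i)"
      unfolding real_polynomial_function_iff_sum by auto
    have "(\<lambda>n. \<Sum>i\<le>N. a i * (c n * (z n * z n ^ i))) sums (\<Sum>i\<le>N. a i * 0)"
    proof (intro sums_sum sums_mult)
      fix i
      have "summable (\<lambda>n. c n * (z n * z n ^ i))" by (rule czs[of "\<lambda>n. z n * z n ^ i" "(1 / l0) ^ Suc i"]) (rule zi)
      then show "(\<lambda>n. c n * (z n * z n ^ i)) sums 0" using mon[of i] by (simp add: sums_iff)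
    qed
    moreover have "(\<lambda>n. \<Sum>i\<le>N. a i * (c n * (z n * z n ^ i))) = (\<lambda>n. c n * (z n * p (z n)))"
      unfolding p sum_distrib_left by (intro ext sum.cong refl) (simp only: mult_ac)
    ultimately show ?thesis by (simp add: sums_iff)
  qed
  have cont: "(\<Sum>n. c n * (z n * f (z n))) = 0" if f: "continuous_on {0..1 / l0} f" for f :: "real \<Rightarrow> real"
  proof -
    define K where "K = (\<Sum>n. \<bar>c n\<bar>) * (1 / l0)"
    have K: "0 \<le> K" unfolding K_def using l0 by (intro mult_nonneg_nonneg suminf_nonneg c) auto
    have fb: "\<exists>B. \<forall>n. \<bar>z n * f (z n)\<bar> \<le> B"
    proof -
      have "compact (f ` {0..1/l0})" by (intro compact_continuous_image f) auto
      then obtain B where B: "\<forall>x\<in>f ` {0..1/l0}. norm x \<le> B" using compact_imp_bounded bounded_iff by metis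
      have "\<bar>z n * f (z n)\<bar> \<le> (1/l0) * B" for n
        unfolding abs_mult using z[of n] B l0 by (intro mult_mono) (auto simp: less_imp_le)
      then show ?thesis by blast
    qed
    have "\<bar>\<Sum>n. c n * (z n * f (z n))\<bar> \<le> K * \<epsilon>" if \<epsilon>: "\<epsilon> > 0" for \<epsilon>
    proof -
      obtain p where p: "real_polynomial_function p" "\<And>x. x \<in> {0..1/l0} \<Longrightarrow> \<bar>f x - p x\<bar> < \<epsilon>"
        using Stone_Weierstrass_real_polynomial_function[OF _ f \<epsilon>] by blast
      have pc: "continuous_on {0..1/l0} p"
        using p(1) continuous_real_polymonial_function by (blast intro: continuous_at_imp_continuous_on)
      have pb: "\<exists>B. \<forall>n. \<bar>z n * p (z n)\<bar> \<le> B"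
      proof -
        have "compact (p ` {0..1/l0})" by (intro compact_continuous_image pc) auto
        then obtain B where B: "\<forall>x\<in>p ` {0..1/l0}. norm x \<le> B" using compact_imp_bounded bounded_iff by metis
        have "\<bar>z n * p (z n)\<bar> \<le> (1/l0) * B" for n
          unfolding abs_mult using z[of n] B l0 by (intro mult_mono) (auto simp: less_imp_le)
        then show ?thesis by blast
      qed
      have "(\<Sum>n. c n * (z n * f (z n))) = (\<Sum>n. c n * (z n * f (z n))) - (\<Sum>n. c n * (z n * p (z n)))"
        using poly[OF p(1)] by simp
      also have "\<dots> = (\<Sum>n. c n * (z n * f (z n)) - c n * (z n * p (z n)))"
      proof -
        obtain B B' where "\<And>n. \<bar>z n * f (z n)\<bar> \<le> B" "\<And>n. \<bar>z n * p (z n)\<bar> \<le> B'" using fb pb by blast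
        then have "summable (\<lambda>n. c n * (z n * f (z n)))" "summable (\<lambda>n. c n * (z n * p (z n)))"
          using czs[of "\<lambda>n. z n * f (z n)" B] czs[of "\<lambda>n. z n * p (z n)" B'] by blast+
        then show ?thesis by (rule suminf_diff)
      qed
      also have "\<dots> = (\<Sum>n. c n * (z n * (f (z n) - p (z n))))" by (simp add: algebra_simps)
      also have "\<bar>\<dots>\<bar> \<le> (\<Sum>n. \<bar>c n\<bar> * ((1/l0) * \<epsilon>))"
      proof -
        have le: "\<bar>z n * (f (z n) - p (z n))\<bar> \<le> (1/l0) * \<epsilon>" for n
          unfolding abs_mult using z[of n] p(2)[of "z n"] l0 by (intro mult_mono) (auto simp: less_imp_le)
        have sm: "summable (\<lambda>n. \<bar>c n * (z n * (f (z n) - p (z n)))\<bar>)"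
          by (rule cz[of "\<lambda>n. z n * (f (z n) - p (z n))" "(1/l0) * \<epsilon>"]) (rule le)
        have "\<bar>\<Sum>n. c n * (z n * (f (z n) - p (z n)))\<bar> \<le> (\<Sum>n. \<bar>c n * (z n * (f (z n) - p (z n)))\<bar>)"
          by (rule summable_rabs[OF sm])
        also have "\<dots> \<le> (\<Sum>n. \<bar>c n\<bar> * ((1/l0) * \<epsilon>))"
        proof (rule suminf_le[OF _ sm summable_mult2[OF c]])
          show "\<bar>c n * (z n * (f (z n) - p (z n)))\<bar> \<le> \<bar>c n\<bar> * ((1/l0) * \<epsilon>)" for n
            using mult_left_mono[OF le[of n], of "\<bar>c n\<bar>"] by (simp only: abs_mult abs_ge_zero)
        qed
        finally show ?thesis .
      qed
      also have "\<dots> = K * \<epsilon>" using suminf_mult2[OF c, of "(1/l0) * \<epsilon>"] by (simp add: K_def)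
      finally show ?thesis .
    qed
    then have small: "\<bar>\<Sum>n. c n * (z n * f (z n))\<bar> \<le> K * \<epsilon>" if "\<epsilon> > 0" for \<epsilon> using that by blast
    have "((\<lambda>\<epsilon>. K * \<epsilon>) \<longlongrightarrow> K * 0) (at_right 0)" by (intro tendsto_intros)
    moreover have "\<forall>\<^sub>F \<epsilon> in at_right 0. \<bar>\<Sum>n. c n * (z n * f (z n))\<bar> \<le> K * \<epsilon>"
      using small by (auto simp: eventually_at_filter)
    ultimately have "\<bar>\<Sum>n. c n * (z n * f (z n))\<bar> \<le> K * 0" by (intro tendsto_lowerbound) auto
    then show ?thesis by simp
  qed
  \<comment> \<open>Tent functions shrinking to the point \<open>1 / \<sigma>\<close>.\<close>
  define f where "f k x = max 0 (1 - real k * \<bar>x - 1 / \<sigma>\<bar>)" for k :: nat and x :: real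
  have f01: "0 \<le> f k x" "f k x \<le> 1" for k x by (auto simp: f_def)
  have "(\<lambda>k. \<Sum>n. c n * (z n * f k (z n))) \<longlonglongrightarrow> (\<Sum>n. if l n = \<sigma> then c n * z n else 0)"
  proof (rule tannerys_theorem[of "\<lambda>n k. c n * (z n * f k (z n))" "\<lambda>n. if l n = \<sigma> then c n * z n else 0" sequentially "\<lambda>n. \<bar>c n\<bar> * (1/l0)", THEN conjunct2, THEN conjunct2])
    show "(\<lambda>k. c n * (z n * f k (z n))) \<longlonglongrightarrow> (if l n = \<sigma> then c n * z n else 0)" for n
    proof (cases "l n = \<sigma>")
      case True
      then have "f k (z n) = 1" for k by (simp add: f_def z_def)
      then show ?thesis using True by simp
    next
      case False
      then have d: "\<bar>z n - 1 / \<sigma>\<bar> > 0" using \<sigma> l0 lpos[of n] by (simp add: z_def field_simps)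
      have "eventually (\<lambda>k. real k \<ge> 1 / \<bar>z n - 1 / \<sigma>\<bar>) sequentially"
        using filterlim_real_sequentially by (simp add: filterlim_at_top)
      then have "eventually (\<lambda>k. c n * (z n * f k (z n)) = 0) sequentially"
        by eventually_elim (use d in \<open>auto simp: f_def field_simps\<close>)
      then show ?thesis using False by (simp add: tendsto_eventually)
    qed
    have "norm (c n * (z n * f k (z n))) \<le> \<bar>c n\<bar> * (1/l0)" for n k
    proof -
      have "\<bar>z n * f k (z n)\<bar> \<le> (1/l0) * 1" unfolding abs_mult using z[of n] f01[of k "z n"] l0 by (intro mult_mono) auto
      then have "\<bar>c n\<bar> * \<bar>z n * f k (z n)\<bar> \<le> \<bar>c n\<bar> * ((1/l0) * 1)" by (rule mult_left_mono) simp
      then show ?thesis by (simp add: abs_mult)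
    qed
    then show "\<forall>\<^sub>F (n, k) in at_top \<times>\<^sub>F sequentially. norm (c n * (z n * f k (z n))) \<le> \<bar>c n\<bar> * (1/l0)"
      by (intro always_eventually) auto
    show "summable (\<lambda>n. \<bar>c n\<bar> * (1/l0))" by (rule summable_mult2[OF c])
  qed simp
  moreover have "(\<Sum>n. c n * (z n * f k (z n))) = 0" for k
    by (rule cont) (auto simp: f_def intro!: continuous_intros)
  ultimately have "(\<lambda>k::nat. 0::real) \<longlonglongrightarrow> (\<Sum>n. if l n = \<sigma> then c n * z n else 0)" by simp
  then have "(\<Sum>n. if l n = \<sigma> then c n * z n else 0) = 0" using LIMSEQ_unique tendsto_const by blast
  moreover have "(\<Sum>n. if l n = \<sigma> then c n * z n else 0) = (\<Sum>n | l n = \<sigma>. if l n = \<sigma> then c n * z n else 0)"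
    by (rule suminf_finite[OF fin]) auto
  moreover have "(\<Sum>n | l n = \<sigma>. if l n = \<sigma> then c n * z n else 0) = (\<Sum>n | l n = \<sigma>. c n) / \<sigma>"
    by (simp add: z_def sum_divide_distrib)
  ultimately show ?thesis using \<sigma> l0 by simp
qed

text \<open>Induction on \<open>j\<close>. If the sum with coefficients \<open>c n / l n ^ j\<close> vanishes for all positive arguments, so
  does its fractional integral of order \<open>\<mu>\<close>; by the recurrence this says that the sum with
  coefficients \<open>c n / l n ^ Suc j\<close> is constant in the argument of the Mittag-Leffler function. It
  tends to \<open>0\<close> at infinity, so the constant, which is the next moment up to the factor \<open>Gamma b\<close>, is \<open>0\<close>.\<close>

lemma relax_moments_vanish:
  fixes c l :: "nat \<Rightarrow> real"
  assumes \<mu>: "0 < \<mu>" "\<mu> \<le> 1" and b: "1 \<le> b" and c: "summable (\<lambda>n. \<bar>c n\<bar>)" and l0: "0 < l0" and l: "\<And>n. l0 \<le> l n"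
    and R: "0 < R" and zero: "\<And>x. 0 < x \<Longrightarrow> x < R \<Longrightarrow> (\<Sum>n. c n * mitlef \<mu> b (l n * x)) = 0" and j: "j \<ge> 1"
  shows "(\<Sum>n. c n / l n ^ j) = 0"
proof -
  have lpos: "0 < l n" for n using l[of n] l0 by linarith
  have b\<mu>: "\<mu> \<le> b" and b0: "0 < b" using \<mu> b by auto
  have ml: "0 \<le> mitlef \<mu> b (l n * x)" "mitlef \<mu> b (l n * x) \<le> 1 / Gamma b" if "0 \<le> x" for n x
    using that lpos[of n] by (auto intro!: mitlef_nonneg[OF \<mu> b\<mu>] mitlef_le_Gamma[OF \<mu> b\<mu>])
  have cj: "summable (\<lambda>n. \<bar>c n / l n ^ j\<bar>)" for j
  proof (rule summable_comparison_test[OF exI[of _ 0] summable_mult2[OF c, of "1 / l0 ^ j"]], intro allI impI)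
    fix n
    have "1 / l n ^ j \<le> 1 / l0 ^ j" using l[of n] l0 by (intro divide_left_mono power_mono) (auto simp: lpos)
    then have "\<bar>c n\<bar> * (1 / l n ^ j) \<le> \<bar>c n\<bar> * (1 / l0 ^ j)" by (intro mult_left_mono) auto
    then show "norm \<bar>c n / l n ^ j\<bar> \<le> \<bar>c n\<bar> * (1 / l0 ^ j)" using lpos[of n] by (simp add: abs_mult)
  qed
  have sj: "summable (\<lambda>n. \<bar>c n / l n ^ j * mitlef \<mu> b (l n * x)\<bar>)" if "0 \<le> x" for j x
  proof (rule summable_comparison_test[OF exI[of _ 0] summable_mult2[OF cj[of j], of "1 / Gamma b"]], intro allI impI)
    fix n
    have "\<bar>c n / l n ^ j * mitlef \<mu> b (l n * x)\<bar> \<le> \<bar>c n / l n ^ j\<bar> * (1 / Gamma b)"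
      unfolding abs_mult using ml[OF that, of n] by (intro mult_left_mono) auto
    then show "norm \<bar>c n / l n ^ j * mitlef \<mu> b (l n * x)\<bar> \<le> \<bar>c n / l n ^ j\<bar> * (1 / Gamma b)" by simp
  qed
  have G: "(\<forall>x>0. (\<Sum>n. c n / l n ^ j * mitlef \<mu> b (l n * x)) = 0) \<and> (j \<ge> 1 \<longrightarrow> (\<Sum>n. c n / l n ^ j) = 0)" for j
  proof (induction j)
    case 0
    show ?case using sum_mitlef_continuation[OF \<mu> b c lpos R zero] by simp
  next
    case (Suc j)
    define C where "C = (\<Sum>n. c n / l n ^ Suc j)"
    have key: "(\<Sum>n. c n / l n ^ Suc j * relax \<mu> b (l n) t) = C * (t powr (b - 1) / Gamma b)" if t: "0 < t" for t
    proof -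
      define f where "f n s = indicator {0<..<t} s *\<^sub>R frac_kernel \<mu> (\<lambda>s. c n / l n ^ j * relax \<mu> b (l n) s) t s" for n s
      have I: "has_bochner_integral lborel (f n) (c n / l n ^ j * relax \<mu> (b + \<mu>) (l n) t)" for n
        using has_frac_integral_mult[OF has_frac_integral_relax[OF \<mu>(1) b0 \<mu>(1) t, of "l n"], of "c n / l n ^ j"]
        by (simp add: has_frac_integral_def f_def[abs_def])
      have rn: "0 \<le> relax \<mu> b (l n) s" for n s using ml(1)[of "s powr \<mu>" n] by (simp add: relax_def)
      have nf: "norm (f n s) = \<bar>c n / l n ^ j\<bar> * (indicator {0<..<t} s *\<^sub>R frac_kernel \<mu> (relax \<mu> b (l n)) t s)" for n s
        using Gamma_real_pos[OF \<mu>(1)] rn[of n s] by (simp add: f_def frac_kernel_def abs_mult indicator_def mult_ac)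
      have In: "(LINT s|lborel. norm (f n s)) = \<bar>c n / l n ^ j\<bar> * relax \<mu> (b + \<mu>) (l n) t" for n
        unfolding nf using has_frac_integral_relax[OF \<mu>(1) b0 \<mu>(1) t, of "l n"] by (simp add: has_frac_integral_def has_bochner_integral_iff)
      have r2: "relax \<mu> (b + \<mu>) (l n) t = (t powr (b - 1) / Gamma b - relax \<mu> b (l n) t) / l n" for n
        using relax_recurrence[OF \<mu>(1) b0 t, of "l n"] lpos[of n] by (simp add: field_simps)
      have r2le: "0 \<le> relax \<mu> (b + \<mu>) (l n) t" "relax \<mu> (b + \<mu>) (l n) t \<le> t powr (b - 1) / Gamma b / l0" for n
      proof -
        show "0 \<le> relax \<mu> (b + \<mu>) (l n) t" using \<mu> b lpos[of n] by (auto simp: relax_def intro!: mult_nonneg_nonneg mitlef_nonneg)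
        have "relax \<mu> (b + \<mu>) (l n) t \<le> t powr (b - 1) / Gamma b / l n" unfolding r2 using rn[of n t] lpos[of n] by (intro divide_right_mono) auto
        also have "\<dots> \<le> t powr (b - 1) / Gamma b / l0" using l[of n] l0 lpos[of n] Gamma_real_pos[OF b0] by (intro divide_left_mono) auto
        finally show "relax \<mu> (b + \<mu>) (l n) t \<le> t powr (b - 1) / Gamma b / l0" .
      qed
      have r2n: "norm (\<bar>c n / l n ^ j\<bar> * relax \<mu> (b + \<mu>) (l n) t) \<le> \<bar>c n / l n ^ j\<bar> * (t powr (b - 1) / Gamma b / l0)" for n
        unfolding real_norm_def abs_mult abs_idempotent abs_of_nonneg[OF r2le(1)] by (intro mult_left_mono r2le) simp
      have g2: "summable (\<lambda>n. LINT s|lborel. norm (f n s))"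
        unfolding In by (rule summable_comparison_test[OF exI[of _ 0] summable_mult2[OF cj[of j], of "t powr (b - 1) / Gamma b / l0"]])
          (use r2n in blast)
      have sr: "summable (\<lambda>n. \<bar>c n / l n ^ j\<bar> * relax \<mu> b (l n) s)" for s
        using summable_mult[OF sj[of "s powr \<mu>" j], of "s powr (b - 1)"] ml(1)[of "s powr \<mu>"]
        by (simp add: relax_def abs_mult mult_ac)
      have g1: "AE s in lborel. summable (\<lambda>n. norm (f n s))"
      proof (rule AE_I2)
        fix s
        have eq: "(\<lambda>n. norm (f n s)) = (\<lambda>n. (indicator {0<..<t} s * ((t - s) powr (\<mu> - 1) / Gamma \<mu>)) * (\<bar>c n / l n ^ j\<bar> * relax \<mu> b (l n) s))"
          unfolding nf by (simp add: frac_kernel_def fun_eq_iff mult_ac)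
        show "summable (\<lambda>n. norm (f n s))" unfolding eq by (rule summable_mult[OF sr])
      qed
      have "(\<lambda>n. integral\<^sup>L lborel (f n)) sums (LINT s|lborel. (\<Sum>n. f n s))"
        using I by (intro sums_integral g1 g2) (auto simp: has_bochner_integral_iff)
      moreover have "(\<Sum>n. f n s) = 0" for s
      proof (cases "0 < s \<and> s < t")
        case True
        have "(\<Sum>n. f n s) = (\<Sum>n. ((t - s) powr (\<mu> - 1) / Gamma \<mu> * s powr (b - 1)) * (c n / l n ^ j * mitlef \<mu> b (l n * s powr \<mu>)))"
          using True by (simp add: f_def frac_kernel_def relax_def mult_ac)
        also have "\<dots> = ((t - s) powr (\<mu> - 1) / Gamma \<mu> * s powr (b - 1)) * (\<Sum>n. c n / l n ^ j * mitlef \<mu> b (l n * s powr \<mu>))"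
          by (rule suminf_mult) (rule summable_rabs_cancel[OF sj], simp)
        also have "\<dots> = 0" using Suc.IH True by simp
        finally show ?thesis .
      qed (simp add: f_def)
      ultimately have z: "(\<lambda>n. c n / l n ^ j * relax \<mu> (b + \<mu>) (l n) t) sums 0"
        using I by (simp add: has_bochner_integral_iff)
      have e: "c n / l n ^ j * relax \<mu> (b + \<mu>) (l n) t = c n / l n ^ Suc j * (t powr (b - 1) / Gamma b) - c n / l n ^ Suc j * relax \<mu> b (l n) t" for n
        unfolding r2 using lpos[of n] by (simp add: field_simps)
      have s1: "summable (\<lambda>n. c n / l n ^ Suc j * (t powr (b - 1) / Gamma b))"
        by (rule summable_mult2[OF summable_rabs_cancel[OF cj]])
      have s2: "summable (\<lambda>n. c n / l n ^ Suc j * relax \<mu> b (l n) t)"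
        using summable_mult[OF summable_rabs_cancel[OF sj[of "t powr \<mu>" "Suc j"]], of "t powr (b - 1)"] by (simp add: relax_def mult_ac)
      have "(\<Sum>n. c n / l n ^ Suc j * (t powr (b - 1) / Gamma b)) - (\<Sum>n. c n / l n ^ Suc j * relax \<mu> b (l n) t) = 0"
        using z unfolding e suminf_diff[OF s1 s2] by (simp only: sums_iff)
      moreover have "(\<Sum>n. c n / l n ^ Suc j * (t powr (b - 1) / Gamma b)) = C * (t powr (b - 1) / Gamma b)"
        unfolding C_def by (rule suminf_mult2[symmetric, OF summable_rabs_cancel[OF cj]])
      ultimately show ?thesis by simp
    qed
    have Gx: "(\<Sum>n. c n / l n ^ Suc j * mitlef \<mu> b (l n * x)) = C / Gamma b" if x: "0 < x" for x
    proof -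
      define t where "t = x powr (1 / \<mu>)"
      have t: "0 < t" "t powr \<mu> = x" using x \<mu> by (auto simp: t_def powr_powr)
      have "(\<Sum>n. c n / l n ^ Suc j * relax \<mu> b (l n) t) = (\<Sum>n. t powr (b - 1) * (c n / l n ^ Suc j * mitlef \<mu> b (l n * x)))"
        by (simp add: relax_def t mult_ac)
      also have "\<dots> = t powr (b - 1) * (\<Sum>n. c n / l n ^ Suc j * mitlef \<mu> b (l n * x))"
        by (rule suminf_mult) (rule summable_rabs_cancel[OF sj], use x in simp)
      finally have eq: "(\<Sum>n. c n / l n ^ Suc j * relax \<mu> b (l n) t) = t powr (b - 1) * (\<Sum>n. c n / l n ^ Suc j * mitlef \<mu> b (l n * x))" .
      have tp: "t powr (b - 1) \<noteq> 0" using t(1) by simp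
      have "t powr (b - 1) * (\<Sum>n. c n / l n ^ Suc j * mitlef \<mu> b (l n * x)) = t powr (b - 1) * (C / Gamma b)"
        unfolding eq[symmetric] key[OF t(1)] by (simp add: mult.commute)
      then show ?thesis by (rule iffD1[OF mult_left_cancel[OF tp]])
    qed
    have "((\<lambda>x. \<Sum>n. c n / l n ^ Suc j * mitlef \<mu> b (l n * x)) \<longlongrightarrow> (\<Sum>n. c n / l n ^ Suc j * 0)) at_top"
    proof (rule tannerys_theorem[of "\<lambda>n x. c n / l n ^ Suc j * mitlef \<mu> b (l n * x)" "\<lambda>n. c n / l n ^ Suc j * 0" at_top "\<lambda>n. \<bar>c n / l n ^ Suc j\<bar> * (1 / Gamma b)", THEN conjunct2, THEN conjunct2])
      show "((\<lambda>x. c n / l n ^ Suc j * mitlef \<mu> b (l n * x)) \<longlongrightarrow> c n / l n ^ Suc j * 0) at_top" for n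
        by (intro tendsto_mult_left relax_limit_zero \<mu> b\<mu> lpos)
      have le: "norm (c n / l n ^ Suc j * mitlef \<mu> b (l n * x)) \<le> \<bar>c n / l n ^ Suc j\<bar> * (1 / Gamma b)" if "0 \<le> x" for n x
        unfolding real_norm_def abs_mult using ml[OF that, of n] by (intro mult_left_mono) auto
      show "\<forall>\<^sub>F (n, x) in at_top \<times>\<^sub>F at_top. norm (c n / l n ^ Suc j * mitlef \<mu> b (l n * x)) \<le> \<bar>c n / l n ^ Suc j\<bar> * (1 / Gamma b)"
        unfolding eventually_prod_filter
        by (intro exI[of _ "\<lambda>_. True"] exI[of _ "\<lambda>x. 0 \<le> x"]) (use le eventually_ge_at_top in auto)
      show "summable (\<lambda>n. \<bar>c n / l n ^ Suc j\<bar> * (1 / Gamma b))" by (rule summable_mult2[OF cj])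
    qed simp
    moreover have "\<forall>\<^sub>F x in at_top. (\<Sum>n. c n / l n ^ Suc j * mitlef \<mu> b (l n * x)) = C / Gamma b"
      using eventually_gt_at_top[of 0] by eventually_elim (rule Gx)
    ultimately have "((\<lambda>x::real. C / Gamma b) \<longlongrightarrow> 0) at_top"
      by (simp add: Lim_transform_eventually)
    then have "C / Gamma b = 0" by (simp add: tendsto_const_iff)
    then have "C = 0" using Gamma_real_pos[OF b0] by simp
    then show ?case using Gx by (simp add: C_def)
  qed
  then show ?thesis using j by blast
qed

section \<open>Weak solutions for polynomial controls\<close>

lemma powr_le_powr_smaller_exponent:
  fixes t T x y :: real
  assumes "0 < t" "t \<le> T" "y \<le> x"
  shows "t powr x \<le> T powr (x - y) * t powr y"
proof -
  have "t powr x = t powr (x - y) * t powr y" by (simp add: powr_add[symmetric])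
  also have "\<dots> \<le> T powr (x - y) * t powr y" using assms by (intro mult_right_mono powr_mono2) auto
  finally show ?thesis .
qed

text \<open>Half a power of the decay \<open>1 / (1 + l * \<tau>)\<close> pays for the weight of the form domain.\<close>

lemma sqrt_weight_bound:
  fixes l \<tau> T0 :: real
  assumes "0 < l" "0 < \<tau>" "\<tau> \<le> T0"
  shows "sqrt (1 + l) / (1 + l * \<tau>) \<le> (sqrt T0 + 1) / sqrt \<tau>" "l / (1 + l * \<tau>) \<le> sqrt (1 + l) * ((sqrt T0 + 1) / sqrt \<tau>)"
proof -
  define a where "a = sqrt l"
  define c where "c = sqrt \<tau>"
  have a: "a > 0" "l = a\<^sup>2" using assms by (auto simp: a_def)
  have c: "c > 0" "\<tau> = c\<^sup>2" "c \<le> sqrt T0" using assms by (auto simp: c_def)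
  have ac: "a * c \<le> 1 + l * \<tau>"
    using zero_le_power2[of "a * c - 1"] mult_pos_pos[OF a(1) c(1)] by (simp add: a(2) c(2) power2_diff power_mult_distrib)
  have p: "1 + l * \<tau> > 0" using assms by (simp add: add_pos_pos)
  have "sqrt (1 + l) \<le> 1 + a" using sqrt_add_le_add_sqrt[of 1 l] assms by (simp add: a_def)
  then have "sqrt (1 + l) * c \<le> (1 + a) * c" using c by (intro mult_right_mono) auto
  also have "\<dots> = c + a * c" by (simp add: algebra_simps)
  also have "\<dots> \<le> sqrt T0 * (1 + l * \<tau>) + 1 * (1 + l * \<tau>)"
  proof (intro add_mono)
    have "sqrt T0 * 1 \<le> sqrt T0 * (1 + l * \<tau>)" using assms by (intro mult_left_mono) auto
    then show "c \<le> sqrt T0 * (1 + l * \<tau>)" using c(3) by linarith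
    show "a * c \<le> 1 * (1 + l * \<tau>)" using ac by simp
  qed
  also have "\<dots> = (sqrt T0 + 1) * (1 + l * \<tau>)" by (simp add: algebra_simps)
  finally show 1: "sqrt (1 + l) / (1 + l * \<tau>) \<le> (sqrt T0 + 1) / sqrt \<tau>"
    using p c(1) unfolding c_def[symmetric] by (simp add: pos_divide_le_eq pos_le_divide_eq mult.commute)
  have "l / (1 + l * \<tau>) \<le> sqrt (1 + l) * (sqrt (1 + l) / (1 + l * \<tau>))"
    using p assms by (simp add: divide_right_mono)
  also have "\<dots> \<le> sqrt (1 + l) * ((sqrt T0 + 1) / sqrt \<tau>)" using 1 assms by (intro mult_left_mono) auto
  finally show "l / (1 + l * \<tau>) \<le> sqrt (1 + l) * ((sqrt T0 + 1) / sqrt \<tau>)" .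
qed

context hilfer_problem
begin

text \<open>Uniform bounds in the weights of \<open>H\<close>, of the form domain and of its dual. The loss
  \<open>t powr (- \<mu> / 2)\<close> in the last two is the price of half a power of \<open>lam n\<close>.\<close>

lemma relax_bounds:
  assumes B: "\<mu> \<le> B"
  obtains C where "0 \<le> C"
    "\<And>n t. t \<in> {0<..T} \<Longrightarrow> \<bar>relax \<mu> B (lam n) t\<bar> \<le> C * t powr (B - 1)"
    "\<And>n t. t \<in> {0<..T} \<Longrightarrow> sqrt (wt n) * \<bar>relax \<mu> B (lam n) t\<bar> \<le> C * t powr (B - 1 - \<mu>/2)"
    "\<And>n t. t \<in> {0<..T} \<Longrightarrow> 1 / sqrt (wt n) * \<bar>lam n * relax \<mu> B (lam n) t\<bar> \<le> C * t powr (B - 1 - \<mu>/2)"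
proof -
  obtain C where C: "C > 0" "\<And>x. x \<ge> 0 \<Longrightarrow> mitlef \<mu> B (x::real) \<le> C / (1 + x)" using mitlef_decay[OF \<mu> B] by blast
  define K where "K = sqrt (T powr \<mu>) + 1"
  have K: "K \<ge> 1" by (simp add: K_def)
  have main: "\<bar>relax \<mu> B (lam n) t\<bar> \<le> t powr (B - 1) * (C / (1 + lam n * t powr \<mu>))" if "t \<in> {0<..T}" for n t
  proof -
    have "0 \<le> lam n * t powr \<mu>" using lam_pos[of n] by simp
    then have "mitlef \<mu> B (lam n * t powr \<mu>) \<le> C / (1 + lam n * t powr \<mu>)" "0 \<le> mitlef \<mu> B (lam n * t powr \<mu>)"
      using C(2) mitlef_nonneg[OF \<mu> B] by blast+
    from mult_left_mono[OF this(1), of "t powr (B - 1)"] this(2) show ?thesis by (simp add: relax_def abs_mult)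
  qed
  have half: "t powr (B - 1 - \<mu>/2) = t powr (B - 1) * (1 / sqrt (t powr \<mu>))" if "t \<in> {0<..T}" for t
  proof -
    have "sqrt (t powr \<mu>) = t powr (\<mu>/2)" by (simp add: powr_half_sqrt[symmetric] powr_powr)
    then show ?thesis by (simp add: powr_diff)
  qed
  have tp: "0 < t powr \<mu>" "t powr \<mu> \<le> T powr \<mu>" if "t \<in> {0<..T}" for t using that \<mu> by (auto intro: powr_mono2)
  show ?thesis
  proof (rule that[of "C * K"])
    show "0 \<le> C * K" using C K by simp
    fix n t assume t: "t \<in> {0<..T}"
    note sb = sqrt_weight_bound[OF lam_pos[of n] tp[OF t], folded K_def]
    have d: "1 + lam n * t powr \<mu> \<ge> 1" using lam_pos[of n] by simp
    have "C / (1 + lam n * t powr \<mu>) \<le> C * K"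
    proof -
      have "C / (1 + lam n * t powr \<mu>) \<le> C / 1" using C d by (intro divide_left_mono) auto
      also have "\<dots> \<le> C * K" using C K by simp
      finally show ?thesis .
    qed
    then have "t powr (B - 1) * (C / (1 + lam n * t powr \<mu>)) \<le> t powr (B - 1) * (C * K)" by (rule mult_left_mono) simp
    then show "\<bar>relax \<mu> B (lam n) t\<bar> \<le> C * K * t powr (B - 1)" using main[OF t, of n] by (simp add: mult_ac)
    have "sqrt (wt n) * \<bar>relax \<mu> B (lam n) t\<bar> \<le> sqrt (wt n) * (t powr (B - 1) * (C / (1 + lam n * t powr \<mu>)))"
      using wt_pos[of n] by (intro mult_left_mono main t) auto
    also have "\<dots> = (t powr (B - 1) * C) * (sqrt (wt n) / (1 + lam n * t powr \<mu>))" by simp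
    also have "\<dots> \<le> (t powr (B - 1) * C) * (K / sqrt (t powr \<mu>))" using C by (intro mult_left_mono sb) auto
    also have "\<dots> = C * K * t powr (B - 1 - \<mu>/2)" unfolding half[OF t] by simp
    finally show "sqrt (wt n) * \<bar>relax \<mu> B (lam n) t\<bar> \<le> C * K * t powr (B - 1 - \<mu>/2)" .
    have "1 / sqrt (wt n) * \<bar>lam n * relax \<mu> B (lam n) t\<bar> \<le> 1 / sqrt (wt n) * (lam n * (t powr (B - 1) * (C / (1 + lam n * t powr \<mu>))))"
      unfolding abs_mult using wt_pos[of n] lam_pos[of n] by (intro mult_left_mono mult_mono main t) auto
    also have "\<dots> = (t powr (B - 1) * C / sqrt (wt n)) * (lam n / (1 + lam n * t powr \<mu>))" by simp
    also have "\<dots> \<le> (t powr (B - 1) * C / sqrt (wt n)) * (sqrt (wt n) * (K / sqrt (t powr \<mu>)))"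
      using C wt_pos[of n] by (intro mult_left_mono sb) auto
    also have "\<dots> = C * K * t powr (B - 1 - \<mu>/2)" unfolding half[OF t] using wt_pos[of n] by simp
    finally show "1 / sqrt (wt n) * \<bar>lam n * relax \<mu> B (lam n) t\<bar> \<le> C * K * t powr (B - 1 - \<mu>/2)" .
  qed
qed

text \<open>A bound by a power of \<open>t\<close> that is uniform over the modes in the weight \<open>w\<close>, with majorant \<open>b\<close>.\<close>

definition wbound :: "(nat \<Rightarrow> real) \<Rightarrow> (nat \<Rightarrow> real) \<Rightarrow> real \<Rightarrow> (nat \<Rightarrow> real \<Rightarrow> real) \<Rightarrow> bool" where
  "wbound b w x c \<longleftrightarrow> (\<exists>C\<ge>0. \<forall>n. \<forall>t\<in>{0<..T}. w n * \<bar>c n t\<bar> \<le> C * t powr x * b n)"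

lemma wboundE:
  assumes "wbound b w x c"
  obtains C where "0 \<le> C" "\<And>n t. t \<in> {0<..T} \<Longrightarrow> w n * \<bar>c n t\<bar> \<le> C * t powr x * b n"
  using assms unfolding wbound_def by blast

lemma wbound_add:
  assumes "wbound b w x c" "wbound b w x c'" "\<And>n. 0 \<le> w n"
  shows "wbound b w x (\<lambda>n t. c n t + c' n t)"
proof -
  obtain C C' where C: "C \<ge> 0" "C' \<ge> 0" "\<And>n t. t \<in> {0<..T} \<Longrightarrow> w n * \<bar>c n t\<bar> \<le> C * t powr x * b n"
    "\<And>n t. t \<in> {0<..T} \<Longrightarrow> w n * \<bar>c' n t\<bar> \<le> C' * t powr x * b n" using assms(1,2) unfolding wbound_def by metis
  have "w n * \<bar>c n t + c' n t\<bar> \<le> (C + C') * t powr x * b n" if "t \<in> {0<..T}" for n t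
  proof -
    have "w n * \<bar>c n t + c' n t\<bar> \<le> w n * \<bar>c n t\<bar> + w n * \<bar>c' n t\<bar>"
      unfolding distrib_left[symmetric] using assms(3) by (intro mult_left_mono) auto
    also have "\<dots> \<le> C * t powr x * b n + C' * t powr x * b n" by (intro add_mono C that)
    finally show ?thesis by (simp add: algebra_simps)
  qed
  then show ?thesis unfolding wbound_def using C(1,2) by (intro exI[of _ "C + C'"]) auto
qed

lemma wbound_sum:
  fixes N :: nat
  assumes "\<And>m. wbound b w x (c m)" "\<And>n. 0 \<le> w n"
  shows "wbound b w x (\<lambda>n t. \<Sum>m<N. c m n t)"
proof (induction N)
  case 0
  show ?case unfolding wbound_def by (intro exI[of _ 0]) simp
next
  case (Suc N)
  then show ?case using wbound_add[OF Suc assms(1)[of N] assms(2)] by simp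
qed

lemma wbound_term:
  assumes a: "\<And>n t. t \<in> {0<..T} \<Longrightarrow> w n * \<bar>a n t\<bar> \<le> C * t powr x" and C: "0 \<le> C" and xy: "y \<le> x"
    and c: "\<And>n. \<bar>c n\<bar> \<le> b n" and w: "\<And>n. 0 \<le> w n"
  shows "wbound b w y (\<lambda>n t. k * a n t * c n)"
  unfolding wbound_def
proof (intro exI[of _ "\<bar>k\<bar> * (C * T powr (x - y))"] conjI allI ballI)
  show "0 \<le> \<bar>k\<bar> * (C * T powr (x - y))" using C by simp
  fix n t assume t: "t \<in> {0<..T}"
  have b0: "0 \<le> b n" using c[of n] by linarith
  have "w n * \<bar>k * a n t * c n\<bar> = \<bar>k\<bar> * (w n * \<bar>a n t\<bar>) * \<bar>c n\<bar>" by (simp add: abs_mult mult_ac)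
  also have "\<dots> \<le> \<bar>k\<bar> * (C * (T powr (x - y) * t powr y)) * b n"
  proof -
    have "C * t powr x \<le> C * (T powr (x - y) * t powr y)"
      using powr_le_powr_smaller_exponent[of t T y x] t xy C by (intro mult_left_mono) auto
    then have "w n * \<bar>a n t\<bar> \<le> C * (T powr (x - y) * t powr y)" using a[OF t, of n] by linarith
    from mult_mono[OF mult_left_mono[OF this, of "\<bar>k\<bar>"] c[of n]] show ?thesis using C by simp
  qed
  also have "\<dots> = \<bar>k\<bar> * (C * T powr (x - y)) * t powr y * b n" by (simp add: mult_ac)
  finally show "w n * \<bar>k * a n t * c n\<bar> \<le> \<bar>k\<bar> * (C * T powr (x - y)) * t powr y * b n" .
qed

lemma wbound_relax:
  assumes B: "\<mu> \<le> B" and c: "\<And>n. \<bar>c n\<bar> \<le> b n"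
  shows "y \<le> B - 1 \<Longrightarrow> wbound b (\<lambda>n. 1) y (\<lambda>n t. k * relax \<mu> B (lam n) t * c n)"
    and "y \<le> B - 1 - \<mu>/2 \<Longrightarrow> wbound b (\<lambda>n. sqrt (wt n)) y (\<lambda>n t. k * relax \<mu> B (lam n) t * c n)"
    and "y \<le> B - 1 - \<mu>/2 \<Longrightarrow> wbound b (\<lambda>n. 1 / sqrt (wt n)) y (\<lambda>n t. k * (lam n * relax \<mu> B (lam n) t) * c n)"
    and "y \<le> B - 1 \<Longrightarrow> wbound b (\<lambda>n. 1 / sqrt (wt n)) y (\<lambda>n t. k * relax \<mu> B (lam n) t * c n)"
proof -
  obtain C where C: "0 \<le> C"
    "\<And>n t. t \<in> {0<..T} \<Longrightarrow> \<bar>relax \<mu> B (lam n) t\<bar> \<le> C * t powr (B - 1)"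
    "\<And>n t. t \<in> {0<..T} \<Longrightarrow> sqrt (wt n) * \<bar>relax \<mu> B (lam n) t\<bar> \<le> C * t powr (B - 1 - \<mu>/2)"
    "\<And>n t. t \<in> {0<..T} \<Longrightarrow> 1 / sqrt (wt n) * \<bar>lam n * relax \<mu> B (lam n) t\<bar> \<le> C * t powr (B - 1 - \<mu>/2)"
    using relax_bounds[OF B] by blast
  have w0: "0 \<le> sqrt (wt n)" "0 \<le> 1 / sqrt (wt n)" for n using wt_pos[of n] by auto
  show "wbound b (\<lambda>n. 1) y (\<lambda>n t. k * relax \<mu> B (lam n) t * c n)" if "y \<le> B - 1"
    by (rule wbound_term[OF _ C(1) that c]) (use C(2) in auto)
  show "wbound b (\<lambda>n. sqrt (wt n)) y (\<lambda>n t. k * relax \<mu> B (lam n) t * c n)" if "y \<le> B - 1 - \<mu>/2"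
    by (rule wbound_term[OF C(3) C(1) that c w0(1)])
  show "wbound b (\<lambda>n. 1 / sqrt (wt n)) y (\<lambda>n t. k * (lam n * relax \<mu> B (lam n) t) * c n)" if "y \<le> B - 1 - \<mu>/2"
    by (rule wbound_term[OF C(4) C(1) that c w0(2)])
  have "1 / sqrt (wt n) * \<bar>relax \<mu> B (lam n) t\<bar> \<le> C * t powr (B - 1)" if "t \<in> {0<..T}" for n t
  proof -
    have "1 / sqrt (wt n) * \<bar>relax \<mu> B (lam n) t\<bar> \<le> 1 * \<bar>relax \<mu> B (lam n) t\<bar>"
      using wt_ge1[of n] by (intro mult_right_mono) auto
    then show ?thesis using C(2)[OF that, of n] by linarith
  qed
  then show "wbound b (\<lambda>n. 1 / sqrt (wt n)) y (\<lambda>n t. k * relax \<mu> B (lam n) t * c n)" if "y \<le> B - 1"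
    by (rule wbound_term[OF _ C(1) that c w0(2)])
qed

text \<open>The fractional integral of the homogeneous solution has \<open>b = 1\<close>: it starts at the initial
  value.\<close>

definition init_mode :: "'a \<Rightarrow> nat \<Rightarrow> real \<Rightarrow> real" where
  "init_mode u0 n t = mitlef \<mu> 1 (lam n * t powr \<mu>) * inner u0 (e n)"

text \<open>A source \<open>t ^ m\<close> is \<open>fact m\<close> times a normalized power; solving the equation raises its order by \<open>\<mu>\<close>
  and the inner integral raises it by \<open>\<alpha>\<close>.\<close>

definition forced_mode :: "nat \<Rightarrow> (nat \<Rightarrow> 'a) \<Rightarrow> nat \<Rightarrow> real \<Rightarrow> real" where
  "forced_mode M gs n t = (\<Sum>m<M. fact m * relax \<mu> (\<mu> + \<alpha> + real m + 1) (lam n) t * inner (gs m) (e n))"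

text \<open>Each mode of the solution is a sum of relaxation functions; the inner integral, its derivative and the
  outer integral only shift the parameter \<open>b\<close>, and the equation is the recurrence.\<close>

lemma weak_solution_polynomial_control:
  assumes u0: "u0 \<in> H" and gs: "\<And>m. gs m \<in> H"
  obtains u where "weak_solution H V E T \<mu> \<nu> u0 (\<lambda>t. \<Sum>m<M. t ^ m *\<^sub>R gs m) u"
    "inner_frac H \<mu> \<nu> u T = S (\<lambda>n. init_mode u0 n T + forced_mode M gs n T)"
    "vsum (\<lambda>n. init_mode u0 n T + forced_mode M gs n T)"
proof -
  define \<gamma> where "\<gamma> = 1 - \<alpha>"
  have ord: "0 \<le> \<alpha>" "0 \<le> \<kappa>" "\<alpha> + \<kappa> = 1 - \<mu>" by (rule orders)+
  have \<gamma>: "\<mu> \<le> \<gamma>" "\<gamma> \<le> 1" "0 < \<gamma>" "\<mu> + \<kappa> = \<gamma>" using ord \<mu> by (auto simp: \<gamma>_def)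
  define c0 where "c0 n = inner u0 (e n)" for n
  define cg where "cg m n = inner (gs m) (e n)" for m n
  \<comment> \<open>One square-summable majorant for all Fourier coefficients involved.\<close>
  define b where "b n = sqrt ((c0 n)\<^sup>2 + (\<Sum>m<M. (cg m n)\<^sup>2))" for n
  have b2: "(b n)\<^sup>2 = (c0 n)\<^sup>2 + (\<Sum>m<M. (cg m n)\<^sup>2)" for n by (simp add: b_def sum_nonneg)
  have b0: "0 \<le> b n" for n by (simp add: b_def sum_nonneg)
  have bs: "summable (\<lambda>n. (b n)\<^sup>2)"
    unfolding b2 c0_def cg_def
    by (intro summable_add summable_sum sums_summable[OF parseval] u0 gs)
  have c0b: "\<bar>c0 n\<bar> \<le> b n" for n unfolding b_def by (rule real_le_rsqrt) (simp add: sum_nonneg)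
  define cg' where "cg' m n = (if m < M then cg m n else 0)" for m n
  have cgb: "\<bar>cg' m n\<bar> \<le> b n" for m n
  proof (cases "m < M")
    case True
    have "(cg m n)\<^sup>2 \<le> (\<Sum>m<M. (cg m n)\<^sup>2)" using True by (intro member_le_sum) auto
    then have "(cg m n)\<^sup>2 \<le> (c0 n)\<^sup>2 + (\<Sum>m<M. (cg m n)\<^sup>2)" by (rule add_increasing[rotated]) simp
    then show ?thesis using True unfolding b_def cg'_def by (intro real_le_rsqrt) simp
  qed (simp add: cg'_def b0)
  \<comment> \<open>The mode, its inner integral (also at \<open>t = 0\<close>), the same as a relaxation function for \<open>t > 0\<close>, the
    derivative, and the outer integral of the derivative.\<close>
  define y where "y n t = 1 * relax \<mu> \<gamma> (lam n) t * c0 n + (\<Sum>m<M. fact m * relax \<mu> (\<mu> + real m + 1) (lam n) t * cg' m n)" for n t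
  define Y where "Y n t = mitlef \<mu> 1 (lam n * t powr \<mu>) * c0 n + (\<Sum>m<M. fact m * relax \<mu> (\<mu> + \<alpha> + real m + 1) (lam n) t * cg' m n)" for n t
  define Y1 where "Y1 n t = 1 * relax \<mu> 1 (lam n) t * c0 n + (\<Sum>m<M. fact m * relax \<mu> (\<mu> + \<alpha> + real m + 1) (lam n) t * cg' m n)" for n t
  define d where "d n t = (-1) * (lam n * relax \<mu> \<mu> (lam n) t) * c0 n + (\<Sum>m<M. fact m * relax \<mu> (\<mu> + \<alpha> + real m) (lam n) t * cg' m n)" for n t
  define q where "q n t = (-1) * (lam n * relax \<mu> \<gamma> (lam n) t) * c0 n + (\<Sum>m<M. fact m * relax \<mu> (1 + real m) (lam n) t * cg' m n)" for n t
  have YY1: "Y n t = Y1 n t" if "0 < t" for n t using that by (simp add: Y_def Y1_def relax_def)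
  have Yfinal: "Y n T = init_mode u0 n T + forced_mode M gs n T" for n
    by (simp add: Y_def init_mode_def forced_mode_def c0_def cg'_def cg_def)
  have w1: "0 \<le> (1::real)" "0 \<le> sqrt (wt n)" "0 \<le> 1 / sqrt (wt n)" for n using wt_pos[of n] by auto
  have Bge: "\<mu> \<le> \<mu> + \<alpha> + real m" "\<mu> \<le> \<mu> + \<alpha> + real m + 1" "\<mu> \<le> \<mu> + real m + 1" "\<mu> \<le> 1 + real m" for m using ord \<mu> by auto
  define r where "r = 1 + \<mu>/2"
  have 1: "wbound b (\<lambda>n. 1) (\<gamma> - 1) y"
    unfolding y_def by (intro wbound_add wbound_sum wbound_relax(1) c0b cgb w1 \<gamma> Bge) (use \<gamma> \<mu> in auto)
  have 2: "wbound b (\<lambda>n. sqrt (wt n)) (- r) y"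
    unfolding y_def by (intro wbound_add wbound_sum wbound_relax(2) c0b cgb w1 \<gamma> Bge) (use \<gamma> \<mu> in \<open>auto simp: r_def\<close>)
  have 3: "wbound b (\<lambda>n. sqrt (wt n)) (- r) Y1"
    unfolding Y1_def by (intro wbound_add wbound_sum wbound_relax(2) c0b cgb w1 \<mu> Bge) (use \<gamma> \<mu> ord in \<open>auto simp: r_def\<close>)
  have 4: "wbound b (\<lambda>n. 1) 0 Y1"
    unfolding Y1_def by (intro wbound_add wbound_sum wbound_relax(1) c0b cgb w1 \<mu> Bge) (use \<gamma> \<mu> ord in auto)
  have 5: "wbound b (\<lambda>n. 1 / sqrt (wt n)) (\<mu>/2 - 1) d"
    unfolding d_def
  proof (rule wbound_add[OF wbound_relax(3)[OF _ c0b] wbound_sum[OF wbound_relax(4)[OF _ cgb]]])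
    show "\<mu> / 2 - 1 \<le> \<mu> + \<alpha> + real m - 1" for m using ord(1) \<mu>(1) by linarith
  qed (use Bge w1 in auto)
  have 6: "wbound b (\<lambda>n. 1 / sqrt (wt n)) (- r) d"
    unfolding d_def
  proof (rule wbound_add[OF wbound_relax(3)[OF _ c0b] wbound_sum[OF wbound_relax(4)[OF _ cgb]]])
    show "- r \<le> \<mu> + \<alpha> + real m - 1" for m using ord(1) \<mu>(1) unfolding r_def by linarith
  qed (use Bge w1 \<mu> in \<open>auto simp: r_def\<close>)
  have 7: "wbound b (\<lambda>n. 1 / sqrt (wt n)) (- r) q"
    unfolding q_def
  proof (rule wbound_add[OF wbound_relax(3)[OF \<gamma>(1) c0b] wbound_sum[OF wbound_relax(4)[OF _ cgb]]])
    show "- r \<le> 1 + real m - 1" for m using \<mu>(1) unfolding r_def by linarith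
  qed (use Bge w1 \<gamma> in \<open>auto simp: r_def\<close>)
  obtain C1 where C1: "0 \<le> C1" "\<And>n t. t \<in> {0<..T} \<Longrightarrow> 1 * \<bar>y n t\<bar> \<le> C1 * t powr (\<gamma> - 1) * b n" by (rule wboundE[OF 1]) auto
  obtain C2 where C2: "0 \<le> C2" "\<And>n t. t \<in> {0<..T} \<Longrightarrow> sqrt (wt n) * \<bar>y n t\<bar> \<le> C2 * t powr (- r) * b n" by (rule wboundE[OF 2]) auto
  obtain C3 where C3: "0 \<le> C3" "\<And>n t. t \<in> {0<..T} \<Longrightarrow> sqrt (wt n) * \<bar>Y1 n t\<bar> \<le> C3 * t powr (- r) * b n" by (rule wboundE[OF 3]) auto
  obtain C4 where C4: "0 \<le> C4" "\<And>n t. t \<in> {0<..T} \<Longrightarrow> 1 * \<bar>Y1 n t\<bar> \<le> C4 * t powr 0 * b n" by (rule wboundE[OF 4]) auto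
  obtain C5 where C5: "0 \<le> C5" "\<And>n t. t \<in> {0<..T} \<Longrightarrow> 1 / sqrt (wt n) * \<bar>d n t\<bar> \<le> C5 * t powr (\<mu>/2 - 1) * b n" by (rule wboundE[OF 5]) auto
  obtain C6 where C6: "0 \<le> C6" "\<And>n t. t \<in> {0<..T} \<Longrightarrow> 1 / sqrt (wt n) * \<bar>d n t\<bar> \<le> C6 * t powr (- r) * b n" by (rule wboundE[OF 6]) auto
  obtain C7 where C7: "0 \<le> C7" "\<And>n t. t \<in> {0<..T} \<Longrightarrow> 1 / sqrt (wt n) * \<bar>q n t\<bar> \<le> C7 * t powr (- r) * b n" by (rule wboundE[OF 7]) auto
  note C = C1(1) C2(1) C3(1) C4(1) C5(1) C6(1) C7(1)
  note CB = C1(2) C2(2) C3(2) C4(2) C5(2) C6(2) C7(2)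
  define C where "C = 1 + C1 + C2 + C3 + C4 + C5 + C6 + C7"
  have Cle: "C1 \<le> C" "C2 \<le> C" "C3 \<le> C" "C4 \<le> C" "C5 \<le> C" "C6 \<le> C" "C7 \<le> C" "1 \<le> C" using C by (auto simp: C_def)
  have up: "K * t powr x * b n \<le> C * t powr x * b n" if "K \<le> C" for K t x n
    using that b0 by (intro mult_right_mono) auto
  have wdiv: "\<bar>z\<bar> \<le> K * t powr x * sqrt (wt n) * b n" if "1 / sqrt (wt n) * \<bar>z\<bar> \<le> K * t powr x * b n" for z K t x n
  proof -
    have "sqrt (wt n) > 0" using wt_pos[of n] by simp
    then show ?thesis using that by (simp add: pos_divide_le_eq mult_ac)
  qed
  have rc: "continuous_on {0<..T} (relax \<mu> B (lam n))" if "0 < B" for B n by (rule continuous_on_relax[OF \<mu>(1) that]) auto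
  have pos: "0 < \<mu> + \<alpha> + real m" "0 < \<mu> + \<alpha> + real m + 1" "0 < \<mu> + real m + 1" for m using ord \<mu> by (auto simp: add_pos_nonneg)
  have hf: "has_frac_integral a (\<lambda>s. k * relax \<mu> B (lam n) s * x) t (k * relax \<mu> (B + a) (lam n) t * x)" if "0 < a" "0 < B" "0 < t" for a B n t k x
  proof -
    have "has_frac_integral a (\<lambda>s. (k * x) * relax \<mu> B (lam n) s) t ((k * x) * relax \<mu> (B + a) (lam n) t)"
      by (intro has_frac_integral_mult has_frac_integral_relax that \<mu>)
    then show ?thesis by (simp add: mult_ac)
  qed
  have rd: "(relax \<mu> (B + 1) (lam n) has_real_derivative relax \<mu> B (lam n) t) (at t)" if "0 < B" "0 < t" for B n t
    by (rule relax_has_derivative[OF \<mu>(1) that])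
  have d1: "(relax \<mu> 1 (lam n) has_real_derivative - (lam n * relax \<mu> \<mu> (lam n) t)) (at t)" if t: "0 < t" for n t
  proof -
    have "((\<lambda>s. 1 - lam n * relax \<mu> (\<mu> + 1) (lam n) s) has_real_derivative 0 - lam n * relax \<mu> \<mu> (lam n) t) (at t)"
      by (intro DERIV_diff DERIV_const DERIV_cmult rd \<mu> t)
    then have "((\<lambda>s. 1 - lam n * relax \<mu> (\<mu> + 1) (lam n) s) has_real_derivative - (lam n * relax \<mu> \<mu> (lam n) t)) (at t)" by simp
    then show ?thesis
    proof (rule DERIV_cong_ev[OF refl _ refl, THEN iffD1, rotated])
      have "eventually (\<lambda>s. s \<in> {0<..}) (nhds t)" using t by (intro eventually_nhds_in_open) auto
      then show "\<forall>\<^sub>F s in nhds t. 1 - lam n * relax \<mu> (\<mu> + 1) (lam n) s = relax \<mu> 1 (lam n) s"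
      proof eventually_elim
        case (elim s)
        then show ?case using relax_recurrence[OF \<mu>(1), of 1 s "lam n"] by (simp add: add.commute)
      qed
    qed
  qed
  have res: "weak_solution H V E T \<mu> \<nu> u0 (\<lambda>t. \<Sum>m<M. t ^ m *\<^sub>R gs m) (\<lambda>t. S (\<lambda>n. y n t)) \<and>
    inner_frac H \<mu> \<nu> (\<lambda>t. S (\<lambda>n. y n t)) T = S (\<lambda>n. Y n T) \<and> vsum (\<lambda>n. Y n T)"
  proof (rule weak_solution_of_modes[of b C r \<gamma> "\<mu>/2" y Y d q])
    show "summable (\<lambda>n. (b n)\<^sup>2)" "\<And>n. 0 \<le> b n" by (rule bs b0)+
    show "0 \<le> C" "0 \<le> r" "0 < \<gamma>" "0 < \<mu>/2" using Cle \<mu> \<gamma> by (auto simp: r_def)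
    show "continuous_on {0<..T} (y n)" for n unfolding y_def by (intro continuous_intros rc \<gamma> pos)
    show "continuous_on {0<..T} (d n)" for n unfolding d_def by (intro continuous_intros rc \<mu> pos)
    show "continuous_on {0<..T} (q n)" for n unfolding q_def by (intro continuous_intros rc \<gamma>) auto
    show "continuous_on {0..T} (Y n)" for n
    proof -
      have m: "continuous_on UNIV (mitlef \<mu> B :: real \<Rightarrow> real)" if "0 < B" for B
        by (simp add: continuous_on_eq_continuous_at isCont_mitlef[OF \<mu>(1) that])
      have p: "continuous_on {0..T} (\<lambda>t. t powr x)" if "0 < x" for x :: real
        using that by (intro continuous_on_powr' continuous_intros) auto
      have mc: "continuous_on {0..T} (\<lambda>t. mitlef \<mu> B (lam n * t powr \<mu>))" if "0 < B" for B
        by (rule continuous_on_compose2[OF m[OF that]]) (auto intro!: continuous_intros p \<mu>)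
      have rc0: "continuous_on {0..T} (relax \<mu> B (lam n))" if "1 < B" for B
        unfolding relax_def real_scaleR_def of_real_eq_id id_apply by (intro continuous_on_mult p mc) (use that in auto)
      have B1: "1 < \<mu> + \<alpha> + real m + 1" for m using ord(1) \<mu>(1) by linarith
      show ?thesis unfolding Y_def
        by (intro continuous_on_add continuous_on_sum continuous_on_mult continuous_on_const mc zero_less_one rc0 B1)
    qed
    show "frac_rel \<alpha> (y n) t (Y n t)" if t: "t \<in> {0<..T}" for n t
    proof (cases "\<alpha> = 0")
      case True
      then have "\<gamma> = 1" by (simp only: \<gamma>_def)
      then have "Y1 n t = y n t" unfolding y_def Y1_def True by simp
      then show ?thesis using True YY1[of t n] t by (simp only: frac_rel_def) auto
    next
      case False
      then have a: "0 < \<alpha>" using ord by linarith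
      have "has_frac_integral \<alpha> (y n) t (1 * relax \<mu> (\<gamma> + \<alpha>) (lam n) t * c0 n + (\<Sum>m<M. fact m * relax \<mu> (\<mu> + real m + 1 + \<alpha>) (lam n) t * cg' m n))"
        unfolding y_def using t by (intro has_frac_integral_add has_frac_integral_sum hf a \<gamma> pos) auto
      moreover have "\<gamma> + \<alpha> = 1" "\<mu> + real m + 1 + \<alpha> = \<mu> + \<alpha> + real m + 1" for m by (simp_all add: \<gamma>_def)
      ultimately have "has_frac_integral \<alpha> (y n) t (Y1 n t)" unfolding Y1_def by (simp only:)
      then show ?thesis using False YY1[of t n] t by (simp only: frac_rel_def) auto
    qed
    show "(Y n has_real_derivative d n t) (at t)" if t: "0 < t" for n t
    proof -
      have "(Y1 n has_real_derivative (- (lam n * relax \<mu> \<mu> (lam n) t)) * c0 n + (\<Sum>m<M. fact m * relax \<mu> (\<mu> + \<alpha> + real m) (lam n) t * cg' m n)) (at t)"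
        unfolding Y1_def mult_1 using t by (intro DERIV_add DERIV_sum DERIV_cmult_right DERIV_cmult d1 rd pos)
      then have "(Y1 n has_real_derivative d n t) (at t)" by (simp add: d_def)
      then show ?thesis
      proof (rule DERIV_cong_ev[OF refl _ refl, THEN iffD1, rotated])
        have "eventually (\<lambda>s. s \<in> {0<..}) (nhds t)" using t by (intro eventually_nhds_in_open) auto
        then show "\<forall>\<^sub>F s in nhds t. Y1 n s = Y n s" by eventually_elim (simp add: YY1)
      qed
    qed
    show "frac_rel \<kappa> (d n) t (q n t)" if t: "t \<in> {0<..T}" for n t
    proof (cases "\<kappa> = 0")
      case True
      then have "\<gamma> = \<mu>" "\<mu> + \<alpha> = 1" using \<gamma>(4) ord(3) by linarith+
      then have "q n t = d n t" unfolding q_def d_def by (simp only:)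
      then show ?thesis using True by (simp only: frac_rel_def) auto
    next
      case False
      then have a: "0 < \<kappa>" using ord by linarith
      have "has_frac_integral \<kappa> (\<lambda>s. (- lam n) * relax \<mu> \<mu> (lam n) s * c0 n + (\<Sum>m<M. fact m * relax \<mu> (\<mu> + \<alpha> + real m) (lam n) s * cg' m n)) t
         ((- lam n) * relax \<mu> (\<mu> + \<kappa>) (lam n) t * c0 n + (\<Sum>m<M. fact m * relax \<mu> (\<mu> + \<alpha> + real m + \<kappa>) (lam n) t * cg' m n))"
        using t by (intro has_frac_integral_add has_frac_integral_sum hf a \<mu> pos) auto
      moreover have "\<mu> + \<alpha> + real m + \<kappa> = 1 + real m" for m using ord(3) by linarith
      moreover have "(- lam n) * x * c0 n = (-1) * (lam n * x) * c0 n" for x by simp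
      ultimately have "has_frac_integral \<kappa> (d n) t (q n t)" unfolding q_def d_def by (simp only: \<gamma>(4))
      then show ?thesis using False by (simp only: frac_rel_def) auto
    qed
    show "u0 \<in> H" by (rule u0)
    show "Y n 0 = inner u0 (e n)" for n by (simp add: Y_def relax_def c0_def)
    show "(\<Sum>m<M. t ^ m *\<^sub>R gs m) \<in> H" for t by (intro subspace_sum[OF subspace_H] subspace_scale[OF subspace_H] gs)
    show "q n t + lam n * y n t = inner (\<Sum>m<M. t ^ m *\<^sub>R gs m) (e n)" if t: "t \<in> {0<..<T}" for n t
    proof -
      have "fact m * relax \<mu> (1 + real m) (lam n) t * cg' m n + lam n * (fact m * relax \<mu> (\<mu> + real m + 1) (lam n) t * cg' m n) = t ^ m * cg' m n" for m
      proof -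
        have "relax \<mu> (1 + real m) (lam n) t + lam n * relax \<mu> (1 + real m + \<mu>) (lam n) t = t powr (1 + real m - 1) / Gamma (1 + real m)"
          using relax_recurrence[OF \<mu>(1), of "1 + real m" t "lam n"] t by simp
        also have "\<dots> = t ^ m / fact m" using t by (simp add: powr_realpow Gamma_fact)
        finally have "fact m * (relax \<mu> (1 + real m) (lam n) t + lam n * relax \<mu> (1 + real m + \<mu>) (lam n) t) * cg' m n = t ^ m * cg' m n" by simp
        moreover have "\<mu> + real m + 1 = 1 + real m + \<mu>" by simp
        ultimately show ?thesis by (simp only:) (simp only: algebra_simps)
      qed
      then have "(\<Sum>m<M. fact m * relax \<mu> (1 + real m) (lam n) t * cg' m n) + lam n * (\<Sum>m<M. fact m * relax \<mu> (\<mu> + real m + 1) (lam n) t * cg' m n) = (\<Sum>m<M. t ^ m * cg' m n)"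
        unfolding sum_distrib_left sum.distrib[symmetric] by (simp only:)
      moreover have "inner (\<Sum>m<M. t ^ m *\<^sub>R gs m) (e n) = (\<Sum>m<M. t ^ m * cg' m n)"
        by (simp add: inner_sum_left cg'_def cg_def)
      ultimately show ?thesis by (simp add: q_def y_def distrib_left)
    qed
    show "\<bar>y n t\<bar> \<le> C * t powr (\<gamma> - 1) * b n" if "t \<in> {0<..T}" for n t using order_trans[OF CB(1)[OF that] up[OF Cle(1)]] by simp
    show "sqrt (wt n) * \<bar>y n t\<bar> \<le> C * t powr (- r) * b n" if "t \<in> {0<..T}" for n t by (rule order_trans[OF CB(2)[OF that] up[OF Cle(2)]])
    show "sqrt (wt n) * \<bar>Y n t\<bar> \<le> C * t powr (- r) * b n" if "t \<in> {0<..T}" for n t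
      using order_trans[OF CB(3)[OF that] up[OF Cle(3)]] YY1[of t n] that by simp
    show "\<bar>Y n t\<bar> \<le> C * b n" if "t \<in> {0..T}" for n t
    proof (cases "t = 0")
      case True
      have "1 * b n \<le> C * b n" using Cle b0 by (intro mult_right_mono) auto
      moreover have "Y n 0 = c0 n" by (simp add: Y_def relax_def)
      ultimately show ?thesis using c0b[of n] True by simp
    next
      case False
      then have "t \<in> {0<..T}" using that by auto
      from order_trans[OF CB(4)[OF this] up[OF Cle(4)]] show ?thesis using False that YY1[of t n] by simp
    qed
    show "\<bar>d n t\<bar> \<le> C * t powr (\<mu>/2 - 1) * sqrt (wt n) * b n" if "t \<in> {0<..T}" for n t by (rule wdiv[OF order_trans[OF CB(5)[OF that] up[OF Cle(5)]]])
    show "\<bar>d n t\<bar> \<le> C * t powr (- r) * sqrt (wt n) * b n" if "t \<in> {0<..T}" for n t by (rule wdiv[OF order_trans[OF CB(6)[OF that] up[OF Cle(6)]]])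
    show "\<bar>q n t\<bar> \<le> C * t powr (- r) * sqrt (wt n) * b n" if "t \<in> {0<..T}" for n t by (rule wdiv[OF order_trans[OF CB(7)[OF that] up[OF Cle(7)]]])
  qed
  show ?thesis by (rule that[OF res[THEN conjunct1]]) (use res in \<open>simp_all add: Yfinal\<close>)
qed

end

section \<open>Density of the terminal values\<close>

text \<open>By Weierstrass approximation \<open>f\<close> is orthogonal to itself.\<close>

lemma continuous_polynomial_moments_vanish:
  fixes f :: "real \<Rightarrow> real"
  assumes T: "0 < T" and f: "continuous_on {0..T} f"
    and mom: "\<And>m::nat. integral {0..T} (\<lambda>s. (T - s) ^ m * f s) = 0" and s: "s \<in> {0..T}"
  shows "f s = 0"
proof -
  have poly: "integral {0..T} (\<lambda>s. p (T - s) * f s) = 0" if "real_polynomial_function p" for p :: "real \<Rightarrow> real"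
  proof -
    from that obtain a :: "nat \<Rightarrow> real" and N where p: "p = (\<lambda>x. \<Sum>i\<le>N. a i * x ^ i)"
      unfolding real_polynomial_function_iff_sum by auto
    have "integral {0..T} (\<lambda>s. p (T - s) * f s) = integral {0..T} (\<lambda>s. \<Sum>i\<le>N. a i * ((T - s) ^ i * f s))"
      by (simp add: p sum_distrib_right mult.assoc)
    also have "\<dots> = (\<Sum>i\<le>N. integral {0..T} (\<lambda>s. a i * ((T - s) ^ i * f s)))"
      by (intro integral_sum integrable_continuous_real continuous_intros f) auto
    also have "\<dots> = 0" by (simp add: mom)
    finally show ?thesis .
  qed
  define I where "I = integral {0..T} (\<lambda>s. f s * f s)"
  define J where "J = integral {0..T} (\<lambda>s. \<bar>f s\<bar>)"
  have J: "0 \<le> J" unfolding J_def by (intro integral_nonneg integrable_continuous_real continuous_intros f) auto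
  have small: "\<bar>I\<bar> \<le> \<delta> * J" if \<delta>: "\<delta> > 0" for \<delta>
  proof -
    have "continuous_on {0..T} (\<lambda>x. f (T - x))" by (rule continuous_on_compose2[OF f]) (auto intro!: continuous_intros)
    then obtain p where p: "real_polynomial_function p" "\<And>x. x \<in> {0..T} \<Longrightarrow> \<bar>f (T - x) - p x\<bar> < \<delta>"
      using Stone_Weierstrass_real_polynomial_function[of "{0..T}" "\<lambda>x. f (T - x)" \<delta>] \<delta> by auto
    have pc: "continuous_on {0..T} (\<lambda>s. p (T - s))"
      by (rule continuous_on_compose2[OF continuous_at_imp_continuous_on[of UNIV p]]) (use p(1) in \<open>auto intro!: continuous_intros continuous_real_polymonial_function\<close>)
    have "I = I - integral {0..T} (\<lambda>s. p (T - s) * f s)" using poly[OF p(1)] by simp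
    also have "\<dots> = integral {0..T} (\<lambda>s. f s * f s - p (T - s) * f s)"
      unfolding I_def by (intro integral_diff[symmetric] integrable_continuous_real continuous_intros f pc)
    also have "norm \<dots> \<le> integral {0..T} (\<lambda>s. \<delta> * \<bar>f s\<bar>)"
    proof (intro integral_norm_bound_integral integrable_continuous_real continuous_intros f pc)
      fix s assume "s \<in> {0..T}"
      then have "\<bar>f s - p (T - s)\<bar> \<le> \<delta>" using p(2)[of "T - s"] by simp
      then show "norm (f s * f s - p (T - s) * f s) \<le> \<delta> * \<bar>f s\<bar>"
        unfolding left_diff_distrib[symmetric] by (simp add: abs_mult mult_right_mono)
    qed
    finally show ?thesis by (simp add: J_def)
  qed
  have "I = 0"
  proof (rule ccontr)
    assume "I \<noteq> 0"
    then have d: "\<bar>I\<bar> / (J + 1) > 0" using J by simp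
    have "\<bar>I\<bar> / (J + 1) * J = \<bar>I\<bar> - \<bar>I\<bar> / (J + 1)" using J by (simp add: field_simps)
    then show False using small[OF d] d by linarith
  qed
  moreover have "(integral {0..T} (\<lambda>s. f s * f s) = 0) = (\<forall>s\<in>{0..T}. f s * f s = 0)"
    by (rule integral_eq_0_iff[OF continuous_on_mult[OF f f] T]) simp
  ultimately have "\<forall>s\<in>{0..T}. f s * f s = 0" unfolding I_def by blast
  then show ?thesis using s by simp
qed

context hilfer_problem
begin

lemma S_add: assumes "vsum c" "vsum d" shows "S (\<lambda>n. c n + d n) = S c + S d"
  using sums_unique[OF sums_add[OF V_series_sums[OF assms(1)] V_series_sums[OF assms(2)]]]
  by (simp add: S_def[of "\<lambda>n. c n + d n"] scaleR_add_left)

lemma S_scale: assumes "vsum c" shows "S (\<lambda>n. k * c n) = k *\<^sub>R S c"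
  using sums_unique[OF sums_scaleR_right[OF V_series_sums[OF assms], of k]]
  by (simp add: S_def[of "\<lambda>n. k * c n"])

lemma zero_H: "0 \<in> H" by (rule subspace_0[OF subspace_H])

text \<open>The coefficients are those of the terminal value of a weak solution with zero initial data.\<close>

lemma vsum_forced: assumes "\<And>m. gs m \<in> H" shows "vsum (\<lambda>n. forced_mode M gs n T)"
  by (rule weak_solution_polynomial_control[where gs = gs and M = M, OF zero_H assms]) (simp add: init_mode_def)

lemma vsum_init: assumes "u0 \<in> H" shows "vsum (\<lambda>n. init_mode u0 n T)"
  by (rule weak_solution_polynomial_control[where gs = "\<lambda>_. 0" and M = 0, OF assms zero_H]) (simp add: forced_mode_def)

lemma forced_mode_extend:
  assumes "M \<le> M'" "\<And>m. M \<le> m \<Longrightarrow> gs m = 0"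
  shows "forced_mode M gs n T = forced_mode M' gs n T"
  unfolding forced_mode_def using assms by (intro sum.mono_neutral_left) auto

text \<open>Up to a factorial, \<open>\<Sum>n. c n * relax \<mu> (b + m + 1) (lam n) T\<close> is the moment of order \<open>m\<close>, with respect to
  \<open>T - s\<close>, of the function \<open>\<Sum>n. c n * relax \<mu> b (lam n) s\<close> on \<open>[0, T]\<close>. Since \<open>b > 1\<close>, this function is
  continuous up to \<open>0\<close>.\<close>

lemma relaxation_sum_vanishes:
  assumes c: "summable (\<lambda>n. \<bar>c n\<bar>)"
    and zero: "\<And>m::nat. (\<lambda>n. c n * relax \<mu> (b + real m) (lam n) T) sums 0" and b: "1 < b"
    and x: "0 < x" "x < T powr \<mu>"
  shows "(\<Sum>n. c n * mitlef \<mu> b (lam n * x)) = 0"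
proof -
  have b\<mu>: "\<mu> \<le> b" and b0: "0 < b" using \<mu> b by auto
  have ml: "0 \<le> mitlef \<mu> B (lam n * y)" "mitlef \<mu> B (lam n * y) \<le> 1 / Gamma B" if "0 \<le> y" "\<mu> \<le> B" for n y B
    using that lam_pos[of n] by (auto intro!: mitlef_nonneg[OF \<mu> that(2)] mitlef_le_Gamma[OF \<mu> that(2)])
  define h where "h s = (\<Sum>n. c n * mitlef \<mu> b (lam n * s powr \<mu>))" for s
  have le: "norm (c n * mitlef \<mu> b (lam n * y)) \<le> \<bar>c n\<bar> * (1 / Gamma b)" if "0 \<le> y" for n y
    unfolding real_norm_def abs_mult using ml[OF that b\<mu>, of n] by (intro mult_left_mono) auto
  have hc: "continuous_on {0..T} h"
  proof -
    have "uniform_limit {0..T} (\<lambda>N s. \<Sum>n<N. c n * mitlef \<mu> b (lam n * s powr \<mu>)) h sequentially"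
      unfolding h_def[abs_def] by (rule Weierstrass_m_test[OF _ summable_mult2[OF c, of "1 / Gamma b"]]) (rule le, simp)
    moreover have "continuous_on {0..T} (\<lambda>s. c n * mitlef \<mu> b (lam n * s powr \<mu>))" for n
    proof -
      have m: "continuous_on UNIV (mitlef \<mu> b :: real \<Rightarrow> real)"
        by (simp add: continuous_on_eq_continuous_at isCont_mitlef[OF \<mu>(1) b0])
      have "continuous_on {0..T} (\<lambda>s. lam n * s powr \<mu>)"
        by (intro continuous_intros continuous_on_powr') (use \<mu> in auto)
      from continuous_on_compose2[OF m this] show ?thesis by (intro continuous_on_mult_left) simp
    qed
    then have "\<forall>\<^sub>F N in sequentially. continuous_on {0..T} (\<lambda>s. \<Sum>n<N. c n * mitlef \<mu> b (lam n * s powr \<mu>))"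
      by (intro always_eventually allI continuous_on_sum)
    ultimately show ?thesis using uniform_limit_theorem by fastforce
  qed
  define K1 where "K1 s = s powr (b - 1) * h s" for s
  have sr: "(\<lambda>n. c n * relax \<mu> b (lam n) s) sums K1 s" for s
  proof -
    have "summable (\<lambda>n. c n * mitlef \<mu> b (lam n * s powr \<mu>))"
      by (rule summable_comparison_test[OF exI[of _ 0] summable_mult2[OF c, of "1 / Gamma b"]]) (use le in auto)
    from sums_mult[OF summable_sums[OF this], of "s powr (b - 1)"]
    show ?thesis by (simp add: relax_def K1_def h_def mult_ac)
  qed
  have rn: "0 \<le> relax \<mu> b (lam n) s" for n s using ml(1)[of "s powr \<mu>" b n] b\<mu> by (simp add: relax_def)
  have mom: "integral {0<..<T} (\<lambda>s. (T - s) ^ m * K1 s) = 0" for m :: nat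
  proof -
    define a where "a = real m + 1"
    have a: "a > 0" by (simp add: a_def)
    define f where "f n s = indicator {0<..<T} s *\<^sub>R frac_kernel a (\<lambda>s. c n * relax \<mu> b (lam n) s) T s" for n s
    have I: "has_bochner_integral lborel (f n) (c n * relax \<mu> (b + a) (lam n) T)" for n
      using has_frac_integral_mult[OF has_frac_integral_relax[OF \<mu>(1) b0 a T, of "lam n"], of "c n"]
      by (simp add: has_frac_integral_def f_def[abs_def])
    have nf: "norm (f n s) = \<bar>c n\<bar> * (indicator {0<..<T} s *\<^sub>R frac_kernel a (relax \<mu> b (lam n)) T s)" for n s
      using Gamma_real_pos[OF a] rn[of n s] by (simp add: f_def frac_kernel_def abs_mult indicator_def mult_ac)
    have In: "(LINT s|lborel. norm (f n s)) = \<bar>c n\<bar> * relax \<mu> (b + a) (lam n) T" for n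
      unfolding nf using has_frac_integral_relax[OF \<mu>(1) b0 a T, of "lam n"] by (simp add: has_frac_integral_def has_bochner_integral_iff)
    have ba: "\<mu> \<le> b + a" using b\<mu> a by simp
    have g2: "summable (\<lambda>n. LINT s|lborel. norm (f n s))"
      unfolding In
    proof (rule summable_comparison_test[OF exI[of _ 0] summable_mult2[OF c, of "T powr (b + a - 1) * (1 / Gamma (b + a))"]], intro allI impI)
      fix n
      have "\<bar>relax \<mu> (b + a) (lam n) T\<bar> \<le> T powr (b + a - 1) * (1 / Gamma (b + a))"
        using mult_left_mono[OF ml(2)[of "T powr \<mu>" "b + a" n], of "T powr (b + a - 1)"] ml(1)[of "T powr \<mu>" "b + a" n] ba
        by (simp add: relax_def abs_mult)
      then show "norm (\<bar>c n\<bar> * relax \<mu> (b + a) (lam n) T) \<le> \<bar>c n\<bar> * (T powr (b + a - 1) * (1 / Gamma (b + a)))"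
        unfolding real_norm_def abs_mult abs_idempotent by (rule mult_left_mono) simp
    qed
    have g1: "AE s in lborel. summable (\<lambda>n. norm (f n s))"
    proof (rule AE_I2)
      fix s
      have "summable (\<lambda>n. \<bar>c n\<bar> * mitlef \<mu> b (lam n * s powr \<mu>))"
        by (rule summable_comparison_test[OF exI[of _ 0] summable_mult2[OF c, of "1 / Gamma b"]])
          (use ml b\<mu> in \<open>auto simp: abs_mult simp del: mult_1_right times_divide_eq_right intro!: mult_left_mono\<close>)
      from summable_mult[OF this, of "indicator {0<..<T} s * ((T - s) powr (a - 1) / Gamma a) * s powr (b - 1)"]
      show "summable (\<lambda>n. norm (f n s))" unfolding nf by (simp add: frac_kernel_def relax_def mult_ac)
    qed
    have i: "\<And>n. integrable lborel (f n)" using I by (simp add: has_bochner_integral_iff)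
    have fs: "(\<Sum>n. f n s) = indicator {0<..<T} s *\<^sub>R ((1 / fact m) * ((T - s) ^ m * K1 s))" for s
    proof (cases "0 < s \<and> s < T")
      case True
      have "(\<lambda>n. (1 / fact m * (T - s) ^ m) * (c n * relax \<mu> b (lam n) s)) sums ((1 / fact m * (T - s) ^ m) * K1 s)"
        by (rule sums_mult[OF sr])
      moreover have "Gamma a = fact m" unfolding a_def by (simp add: Gamma_fact add.commute)
      ultimately show ?thesis using True by (simp add: f_def frac_kernel_def a_def powr_realpow sums_iff)
    qed (simp add: f_def)
    have "(\<lambda>n. integral\<^sup>L lborel (f n)) sums (LINT s|lborel. (\<Sum>n. f n s))" by (intro sums_integral g1 g2 i)
    moreover have "(\<lambda>n. integral\<^sup>L lborel (f n)) sums 0"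
      using zero[of "Suc m"] I by (simp add: has_bochner_integral_iff a_def add_ac)
    ultimately have "(LINT s|lborel. (\<Sum>n. f n s)) = 0" using sums_unique2 by blast
    then have z: "(LINT s:{0<..<T}|lborel. (1 / fact m) * ((T - s) ^ m * K1 s)) = 0"
      unfolding fs set_lebesgue_integral_def .
    have "integrable lborel (\<lambda>s. \<Sum>n. f n s)" by (intro integrable_suminf g1 g2 i)
    then have "set_integrable lborel {0<..<T} (\<lambda>s. (1 / fact m) * ((T - s) ^ m * K1 s))"
      unfolding fs set_integrable_def .
    from set_borel_integral_eq_integral(2)[OF this] z
    have "integral {0<..<T} (\<lambda>s. (1 / fact m) * ((T - s) ^ m * K1 s)) = 0" by simp
    then show ?thesis by simp
  qed
  have K1c: "continuous_on {0..T} K1"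
    unfolding K1_def[abs_def] using b by (intro continuous_intros continuous_on_powr' hc) auto
  define s where "s = x powr (1 / \<mu>)"
  have s: "0 < s" "s powr \<mu> = x" "s < T"
  proof -
    show "0 < s" "s powr \<mu> = x" using x \<mu> by (auto simp: s_def powr_powr)
    have "x powr (1 / \<mu>) < (T powr \<mu>) powr (1 / \<mu>)" using x \<mu> by (intro powr_less_mono2) auto
    then show "s < T" using \<mu> T by (simp add: s_def powr_powr)
  qed
  have "K1 s = 0"
    by (rule continuous_polynomial_moments_vanish[OF T K1c]) (use s mom in \<open>auto simp: integral_open_interval_real\<close>)
  then have "h s = 0" using s(1) by (simp add: K1_def)
  then show ?thesis by (simp add: h_def s(2))
qed

text \<open>The duality argument: a functional that vanishes on the terminal values defines, eigenvalue by
  eigenvalue, eigenvectors orthogonal to \<open>W\<close>.\<close>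

lemma forced_terminal_values_dense:
  assumes W: "subspace W" "W \<subseteq> H"
    and ucp: "\<forall>\<phi> c. c > 0 \<longrightarrow> eigvec \<phi> c \<longrightarrow> (\<forall>g\<in>W. inner \<phi> g = 0) \<longrightarrow> \<phi> = 0"
    and z: "z \<in> H" and \<epsilon>: "\<epsilon> > 0"
  shows "\<exists>M gs. (\<forall>m. gs m \<in> W) \<and> norm (S (\<lambda>n. forced_mode M gs n T) - z) \<le> \<epsilon>"
proof -
  define R where "R = {S (\<lambda>n. forced_mode M gs n T) |M gs. (\<forall>m. gs m \<in> W) \<and> (\<forall>m\<ge>M. gs m = 0)}"
  have W0: "0 \<in> W" by (rule subspace_0[OF W(1)])
  have R: "subspace R"
  proof (rule subspaceI)
    have "S (\<lambda>n. forced_mode 0 (\<lambda>_. 0) n T) = 0" by (simp add: forced_mode_def S_def)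
    then show "0 \<in> R" unfolding R_def using W0 by force
    fix x y assume "x \<in> R" "y \<in> R"
    then obtain M gs M' gs' where x: "x = S (\<lambda>n. forced_mode M gs n T)" "\<And>m. gs m \<in> W" "\<And>m. M \<le> m \<Longrightarrow> gs m = 0"
      and y: "y = S (\<lambda>n. forced_mode M' gs' n T)" "\<And>m. gs' m \<in> W" "\<And>m. M' \<le> m \<Longrightarrow> gs' m = 0"
      unfolding R_def by blast
    define N where "N = max M M'"
    have "x = S (\<lambda>n. forced_mode N gs n T)" "y = S (\<lambda>n. forced_mode N gs' n T)"
      using forced_mode_extend[of M N gs] forced_mode_extend[of M' N gs'] x y by (simp_all add: N_def)
    moreover have "forced_mode N gs n T + forced_mode N gs' n T = forced_mode N (\<lambda>m. gs m + gs' m) n T" for n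
      by (simp add: forced_mode_def sum.distrib inner_left_distrib distrib_left)
    moreover have "vsum (\<lambda>n. forced_mode N gs n T)" "vsum (\<lambda>n. forced_mode N gs' n T)"
      using x(2) y(2) W(2) by (auto intro!: vsum_forced)
    ultimately have "x + y = S (\<lambda>n. forced_mode N (\<lambda>m. gs m + gs' m) n T)"
      using S_add[of "\<lambda>n. forced_mode N gs n T" "\<lambda>n. forced_mode N gs' n T"] by simp
    moreover have "\<forall>m. gs m + gs' m \<in> W" using x(2) y(2) subspace_add[OF W(1)] by blast
    moreover have "\<forall>m\<ge>N. gs m + gs' m = 0" using x(3) y(3) by (simp add: N_def)
    ultimately show "x + y \<in> R" unfolding R_def by blast
  next
    fix k x assume "x \<in> R"
    then obtain M gs where x: "x = S (\<lambda>n. forced_mode M gs n T)" "\<And>m. gs m \<in> W" "\<And>m. M \<le> m \<Longrightarrow> gs m = 0"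
      unfolding R_def by blast
    have "k * forced_mode M gs n T = forced_mode M (\<lambda>m. k *\<^sub>R gs m) n T" for n
      by (simp add: forced_mode_def sum_distrib_left mult_ac)
    moreover have "vsum (\<lambda>n. forced_mode M gs n T)" using x(2) W(2) by (auto intro!: vsum_forced)
    ultimately have "k *\<^sub>R x = S (\<lambda>n. forced_mode M (\<lambda>m. k *\<^sub>R gs m) n T)" using S_scale[of "\<lambda>n. forced_mode M gs n T" k] x(1) by simp
    moreover have "\<forall>m. k *\<^sub>R gs m \<in> W" "\<forall>m\<ge>M. k *\<^sub>R gs m = 0" using x subspace_scale[OF W(1)] by auto
    ultimately show "k *\<^sub>R x \<in> R" unfolding R_def by blast
  qed
  have "z \<in> closure R"
  proof (rule ccontr)
    assume "z \<notin> closure R"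
    then obtain l where l: "bounded_linear l" "\<And>x. x \<in> R \<Longrightarrow> l x = 0" "l z \<noteq> (0::real)"
      using separating_functional[OF R] by blast
    define \<psi> where "\<psi> n = l (e n)" for n
    have lin: "linear l" by (rule bounded_linear.linear[OF l(1)])
    obtain K where K: "K > 0" "\<And>x. norm (l x) \<le> norm x * K" using bounded_linear.pos_bounded[OF l(1)] by blast
    have \<psi>s: "summable (\<lambda>n. (\<psi> n)\<^sup>2)"
    proof (rule bounded_imp_summable[of _ "K\<^sup>2"])
      fix n
      define s where "s = (\<Sum>k\<le>n. (\<psi> k)\<^sup>2)"
      have s0: "0 \<le> s" by (simp add: s_def sum_nonneg)
      have "l (comb \<psi> {..n}) = s"
        by (simp add: comb_def linear_sum[OF lin] linear_scale[OF lin] s_def \<psi>_def power2_eq_square)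
      moreover have "norm (comb \<psi> {..n}) = sqrt s" by (simp add: norm_eq_sqrt_inner inner_comb_self s_def)
      ultimately have "s \<le> sqrt s * K" using K(2)[of "comb \<psi> {..n}"] s0 by simp
      then have q: "sqrt s * sqrt s \<le> sqrt s * K" using s0 by simp
      have "sqrt s \<le> K"
      proof (cases "s = 0")
        case False
        then show ?thesis using mult_left_le_imp_le[OF q] s0 by simp
      qed (use K(1) in simp)
      then have "(sqrt s)\<^sup>2 \<le> K\<^sup>2" using s0 by (intro power_mono) auto
      then show "(\<Sum>k\<le>n. (\<psi> k)\<^sup>2) \<le> K\<^sup>2" using s0 by (simp add: s_def)
    qed simp
    have "\<psi> n0 = 0" for n0
    proof -
      define F where "F = {n. lam n = lam n0}"
      have fF: "finite F" unfolding F_def by (rule finite_subset[OF _ finite_lam[of "lam n0"]]) auto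
      have ev: "eigvec (comb \<psi> F) (lam n0)" unfolding comb_def
      proof (rule eigvec_sum)
        fix n assume "n \<in> F"
        then show "eigvec (e n) (lam n0)" using eig[of n] by (simp add: F_def)
      qed
      have "inner (comb \<psi> F) g = 0" if g: "g \<in> W" for g
      proof -
        have gH: "g \<in> H" using g W by blast
        define c where "c n = inner g (e n) * \<psi> n" for n
        have c: "summable (\<lambda>n. \<bar>c n\<bar>)"
        proof (rule summable_comparison_test[OF exI[of _ 0] summable_add[OF sums_summable[OF parseval[OF gH]] \<psi>s]], intro allI impI)
          fix n
          have "0 \<le> \<bar>inner g (e n)\<bar> * \<bar>\<psi> n\<bar>" by simp
          then show "norm \<bar>c n\<bar> \<le> (inner g (e n))\<^sup>2 + (\<psi> n)\<^sup>2"
            using sum_squares_bound[of "\<bar>inner g (e n)\<bar>" "\<bar>\<psi> n\<bar>"]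
            unfolding real_norm_def c_def abs_idempotent abs_mult power2_abs by linarith
        qed
        \<comment> \<open>Controls with the single power \<open>t ^ m\<close> give the sums with parameter \<open>b + m\<close>.\<close>
        define b where "b = \<mu> + \<alpha> + 1"
        have b: "1 < b" using \<mu> orders by (simp add: b_def)
        have zero: "(\<lambda>n. c n * relax \<mu> (b + real m) (lam n) T) sums 0" for m :: nat
        proof -
          define gs where "gs k = (if k = m then g else 0)" for k
          have gs: "\<forall>k. gs k \<in> W" "\<forall>k\<ge>Suc m. gs k = 0" using g W0 by (auto simp: gs_def)
          have fm: "forced_mode (Suc m) gs n T = fact m * relax \<mu> (b + real m) (lam n) T * inner g (e n)" for n
          proof -
            have "(\<Sum>k<m. fact k * relax \<mu> (\<mu> + \<alpha> + real k + 1) (lam n) T * inner (gs k) (e n)) = 0"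
              by (intro sum.neutral) (auto simp: gs_def)
            then show ?thesis by (simp add: forced_mode_def gs_def b_def add_ac)
          qed
          have "S (\<lambda>n. forced_mode (Suc m) gs n T) \<in> R" unfolding R_def using gs by blast
          then have l0: "l (S (\<lambda>n. forced_mode (Suc m) gs n T)) = 0" by (rule l(2))
          have "vsum (\<lambda>n. forced_mode (Suc m) gs n T)" using gs(1) W(2) by (auto intro!: vsum_forced)
          from bounded_linear.sums[OF l(1) V_series_sums[OF this]]
          have "(\<lambda>n. forced_mode (Suc m) gs n T * \<psi> n) sums 0"
            by (simp add: linear_scale[OF lin] l0 \<psi>_def)
          from sums_mult[OF this, of "1 / fact m"]
          show ?thesis unfolding fm c_def by (simp add: mult_ac)
        qed
        have mv: "(\<Sum>n. c n * mitlef \<mu> b (lam n * x)) = 0" if "0 < x" "x < T powr \<mu>" for x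
          by (rule relaxation_sum_vanishes[OF c zero b that])
        have "(\<Sum>n. c n / lam n ^ j) = 0" if "j \<ge> 1" for j
          by (rule relax_moments_vanish[OF \<mu> less_imp_le[OF b] c l0 _ mv that]) (use T in auto)
        then have "(\<Sum>n | lam n = lam n0. c n) = 0"
          by (intro moments_vanish_imp_groups_vanish[OF c l0]) (use fF in \<open>auto simp: F_def\<close>)
        moreover have "inner (comb \<psi> F) g = (\<Sum>n\<in>F. c n)"
          unfolding inner_comb c_def
          by (intro sum.cong refl) (simp add: inner_commute mult.commute)
        ultimately show ?thesis by (simp add: F_def)
      qed
      then have "comb \<psi> F = 0" using ucp lam_pos ev by blast
      then have "inner (comb \<psi> F) (e n0) = 0" by simp
      then show ?thesis using fF by (simp add: inner_comb_e F_def)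
    qed
    then have "(\<lambda>n. 0) sums l z"
      using bounded_linear.sums[OF l(1) expansion[OF z]] by (simp add: linear_scale[OF lin] \<psi>_def)
    then show False using l(3) sums_unique by fastforce
  qed
  then obtain r where r: "r \<in> R" "dist r z < \<epsilon>" using \<epsilon> closure_approachable by blast
  then obtain M gs where g: "\<And>m. gs m \<in> W" "r = S (\<lambda>n. forced_mode M gs n T)" unfolding R_def by blast
  show ?thesis using g r(2) by (intro exI[of _ M] exI[of _ gs]) (simp add: dist_norm)
qed

text \<open>By linearity it suffices to reach, from zero initial data, the difference of \<open>u1\<close> and the
  uncontrolled terminal value.\<close>

lemma approximately_controllable:
  assumes W: "subspace W" "W \<subseteq> H"
    and ucp: "\<forall>\<phi> c. c > 0 \<longrightarrow> eigvec \<phi> c \<longrightarrow> (\<forall>g\<in>W. inner \<phi> g = 0) \<longrightarrow> \<phi> = 0"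
    and u: "u0 \<in> H" "u1 \<in> H" and \<epsilon>: "\<epsilon> > 0"
  shows "\<exists>M gs. (\<forall>m. gs m \<in> W) \<and> (\<exists>u. weak_solution H V E T \<mu> \<nu> u0 (\<lambda>t. \<Sum>m<M. t ^ m *\<^sub>R gs m) u) \<and>
    (\<forall>u. weak_solution H V E T \<mu> \<nu> u0 (\<lambda>t. \<Sum>m<M. t ^ m *\<^sub>R gs m) u \<longrightarrow> norm (inner_frac H \<mu> \<nu> u T - u1) \<le> \<epsilon>)"
proof -
  define z where "z = u1 - S (\<lambda>n. init_mode u0 n T)"
  have zH: "z \<in> H" unfolding z_def
    by (intro subspace_diff[OF subspace_H] u V_sub_H V_series_V vsum_init)
  obtain M gs where g: "\<And>m. gs m \<in> W" "norm (S (\<lambda>n. forced_mode M gs n T) - z) \<le> \<epsilon>"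
    using forced_terminal_values_dense[OF W ucp zH \<epsilon>] by blast
  have gH: "\<And>m. gs m \<in> H" using g(1) W(2) by blast
  obtain u where u': "weak_solution H V E T \<mu> \<nu> u0 (\<lambda>t. \<Sum>m<M. t ^ m *\<^sub>R gs m) u"
    "inner_frac H \<mu> \<nu> u T = S (\<lambda>n. init_mode u0 n T + forced_mode M gs n T)"
    by (rule weak_solution_polynomial_control[OF u(1) gH])
  have uT: "inner_frac H \<mu> \<nu> u T - u1 = S (\<lambda>n. forced_mode M gs n T) - z"
    unfolding u'(2) S_add[OF vsum_init[OF u(1)] vsum_forced[OF gH]] by (simp add: z_def)
  show ?thesis
  proof (intro exI[of _ M] exI[of _ gs] conjI allI impI)
    show "gs m \<in> W" for m by (rule g(1))
    show "\<exists>u. weak_solution H V E T \<mu> \<nu> u0 (\<lambda>t. \<Sum>m<M. t ^ m *\<^sub>R gs m) u" using u'(1) by blast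
    fix v assume v: "weak_solution H V E T \<mu> \<nu> u0 (\<lambda>t. \<Sum>m<M. t ^ m *\<^sub>R gs m) v"
    have "inner_frac H \<mu> \<nu> v T = inner_frac H \<mu> \<nu> u T"
      by (rule weak_solution_unique[OF v u'(1), of "\<lambda>n t. \<Sum>m<M. t ^ m * inner (gs m) (e n)"])
        (auto simp: inner_sum_left intro!: continuous_intros)
    then show "norm (inner_frac H \<mu> \<nu> v T - u1) \<le> \<epsilon>" using uT g(2) by simp
  qed
qed

end

section \<open>Square-integrable functions supported in a set\<close>

lemma ae_eq_refl: "square_integrable f \<Longrightarrow> ae_eq f f" by (simp add: ae_eq_def)

lemma L2_rep:
  obtains f where "square_integrable f" "F = abs_L2 f"
  using Quotient3_abs_rep[OF Quotient3_L2, of F] Quotient3_rep_reflp[OF Quotient3_L2, of F]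
  unfolding ae_eq_def by metis

lemma inner_abs_L2:
  assumes "square_integrable f" "square_integrable g"
  shows "inner (abs_L2 f) (abs_L2 g) = (LINT x|lborel. f x * g x)"
  using assms by (intro inner_L2.abs_eq ae_eq_refl)

lemma vanishes_on_abs_L2:
  assumes "square_integrable f"
  shows "vanishes_on (abs_L2 f) S \<longleftrightarrow> (AE x in lborel. x \<in> S \<longrightarrow> f x = 0)"
  using vanishes_on.abs_eq[OF ae_eq_refl[OF assms]] by simp

lemma square_integrable_indicator_times:
  fixes f :: "'a::euclidean_space \<Rightarrow> real"
  assumes f: "square_integrable f" and S: "S \<in> sets borel"
  shows "square_integrable (\<lambda>x. indicator S x * f x)"
proof -
  have "integrable lborel (\<lambda>x. indicator S x *\<^sub>R (f x)\<^sup>2)"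
    using f S by (intro integrable_mult_indicator) (auto simp: square_integrable_def)
  moreover have "(indicator S x * f x)\<^sup>2 = indicator S x *\<^sub>R (f x)\<^sup>2" for x by (simp add: indicator_def)
  moreover have "(\<lambda>x. indicator S x * f x) \<in> borel_measurable borel"
    using f S by (intro borel_measurable_times borel_measurable_indicator) (auto simp: square_integrable_def)
  ultimately show ?thesis by (simp add: square_integrable_def)
qed

text \<open>Test with the restriction of \<open>h\<close> to \<open>S\<close>. This one fact yields that \<open>L2_on \<Omega>\<close> is closed and translates
  orthogonality to the controls into vanishing on \<open>\<omega>\<close>.\<close>

lemma vanishes_on_iff_orthogonal:
  fixes h :: "'a::euclidean_space L2"
  assumes S: "S \<in> sets borel"
  shows "vanishes_on h S \<longleftrightarrow> (\<forall>g\<in>L2_on S. inner g h = 0)"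
proof -
  obtain f where f: "square_integrable f" "h = abs_L2 f" by (rule L2_rep)
  show ?thesis
  proof (intro iffI ballI)
    fix g assume v: "vanishes_on h S" and "g \<in> L2_on S"
    moreover obtain k where k: "square_integrable k" "g = abs_L2 k" by (rule L2_rep)
    ultimately have "AE x in lborel. x \<in> S \<longrightarrow> f x = 0" "AE x in lborel. x \<in> - S \<longrightarrow> k x = 0"
      by (simp_all add: L2_on_def f vanishes_on_abs_L2)
    then have "AE x in lborel. k x * f x = 0" by (rule eventually_elim2) auto
    then show "inner g h = 0" using f k by (simp add: inner_abs_L2 integral_eq_zero_AE)
  next
    assume o: "\<forall>g\<in>L2_on S. inner g h = 0"
    define k where "k x = indicator S x * f x" for x
    have k: "square_integrable k" unfolding k_def[abs_def] by (rule square_integrable_indicator_times[OF f(1) S])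
    have "abs_L2 k \<in> L2_on S" by (simp add: L2_on_def vanishes_on_abs_L2[OF k] k_def)
    then have "inner (abs_L2 k) h = 0" using o by blast
    then have "(LINT x|lborel. k x * f x) = 0" by (simp add: f(2) inner_abs_L2[OF k f(1)])
    moreover have "integrable lborel (\<lambda>x. k x * f x)" by (rule square_integrable_mult[OF k f(1)])
    ultimately have "AE x in lborel. k x * f x = 0"
      by (subst (asm) integral_nonneg_eq_0_iff_AE) (auto simp: k_def indicator_def)
    then show "vanishes_on h S" unfolding f(2) vanishes_on_abs_L2[OF f(1)]
      by (rule eventually_mono) (auto simp: k_def)
  qed
qed

lemma L2_on_eq_orthogonal:
  fixes \<Omega> :: "'a::euclidean_space set"
  assumes "\<Omega> \<in> sets borel"
  shows "L2_on \<Omega> = {h. \<forall>g\<in>L2_on (- \<Omega>). inner g h = 0}"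
  using vanishes_on_iff_orthogonal[of "- \<Omega>"] assms by (auto simp: L2_on_def[of \<Omega>])

lemma subspace_L2_on:
  fixes \<Omega> :: "'a::euclidean_space set"
  assumes "\<Omega> \<in> sets borel" shows "subspace (L2_on \<Omega>)"
  unfolding L2_on_eq_orthogonal[OF assms] by (intro subspaceI) (auto simp: inner_right_distrib)

lemma closed_L2_on:
  fixes \<Omega> :: "'a::euclidean_space set"
  assumes "\<Omega> \<in> sets borel" shows "closed (L2_on \<Omega>)"
proof -
  have "L2_on \<Omega> = (\<Inter>g\<in>L2_on (- \<Omega>). {h. inner g h = 0})" unfolding L2_on_eq_orthogonal[OF assms] by auto
  then show ?thesis by (auto intro!: closed_INT closed_Collect_eq continuous_intros)
qed

lemma L2_on_mono: "\<omega> \<subseteq> \<Omega> \<Longrightarrow> L2_on \<omega> \<subseteq> L2_on \<Omega>"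
proof
  fix g assume s: "\<omega> \<subseteq> \<Omega>" and g: "g \<in> L2_on \<omega>"
  obtain f where f: "square_integrable f" "g = abs_L2 f" by (rule L2_rep)
  have "AE x in lborel. x \<in> - \<omega> \<longrightarrow> f x = 0" using g by (simp add: L2_on_def f vanishes_on_abs_L2)
  then have "AE x in lborel. x \<in> - \<Omega> \<longrightarrow> f x = 0" by (rule eventually_mono) (use s in auto)
  then show "g \<in> L2_on \<Omega>" by (simp add: L2_on_def f vanishes_on_abs_L2)
qed

text \<open>A representative that vanishes everywhere outside \<open>S\<close>, so that extension by zero does not change it.\<close>

lemma L2_on_rep:
  fixes g :: "'a::euclidean_space L2"
  assumes S: "S \<in> sets borel" and g: "g \<in> L2_on S"
  shows "\<exists>r. square_integrable r \<and> g = abs_L2 r \<and> (\<forall>x. x \<notin> S \<longrightarrow> r x = 0)"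
proof -
  obtain f where f: "square_integrable f" "g = abs_L2 f" by (rule L2_rep)
  have "AE x in lborel. x \<in> - S \<longrightarrow> f x = 0" using g by (simp add: L2_on_def f vanishes_on_abs_L2)
  then have "AE x in lborel. f x = indicator S x * f x" by (rule eventually_mono) (auto simp: indicator_def)
  moreover have r: "square_integrable (\<lambda>x. indicator S x * f x)" by (rule square_integrable_indicator_times[OF f(1) S])
  ultimately have "ae_eq f (\<lambda>x. indicator S x * f x)" using f(1) by (simp add: ae_eq_def)
  then have "g = abs_L2 (\<lambda>x. indicator S x * f x)" unfolding f(2) by (rule Quotient3_rel_abs[OF Quotient3_L2])
  then show ?thesis using r by (intro exI[of _ "\<lambda>x. indicator S x * f x"]) auto
qed

lemma abs_L2_sum:
  fixes r :: "nat \<Rightarrow> 'a::euclidean_space \<Rightarrow> real"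
  assumes "\<And>m. square_integrable (r m)"
  shows "square_integrable (\<lambda>x. \<Sum>m<M. a m * r m x) \<and> abs_L2 (\<lambda>x. \<Sum>m<M. a m * r m x) = (\<Sum>m<M. a m *\<^sub>R abs_L2 (r m))"
proof (induction M)
  case 0
  show ?case by (simp add: square_integrable_zero zero_L2_def)
next
  case (Suc M)
  have c: "square_integrable (\<lambda>x. a M * r M x)" by (rule square_integrable_cmult[OF assms])
  have "abs_L2 (\<lambda>x. (\<Sum>m<M. a m * r m x) + a M * r M x) = abs_L2 (\<lambda>x. \<Sum>m<M. a m * r m x) + abs_L2 (\<lambda>x. a M * r M x)"
    using Suc c by (intro plus_L2.abs_eq[symmetric] ae_eq_refl) auto
  also have "abs_L2 (\<lambda>x. a M * r M x) = a M *\<^sub>R abs_L2 (r M)"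
    by (intro scaleR_L2.abs_eq[symmetric] ae_eq_refl assms)
  finally show ?case using Suc square_integrable_add[OF _ c] by simp
qed

lemma square_integrable_tensor:
  fixes r :: "'a::euclidean_space \<Rightarrow> real" and q :: "real \<Rightarrow> real"
  assumes r: "square_integrable r" and q: "square_integrable q"
  shows "square_integrable (\<lambda>z. r (fst z) * q (snd z))"
proof -
  have rm[measurable]: "r \<in> borel_measurable borel" and qm[measurable]: "q \<in> borel_measurable borel"
    and ri: "integrable lborel (\<lambda>x. (r x)\<^sup>2)" and qi: "integrable lborel (\<lambda>x. (q x)\<^sup>2)"
    using r q by (auto simp: square_integrable_def)
  have m: "(\<lambda>z. r (fst z) * q (snd z)) \<in> borel_measurable borel"
    unfolding borel_prod[symmetric] by measurable
  have "integrable (lborel \<Otimes>\<^sub>M lborel) (\<lambda>z. (r (fst z) * q (snd z))\<^sup>2)"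
  proof (rule lborel_pair.Fubini_integrable)
    show "(\<lambda>z. (r (fst z) * q (snd z))\<^sup>2) \<in> borel_measurable (lborel \<Otimes>\<^sub>M lborel)"
      unfolding lborel_prod using m by simp
    show "integrable lborel (\<lambda>x. LINT y|lborel. norm ((r (fst (x, y)) * q (snd (x, y)))\<^sup>2))"
      using integrable_mult_left[OF ri, of "LINT y|lborel. (q y)\<^sup>2"] by (simp add: power_mult_distrib)
    show "AE x in lborel. integrable lborel (\<lambda>y. (r (fst (x, y)) * q (snd (x, y)))\<^sup>2)"
      using qi by (simp add: power_mult_distrib)
  qed
  then show ?thesis using m unfolding square_integrable_def lborel_prod by simp
qed

text \<open>The cutoff makes the power square integrable on the whole line.\<close>

lemma square_integrable_power: "square_integrable (\<lambda>t. indicator {0<..<T} t * t ^ m :: real)"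
proof -
  have "set_integrable lborel {0..T} (\<lambda>t. (t ^ m)\<^sup>2)"
    unfolding set_integrable_def by (rule borel_integrable_compact) (auto intro!: continuous_intros)
  then have "set_integrable lborel {0<..<T} (\<lambda>t. (t ^ m)\<^sup>2)" by (rule set_integrable_subset) auto
  moreover have "(indicator {0<..<T} t * t ^ m)\<^sup>2 = indicator {0<..<T} t *\<^sub>R (t ^ m)\<^sup>2" for t :: real
    by (simp add: indicator_def)
  ultimately show ?thesis unfolding square_integrable_def set_integrable_def by simp
qed

text \<open>Choosing representatives of the coefficients turns the abstract control into a jointly measurable
  function of space and time.\<close>

lemma polynomial_control_realizable:
  fixes \<omega> :: "'a::euclidean_space set"
  assumes \<omega>: "\<omega> \<in> sets borel" and gs: "\<And>m. gs m \<in> L2_on \<omega>"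
  obtains f where "square_integrable_on f (\<omega> \<times> {0<..<T})"
    "localized_control \<omega> f = (\<lambda>t. \<Sum>m<M. t ^ m *\<^sub>R gs m)"
proof -
  obtain r where r: "\<And>m::nat. square_integrable (r m)" "\<And>m. gs m = abs_L2 (r m)" "\<And>m x. x \<notin> \<omega> \<Longrightarrow> r m x = 0"
    using L2_on_rep[OF \<omega> gs] by metis
  define f where "f z = (\<Sum>m<M. snd z ^ m * r m (fst z))" for z
  show ?thesis
  proof (rule that[of f])
    have "extend0 (\<omega> \<times> {0<..<T}) f = (\<lambda>z. \<Sum>m<M. 1 * (r m (fst z) * (indicator {0<..<T} (snd z) * snd z ^ m)))"
    proof
      fix z show "extend0 (\<omega> \<times> {0<..<T}) f z = (\<Sum>m<M. 1 * (r m (fst z) * (indicator {0<..<T} (snd z) * snd z ^ m)))"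
        using r(3)[of "fst z"] by (cases z) (auto simp: extend0_def f_def indicator_def mult.commute)
    qed
    moreover have "square_integrable (\<lambda>z. \<Sum>m<M. 1 * (r m (fst z) * (indicator {0<..<T} (snd z) * snd z ^ m)))"
      by (rule abs_L2_sum[THEN conjunct1]) (rule square_integrable_tensor[OF r(1) square_integrable_power])
    ultimately show "square_integrable_on f (\<omega> \<times> {0<..<T})" by (simp add: square_integrable_on_def)
    show "localized_control \<omega> f = (\<lambda>t. \<Sum>m<M. t ^ m *\<^sub>R gs m)"
    proof
      fix t
      have "extend0 \<omega> (\<lambda>x. f (x, t)) = (\<lambda>x. \<Sum>m<M. t ^ m * r m x)"
        using r(3) by (auto simp: extend0_def f_def fun_eq_iff)
      then show "localized_control \<omega> f t = (\<Sum>m<M. t ^ m *\<^sub>R gs m)"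
        using abs_L2_sum[of r "\<lambda>m. t ^ m" M, OF r(1)] by (simp add: localized_control_def r(2))
    qed
  qed
qed

section \<open>Mean approximate controllability\<close>

text \<open>The abstract result with \<open>H = L2_on \<Omega>\<close> and the coefficient space \<open>W = L2_on \<omega>\<close>.\<close>

theorem theorem2p7:
  fixes \<Omega> \<omega> :: "(real ^ 'n) set"
    and D V :: "(real ^ 'n) L2 set"
    and A :: "(real ^ 'n) L2 \<Rightarrow> (real ^ 'n) L2"
    and E :: "(real ^ 'n) L2 \<Rightarrow> (real ^ 'n) L2 \<Rightarrow> real"
    and ev :: "nat \<Rightarrow> real"
    and \<mu> \<nu> :: real
  assumes "open \<Omega>" "bounded \<Omega>"
    and "selfadjoint_operator (L2_on \<Omega>) D A" "nonneg_operator D A"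
    and "compactly_embedded_domain D A"
    and "nonneg_symmetric_form (L2_on \<Omega>) V E" "closed_form V E"
    and "associated_operator (L2_on \<Omega>) V E D A"
    and "range ev = {c. eigenvalue D A c}" "incseq ev" "filterlim ev at_top sequentially"
    and "ev 0 > 0"
    and "0 \<le> \<nu>" "\<nu> \<le> 1" "0 < \<mu>" "\<mu> \<le> 1"
    and "open \<omega>" "\<omega> \<noteq> {}" "\<omega> \<subseteq> \<Omega>"
    and unique_continuation: "\<And>c \<phi>. c > 0 \<Longrightarrow> \<phi> \<in> D \<Longrightarrow> A \<phi> = c *\<^sub>R \<phi> \<Longrightarrow> vanishes_on \<phi> \<omega>
          \<Longrightarrow> vanishes_on \<phi> \<Omega>"
  shows "\<forall>T>0. \<forall>u0\<in>L2_on \<Omega>. \<forall>u1\<in>L2_on \<Omega>. \<forall>\<epsilon>>0.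
    \<exists>f :: (real ^ 'n) \<times> real \<Rightarrow> real. square_integrable_on f (\<omega> \<times> {0<..<T}) \<and>
      (\<exists>u. weak_solution (L2_on \<Omega>) V E T \<mu> \<nu> u0 (localized_control \<omega> f) u) \<and>
      (\<forall>u. weak_solution (L2_on \<Omega>) V E T \<mu> \<nu> u0 (localized_control \<omega> f) u
         \<longrightarrow> norm (inner_frac (L2_on \<Omega>) \<mu> \<nu> u T - u1) \<le> \<epsilon>)"
proof (intro allI ballI impI)
  fix T :: real and u0 u1 and \<epsilon> :: real
  assume T: "0 < T" and u: "u0 \<in> L2_on \<Omega>" "u1 \<in> L2_on \<Omega>" and \<epsilon>: "0 < \<epsilon>"
  have B: "\<Omega> \<in> sets borel" "\<omega> \<in> sets borel" using assms(1,17) by auto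
  interpret form_operator "L2_on \<Omega>" D V A E
    by (intro form_operator.intro subspace_L2_on closed_L2_on B assms(3,5-8))
  have "infinite (range ev)"
  proof
    assume "finite (range ev)"
    then obtain K where K: "\<And>n. ev n \<le> K" using bdd_above_finite[of "range ev"] by (auto simp: bdd_above_def)
    have "\<forall>\<^sub>F n in sequentially. K + 1 \<le> ev n" using assms(11) by (simp add: filterlim_at_top)
    then obtain n where "K + 1 \<le> ev n" by (auto simp: eventually_sequentially)
    then show False using K[of n] by simp
  qed
  then have "infinite {c. eigenvalue D A c}" using assms(9) by simp
  then have "\<exists>(e :: nat \<Rightarrow> (real ^ 'n) L2) (lam :: nat \<Rightarrow> real). (\<forall>n. eigvec (e n) (lam n)) \<and> (\<forall>m n. inner (e m) (e n) = (if m = n then 1 else 0)) \<and>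
      (\<forall>h\<in>L2_on \<Omega>. (\<forall>n. inner h (e n) = 0) \<longrightarrow> h = 0) \<and> (\<forall>R. finite {n. lam n \<le> R})"
  proof (rule eigenbasis_exists)
    fix e :: "nat \<Rightarrow> (real ^ 'n) L2" and lam :: "nat \<Rightarrow> real"
    assume a: "\<And>n. eigvec (e n) (lam n)" "\<And>m n. inner (e m) (e n) = (if m = n then 1 else 0)"
      "\<And>h. h \<in> L2_on \<Omega> \<Longrightarrow> (\<And>n. inner h (e n) = 0) \<Longrightarrow> h = 0" "\<And>R. finite {n. lam n \<le> R}"
    show ?thesis by (intro exI[of _ e] exI[of _ lam] conjI allI ballI impI a) auto
  qed
  then obtain e :: "nat \<Rightarrow> (real ^ 'n) L2" and lam :: "nat \<Rightarrow> real" where b: "\<forall>n. eigvec (e n) (lam n)" "\<forall>m n. inner (e m) (e n) = (if m = n then 1 else 0)"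
    "\<forall>h\<in>L2_on \<Omega>. (\<forall>n. inner h (e n) = 0) \<longrightarrow> h = 0" "\<forall>R. finite {n. lam n \<le> R}"
    by blast
  have l: "ev 0 \<le> lam n" for n
  proof -
    have "e n \<noteq> 0" using b(2)[rule_format, of n n] by auto
    then have "lam n \<in> range ev" unfolding assms(9) using b(1)[rule_format, of n] by (auto simp: eigenvalue_def eigvec_def)
    then show ?thesis using incseqD[OF assms(10), of 0] by auto
  qed
  interpret hilfer_problem "L2_on \<Omega>" D V A E e lam "ev 0" \<mu> \<nu> T
    by unfold_locales (use b l T assms(12-16) in auto)
  have W: "subspace (L2_on \<omega>)" "L2_on \<omega> \<subseteq> L2_on \<Omega>" using subspace_L2_on[OF B(2)] L2_on_mono[OF assms(19)] by auto
  have ucp: "\<forall>\<phi> c. c > 0 \<longrightarrow> eigvec \<phi> c \<longrightarrow> (\<forall>g\<in>L2_on \<omega>. inner \<phi> g = 0) \<longrightarrow> \<phi> = 0"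
  proof (intro allI impI)
    fix \<phi> c assume c: "c > 0" and \<phi>: "eigvec \<phi> c" and o: "\<forall>g\<in>L2_on \<omega>. inner \<phi> g = 0"
    have "vanishes_on \<phi> \<omega>" unfolding vanishes_on_iff_orthogonal[OF B(2)] using o by (simp add: inner_commute)
    then have "vanishes_on \<phi> \<Omega>" using unique_continuation[OF c] \<phi> by (simp add: eigvec_def)
    moreover have "\<phi> \<in> L2_on \<Omega>" using \<phi> D_sub_H by (simp add: eigvec_def)
    ultimately have "inner \<phi> \<phi> = 0" using vanishes_on_iff_orthogonal[OF B(1)] by blast
    then show "\<phi> = 0" by simp
  qed
  obtain M gs where g: "\<forall>m. gs m \<in> L2_on \<omega>"
    "\<exists>u. weak_solution (L2_on \<Omega>) V E T \<mu> \<nu> u0 (\<lambda>t. \<Sum>m<M. t ^ m *\<^sub>R gs m) u"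
    "\<forall>u. weak_solution (L2_on \<Omega>) V E T \<mu> \<nu> u0 (\<lambda>t. \<Sum>m<M. t ^ m *\<^sub>R gs m) u \<longrightarrow>
       norm (inner_frac (L2_on \<Omega>) \<mu> \<nu> u T - u1) \<le> \<epsilon>"
    using approximately_controllable[OF W ucp u \<epsilon>] by blast
  obtain f where f: "square_integrable_on f (\<omega> \<times> {0<..<T})"
    "localized_control \<omega> f = (\<lambda>t. \<Sum>m<M. t ^ m *\<^sub>R gs m)"
    by (rule polynomial_control_realizable[OF B(2) g(1)[rule_format], where M = M])
  show "\<exists>f :: (real ^ 'n) \<times> real \<Rightarrow> real. square_integrable_on f (\<omega> \<times> {0<..<T}) \<and>
      (\<exists>u. weak_solution (L2_on \<Omega>) V E T \<mu> \<nu> u0 (localized_control \<omega> f) u) \<and>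
      (\<forall>u. weak_solution (L2_on \<Omega>) V E T \<mu> \<nu> u0 (localized_control \<omega> f) u
         \<longrightarrow> norm (inner_frac (L2_on \<Omega>) \<mu> \<nu> u T - u1) \<le> \<epsilon>)"
    using f g(2,3) by (intro exI[of _ f]) simp
qed

end
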